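(* Let $\mathcal{G}_D$, $K$, $Q$, $b_0$, $\tilde K$, $\mathcal{G}_D'$, $\psi$ and $L=\{L_1,\dots,L_n\}$ be as in the context, and suppose that $K$ is $2$-non-degenerate. Then (for a suitable choice of the additive constant in $\psi$) $L$ forms a T-graph in $\mathbb{R}^2$ whose root vertices are the vertices of $Q$, and $\mathcal{G}_D$ coincides with $\mathcal{G}_D(L)$ up to gauge equivalence. Moreover, for every vertex $v$ of $\mathcal{G}_D'$, $\psi(v)$ is a vertex of the T-graph, and if $v$ corresponds to an outer face then $\psi(v)$ is a root vertex.
   Context: Let $\mathcal{G}_D$ be a finite bipartite planar graph with black vertices $b_1,\dots,b_n$, white vertices $w_1,\dots,w_n$, generic positive edge weights $\nu$, having a perfect matching and no unused edges (edges lying in no perfect matching). A Kasteleyn matrix $K$ is the real $n\times n$ matrix with $K_{i,j}=\pm\nu(b_iw_j)$ if $b_i\sim w_j$ and $0$ otherwise, with signs such that around each interior face of degree $d$ the product of signs is $(-1)^{d/2+1}$. $K$ is $k$-non-degenerate if all of its $(n-k)\times(n-k)$ minors have nonzero determinant. Two weighted bipartite graphs are gauge equivalent if they are isomorphic and the weight ratio on each edge $wb$ is $f_1(w)f_2(b)$ for some functions $f_1,f_2$ (equivalently, one matrix is obtained from the other by multiplying rows and columns by nonzero constants). Construction: Let $b_0$ be a black vertex on the outer face, and suppose the outer face has $m$ black and $m$ white vertices. Fix a generic convex $(m+1)$-gon $Q$ with edge vectors $q_0,\dots,q_m\in\mathbb{C}$ in cyclic order ($q_0=-\sum_{i=1}^m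 q_i$). Let $A_w$ (a row vector indexed by white vertices) take the values $q_1,\dots,q_m$ in cyclic order on the white vertices of the outer face and $0$ elsewhere; let $A_b$ (a column vector indexed by black vertices) be $1$ at $b_0$ and $0$ elsewhere. Let $f$ solve $Kf=A_b$, let $K'$ be $K$ with its $j$-th column multiplied by $f_j$, let $g$ be the row vector with $gK'=A_w$, and let $\tilde K$ be $K'$ with its $i$-th row multiplied by $g_i$; thus $\tilde K\mathbf{1}$ is a nonzero multiple of $A_b$ and $\mathbf{1}^t\tilde K=A_w$, and all entries of row $i$ of $\tilde K$ are real multiples of $g_i$. Draw non-crossing curves from each white vertex of the outer face and from $b_0$ to infinity, dividing the outer face into $m+1$ outer regions; $\mathcal{G}_D'$ is the graph whose vertices are the interior faces of $\mathcal{G}_D$ and these $m+1$ outer regions, with one dual edge crossing each edge of $\mathcal{G}_D$. Let $\psi:\mathcal{G}_D'\to\mathbb{C}\cong\mathbb{R}^2$ be the function (unique up to an additive constant) whose increment across the dual of each edge $b_iw_j$ equals $\tilde K_{i,j}$ (the flow $\tilde K$ rotated by ninety degrees, with a fixed orientation convention), extended linearly along dual edges. For each black vertex $b_i$, the $\psi$-image of the union of the dual edges of the edges incident to $b_i$ is a line segment; let $L_i$ be its (open) interior. For a collection $L$ of disjoint open segments forming a T-graph in $\mathbb{R}^2$ (union connected, containing all its limit points except finitely many root vertices on the boundary of the unbounded complementary component), $\mathcal{G}_D(L)$ is the bipartite graph whose black vertices are the $L_i$ and whose white vertices are the faces (bounded components of the complement of $\bigcup L_i\cup C$, $C$ a closed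 curve around $\bigcup L_i$ through the roots) except one outer face, with $F\sim L_i$ weighted by the length of the portion of $L_i$ on the boundary of $F$. *)

theory Defs
  imports
    "HOL-Analysis.Analysis"
    "HOL-Combinatorics.Orbits"
    "Jordan_Normal_Form.Determinant"
    "Jordan_Normal_Form.DL_Submatrix"
begin

section \<open>Generic points\<close>

text \<open>The ring of real polynomials in a family \<open>C\<close> of real-valued coordinate functions.\<close>

inductive_set polynomials_in :: "('x \<Rightarrow> real) set \<Rightarrow> ('x \<Rightarrow> real) set"
  for C :: "('x \<Rightarrow> real) set" where
  const: "(\<lambda>_. c) \<in> polynomials_in C"
| coord: "x \<in> C \<Longrightarrow> x \<in> polynomials_in C"
| add: "p \<in> polynomials_in C \<Longrightarrow> q \<in> polynomials_in C \<Longrightarrow> (\<lambda>x. p x + q x) \<in> polynomials_in C"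
| mult: "p \<in> polynomials_in C \<Longrightarrow> q \<in> polynomials_in C \<Longrightarrow> (\<lambda>x. p x * q x) \<in> polynomials_in C"

text \<open>\<open>P\<close> holds off a proper real algebraic subset.\<close>

definition generically :: "('x \<Rightarrow> real) set \<Rightarrow> ('x \<Rightarrow> bool) \<Rightarrow> bool" where
  "generically C P \<longleftrightarrow>
     (\<exists>p \<in> polynomials_in C. (\<exists>x. p x \<noteq> 0) \<and> (\<forall>x. p x \<noteq> 0 \<longrightarrow> P x))"

definition weight_coords :: "'e set \<Rightarrow> (('e \<Rightarrow> real) \<Rightarrow> real) set" where
  "weight_coords E = {(\<lambda>\<nu>. \<nu> e) | e. e \<in> E}"

definition polygon_coords :: "nat \<Rightarrow> ((nat \<Rightarrow> complex) \<Rightarrow> real) set" where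
  "polygon_coords m = {(\<lambda>r. Re (r k)) | k. k \<le> m} \<union> {(\<lambda>r. Im (r k)) | k. k \<le> m}"

section \<open>Weighted bipartite graphs and gauge equivalence\<close>

record ('b, 'w) weighted_bigraph =
  blacks :: "'b set"
  whites :: "'w set"
  adjacency :: "('b \<times> 'w) set"
  weight :: "'b \<Rightarrow> 'w \<Rightarrow> real"

text \<open>Gauge equivalence through an isomorphism that is \<open>\<beta>\<close> on the black vertices.\<close>

definition gauge_equivalent_via ::
  "('b \<Rightarrow> 'c) \<Rightarrow> ('b, 'w) weighted_bigraph \<Rightarrow> ('c, 'v) weighted_bigraph \<Rightarrow> bool" where
  "gauge_equivalent_via \<beta> G H \<longleftrightarrow>
     bij_betw \<beta> (blacks G) (blacks H) \<and>
     (\<exists>\<omega> f1 f2. bij_betw \<omega> (whites G) (whites H) \<and>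
        (\<forall>b \<in> blacks G. \<forall>w \<in> whites G.
           (b, w) \<in> adjacency G \<longleftrightarrow> (\<beta> b, \<omega> w) \<in> adjacency H) \<and>
        (\<forall>w \<in> whites G. f1 w \<noteq> 0) \<and> (\<forall>b \<in> blacks G. f2 b \<noteq> 0) \<and>
        (\<forall>(b, w) \<in> adjacency G. weight H (\<beta> b) (\<omega> w) = f1 w * f2 b * weight G b w))"

section \<open>Bipartite plane graphs\<close>

text \<open>
  A simple bipartite graph embedded in the plane (sphere), given by its rotation system.  Black and
  white vertices are both numbered by \<open>{..<n}\<close> and the edge between black \<open>i\<close> and white \<open>j\<close> is
  \<open>(i, j)\<close>; \<open>rot_b\<close> and \<open>rot_w\<close> give the next edge counterclockwise around the black, respectively
  white, endpoint.
\<close>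

record bipartite_map =
  nverts :: nat
  edges :: "(nat \<times> nat) set"
  rot_b :: "nat \<times> nat \<Rightarrow> nat \<times> nat"
  rot_w :: "nat \<times> nat \<Rightarrow> nat \<times> nat"

text \<open>
  Walking along \<open>e\<close> from black to white with a face on the right hand side, the boundary of this
  face continues along \<open>rot_w e\<close>, from white to black, and then along \<open>rot_b (rot_w e)\<close>, again from
  black to white.  The faces are therefore the orbits of \<open>rot_b \<circ> rot_w\<close>: the orbit of \<open>e\<close> stands
  for the face on the right of \<open>e\<close> and has half as many elements as the face has sides.
\<close>

definition face_perm :: "bipartite_map \<Rightarrow> nat \<times> nat \<Rightarrow> nat \<times> nat" where
  "face_perm G = rot_b G \<circ> rot_w G"

definition faces :: "bipartite_map \<Rightarrow> (nat \<times> nat) set set" where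
  "faces G = orbit (face_perm G) ` edges G"

text \<open>Planarity is Euler's formula \<open>V - E + F = 2\<close> for the connected map.\<close>

definition plane_bipartite_map :: "bipartite_map \<Rightarrow> bool" where
  "plane_bipartite_map G \<longleftrightarrow>
     fst ` edges G = {..<nverts G} \<and> snd ` edges G = {..<nverts G} \<and>
     rot_b G permutes edges G \<and> rot_w G permutes edges G \<and>
     (\<forall>e \<in> edges G. orbit (rot_b G) e = {e' \<in> edges G. fst e' = fst e}) \<and>
     (\<forall>e \<in> edges G. orbit (rot_w G) e = {e' \<in> edges G. snd e' = snd e}) \<and>
     (\<forall>e \<in> edges G. \<forall>e' \<in> edges G.
        (e, e') \<in> {(x, y). x \<in> edges G \<and> y \<in> edges G \<and> (fst x = fst y \<or> snd x = snd y)}\<^sup>*) \<and>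
     2 * int (nverts G) - int (card (edges G)) + int (card (faces G)) = 2"

definition perfect_matching :: "bipartite_map \<Rightarrow> (nat \<times> nat) set \<Rightarrow> bool" where
  "perfect_matching G M \<longleftrightarrow> M \<subseteq> edges G \<and>
     (\<forall>i < nverts G. \<exists>!e. e \<in> M \<and> fst e = i) \<and> (\<forall>j < nverts G. \<exists>!e. e \<in> M \<and> snd e = j)"

definition weighted_graph ::
  "bipartite_map \<Rightarrow> (nat \<times> nat \<Rightarrow> real) \<Rightarrow> (nat, nat) weighted_bigraph" where
  "weighted_graph G \<nu> = \<lparr> blacks = {..<nverts G}, whites = {..<nverts G},
     adjacency = edges G, weight = (\<lambda>i j. \<nu> (i, j)) \<rparr>"

section \<open>The outer face\<close>

text \<open>
  The outer face and the black vertex \<open>b\<^sub>0\<close> on it are given by an edge \<open>a\<close>: the outer face is the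
  face on the right of \<open>a\<close>, and \<open>b\<^sub>0\<close> is the black endpoint of \<open>a\<close>.  The outer face is then
  traversed counterclockwise around the graph, and its white vertices, starting after \<open>b\<^sub>0\<close>, are
  \<open>outer_white G a 1, \<dots>, outer_white G a m\<close>.
\<close>

definition outer_face :: "bipartite_map \<Rightarrow> nat \<times> nat \<Rightarrow> (nat \<times> nat) set" where
  "outer_face G a = orbit (face_perm G) a"

definition outer_size :: "bipartite_map \<Rightarrow> nat \<times> nat \<Rightarrow> nat" where
  "outer_size G a = card (outer_face G a)"

definition outer_white :: "bipartite_map \<Rightarrow> nat \<times> nat \<Rightarrow> nat \<Rightarrow> nat" where
  "outer_white G a k = snd ((face_perm G ^^ (k - 1)) a)"

section \<open>Kasteleyn matrices\<close>

text \<open>The edges of the face \<open>F\<close> are \<open>e\<close> and \<open>rot_w G e\<close> for \<open>e \<in> F\<close>; its degree is \<open>2 * card F\<close>.\<close>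

definition kasteleyn_signs :: "bipartite_map \<Rightarrow> nat \<times> nat \<Rightarrow> (nat \<times> nat \<Rightarrow> real) \<Rightarrow> bool" where
  "kasteleyn_signs G a s \<longleftrightarrow>
     (\<forall>e \<in> edges G. s e = 1 \<or> s e = - 1) \<and>
     (\<forall>F \<in> faces G - {outer_face G a}.
        (\<Prod>e\<in>F. s e * s (rot_w G e)) = (- 1) ^ (2 * card F div 2 + 1))"

definition kasteleyn_matrix ::
  "bipartite_map \<Rightarrow> (nat \<times> nat \<Rightarrow> real) \<Rightarrow> (nat \<times> nat \<Rightarrow> real) \<Rightarrow> real mat" where
  "kasteleyn_matrix G s \<nu> =
     Matrix.mat (nverts G) (nverts G) (\<lambda>e. if e \<in> edges G then s e * \<nu> e else 0)"

definition nondegenerate :: "nat \<Rightarrow> real mat \<Rightarrow> bool" where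
  "nondegenerate k A \<longleftrightarrow>
     (\<forall>I J. I \<subseteq> {..<dim_row A} \<and> J \<subseteq> {..<dim_col A} \<and>
        card I = dim_row A - k \<and> card J = dim_col A - k \<longrightarrow>
        Determinant.det (submatrix A I J) \<noteq> 0)"

section \<open>The construction\<close>

text \<open>
  A strictly convex polygon with vertices \<open>r 0, \<dots>, r m\<close> in cyclic order (of either orientation).
  Its edge vectors are \<open>q\<^sub>k = r k - r (k - 1)\<close> for \<open>1 \<le> k \<le> m\<close>, and \<open>q\<^sub>0 = r 0 - r m\<close>.
\<close>

definition convex_polygon :: "nat \<Rightarrow> (nat \<Rightarrow> complex) \<Rightarrow> bool" where
  "convex_polygon m r \<longleftrightarrow> 2 \<le> m \<and> inj_on r {..m} \<and>
     (\<forall>k \<le> m. closed_segment (r k) (r (Suc k mod Suc m)) edge_of (convex hull (r ` {..m})))"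

definition A_w :: "bipartite_map \<Rightarrow> nat \<times> nat \<Rightarrow> (nat \<Rightarrow> complex) \<Rightarrow> complex Matrix.vec" where
  "A_w G a r = Matrix.vec (nverts G)
     (\<lambda>j. \<Sum>k = 1..outer_size G a. if outer_white G a k = j then r k - r (k - 1) else 0)"

definition A_b :: "bipartite_map \<Rightarrow> nat \<times> nat \<Rightarrow> real Matrix.vec" where
  "A_b G a = unit_vec (nverts G) (fst a)"

definition scale_cols :: "real mat \<Rightarrow> real Matrix.vec \<Rightarrow> real mat" where
  "scale_cols A f = Matrix.mat (dim_row A) (dim_col A) (\<lambda>(i, j). A $$ (i, j) * vec_index f j)"

definition scale_rows :: "complex Matrix.vec \<Rightarrow> complex mat \<Rightarrow> complex mat" where
  "scale_rows g A = Matrix.mat (dim_row A) (dim_col A) (\<lambda>(i, j). vec_index g i * A $$ (i, j))"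

text \<open>
  The vertices of the dual graph: \<open>Inner F\<close> for an interior face \<open>F\<close>, and \<open>Outer 0, \<dots>, Outer m\<close>
  for the outer regions, in counterclockwise order starting at the curve from \<open>b\<^sub>0\<close> to infinity.
  Thus \<open>Outer k\<close> lies between the curves from the \<open>k\<close>-th and the \<open>k+1\<close>-st outer white vertex, where
  \<open>b\<^sub>0\<close> takes the place of the \<open>0\<close>-th and of the \<open>m+1\<close>-st one; for \<open>k < m\<close> it is on the right of
  the edge \<open>(face_perm G ^^ k) a\<close>.
\<close>

datatype dual_vertex = Inner "(nat \<times> nat) set" | Outer nat

definition dual_vertices :: "bipartite_map \<Rightarrow> nat \<times> nat \<Rightarrow> dual_vertex set" where
  "dual_vertices G a = Inner ` (faces G - {outer_face G a}) \<union> Outer ` {..outer_size G a}"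

text \<open>
  The endpoints of the dual edge crossing \<open>e\<close>, on the right and on the left of \<open>e\<close> directed from
  black to white.  The corner at the black endpoint between \<open>e\<close> and \<open>rot_b G e\<close> is on the left of
  \<open>e\<close> and on the right of \<open>rot_b G e\<close>; it is cut in two by a curve to infinity only if
  \<open>rot_b G e = a\<close>.
\<close>

definition right_vertex :: "bipartite_map \<Rightarrow> nat \<times> nat \<Rightarrow> nat \<times> nat \<Rightarrow> dual_vertex" where
  "right_vertex G a e =
     (if e \<in> outer_face G a then Outer (funpow_dist (face_perm G) a e)
      else Inner (orbit (face_perm G) e))"

definition left_vertex :: "bipartite_map \<Rightarrow> nat \<times> nat \<Rightarrow> nat \<times> nat \<Rightarrow> dual_vertex" where
  "left_vertex G a e =
     (if rot_b G e = a then Outer (outer_size G a) else right_vertex G a (rot_b G e))"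

text \<open>
  The flow \<open>T\<close> from black to white, rotated counterclockwise by ninety degrees, is the gradient
  of \<open>\<psi>\<close>.
\<close>

definition dual_potential ::
  "bipartite_map \<Rightarrow> nat \<times> nat \<Rightarrow> complex mat \<Rightarrow> (dual_vertex \<Rightarrow> complex) \<Rightarrow> bool" where
  "dual_potential G a T \<psi> \<longleftrightarrow>
     (\<forall>e \<in> edges G. \<psi> (left_vertex G a e) - \<psi> (right_vertex G a e) = T $$ e)"

definition construction ::
  "bipartite_map \<Rightarrow> nat \<times> nat \<Rightarrow> real mat \<Rightarrow> (nat \<Rightarrow> complex) \<Rightarrow>
   real Matrix.vec \<Rightarrow> complex Matrix.vec \<Rightarrow> (dual_vertex \<Rightarrow> complex) \<Rightarrow> bool" where
  "construction G a K r f g \<psi> \<longleftrightarrow>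
     (let K' = map_mat complex_of_real (scale_cols K f)
      in f \<in> carrier_vec (nverts G) \<and> K *\<^sub>v f = A_b G a \<and>
         g \<in> carrier_vec (nverts G) \<and> transpose_mat K' *\<^sub>v g = A_w G a r \<and>
         dual_potential G a (scale_rows g K') \<psi>)"

definition dual_segment ::
  "bipartite_map \<Rightarrow> nat \<times> nat \<Rightarrow> (dual_vertex \<Rightarrow> complex) \<Rightarrow> nat \<Rightarrow> complex set" where
  "dual_segment G a \<psi> i = rel_interior
     (\<Union>e \<in> {e \<in> edges G. fst e = i}.
        closed_segment (\<psi> (right_vertex G a e)) (\<psi> (left_vertex G a e)))"

section \<open>T-graphs\<close>

definition T_graph :: "complex set set \<Rightarrow> complex set \<Rightarrow> bool" where
  "T_graph \<L> R \<longleftrightarrow> finite \<L> \<and>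
     (\<forall>l \<in> \<L>. \<exists>x y. x \<noteq> y \<and> l = open_segment x y) \<and>
     disjoint \<L> \<and> connected (\<Union>\<L>) \<and>
     R = {z. z islimpt \<Union>\<L>} - \<Union>\<L> \<and> finite R \<and>
     R \<subseteq> frontier (outside (closure (\<Union>\<L>)))"

definition T_vertices :: "complex set set \<Rightarrow> complex set" where
  "T_vertices \<L> = {x. \<exists>y. x \<noteq> y \<and> open_segment x y \<in> \<L>}"

definition enclosing_curve :: "complex set set \<Rightarrow> complex set \<Rightarrow> (real \<Rightarrow> complex) \<Rightarrow> bool" where
  "enclosing_curve \<L> R \<gamma> \<longleftrightarrow> simple_path \<gamma> \<and> pathfinish \<gamma> = pathstart \<gamma> \<and>
     R \<subseteq> path_image \<gamma> \<and> \<Union>\<L> \<subseteq> inside (path_image \<gamma>)"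

definition T_faces :: "complex set set \<Rightarrow> (real \<Rightarrow> complex) \<Rightarrow> complex set set" where
  "T_faces \<L> \<gamma> = {F \<in> components (- (\<Union>\<L> \<union> path_image \<gamma>)). bounded F}"

text \<open>The outer faces are those having more than root vertices in common with the curve.\<close>

definition outer_T_face ::
  "complex set set \<Rightarrow> complex set \<Rightarrow> (real \<Rightarrow> complex) \<Rightarrow> complex set \<Rightarrow> bool" where
  "outer_T_face \<L> R \<gamma> F \<longleftrightarrow> F \<in> T_faces \<L> \<gamma> \<and> \<not> frontier F \<inter> path_image \<gamma> \<subseteq> R"

text \<open>The length of \<open>S \<inter> l\<close> for an open segment \<open>l\<close>; it does not depend on the order of the endpoints.\<close>

definition length_on :: "complex set \<Rightarrow> complex set \<Rightarrow> real" where
  "length_on l S =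
     (let (x, y) = (SOME (x, y). x \<noteq> y \<and> l = open_segment x y)
      in dist x y * measure lborel {t \<in> {0<..<1}. linepath x y t \<in> S})"

definition dimer_graph ::
  "complex set set \<Rightarrow> (real \<Rightarrow> complex) \<Rightarrow> complex set \<Rightarrow> (complex set, complex set) weighted_bigraph"
  where
  "dimer_graph \<L> \<gamma> F0 = \<lparr> blacks = \<L>, whites = T_faces \<L> \<gamma> - {F0},
     adjacency = {(l, F). l \<in> \<L> \<and> F \<in> T_faces \<L> \<gamma> - {F0} \<and> length_on l (frontier F) > 0},
     weight = (\<lambda>l F. length_on l (frontier F)) \<rparr>"

end

theory Submission
  imports Defs "HOL-Complex_Analysis.Contour_Integration"
begin

text \<open>
  The signs of the Kasteleyn matrix and Euler's formula force the flow to have, with the outer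
  regions counted suitably, the least possible number of sign changes around every vertex and face.
  Hence the dual edges around a white vertex bound a strictly convex polygon, all these polygons have
  the orientation of \<open>Q\<close>, and counting signed crossings with a generic ray shows that they tile \<open>Q\<close>.
  Every other black vertex turns back exactly twice, at the ends of its segment, so the segments are
  disjoint.  For an enclosing curve \<open>\<gamma>\<close>, the boundary of an outer polygon without its side on \<open>Q\<close> is
  a crosscut of the inside of \<open>\<gamma>\<close>, which identifies the faces of the T-graph.  Non-degeneracy enters
  through the \<open>2 \<times> 2\<close> minors of the inverse matrix: for generic \<open>Q\<close> no two segments are parallel.
\<close>

text \<open>Both sign counts follow one scheme. Every edge names one corner of a face, every corner
  is charged to a vertex or to a face, parity gives each of these a lower bound, and the bounds add
  up to the number of edges prescribed by Euler's formula, so all of them are sharp. The scheme runs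
  once over the corners at black vertices, with the signs of the flow, and then, for each generic
  direction \<open>v\<close>, over the corners at white vertices, with the signs of
  \<open>cr v (T e)\<close>. The obstacle is that a map given by rotations carries no plane
  topology. Euler's formula also has to replace the Jordan curve theorem, and does so as a dimension
  count: gradients on the dual and coboundaries on the primal graph are orthogonal. This yields the
  existence of \<open>\<psi>\<close> and, since a graph whose edges all lie in perfect matchings has
  no white cut vertex, that the outer face visits each white vertex at most once. Non-degeneracy
  speaks only of minors of size \<open>n - 2\<close>. That the determinant and the minors of size
  \<open>n - 1\<close> do not vanish, which keeps \<open>f\<close> away from 0, is where generic
  weights enter.\<close>

definition cr :: "complex => complex => real" where
  "cr x y = Re x * Im y - Im x * Re y"

lemma cr_simps [simp]:
  "cr (x + y) z = cr x z + cr y z" "cr x (y + z) = cr x y + cr x z"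
  "cr (x - y) z = cr x z - cr y z" "cr x (y - z) = cr x y - cr x z"
  "cr (- x) z = - cr x z" "cr x (- z) = - cr x z"
  "cr (of_real c * x) z = c * cr x z" "cr x (of_real c * z) = c * cr x z"
  "cr (c *\<^sub>R x) z = c * cr x z" "cr x (c *\<^sub>R z) = c * cr x z"
  "cr 0 z = 0" "cr x 0 = 0" "cr x x = 0"
  by (auto simp: cr_def algebra_simps)

lemma cr_commute: "cr x y = - cr y x"
  by (simp add: cr_def)

lemma cr_sum_right: "cr x (\<Sum>i\<in>I. f i) = (\<Sum>i\<in>I. cr x (f i))"
  by (simp add: cr_def sum_distrib_left sum_subtractf)

lemma cr_inner: "cr x z = inner (\<i> * x) z"
  by (simp add: cr_def inner_complex_def)

text \<open>Cramer's rule in the basis \<open>x\<close>, \<open>y\<close>.\<close>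

lemma cr_expand:
  assumes "cr x y ~= 0"
  shows "z = of_real (cr z y / cr x y) * x + of_real (cr x z / cr x y) * y"
proof -
  have "cr x y * Re z = cr z y * Re x + cr x z * Re y" "cr x y * Im z = cr z y * Im x + cr x z * Im y"
    by (simp_all add: cr_def algebra_simps)
  then have "Re z = (cr z y * Re x + cr x z * Re y) / cr x y" "Im z = (cr z y * Im x + cr x z * Im y) / cr x y"
    using assms by (metis nonzero_mult_div_cancel_left)+
  then show ?thesis by (simp add: complex_eq_iff add_divide_distrib)
qed

lemma cr_eq_0_iff:
  assumes "x ~= 0"
  shows "cr x y = 0 \<longleftrightarrow> (\<exists>c. y = of_real c * x)"
proof
  assume *: "cr x y = 0"
  have n: "(Re x)\<^sup>2 + (Im x)\<^sup>2 ~= 0"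
    using assms by (simp add: complex_eq_iff sum_power2_eq_zero_iff)
  \<comment> \<open>The coefficient of the orthogonal projection of \<open>y\<close> to the line
    through \<open>x\<close>.\<close>
  define c where "c = (Re x * Re y + Im x * Im y) / ((Re x)\<^sup>2 + (Im x)\<^sup>2)"
  have 1: "Re x * Im y = Im x * Re y" using * by (simp add: cr_def)
  have 2: "((Re x)\<^sup>2 + (Im x)\<^sup>2) * Re y = (Re x * Re y + Im x * Im y) * Re x"
    using arg_cong[OF 1, of "\<lambda>u. Im x * u"] by (simp only: power2_eq_square ring_distribs mult_ac)
  have 3: "((Re x)\<^sup>2 + (Im x)\<^sup>2) * Im y = (Re x * Re y + Im x * Im y) * Im x"
    using arg_cong[OF 1, of "\<lambda>u. Re x * u"] by (simp only: power2_eq_square ring_distribs mult_ac)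
  have "Re y = c * Re x" "Im y = c * Im x"
    using 2 3 n unfolding c_def by (simp_all add: nonzero_eq_divide_eq mult.commute)
  then have "y = of_real c * x"
    by (simp add: complex_eq_iff)
  then show "\<exists>c. y = of_real c * x" by blast
qed auto

text \<open>The witness is \<open>t\<close> rotated by a small angle.\<close>

lemma cr_perturb:
  assumes "finite S" "t ~= 0" "\<And>x. x \<in> S ==> x ~= 0"
  obtains v where "cr v t ~= 0" "0 < cr v t \<longleftrightarrow> \<delta>" "\<And>x. x \<in> S ==> cr v x ~= 0"
    "\<And>x. x \<in> S ==> cr t x ~= 0 ==> 0 < cr v x \<longleftrightarrow> 0 < cr t x"
proof -
  define w where "w = (if \<delta> then - \<i> * t else \<i> * t)"
  have n: "(Re t)\<^sup>2 + (Im t)\<^sup>2 > 0"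
    using assms(2) by (simp add: complex_eq_iff sum_power2_gt_zero_iff)
  have wt: "cr w t = (if \<delta> then 1 else -1) * ((Re t)\<^sup>2 + (Im t)\<^sup>2)"
    by (simp add: w_def cr_def power2_eq_square)
  \<comment> \<open>For \<open>x\<close> parallel to \<open>t\<close> only the summand with
    \<open>w\<close> counts, and it is nonzero. For the other \<open>x\<close> the strict sign of
    \<open>cr t x\<close> survives a small change.\<close>
  have ev: "\<forall>\<^sub>F e in at_right (0::real). cr (t + of_real e * w) x ~= 0 \<and>
      (cr t x ~= 0 \<longrightarrow> (0 < cr (t + of_real e * w) x \<longleftrightarrow> 0 < cr t x))" if x: "x \<in> S" for x
  proof (cases "cr t x = 0")
    case True
    then obtain c where c: "x = of_real c * t" using cr_eq_0_iff[OF assms(2)] by blast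
    then have "c ~= 0" using assms(3)[OF x] by auto
    moreover have "cr w t ~= 0" using n wt by (cases \<delta>) auto
    ultimately have "cr w x ~= 0" using c by simp
    then show ?thesis
      by (intro eventually_mono[OF eventually_at_right_less[of 0]]) (simp add: True)
  next
    case False
    have lim: "((\<lambda>e. cr (t + of_real e * w) x) \<longlongrightarrow> cr t x + 0 * cr w x) (at_right 0)"
      by (simp only: cr_simps) (intro tendsto_intros)
    show ?thesis
    proof (cases "0 < cr t x")
      case True
      have "\<forall>\<^sub>F e in at_right 0. 0 < cr (t + of_real e * w) x"
        using order_tendstoD(1)[OF lim, of 0] True by simp
      then show ?thesis using True by (auto elim: eventually_mono)
    next
      case F: False
      have "\<forall>\<^sub>F e in at_right 0. cr (t + of_real e * w) x < 0"
        using order_tendstoD(2)[OF lim, of 0] F False by simp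
      then show ?thesis using F by (auto elim: eventually_mono)
    qed
  qed
  have "\<forall>\<^sub>F e in at_right (0::real). \<forall>x\<in>S. cr (t + of_real e * w) x ~= 0 \<and>
      (cr t x ~= 0 \<longrightarrow> (0 < cr (t + of_real e * w) x \<longleftrightarrow> 0 < cr t x))"
    using ev by (intro eventually_ball_finite assms) auto
  then have "\<forall>\<^sub>F e in at_right (0::real). (\<forall>x\<in>S. cr (t + of_real e * w) x ~= 0 \<and>
      (cr t x ~= 0 \<longrightarrow> (0 < cr (t + of_real e * w) x \<longleftrightarrow> 0 < cr t x))) \<and> 0 < e"
    by (intro eventually_conj eventually_at_right_less)
  then obtain e :: real where e: "\<forall>x\<in>S. cr (t + of_real e * w) x ~= 0 \<and>
      (cr t x ~= 0 \<longrightarrow> (0 < cr (t + of_real e * w) x \<longleftrightarrow> 0 < cr t x))" "0 < e"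
    using eventually_happens'[OF trivial_limit_at_right_real] by blast
  have "cr (t + of_real e * w) t = e * cr w t" by simp
  then have "cr (t + of_real e * w) t ~= 0" "0 < cr (t + of_real e * w) t \<longleftrightarrow> \<delta>"
    using n e(2) by (auto simp: wt zero_less_mult_iff)
  then show ?thesis using e that by blast
qed

section \<open>Periodic sequences and their changes of sign\<close>

lemma periodic_sum_shift:
  fixes f :: "nat => 'a::ab_group_add"
  assumes "\<And>l. f (l + d) = f l"
  shows "(\<Sum>l<d. f (i + l)) = (\<Sum>l<d. f l)"
proof (induction i)
  case (Suc i)
  have "(\<Sum>l<d. f (Suc i + l)) + f i = (\<Sum>l<Suc d. f (i + l))"
    by (subst sum.lessThan_Suc_shift) (simp add: add.commute)
  also have "\<dots> = (\<Sum>l<d. f (i + l)) + f i" by (simp add: assms)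
  finally show ?case using Suc by simp
qed simp

lemma periodic_mod:
  fixes f :: "nat => 'a"
  assumes "\<And>l. f (l + d) = f l"
  shows "f (l mod d) = f l"
proof -
  have "f (r + k * d) = f r" for r k
  proof (induction k)
    case (Suc k)
    have "f (r + Suc k * d) = f ((r + k * d) + d)" by (simp add: algebra_simps)
    then show ?case using assms Suc by simp
  qed simp
  from this[of "l mod d" "l div d"] show ?thesis by simp
qed

text \<open>The number of changes is the same over every window of length \<open>d\<close>. In the
  window starting at \<open>i\<close> one of the two changes is \<open>i\<close> itself, so a single
  further one separates two constant blocks.\<close>

lemma two_changes:
  fixes b :: "nat => bool"
  assumes per: "\<And>l. b (l + d) = b l" and two: "card {l. l < d \<and> b l ~= b (Suc l)} = 2"
    and i: "b i ~= b (Suc i)"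
  obtains k where "0 < k" "k < d" "\<And>l. l < k ==> b (Suc i + l) = b (Suc i)"
    "\<And>l. k \<le> l ==> l < d ==> b (Suc i + l) ~= b (Suc i)"
proof -
  define f :: "nat => int" where "f l = (if b l ~= b (Suc l) then 1 else 0)" for l
  have pf: "f (l + d) = f l" for l using per[of l] per[of "Suc l"] by (simp add: f_def)
  have card_f: "(\<Sum>l<d. f (j + l)) = card {l. l < d \<and> b (j + l) ~= b (Suc (j + l))}" for j
    by (simp add: f_def sum.If_cases Int_def)
  have c2: "card {l. l < d \<and> b (i + l) ~= b (Suc (i + l))} = 2"
    using periodic_sum_shift[of f d i, OF pf] card_f[of i] card_f[of 0] two by simp
  then obtain x y where xy: "{l. l < d \<and> b (i + l) ~= b (Suc (i + l))} = {x, y}" "x ~= y"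
    by (auto simp: card_2_iff)
  have "0 < d" using two by (cases d) auto
  then have "0 \<in> {l. l < d \<and> b (i + l) ~= b (Suc (i + l))}" using i by simp
  then have "x = 0 \<or> y = 0" unfolding xy(1) by auto
  then obtain k where k: "{l. l < d \<and> b (i + l) ~= b (Suc (i + l))} = {0, k}" "0 < k"
    using xy by (metis insert_commute neq0_conv)
  have "k \<in> {l. l < d \<and> b (i + l) ~= b (Suc (i + l))}" unfolding k(1) by simp
  then have kd: "k < d" "b (i + k) ~= b (Suc (i + k))" by simp_all
  have st: "b (i + l) = b (Suc (i + l))" if "0 < l" "l < d" "l ~= k" for l
  proof -
    have "l \<notin> {l. l < d \<and> b (i + l) ~= b (Suc (i + l))}" unfolding k(1) using that by simp
    then show ?thesis using that by simp
  qed
  have A: "b (Suc i + l) = b (Suc i)" if "l < k" for l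
    using that
  proof (induction l)
    case (Suc l) then show ?case using st[of "Suc l"] kd by simp
  qed simp
  have B: "b (Suc i + l) ~= b (Suc i)" if "k \<le> l" "l < d" for l
    using that
  proof (induction l rule: nat_induct_at_least)
    case base
    then show ?case using kd A[of "k - 1"] k(2) by auto
  next
    case (Suc l) then show ?case using st[of "Suc l"] by simp
  qed
  show ?thesis using that[OF k(2) kd(1) A B] .
qed

text \<open>
  The signed number of crossings of the ray from \<open>z\<close> in direction \<open>v\<close> by the segment from \<open>x\<close> to
  \<open>y\<close>; only used when \<open>x\<close> and \<open>y\<close> are off the line through the ray and \<open>z\<close> is off the segment.
\<close>

definition crossing :: "complex => complex => complex => complex => real" where
  "crossing v z x y =
     (if cr v (x - z) < 0 \<and> 0 < cr v (y - z) \<and> 0 < cr (x - z) (y - z) then 1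
      else if cr v (y - z) < 0 \<and> 0 < cr v (x - z) \<and> cr (x - z) (y - z) < 0 then -1 else 0)"

text \<open>On a line that is transversal to the ray, the signed crossing is a difference of values
  of one function: \<open>F\<close> is the indicator of the points on the positive side, and it is
  identically zero if the line misses the ray (\<open>s \<le> 0\<close>). Crossings of consecutive
  pieces of one line therefore telescope.\<close>

lemma crossing_line:
  assumes vg: "cr v g ~= 0"
  obtains F :: "real => real" where
    "\<And>\<alpha> \<beta>. cr v (o' + of_real \<alpha> * g - z) ~= 0 ==> cr v (o' + of_real \<beta> * g - z) ~= 0 ==>
       crossing v z (o' + of_real \<alpha> * g) (o' + of_real \<beta> * g) = F \<beta> - F \<alpha>"
proof -
  define s where "s = cr (o' - z) g / cr v g"
  define \<tau> where "\<tau> = cr v (o' - z) / cr v g"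
  have oz: "o' - z = of_real s * v + of_real \<tau> * g"
    unfolding s_def \<tau>_def by (rule cr_expand[OF vg])
  have e: "o' + of_real \<alpha> * g - z = of_real s * v + of_real (\<tau> + \<alpha>) * g" for \<alpha>
    using oz by (simp add: algebra_simps)
  have h: "cr v (o' + of_real \<alpha> * g - z) = (\<tau> + \<alpha>) * cr v g" for \<alpha>
    unfolding e by (simp del: of_real_add)
  have c: "cr (o' + of_real \<alpha> * g - z) (o' + of_real \<beta> * g - z) = s * ((\<tau> + \<beta>) * cr v g - (\<tau> + \<alpha>) * cr v g)" for \<alpha> \<beta>
    unfolding e cr_simps using cr_commute[of g v] by (simp add: algebra_simps)
  define F :: "real => real" where "F \<alpha> = (if s > 0 \<and> (\<tau> + \<alpha>) * cr v g > 0 then 1 else 0)" for \<alpha>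
  have "crossing v z (o' + of_real \<alpha> * g) (o' + of_real \<beta> * g) = F \<beta> - F \<alpha>"
    if "cr v (o' + of_real \<alpha> * g - z) ~= 0" "cr v (o' + of_real \<beta> * g - z) ~= 0" for \<alpha> \<beta>
  proof -
    let ?x = "(\<tau> + \<alpha>) * cr v g" and ?y = "(\<tau> + \<beta>) * cr v g"
    have xy: "?x ~= 0" "?y ~= 0" using that unfolding h by auto
    have "crossing v z (o' + of_real \<alpha> * g) (o' + of_real \<beta> * g) =
      (if ?x < 0 \<and> 0 < ?y \<and> 0 < s * (?y - ?x) then 1
       else if ?y < 0 \<and> 0 < ?x \<and> s * (?y - ?x) < 0 then -1 else 0)"
      unfolding crossing_def h c by simp
    also have "\<dots> = F \<beta> - F \<alpha>"
      using xy unfolding F_def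
      by (cases "?x < 0"; cases "?y < 0"; cases "s > 0")
         (auto simp: zero_less_mult_iff mult_less_0_iff not_less)
    finally show ?thesis .
  qed
  then show ?thesis using that by blast
qed

section \<open>Polygons that are convex by a count of sign changes\<close>

text \<open>Strict convexity in the only form that the corner counts supply: seen from any direction
  not parallel to a side, the polygon changes between rising and falling exactly twice per turn.
  Convexity, the orientation and simplicity have to be derived from this.\<close>

locale cyclic_polygon =
  fixes p :: "nat => complex" and d :: nat
  assumes d3: "3 \<le> d"
    and periodic: "p (j + d) = p j"
    and nonparallel: "i < d ==> j < d ==> i ~= j ==> cr (p (Suc i) - p i) (p (Suc j) - p j) ~= 0"
    and two_sign_changes: "(\<And>j. j < d ==> cr v (p (Suc j) - p j) ~= 0) ==>
      card {j. j < d \<and> (0 < cr v (p (Suc j) - p j)) ~= (0 < cr v (p (Suc (Suc j)) - p (Suc j)))} = 2"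
begin

definition side :: "nat => complex" where "side j = p (Suc j) - p j"

lemma d_pos: "0 < d" using d3 by simp

lemma p_mod: "p (j mod d) = p j"
  by (rule periodic_mod) (rule periodic)

lemma side_periodic: "side (j + d) = side j"
  using periodic[of j] periodic[of "Suc j"] by (simp add: side_def)

lemma side_mod: "side (j mod d) = side j"
  by (rule periodic_mod) (rule side_periodic)

lemma side_nonparallel:
  assumes "i mod d ~= j mod d"
  shows "cr (side i) (side j) ~= 0"
  using nonparallel[of "i mod d" "j mod d"] assms d_pos
  by (metis mod_less_divisor side_def side_mod)

lemma side_nonzero: "side j ~= 0"
proof -
  have "j mod d ~= Suc j mod d" using d3 by (simp add: mod_Suc)
  from side_nonparallel[OF this] show ?thesis by auto
qed

lemma sum_side: "(\<Sum>l<d. side (i + l)) = 0"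
proof -
  have "(\<Sum>l<n. side (i + l)) = p (i + n) - p i" for n
    by (induction n) (simp_all add: side_def)
  then show ?thesis by (simp add: periodic)
qed

lemma Suc_mod_neq: "j mod d ~= Suc j mod d" "j mod d ~= Suc (Suc j) mod d"
  using d3 by (auto simp: mod_Suc split: if_splits)

lemma add_mod_neq: "0 < l ==> l < d ==> (j + l) mod d ~= j mod d"
  using mod_eq_dvd_iff_nat[of j "j + l" d] by (auto dest: dvd_imp_le)

text \<open>The hypothesis on sign changes applies to generic directions only, while the arguments
  look along a side. The perturbed direction sees every side not parallel to \<open>t\<close> as
  \<open>t\<close> does, and the sign it gives to \<open>t\<close> itself is free.\<close>

lemma generic_direction:
  assumes "t ~= 0" "finite S" "\<And>x. x \<in> S ==> x ~= 0"
  obtains v where "cr v t ~= 0" "0 < cr v t \<longleftrightarrow> \<delta>" "\<And>j. cr v (side j) ~= 0"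
    "\<And>j. cr t (side j) ~= 0 ==> 0 < cr v (side j) \<longleftrightarrow> 0 < cr t (side j)" "\<And>x. x \<in> S ==> cr v x ~= 0"
proof -
  obtain v where v: "cr v t ~= 0" "0 < cr v t \<longleftrightarrow> \<delta>" "\<And>x. x \<in> side ` {..<d} \<union> S ==> cr v x ~= 0"
    "\<And>x. x \<in> side ` {..<d} \<union> S ==> cr t x ~= 0 ==> 0 < cr v x \<longleftrightarrow> 0 < cr t x"
    by (rule cr_perturb[of "side ` {..<d} \<union> S" t \<delta>]) (use assms side_nonzero in auto)
  have m: "side j \<in> side ` {..<d} \<union> S" for j
    using side_mod[of j] d_pos by (metis UnI1 image_eqI lessThan_iff mod_less_divisor)
  show ?thesis using that[of v] v m by auto
qed

lemma two_side_changes: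
  assumes "\<And>j. cr v (side j) ~= 0" and "(0 < cr v (side i)) ~= (0 < cr v (side (Suc i)))"
  obtains k where "0 < k" "k < d"
    "\<And>l. l < k ==> 0 < cr v (side (Suc i + l)) \<longleftrightarrow> 0 < cr v (side (Suc i))"
    "\<And>l. k \<le> l ==> l < d ==> (0 < cr v (side (Suc i + l))) ~= (0 < cr v (side (Suc i)))"
proof (rule two_changes[of "\<lambda>l. 0 < cr v (side l)" d i])
  show "card {l. l < d \<and> (0 < cr v (side l)) ~= (0 < cr v (side (Suc l)))} = 2"
    using two_sign_changes[of v] assms(1) by (simp add: side_def)
qed (use that assms side_periodic in auto)

text \<open>Were two consecutive turns opposite, the neighbours of the side \<open>t\<close> between
  them would lie on one side of the line of \<open>t\<close>. A direction near \<open>t\<close> that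
  gives \<open>t\<close> the opposite sign then changes sign right before and right after
  \<open>t\<close>, which uses up both changes. So all other sides lie on that same side of
  \<open>t\<close>, although the sides sum to zero.\<close>

lemma turn_step: "0 < cr (side j) (side (Suc j)) \<longleftrightarrow> 0 < cr (side (Suc j)) (side (Suc (Suc j)))"
proof (rule ccontr)
  define t where "t = side (Suc j)"
  define s where "s \<longleftrightarrow> 0 < cr t (side (Suc (Suc j)))"
  assume "\<not> ?thesis"
  moreover have nz: "cr (side j) (side (Suc j)) ~= 0"
    by (rule side_nonparallel) (rule Suc_mod_neq)
  ultimately have a: "0 < cr t (side j) \<longleftrightarrow> s" "cr t (side j) ~= 0"
    using cr_commute[of t "side j"] by (auto simp: s_def t_def)
  have b: "cr t (side (Suc (Suc j))) ~= 0"
    unfolding t_def by (rule side_nonparallel) (rule Suc_mod_neq)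
  \<comment> \<open>The sign on \<open>t\<close> is chosen against the common sign \<open>s\<close>
    of its two neighbours.\<close>
  obtain v where v: "0 < cr v t \<longleftrightarrow> \<not> s" "\<And>j. cr v (side j) ~= 0"
    "\<And>j. cr t (side j) ~= 0 ==> 0 < cr v (side j) \<longleftrightarrow> 0 < cr t (side j)"
    by (rule generic_direction[of t "{}" "\<not> s"]) (auto simp: side_nonzero t_def)
  have "(0 < cr v (side j)) ~= (0 < cr v (side (Suc j)))"
    using a v(1) v(3)[of j] by (simp add: t_def)
  from two_side_changes[OF v(2) this] obtain k where k: "0 < k" "k < d"
    "\<And>l. l < k ==> 0 < cr v (side (Suc j + l)) \<longleftrightarrow> 0 < cr v (side (Suc j))"
    "\<And>l. k \<le> l ==> l < d ==> (0 < cr v (side (Suc j + l))) ~= (0 < cr v (side (Suc j)))"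
    by blast
  have "0 < cr v (side (Suc (Suc j))) \<longleftrightarrow> s"
    using v(3)[OF b] s_def by simp
  then have "k = 1"
    using k(1) k(3)[of 1] v(1) by (cases "1 < k") (auto simp: t_def)
  then have c: "0 < cr t (side (Suc j + l)) \<longleftrightarrow> s" "cr t (side (Suc j + l)) ~= 0" if "0 < l" "l < d" for l
  proof -
    show n: "cr t (side (Suc j + l)) ~= 0"
      unfolding t_def by (rule side_nonparallel) (use add_mod_neq[OF that, of "Suc j"] in simp)
    show "0 < cr t (side (Suc j + l)) \<longleftrightarrow> s"
      using k(4)[of l] \<open>k = 1\<close> v(1) v(3)[OF n] that by (auto simp: t_def)
  qed
  have "0 = (\<Sum>l<d. cr t (side (Suc j + l)))"
    using sum_side[of "Suc j"] by (simp add: cr_sum_right[symmetric])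
  also have "\<dots> = cr t (side (Suc j + 0)) + (\<Sum>l\<in>{..<d}-{0}. cr t (side (Suc j + l)))"
    by (rule sum.remove) (use d_pos in auto)
  finally have z: "(\<Sum>l\<in>{..<d}-{0}. cr t (side (Suc j + l))) = 0" by (simp add: t_def)
  have "1 \<in> {..<d} - {0}" using d3 by auto
  then have ne: "finite ({..<d} - {0})" "{..<d} - {0} ~= {}" by blast+
  show False
  proof (cases s)
    case True
    have "0 < (\<Sum>l\<in>{..<d}-{0}. cr t (side (Suc j + l)))"
      by (rule sum_pos[OF ne]) (use c True in auto)
    then show False using z by simp
  next
    case False
    have "0 < (\<Sum>l\<in>{..<d}-{0}. - cr t (side (Suc j + l)))"
      by (rule sum_pos[OF ne]) (use c False in force)
    then show False using z by (simp add: sum_negf)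
  qed
qed

definition orient :: real where "orient = sgn (cr (side 0) (side 1))"

lemma orient_cases: "orient = 1 \<or> orient = - 1"
  using side_nonparallel[of 0 1] d3 by (auto simp: orient_def sgn_if)

lemma orient_abs [simp]: "\<bar>orient\<bar> = 1" "orient * orient = 1" "orient * (orient * x) = x"
  using orient_cases by auto

lemma orient_turn: "0 < orient * cr (side j) (side (Suc j))"
proof -
  have nz: "cr (side j) (side (Suc j)) ~= 0" for j
    by (rule side_nonparallel) (rule Suc_mod_neq)
  have "0 < cr (side j) (side (Suc j)) \<longleftrightarrow> 0 < cr (side 0) (side (Suc 0))"
    by (induction j) (use turn_step in auto)
  then show ?thesis
    using nz[of j] nz[of 0] by (auto simp: orient_def sgn_if)
qed

text \<open>The distance from the line of side \<open>j\<close> times the length of that side, with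
  a sign that is positive on the inner side for either orientation.\<close>

definition level :: "nat => complex => real" where
  "level j z = orient * cr (side j) (z - p j)"

lemma level_mod: "level (j mod d) z = level j z"
  by (simp add: level_def side_mod p_mod)

lemma level_affine: "level j (z + y) = level j z + orient * cr (side j) y"
  by (simp add: level_def algebra_simps)

lemma level_Suc: "level j z = orient * cr (side j) (z - p (Suc j))"
proof -
  have "z - p j = (z - p (Suc j)) + side j" by (simp add: side_def)
  then show ?thesis unfolding level_def by (simp only: cr_simps) simp
qed

text \<open>In a direction close to side \<open>j\<close>, one change of sign occurs right before
  side \<open>j\<close>, so the sides starting with \<open>j\<close> form one block of each sign.
  Along the polygon the level thus starts at 0, stays there along side \<open>j\<close>, rises
  strictly, then falls strictly, and is back at 0 after a full turn.\<close>

lemma level_vertex_rel: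
  assumes "l \<le> d"
  shows "0 \<le> level j (p (j + l))" and "2 \<le> l ==> l < d ==> 0 < level j (p (j + l))"
proof -
  \<comment> \<open>The side before \<open>j\<close>, shifted by a period so that the subtraction
    does not truncate at \<open>j = 0\<close>.\<close>
  define i where "i = j + d - 1"
  have i: "Suc i = j + d" using d_pos by (simp add: i_def)
  have si: "side (Suc i + l) = side (j + l)" for l
    using side_periodic[of "j + l"] by (simp add: i add.commute add.left_commute)
  obtain v where v: "0 < cr v (side j) \<longleftrightarrow> 0 < orient" "\<And>j. cr v (side j) ~= 0"
    "\<And>l. cr (side j) (side l) ~= 0 ==> 0 < cr v (side l) \<longleftrightarrow> 0 < cr (side j) (side l)"
    by (rule generic_direction[of "side j" "{}" "0 < orient"]) (auto simp: side_nonzero)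
  have ti: "0 < orient * cr (side i) (side j)" using orient_turn[of i] si[of 0] by simp
  then have ni: "cr (side j) (side i) ~= 0" using cr_commute[of "side i" "side j"] by auto
  have "0 < cr v (side i) \<longleftrightarrow> \<not> 0 < orient"
    using v(3)[OF ni] ti cr_commute[of "side i" "side j"] orient_cases
    by (auto simp: zero_less_mult_iff mult_less_0_iff)
  then have "(0 < cr v (side i)) ~= (0 < cr v (side (Suc i)))" using v(1) si[of 0] by simp
  from two_side_changes[OF v(2) this] obtain k where k: "0 < k" "k < d"
    "\<And>l. l < k ==> 0 < cr v (side (j + l)) \<longleftrightarrow> 0 < orient"
    "\<And>l. k \<le> l ==> l < d ==> (0 < cr v (side (j + l))) ~= (0 < orient)"
    using si v(1) si[of 0] by auto
  have n: "cr (side j) (side (j + l)) ~= 0" if "0 < l" "l < d" for l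
    by (rule side_nonparallel) (use add_mod_neq[OF that, of j] in simp)
  have pos: "0 < orient * cr (side j) (side (j + l))" if "0 < l" "l < k" for l
    using v(3)[OF n, of l] k(2) k(3)[of l] n[of l] that orient_cases by (auto simp: zero_less_mult_iff)
  have neg: "orient * cr (side j) (side (j + l)) < 0" if "k \<le> l" "l < d" for l
    using v(3)[OF n, of l] k(1) k(4)[of l] n[of l] that orient_cases by (auto simp: mult_less_0_iff)
  have "k ~= 1"
    using neg[of 1] orient_turn[of j] d3 by auto
  then have k2: "2 \<le> k" using k(1) by simp
  have lev: "level j (p (j + l)) = (\<Sum>i<l. orient * cr (side j) (side (j + i)))" for l
  proof (induction l)
    case (Suc l)
    have "p (j + Suc l) = p (j + l) + side (j + l)" by (simp add: side_def)
    then show ?case using Suc by (simp add: level_affine)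
  qed (simp add: level_def)
  have tot: "level j (p (j + d)) = 0" by (simp add: level_def periodic)
  have up: "0 < level j (p (j + l))" if "2 \<le> l" "l \<le> k" for l
    unfolding lev using that
  proof (induction l rule: nat_induct_at_least)
    case base then show ?case using pos[of 1] k2 by (simp add: numeral_2_eq_2)
  next
    case (Suc l) then show ?case using pos[of l] by simp
  qed
  have down: "0 < level j (p (j + l))" if "k \<le> l" "l < d" for l
    using that(2,1)
  proof (induction rule: strict_inc_induct)
    case (base i)
    have "level j (p (j + d)) = level j (p (j + i)) + orient * cr (side j) (side (j + i))"
      unfolding lev base(1) by simp
    then show ?case using neg[of i] base tot by simp
  next
    case (step i)
    have "level j (p (j + Suc i)) = level j (p (j + i)) + orient * cr (side j) (side (j + i))"
      unfolding lev by simp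
    then show ?case using neg[of i] step by simp
  qed
  show s: "2 \<le> l ==> l < d ==> 0 < level j (p (j + l))"
    using up[of l] down[of l] by linarith
  show "0 \<le> level j (p (j + l))"
  proof (cases "l = 0 \<or> l = 1 \<or> l = d")
    case True
    moreover have "level j (p (j + 0)) = 0" "level j (p (j + 1)) = 0" by (simp add: level_def, simp add: level_Suc)
    ultimately show ?thesis using tot by auto
  next
    case False
    then show ?thesis using s assms by fastforce
  qed
qed

lemma index_rel:
  obtains i where "i < d" "(j + i) mod d = l mod d" "p l = p (j + i)"
proof -
  define i0 where "i0 = l + j * d - j"
  have "j \<le> j * d" using d_pos by (cases d) auto
  then have e: "j + i0 = l + j * d" unfolding i0_def by arith
  have m: "(j + i0 mod d) mod d = l mod d" by (simp add: mod_simps e)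
  then have "p l = p (j + i0 mod d)" by (metis p_mod)
  with m d_pos show ?thesis using that[of "i0 mod d"] by simp
qed

lemma level_vertex_nonneg: "0 \<le> level j (p l)"
proof -
  obtain i where "i < d" "p l = p (j + i)" using index_rel by blast
  then show ?thesis using level_vertex_rel(1)[of i j] by simp
qed

lemma level_vertex_pos:
  assumes "l mod d ~= j mod d" "l mod d ~= Suc j mod d"
  shows "0 < level j (p l)"
proof -
  obtain i where i: "i < d" "(j + i) mod d = l mod d" "p l = p (j + i)" using index_rel by blast
  have "i ~= 0" "i ~= 1" using i(2) assms by (metis add.right_neutral, metis Suc_eq_plus1)
  then show ?thesis using level_vertex_rel(2)[of i j] i by simp
qed

definition tile :: "complex set" where "tile = {z. \<forall>j<d. 0 < level j z}"

lemma tileD: "z \<in> tile ==> 0 < level j z"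
  using level_mod[of j z] d_pos by (metis (mono_tags, lifting) mem_Collect_eq mod_less_divisor tile_def)

definition closed_tile :: "complex set" where "closed_tile = {z. \<forall>j<d. 0 \<le> level j z}"

lemma closed_tileD: "z \<in> closed_tile ==> 0 \<le> level j z"
  using level_mod[of j z] d_pos by (metis (mono_tags, lifting) mem_Collect_eq mod_less_divisor closed_tile_def)

lemma level_halfspace:
  "{z. 0 < level j z} = {z. orient * cr (side j) (p j) < inner (orient *\<^sub>R (\<i> * side j)) z}"
  "{z. 0 \<le> level j z} = {z. orient * cr (side j) (p j) \<le> inner (orient *\<^sub>R (\<i> * side j)) z}"
proof -
  have "level j z = inner (orient *\<^sub>R (\<i> * side j)) z - orient * cr (side j) (p j)" for z
    unfolding level_def inner_scaleR_left cr_inner[symmetric] by (simp add: algebra_simps)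
  then show "{z. 0 < level j z} = {z. orient * cr (side j) (p j) < inner (orient *\<^sub>R (\<i> * side j)) z}"
    "{z. 0 \<le> level j z} = {z. orient * cr (side j) (p j) \<le> inner (orient *\<^sub>R (\<i> * side j)) z}" by auto
qed

lemma tile_Inter: "tile = (\<Inter>j<d. {z. 0 < level j z})" "closed_tile = (\<Inter>j<d. {z. 0 \<le> level j z})"
  by (auto simp: tile_def closed_tile_def)

lemma open_tile: "open tile"
  unfolding tile_Inter level_halfspace by (intro open_INT finite_lessThan ballI open_halfspace_gt)

lemma convex_tile: "convex tile"
  unfolding tile_Inter level_halfspace by (intro convex_INT convex_halfspace_gt)

lemma closed_closed_tile: "closed closed_tile"
  unfolding tile_Inter level_halfspace by (intro closed_INT ballI closed_halfspace_ge)

lemma convex_closed_tile: "convex closed_tile"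
  unfolding tile_Inter level_halfspace by (intro convex_INT convex_halfspace_ge)

lemma level_comb: "level j ((1 - u) *\<^sub>R x + u *\<^sub>R y) = (1 - u) * level j x + u * level j y"
  unfolding level_def cr_simps by (simp add: algebra_simps)

lemma vertex_in_closed_tile: "p j \<in> closed_tile"
  by (simp add: closed_tile_def level_vertex_nonneg)

lemma tile_nonempty: "tile ~= {}"
proof -
  \<comment> \<open>The centroid of the vertices: its levels are averages of nonnegative numbers,
    and the vertex after side \<open>j + 1\<close> contributes a positive one to level
    \<open>j\<close>.\<close>
  define c where "c = (1 / d) *\<^sub>R (\<Sum>i<d. p i)"
  have "level j c = (\<Sum>i<d. level j (p i)) / d" for j
  proof -
    have "c - p j = (1 / d) *\<^sub>R (\<Sum>i<d. p i - p j)"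
      using d_pos by (simp add: c_def sum_subtractf scaleR_diff_right) (simp add: scaleR_conv_of_real)
    then show ?thesis by (simp only: level_def cr_simps cr_sum_right) (simp add: sum_distrib_left sum_divide_distrib)
  qed
  moreover have "0 < (\<Sum>i<d. level j (p i))" if "j < d" for j
  proof -
    have "Suc (Suc j) mod d ~= j mod d" "Suc (Suc j) mod d ~= Suc j mod d"
      using Suc_mod_neq[of j] Suc_mod_neq[of "Suc j"] by metis+
    then have "0 < level j (p (Suc (Suc j) mod d))"
      using level_vertex_pos[of "Suc (Suc j)" j] by (simp add: p_mod)
    then show ?thesis
      by (intro sum_pos2[where i = "Suc (Suc j) mod d"]) (use d_pos level_vertex_nonneg in auto)
  qed
  ultimately have "c \<in> tile" using d_pos by (simp add: tile_def)
  then show ?thesis by blast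
qed

text \<open>A side with positive level tolerates any small motion, and a side with level 0 needs an
  inward motion. There are finitely many sides, so one bound on the step serves all.\<close>

lemma eventually_in_tile:
  assumes "z \<in> closed_tile" "\<And>j. j < d ==> 0 < level j z \<or> 0 < orient * cr (side j) y"
  shows "\<forall>\<^sub>F s in at_right (0::real). z + of_real s * y \<in> tile"
proof -
  have "\<forall>\<^sub>F s in at_right (0::real). 0 < level j (z + of_real s * y)" if j: "j < d" for j
  proof -
    have e: "level j (z + of_real s * y) = level j z + s * (orient * cr (side j) y)" for s
      by (simp add: level_affine)
    show ?thesis
    proof (cases "0 < level j z")
      case True
      have "((\<lambda>s. level j z + s * (orient * cr (side j) y)) \<longlongrightarrow> level j z + 0 * (orient * cr (side j) y)) (at_right 0)"
        by (intro tendsto_intros)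
      from order_tendstoD(1)[OF this, of 0] True show ?thesis unfolding e by simp
    next
      case False
      then have "0 < orient * cr (side j) y" using assms(2)[OF j] by simp
      moreover have "0 \<le> level j z" using assms(1) closed_tileD by blast
      ultimately show ?thesis
        unfolding e by (intro eventually_mono[OF eventually_at_right_less[of 0]]) (simp add: add_nonneg_pos)
    qed
  qed
  then have "\<forall>\<^sub>F s in at_right (0::real). \<forall>j\<in>{..<d}. 0 < level j (z + of_real s * y)"
    by (intro eventually_ball_finite) auto
  then show ?thesis by (rule eventually_mono) (simp add: tile_def)
qed

text \<open>Only the two sides meeting at the corner have level 0 there, and both see a positive
  combination of the outgoing side and the reversed incoming side as pointing inwards.\<close>

lemma sector_in_tile:
  assumes "0 < \<alpha>" "0 < \<beta>"
  shows "\<forall>\<^sub>F s in at_right (0::real). p (Suc j) + of_real s * (of_real \<beta> * side (Suc j) - of_real \<alpha> * side j) \<in> tile"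
proof (rule eventually_in_tile[OF vertex_in_closed_tile])
  fix l assume "l < d"
  show "0 < level l (p (Suc j)) \<or> 0 < orient * cr (side l) (of_real \<beta> * side (Suc j) - of_real \<alpha> * side j)"
  proof (rule disjCI)
    assume "\<not> 0 < orient * cr (side l) (of_real \<beta> * side (Suc j) - of_real \<alpha> * side j)"
    moreover have "0 < orient * cr (side j) (side (Suc j))" by (rule orient_turn)
    moreover have "cr (side (Suc j)) (side j) = - cr (side j) (side (Suc j))" by (rule cr_commute)
    ultimately have ne: "side l ~= side j" "side l ~= side (Suc j)"
      using assms by (auto simp: zero_less_mult_iff mult_less_0_iff)
    have "Suc j mod d ~= l mod d" using ne side_mod by metis
    moreover have "Suc j mod d ~= Suc l mod d"
    proof
      assume e: "Suc j mod d = Suc l mod d"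
      have "(Suc j + (d - 1)) mod d = (Suc l + (d - 1)) mod d" using e by (metis mod_add_left_eq)
      then have "j mod d = l mod d" using d_pos by simp
      then show False using ne side_mod by metis
    qed
    ultimately show "0 < level l (p (Suc j))" by (rule level_vertex_pos)
  qed
qed

text \<open>In the relative interior of side \<open>j\<close> all other levels are positive: each of
  them is nonnegative at both ends and, since sides are not parallel, differs between them.\<close>

lemma edge_inward:
  assumes "0 < \<alpha>" "\<alpha> < 1" "0 < orient * cr (side j) y"
  shows "\<forall>\<^sub>F s in at_right (0::real). (p j + of_real \<alpha> * side j) + of_real s * y \<in> tile"
proof (rule eventually_in_tile)
  have e: "p j + of_real \<alpha> * side j = (1 - \<alpha>) *\<^sub>R p j + \<alpha> *\<^sub>R p (Suc j)"
    by (simp add: side_def scaleR_conv_of_real algebra_simps)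
  show "p j + of_real \<alpha> * side j \<in> closed_tile"
    unfolding e by (rule convexD_alt[OF convex_closed_tile]) (use assms vertex_in_closed_tile in auto)
  fix l assume "l < d"
  show "0 < level l (p j + of_real \<alpha> * side j) \<or> 0 < orient * cr (side l) y"
  proof (rule disjCI)
    assume "\<not> 0 < orient * cr (side l) y"
    then have "l mod d ~= j mod d" using assms(3) side_mod by metis
    then have n: "cr (side l) (side j) ~= 0" by (rule side_nonparallel)
    have "level l (p (Suc j)) = level l (p j) + orient * cr (side l) (side j)"
      using level_affine[of l "p j" "side j"] by (simp add: side_def)
    then have ne: "level l (p (Suc j)) ~= level l (p j)" using n orient_cases by auto
    have "0 \<le> level l (p j)" "0 \<le> level l (p (Suc j))" by (rule level_vertex_nonneg)+
    then have "0 < (1 - \<alpha>) * level l (p j) + \<alpha> * level l (p (Suc j))"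
      using assms ne
      by (metis add_nonneg_pos add_pos_nonneg diff_gt_0_iff_gt less_eq_real_def mult_nonneg_nonneg mult_pos_pos)
    then show "0 < level l (p j + of_real \<alpha> * side j)" unfolding e level_comb .
  qed
qed

lemma closure_tile: "closure tile = closed_tile"
proof
  show "closure tile \<subseteq> closed_tile"
    by (rule closure_minimal[OF _ closed_closed_tile]) (auto simp: tile_def closed_tile_def less_imp_le)
  show "closed_tile \<subseteq> closure tile"
  proof
    fix z assume z: "z \<in> closed_tile"
    obtain c where c: "c \<in> tile" using tile_nonempty by blast
    have "\<forall>\<^sub>F s in at_right (0::real). z + of_real s * (c - z) \<in> tile"
    proof (rule eventually_in_tile[OF z])
      fix j assume "j < d"
      have "level j c = level j z + orient * cr (side j) (c - z)"
        using level_affine[of j z "c - z"] by simp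
      then show "0 < level j z \<or> 0 < orient * cr (side j) (c - z)"
        using tileD[OF c, of j] by linarith
    qed
    moreover have "((\<lambda>s. z + of_real s * (c - z)) \<longlongrightarrow> z + of_real 0 * (c - z)) (at_right (0::real))"
      by (intro tendsto_intros)
    ultimately have "z + of_real 0 * (c - z) \<in> closure tile"
      by (intro Lim_in_closed_set[OF closed_closure _ trivial_limit_at_right_real])
         (auto elim: eventually_mono intro: closure_subset[THEN subsetD])
    then show "z \<in> closure tile" by simp
  qed
qed

text \<open>A frontier point has some level \<open>j\<close> equal to 0, so it lies on the line of
  side \<open>j\<close>. The levels of the preceding and the following side then confine it to the
  side itself.\<close>

lemma frontier_tile: "frontier tile = (\<Union>j<d. closed_segment (p j) (p (Suc j)))"
proof -
  have fr: "frontier tile = closed_tile - tile"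
    by (simp add: frontier_def closure_tile interior_open open_tile)
  show ?thesis
  proof (intro equalityI subsetI)
    fix z assume "z \<in> frontier tile"
    then have z: "z \<in> closed_tile" "z \<notin> tile" by (auto simp: fr)
    then obtain j where j: "j < d" "\<not> 0 < level j z" by (auto simp: tile_def)
    then have "level j z = 0" using closed_tileD[OF z(1), of j] by simp
    then have "cr (side j) (z - p j) = 0" using orient_cases by (auto simp: level_def)
    then obtain \<alpha> where \<alpha>: "z - p j = of_real \<alpha> * side j"
      using cr_eq_0_iff[OF side_nonzero] by blast
    define i where "i = j + d - 1"
    have i: "Suc i = j + d" using d_pos by (simp add: i_def)
    have "0 \<le> level (Suc j) z" "0 \<le> level i z" using closed_tileD[OF z(1)] by auto
    moreover have "level i z = \<alpha> * (orient * cr (side i) (side (Suc i)))"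
      using \<alpha> unfolding level_Suc by (simp add: i periodic side_periodic)
    ultimately have "0 \<le> \<alpha>" using orient_turn[of i] by (simp add: zero_le_mult_iff)
    have "z - p (Suc j) = of_real (\<alpha> - 1) * side j" using \<alpha> by (simp add: side_def algebra_simps)
    then have "level (Suc j) z = orient * ((\<alpha> - 1) * cr (side (Suc j)) (side j))"
      unfolding level_def by (simp only: cr_simps)
    also have "\<dots> = (1 - \<alpha>) * (orient * cr (side j) (side (Suc j)))"
      using cr_commute[of "side (Suc j)" "side j"] by (simp add: algebra_simps)
    finally have "\<alpha> \<le> 1" using orient_turn[of j] \<open>0 \<le> level (Suc j) z\<close> by (simp add: zero_le_mult_iff)
    have "z = (1 - \<alpha>) *\<^sub>R p j + \<alpha> *\<^sub>R p (Suc j)"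
      using \<alpha> by (simp add: side_def scaleR_conv_of_real algebra_simps)
    then show "z \<in> (\<Union>j<d. closed_segment (p j) (p (Suc j)))"
      using \<open>0 \<le> \<alpha>\<close> \<open>\<alpha> \<le> 1\<close> j(1) by (auto simp: in_segment)
  next
    fix z assume "z \<in> (\<Union>j<d. closed_segment (p j) (p (Suc j)))"
    then obtain j where j: "j < d" "z \<in> closed_segment (p j) (p (Suc j))" by blast
    then obtain u where u: "0 \<le> u" "u \<le> 1" "z = (1 - u) *\<^sub>R p j + u *\<^sub>R p (Suc j)" by (auto simp: in_segment)
    have "level j (p j) = 0" "level j (p (Suc j)) = 0" by (simp_all add: level_def side_def)
    then have "level j z = 0" unfolding u(3) level_comb by simp
    then have "z \<notin> tile" using tileD[of z j] by auto
    moreover have "z \<in> closed_tile"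
      using closed_segment_subset[OF vertex_in_closed_tile vertex_in_closed_tile convex_closed_tile] j(2) by blast
    ultimately show "z \<in> frontier tile" by (simp add: fr)
  qed
qed

lemma unimodal:
  assumes "\<And>j. j < d ==> cr v (side j) ~= 0"
  obtains i k where "0 < k" "k < d" "\<And>l. l < k ==> 0 < cr v (side (i + l))"
    "\<And>l. k \<le> l ==> l < d ==> cr v (side (i + l)) < 0"
proof -
  have nz: "cr v (side j) ~= 0" for j
    using assms[of "j mod d"] d_pos by (simp add: side_mod)
  define b where "b l \<longleftrightarrow> 0 < cr v (side l)" for l
  have "card {l. l < d \<and> b l ~= b (Suc l)} = 2"
    using two_sign_changes[of v] nz by (simp add: side_def b_def)
  then obtain l0 where l0: "b l0 ~= b (Suc l0)" by (metis (mono_tags, lifting) card.empty empty_Collect_eq zero_neq_numeral)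
  \<comment> \<open>Some step must go from falling to rising: otherwise, after the known change, the
    sequence would stay false for ever, against periodicity.\<close>
  have "\<exists>i. \<not> b i \<and> b (Suc i)"
  proof (rule ccontr)
    assume "\<nexists>i. \<not> b i \<and> b (Suc i)"
    then have st: "\<not> b i ==> \<not> b (i + j)" for i j by (induction j) auto
    have "\<not> b (Suc l0)" "b l0" using l0 \<open>\<nexists>i. \<not> b i \<and> b (Suc i)\<close> by auto
    moreover have "l0 + d = Suc l0 + (d - 1)" using d_pos by simp
    moreover have "b (l0 + d) = b l0" by (simp add: b_def side_periodic)
    ultimately show False using st by metis
  qed
  then obtain i where i: "\<not> b i" "b (Suc i)" by blast
  then have "(0 < cr v (side i)) ~= (0 < cr v (side (Suc i)))" by (simp add: b_def)
  from two_side_changes[OF nz this] i obtain k where k: "0 < k" "k < d"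
    "\<And>l. l < k ==> 0 < cr v (side (Suc i + l))" "\<And>l. k \<le> l ==> l < d ==> \<not> 0 < cr v (side (Suc i + l))"
    unfolding b_def by metis
  show ?thesis using that[of k "Suc i"] k nz by (metis linorder_neqE_linordered_idom)
qed

text \<open>Seen from a vertex where the height turns from rising to falling, a point of the tile
  has a negative coefficient on the incoming and a positive one on the outgoing side. Both
  contributions lower the height.\<close>

lemma below_max_vertex:
  assumes "z \<in> tile" "0 < cr v (side i)" "cr v (side (Suc i)) < 0"
  shows "cr v (z - p (Suc i)) < 0"
proof -
  let ?x = "side i" and ?y = "side (Suc i)"
  have t: "0 < orient * cr ?x ?y" by (rule orient_turn)
  then have n: "cr ?x ?y ~= 0" by auto
  let ?w = "z - p (Suc i)"
  have "0 < orient * cr ?x ?w" using tileD[OF assms(1), of i] by (simp add: level_Suc)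
  moreover have "0 < orient * cr ?y ?w" using tileD[OF assms(1), of "Suc i"] by (simp add: level_def)
  ultimately have *: "0 < cr ?x ?w / cr ?x ?y" "cr ?w ?y / cr ?x ?y < 0"
    using t cr_commute[of ?y ?w] by (auto simp: zero_less_mult_iff zero_less_divide_iff divide_less_0_iff)
  have "cr v ?w = (cr ?w ?y / cr ?x ?y) * cr v ?x + (cr ?x ?w / cr ?x ?y) * cr v ?y"
    by (subst cr_expand[OF n, of ?w]) (simp only: cr_simps)
  also have "\<dots> < 0"
    by (intro add_neg_neg mult_neg_pos mult_pos_neg) (use * assms(2,3) in auto)
  finally show ?thesis .
qed

lemma above_min_vertex:
  assumes "z \<in> tile" "cr v (side i) < 0" "0 < cr v (side (Suc i))"
  shows "0 < cr v (z - p (Suc i))"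
  using below_max_vertex[of z "- v" i] assms by simp

lemma tile_bound:
  assumes "\<And>j. j < d ==> cr v (side j) ~= 0" and z: "z \<in> tile"
  shows "\<bar>cr v z\<bar> \<le> (\<Sum>l<d. \<bar>cr v (p l)\<bar>)"
proof -
  obtain i k where k: "0 < k" "k < d" "\<And>l. l < k ==> 0 < cr v (side (i + l))"
    "\<And>l. k \<le> l ==> l < d ==> cr v (side (i + l)) < 0" using unimodal[OF assms(1)] by metis
  have b: "\<bar>cr v (p l)\<bar> \<le> (\<Sum>l<d. \<bar>cr v (p l)\<bar>)" for l
    using member_le_sum[of "l mod d" "{..<d}" "\<lambda>l. \<bar>cr v (p l)\<bar>"] d_pos by (simp add: p_mod)
  have "cr v (z - p (Suc (i + (k - 1)))) < 0"
    using below_max_vertex[OF z, of v "i + (k - 1)"] k(1,2) k(3)[of "k - 1"] k(4)[of k] by simp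
  moreover have "0 < cr v (z - p (Suc (i + (d - 1))))"
    using above_min_vertex[OF z, of v "i + (d - 1)"] k(1,2) k(3)[of 0] k(4)[of "d - 1"] side_periodic[of i] by simp
  ultimately show ?thesis
    using b[of "Suc (i + (k - 1))"] b[of "Suc (i + (d - 1))"] by simp
qed

text \<open>Heights in a generic direction are bounded by those of the highest and the lowest
  vertex. Two independent generic directions bound both coordinates.\<close>

lemma bounded_tile: "bounded tile"
proof -
  obtain v where v: "v ~= 0" "\<And>j. cr v (side j) ~= 0"
    by (rule generic_direction[of "side 0" "{}" True]) (use side_nonzero cr_simps(11) in \<open>auto, metis\<close>)
  obtain w where w: "cr w v ~= 0" "\<And>j. cr w (side j) ~= 0"
    using generic_direction[of v "{}" True] v(1) by (metis finite.emptyI empty_iff)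
  define M where "M u = (\<Sum>l<d. \<bar>cr u (p l)\<bar>)" for u
  have "norm z \<le> (M v / \<bar>cr w v\<bar>) * norm w + (M w / \<bar>cr w v\<bar>) * norm v" if z: "z \<in> tile" for z
  proof -
    have "norm z = norm (of_real (cr z v / cr w v) * w + of_real (cr w z / cr w v) * v)"
      using cr_expand[OF w(1), of z] by simp
    also have "\<dots> \<le> \<bar>cr z v / cr w v\<bar> * norm w + \<bar>cr w z / cr w v\<bar> * norm v"
      by (rule order_trans[OF norm_triangle_ineq]) (simp only: norm_mult norm_of_real order_refl)
    also have "\<dots> \<le> (M v / \<bar>cr w v\<bar>) * norm w + (M w / \<bar>cr w v\<bar>) * norm v"
      using tile_bound[OF v(2) z] tile_bound[OF w(2) z] cr_commute[of z v]
      by (intro add_mono mult_right_mono) (auto simp: M_def intro: divide_right_mono)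
    finally show ?thesis .
  qed
  then show ?thesis unfolding bounded_iff by blast
qed

text \<open>The winding number of the polygon, computed with a ray. Heights over the line of the ray
  are unimodal, so the line meets at most one rising side \<open>a\<close> and one falling side
  \<open>b\<close>. Their intersections with the line, at the parameters \<open>S a\<close> and
  \<open>S b\<close>, bound the part of the line inside the polygon, and \<open>z\<close> is inside
  iff the parameter 0 lies strictly between them.\<close>

lemma sum_crossing:
  assumes v: "\<And>j. j < d ==> cr v (side j) ~= 0" and zp: "\<And>j. cr v (p j - z) ~= 0"
    and zl: "\<And>j. j < d ==> cr (side j) (z - p j) ~= 0"
  shows "(\<Sum>j<d. crossing v z (p j) (p (Suc j))) = (if z \<in> tile then orient else 0)"
proof -
  obtain i k where k: "0 < k" "k < d" "\<And>l. l < k ==> 0 < cr v (side (i + l))"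
    "\<And>l. k \<le> l ==> l < d ==> cr v (side (i + l)) < 0" using unimodal[OF v] by metis
  define H where "H l = cr v (p (i + l) - z)" for l
  define X where "X l = crossing v z (p (i + l)) (p (Suc (i + l)))" for l
  have sumX: "(\<Sum>j<d. crossing v z (p j) (p (Suc j))) = (\<Sum>l<d. X l)"
    unfolding X_def
    by (rule periodic_sum_shift[symmetric]) (metis add_Suc periodic)
  have Hnz: "H l ~= 0" for l using zp by (simp add: H_def)
  have HS: "H (Suc l) = H l + cr v (side (i + l))" for l by (simp add: H_def side_def)
  have up: "H l < H (Suc l)" if "l < k" for l using k(3)[OF that] by (simp add: HS)
  have down: "H (Suc l) < H l" if "k \<le> l" "l < d" for l using k(4)[OF that] by (simp add: HS)
  have up': "H l \<le> H l'" if "l \<le> l'" "l' \<le> k" for l l'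
    using that
  proof (induction rule: dec_induct)
    case (step n) then show ?case using up[of n] by simp
  qed simp
  have down': "H l' \<le> H l" if "l \<le> l'" "k \<le> l" "l' \<le> d" for l l'
    using that(1) that(2,3)
  proof (induction rule: dec_induct)
    case (step n) then show ?case using down[of n] by simp
  qed simp
  have Hd: "H d = H 0" by (simp add: H_def periodic)
  have Hmin: "H 0 \<le> H l" and Hmax: "H l \<le> H k" if "l \<le> d" for l
    using up'[of 0 l] up'[of l k] down'[of k l] down'[of l d] that Hd k(2) by (cases "l \<le> k"; force)+
  have X0: "X l = 0" if "0 < H l \<longleftrightarrow> 0 < H (Suc l)" for l
    using that Hnz[of l] Hnz[of "Suc l"] by (auto simp: X_def crossing_def H_def)
  show ?thesis
  proof (cases "0 < H 0")
    case True
    then have "X l = 0" if "l < d" for l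
      using that Hmin[of l] Hmin[of "Suc l"] by (intro X0) auto
    then have "(\<Sum>l<d. X l) = 0" by simp
    moreover have "z \<notin> tile"
    proof
      assume "z \<in> tile"
      from above_min_vertex[OF this, of v "i + (d - 1)"] have "0 < cr v (z - p (i + d))"
        using k(1,2) k(3)[of 0] k(4)[of "d - 1"] side_periodic[of i] by simp
      then show False using True by (simp add: H_def periodic)
    qed
    ultimately show ?thesis by (simp add: sumX)
  next
    case F0: False
    show ?thesis
    proof (cases "H k < 0")
      case True
      then have "X l = 0" if "l < d" for l
        using that Hmax[of l] Hmax[of "Suc l"] by (intro X0) auto
      then have "(\<Sum>l<d. X l) = 0" by simp
      moreover have "z \<notin> tile"
      proof
        assume "z \<in> tile"
        from below_max_vertex[OF this, of v "i + (k - 1)"] have "cr v (z - p (i + k)) < 0"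
          using k(1,2) k(3)[of "k - 1"] k(4)[of k] by simp
        then show False using True by (simp add: H_def)
      qed
      ultimately show ?thesis by (simp add: sumX)
    next
      case False
      have h0: "H 0 < 0" using F0 Hnz[of 0] by linarith
      have hk: "0 < H k" using False Hnz[of k] by linarith
      \<comment> \<open>The last vertex below the line on the rising part; the side starting there
        is the one that crosses upwards.\<close>
      define a where "a = (GREATEST l. l < k \<and> H l < 0)"
      have a: "a < k \<and> H a < 0" unfolding a_def
        by (rule GreatestI_nat[where k = 0 and b = k]) (use h0 k in auto)
      have a1: "0 < H (Suc a)"
      proof (rule ccontr)
        assume "\<not> 0 < H (Suc a)"
        then have "H (Suc a) < 0" using Hnz[of "Suc a"] by linarith
        moreover have "Suc a ~= k" using hk calculation by auto
        ultimately have "Suc a \<le> a"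
          unfolding a_def by (intro Greatest_le_nat[where b = k]) (use a a_def in auto)
        then show False by simp
      qed
      \<comment> \<open>Correspondingly, the last vertex above the line on the falling part.\<close>
      define b where "b = (GREATEST l. k \<le> l \<and> l < d \<and> 0 < H l)"
      have b: "k \<le> b \<and> b < d \<and> 0 < H b" unfolding b_def
        by (rule GreatestI_nat[where k = k and b = d]) (use hk k in auto)
      have b1: "H (Suc b) < 0"
      proof (rule ccontr)
        assume "\<not> H (Suc b) < 0"
        then have "0 < H (Suc b)" using Hnz[of "Suc b"] by linarith
        moreover have "Suc b ~= d" using h0 Hd calculation by auto
        ultimately have "Suc b \<le> b"
          unfolding b_def by (intro Greatest_le_nat[where b = d]) (use b b_def in auto)
        then show False by simp
      qed
      have other: "X l = 0" if "l < d" "l ~= a" "l ~= b" for l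
      proof (cases "l < k")
        case True
        show ?thesis
        proof (cases "l < a")
          case T: True
          then have "H l < 0" "H (Suc l) < 0" using up'[of l a] up'[of "Suc l" a] a by auto
          then show ?thesis by (intro X0) auto
        next
          case False
          then have "0 < H l" "0 < H (Suc l)" using up'[of "Suc a" l] up'[of "Suc a" "Suc l"] a1 that True by auto
          then show ?thesis by (intro X0) auto
        qed
      next
        case False
        show ?thesis
        proof (cases "l < b")
          case T: True
          then have "0 < H l" "0 < H (Suc l)" using down'[of l b] down'[of "Suc l" b] b False by auto
          then show ?thesis by (intro X0) auto
        next
          case F: False
          then have "H l < 0" "H (Suc l) < 0" using down'[of "Suc b" l] down'[of "Suc b" "Suc l"] b b1 that False by auto
          then show ?thesis by (intro X0) auto
        qed
      qed
      have ab: "a ~= b" "a < d" "b < d" using a b k by auto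
      have sX: "(\<Sum>l<d. X l) = X a + X b"
      proof -
        have "(\<Sum>l<d. X l) = (\<Sum>l\<in>{a, b}. X l)"
          by (rule sum.mono_neutral_right) (use ab other in auto)
        then show ?thesis using ab by simp
      qed
      define E where "E l = cr (side (i + l)) (z - p (i + l))" for l
      have EX: "cr (p (i + l) - z) (p (Suc (i + l)) - z) = E l" for l
      proof -
        have "p (Suc (i + l)) - z = (p (i + l) - z) + side (i + l)" by (simp add: side_def)
        then have "cr (p (i + l) - z) (p (Suc (i + l)) - z) = cr (p (i + l) - z) (side (i + l))"
          by (simp only: cr_simps(2) cr_simps(13) add_0)
        also have "\<dots> = E l" unfolding E_def cr_commute[of _ "side (i + l)"]
          by (simp add: algebra_simps)
        finally show ?thesis .
      qed
      have En: "E l ~= 0" for l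
        using zl[of "(i + l) mod d"] d_pos by (simp add: E_def side_mod p_mod)
      \<comment> \<open>The position along \<open>v\<close>, measured from \<open>z\<close>, at
        which the line of the ray meets the line of the side.\<close>
      define S where "S l = E l / cr v (side (i + l))" for l
      have va: "0 < cr v (side (i + a))" "cr v (side (i + b)) < 0" using k(3)[of a] k(4)[of b] a b by auto
      have HH: "cr v (p (i + l) - z) = H l" "cr v (p (Suc (i + l)) - z) = H (Suc l)" for l
        by (simp_all add: H_def)
      have Xa: "X a = (if 0 < S a then 1 else 0)"
        unfolding X_def crossing_def EX HH using a a1 va by (auto simp: S_def zero_less_divide_iff)
      have Xb: "X b = (if 0 < S b then - 1 else 0)"
        unfolding X_def crossing_def EX HH using b b1 va by (auto simp: S_def zero_less_divide_iff)
      have pt: "z + of_real (S l) * v \<in> closed_segment (p (i + l)) (p (Suc (i + l)))"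
        if "H l < 0 \<and> 0 < H (Suc l) \<or> 0 < H l \<and> H (Suc l) < 0" for l
      proof -
        let ?t = "side (i + l)"
        have vt: "cr v ?t ~= 0" using that HS[of l] by auto
        define u where "u = - H l / cr v ?t"
        have u: "0 \<le> u" "u \<le> 1"
          using that HS[of l] by (auto simp: u_def field_simps)
        have "p (i + l) - z = of_real (cr (p (i + l) - z) ?t / cr v ?t) * v + of_real (H l / cr v ?t) * ?t"
          using cr_expand[OF vt, of "p (i + l) - z"] by (simp only: H_def)
        moreover have "cr (p (i + l) - z) ?t = E l"
          unfolding E_def by (subst cr_commute) (simp add: algebra_simps)
        ultimately have "z + of_real (S l) * v = p (i + l) + of_real u * ?t"
          by (simp add: S_def u_def algebra_simps)
        also have "\<dots> = (1 - u) *\<^sub>R p (i + l) + u *\<^sub>R p (Suc (i + l))"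
          by (simp add: side_def scaleR_conv_of_real algebra_simps)
        finally show ?thesis using u by (auto simp: in_segment)
      qed
      have pa: "z + of_real (S a) * v \<in> closed_segment (p (i + a)) (p (Suc (i + a)))"
        and pb: "z + of_real (S b) * v \<in> closed_segment (p (i + b)) (p (Suc (i + b)))"
        using pt a a1 b b1 by blast+
      have ca: "z + of_real (S a) * v \<in> closed_tile" and cb: "z + of_real (S b) * v \<in> closed_tile"
        using closed_segment_subset[OF vertex_in_closed_tile vertex_in_closed_tile convex_closed_tile] pa pb by blast+
      \<comment> \<open>The intersection with side \<open>a\<close> belongs to the closed tile, so
        its level for side \<open>b\<close> is nonnegative. This fixes the order of the two
        intersections.\<close>
      have ord: "0 \<le> orient * (S a - S b)"
      proof -
        have "cr (side (i + b)) v = - cr v (side (i + b))" by (rule cr_commute)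
        moreover have "E b = S b * cr v (side (i + b))" using va by (simp add: S_def)
        moreover have lb: "level (i + b) (z + of_real (S a) * v) = orient * E b + orient * (S a * cr (side (i + b)) v)"
          by (simp only: level_affine cr_simps) (simp only: level_def E_def)
        ultimately have "level (i + b) (z + of_real (S a) * v) = orient * (S a - S b) * (- cr v (side (i + b)))"
          by (simp add: lb algebra_simps)
        then have "0 \<le> orient * (S a - S b) * (- cr v (side (i + b)))"
          using closed_tileD[OF ca] by metis
        then show ?thesis using va by (simp add: zero_le_mult_iff mult_le_0_iff)
      qed
      have Sn: "S a ~= 0" "S b ~= 0" using En va by (auto simp: S_def)
      have tl: "z \<in> tile \<longleftrightarrow> 0 < orient * S a \<and> orient * S b < 0"
      proof
        assume "z \<in> tile"
        then have "0 < orient * E a" "0 < orient * E b" using tileD by (auto simp: E_def level_def)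
        then show "0 < orient * S a \<and> orient * S b < 0"
          using va by (auto simp: S_def zero_less_mult_iff mult_less_0_iff zero_less_divide_iff divide_less_0_iff)
      next
        assume *: "0 < orient * S a \<and> orient * S b < 0"
        then have ss: "(S a < 0 \<and> 0 < S b) \<or> (S b < 0 \<and> 0 < S a)"
          by (auto simp: zero_less_mult_iff mult_less_0_iff)
        \<comment> \<open>The weight for which the convex combination of the two intersection points
          is \<open>z\<close>.\<close>
        define u where "u = S a / (S a - S b)"
        have u: "0 \<le> u" "u \<le> 1" using ss by (auto simp: u_def field_simps)
        have "(1 - u) * S a + u * S b = S a - u * (S a - S b)" by (simp add: algebra_simps)
        also have "\<dots> = 0" using ss by (auto simp: u_def)
        finally have z0: "of_real ((1 - u) * S a + u * S b) = (0::complex)" by (simp only: of_real_0)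
        have "(1 - u) *\<^sub>R (z + of_real (S a) * v) + u *\<^sub>R (z + of_real (S b) * v) = z + of_real ((1 - u) * S a + u * S b) * v"
          by (simp add: scaleR_conv_of_real algebra_simps)
        then have "(1 - u) *\<^sub>R (z + of_real (S a) * v) + u *\<^sub>R (z + of_real (S b) * v) = z"
          unfolding z0 by simp
        then have "z \<in> closed_tile"
          using convexD_alt[OF convex_closed_tile ca cb u] by simp
        moreover have "level j z ~= 0" if "j < d" for j
          using zl[OF that] orient_cases by (auto simp: level_def)
        ultimately show "z \<in> tile" unfolding closed_tile_def tile_def by (force simp: less_le)
      qed
      show ?thesis
        unfolding sumX sX Xa Xb tl using ord Sn orient_cases by auto
    qed
  qed
qed

end

section \<open>Linear systems and the dimension count\<close>

text \<open>Gaussian elimination by induction on the equations: an equation with a nonzero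
  coefficient at \<open>v0\<close> removes \<open>v0\<close> from the others and fixes its value
  afterwards.\<close>

lemma underdetermined_system:
  fixes A :: "'e => 'v => real"
  assumes "finite E" "finite V" "card E < card V"
  shows "\<exists>x. (\<exists>v\<in>V. x v ~= 0) \<and> (\<forall>e\<in>E. (\<Sum>v\<in>V. A e v * x v) = 0)"
  using assms
proof (induction E arbitrary: V A rule: finite_induct)
  case empty
  then obtain v where "v \<in> V" by fastforce
  then show ?case by (intro exI[of _ "\<lambda>_. 1"]) auto
next
  case (insert e0 E)
  show ?case
  proof (cases "\<forall>v\<in>V. A e0 v = 0")
    case True
    obtain x where "\<exists>v\<in>V. x v ~= 0" "\<forall>e\<in>E. (\<Sum>v\<in>V. A e v * x v) = 0"
      using insert.IH[of V A] insert.prems insert.hyps by auto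
    then show ?thesis using True by (intro exI[of _ x]) auto
  next
    case False
    then obtain v0 where v0: "v0 \<in> V" "A e0 v0 ~= 0" by blast
    define A' where "A' e v = A e v - A e v0 * A e0 v / A e0 v0" for e v
    have "card E < card (V - {v0})"
      using insert.prems insert.hyps v0 by (simp add: card_Diff_singleton)
    then obtain x where x: "\<exists>v\<in>V - {v0}. x v ~= 0" "\<forall>e\<in>E. (\<Sum>v\<in>V - {v0}. A' e v * x v) = 0"
      using insert.IH[of "V - {v0}" A'] insert.prems by auto
    define y where "y v = (if v = v0 then - (\<Sum>v\<in>V - {v0}. A e0 v * x v) / A e0 v0 else x v)" for v
    have sum_y: "(\<Sum>v\<in>V. A e v * y v) = A e v0 * y v0 + (\<Sum>v\<in>V - {v0}. A e v * x v)" for e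
      using sum.remove[OF insert.prems(1) v0(1), of "\<lambda>v. A e v * y v"] by (simp add: y_def)
    have "(\<Sum>v\<in>V. A e v * y v) = 0" if "e \<in> E" for e
    proof -
      have "(\<Sum>v\<in>V - {v0}. A' e v * x v)
        = (\<Sum>v\<in>V - {v0}. A e v * x v) - (\<Sum>v\<in>V - {v0}. A e v0 / A e0 v0 * (A e0 v * x v))"
        unfolding sum_subtractf[symmetric] A'_def by (rule sum.cong) (simp_all add: algebra_simps)
      also have "\<dots> = (\<Sum>v\<in>V. A e v * y v)"
        unfolding sum_y sum_distrib_left[symmetric] by (simp add: y_def)
      finally show ?thesis using x(2) that by simp
    qed
    moreover have "(\<Sum>v\<in>V. A e0 v * y v) = 0"
      unfolding sum_y using v0 by (simp add: y_def)
    moreover have "\<exists>v\<in>V. y v ~= 0" using x(1) by (auto simp: y_def)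
    ultimately show ?thesis by (intro exI[of _ y]) auto
  qed
qed

text \<open>Homogenisation: the right-hand side becomes the column of an extra unknown
  \<open>None\<close>. There are then more unknowns than equations, and injectivity forces the new
  component of a nontrivial solution to be nonzero, so that it can be divided out.\<close>

lemma square_system_solvable:
  fixes A :: "'e => 'v => real"
  assumes "finite E" "finite V" "card E = card V"
    and inj: "\<And>x. (\<And>e. e \<in> E ==> (\<Sum>v\<in>V. A e v * x v) = 0) ==> \<forall>v\<in>V. x v = 0"
  shows "\<exists>x. \<forall>e\<in>E. (\<Sum>v\<in>V. A e v * x v) = T e"
proof -
  define B where "B e w = (case w of None => - T e | Some v => A e v)" for e w
  have "card E < card (insert None (Some ` V))"
    using assms by (simp add: card_image)
  then obtain x where x: "\<exists>w\<in>insert None (Some ` V). x w ~= 0"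
    "\<forall>e\<in>E. (\<Sum>w\<in>insert None (Some ` V). B e w * x w) = 0"
    using underdetermined_system[of E "insert None (Some ` V)" B] assms by auto
  have s: "(\<Sum>w\<in>insert None (Some ` V). B e w * x w) = - T e * x None + (\<Sum>v\<in>V. A e v * x (Some v))" for e
    using assms(2) by (simp add: B_def sum.reindex o_def)
  have "x None ~= 0"
  proof
    assume "x None = 0"
    then have "\<forall>v\<in>V. x (Some v) = 0" using x(2) s by (intro inj) simp
    then show False using x(1) \<open>x None = 0\<close> by auto
  qed
  then have "(\<Sum>v\<in>V. A e v * (x (Some v) / x None)) = T e" if "e \<in> E" for e
    using x(2) that unfolding s by (simp add: sum_divide_distrib[symmetric] field_simps)
  then show ?thesis by (intro exI[of _ "\<lambda>v. x (Some v) / x None"]) blast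
qed

text \<open>
  Edge functions decompose orthogonally into gradients of functions on the dual vertices \<open>D\<close> and
  coboundaries of functions on a set \<open>V\<close> of primal vertices; \<open>N v\<close> is the set of edges at \<open>v\<close>.
\<close>

locale gradient_decomposition =
  fixes E :: "'e set" and D :: "'d set" and V :: "'v set"
    and L R :: "'e => 'd" and N :: "'v => 'e set" and d0 :: 'd
  assumes finite_E: "finite E" and finite_D: "finite D" and finite_V: "finite V"
    and LR: "e \<in> E ==> L e \<in> D" "e \<in> E ==> R e \<in> D" and d0: "d0 \<in> D"
    and N: "v \<in> V ==> N v \<subseteq> E"
    and conserved: "\<And>\<psi> :: 'd => real. v \<in> V ==> (\<Sum>e\<in>N v. \<psi> (L e) - \<psi> (R e)) = 0"
    and connected_D: "\<And>\<psi> :: 'd => real. (\<And>e. e \<in> E ==> \<psi> (L e) = \<psi> (R e)) ==> d \<in> D ==> \<psi> d = \<psi> d0"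
    and connected_V: "\<And>\<eta> :: 'v => real. (\<And>e. e \<in> E ==> (\<Sum>v\<in>{v\<in>V. e \<in> N v}. \<eta> v) = 0) ==> v \<in> V ==> \<eta> v = 0"
begin

text \<open>The potential is normalised to 0 at \<open>d0\<close>, which contributes no unknown.
  This is the source of the \<open>Suc\<close> in the cardinality statements.\<close>

definition unknowns :: "('d + 'v) set" where
  "unknowns = Inl ` (D - {d0}) \<union> Inr ` V"

definition coefficient :: "'e => 'd + 'v => real" where
  "coefficient e w = (case w of Inl d => (if L e = d then 1 else 0) - (if R e = d then 1 else 0)
     | Inr v => (if e \<in> N v then 1 else 0))"

lemma finite_unknowns: "finite unknowns"
  using finite_D finite_V by (simp add: unknowns_def)

lemma card_unknowns: "Suc (card unknowns) = card D + card V"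
proof -
  have "card unknowns = card (D - {d0}) + card V"
    unfolding unknowns_def using finite_D finite_V
    by (subst card_Un_disjoint) (auto simp: card_image)
  then show ?thesis using card.remove[OF finite_D d0] by simp
qed

definition potential :: "('d + 'v => real) => 'd => real" where
  "potential x d = (if d = d0 then 0 else x (Inl d))"

definition coboundary :: "('d + 'v => real) => 'e => real" where
  "coboundary x e = (\<Sum>v\<in>{v\<in>V. e \<in> N v}. x (Inr v))"

lemma system_eq:
  assumes "e \<in> E"
  shows "(\<Sum>w\<in>unknowns. coefficient e w * x w) = potential x (L e) - potential x (R e) + coboundary x e"
proof -
  have pot: "(\<Sum>d\<in>D - {d0}. (if c = d then 1 else 0) * x (Inl d)) = potential x c" if "c \<in> D" for c
    using that finite_D by (simp add: potential_def if_distrib[of "\<lambda>u. u * _"] cong: if_cong)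
  have "(\<Sum>w\<in>unknowns. coefficient e w * x w)
    = (\<Sum>d\<in>D - {d0}. coefficient e (Inl d) * x (Inl d)) + (\<Sum>v\<in>V. coefficient e (Inr v) * x (Inr v))"
    unfolding unknowns_def using finite_D finite_V
    by (subst sum.union_disjoint) (auto simp: sum.reindex o_def)
  also have "(\<Sum>d\<in>D - {d0}. coefficient e (Inl d) * x (Inl d)) = potential x (L e) - potential x (R e)"
    unfolding pot[OF LR(1)[OF assms], symmetric] pot[OF LR(2)[OF assms], symmetric] sum_subtractf[symmetric]
    by (rule sum.cong) (auto simp: coefficient_def)
  also have "(\<Sum>v\<in>V. coefficient e (Inr v) * x (Inr v)) = coboundary x e"
    unfolding coboundary_def using finite_V
    by (simp add: coefficient_def sum.inter_filter if_distrib[of "\<lambda>u. u * _"] cong: if_cong)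
  finally show ?thesis .
qed

lemma coboundary_orthogonal:
  assumes "\<And>v. v \<in> V ==> (\<Sum>e\<in>N v. T e) = 0"
  shows "(\<Sum>e\<in>E. coboundary x e * T e) = 0"
proof -
  have "(\<Sum>e\<in>E. coboundary x e * T e) = (\<Sum>e\<in>E. \<Sum>v\<in>V. if e \<in> N v then x (Inr v) * T e else 0)"
    unfolding coboundary_def sum_distrib_right using finite_V by (simp add: sum.inter_filter)
  also have "\<dots> = (\<Sum>v\<in>V. \<Sum>e\<in>E. if e \<in> N v then x (Inr v) * T e else 0)" by (rule sum.swap)
  also have "\<dots> = (\<Sum>v\<in>V. x (Inr v) * (\<Sum>e\<in>N v. T e))"
  proof (rule sum.cong[OF refl])
    fix v assume "v \<in> V"
    then have "{e \<in> E. e \<in> N v} = N v" using N by blast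
    then show "(\<Sum>e\<in>E. if e \<in> N v then x (Inr v) * T e else 0) = x (Inr v) * (\<Sum>e\<in>N v. T e)"
      using finite_E by (simp add: sum.inter_filter[symmetric] sum_distrib_left)
  qed
  also have "\<dots> = 0" using assms by simp
  finally show ?thesis .
qed

text \<open>For a kernel vector the gradient part is minus the coboundary part. Gradients are
  conserved at every vertex, hence orthogonal to coboundaries, so the sum of squares of the
  coboundary vanishes, and connectedness kills both parts.\<close>

lemma system_injective:
  assumes "\<And>e. e \<in> E ==> (\<Sum>w\<in>unknowns. coefficient e w * x w) = 0"
  shows "\<forall>w\<in>unknowns. x w = 0"
proof -
  let ?g = "\<lambda>e. potential x (L e) - potential x (R e)"
  have z: "?g e = - coboundary x e" if "e \<in> E" for e
    using assms[OF that] system_eq[OF that, of x] by simp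
  have "(\<Sum>e\<in>E. coboundary x e * ?g e) = 0"
    by (rule coboundary_orthogonal) (rule conserved)
  then have "(\<Sum>e\<in>E. (coboundary x e)\<^sup>2) = 0"
    using z by (simp add: power2_eq_square sum_negf)
  then have c: "coboundary x e = 0" if "e \<in> E" for e
    using that finite_E by (simp add: sum_nonneg_eq_0_iff)
  have "x (Inr v) = 0" if "v \<in> V" for v
    using connected_V[of "\<lambda>v. x (Inr v)", OF _ that] c by (simp add: coboundary_def)
  moreover have "x (Inl d) = 0" if "d \<in> D - {d0}" for d
  proof -
    have "potential x d = potential x d0"
      by (rule connected_D) (use z c that in auto)
    then show ?thesis using that by (simp add: potential_def)
  qed
  ultimately show ?thesis by (auto simp: unknowns_def)
qed

text \<open>An injective system cannot have more unknowns than equations.\<close>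

lemma card_le: "card D + card V \<le> Suc (card E)"
proof (rule ccontr)
  assume "\<not> ?thesis"
  then have "card E < card unknowns" using card_unknowns by simp
  then show False
    using underdetermined_system[OF finite_E finite_unknowns, of coefficient] system_injective by blast
qed

text \<open>With equality the system is square, so \<open>T\<close> is a gradient plus a coboundary.
  As \<open>T\<close> is conserved, that coboundary is orthogonal to \<open>T\<close> and to all
  gradients, hence to itself.\<close>

lemma gradient_exists:
  assumes "card D + card V = Suc (card E)" and T: "\<And>v. v \<in> V ==> (\<Sum>e\<in>N v. T e) = 0"
  shows "\<exists>\<psi> :: 'd => real. \<forall>e\<in>E. \<psi> (L e) - \<psi> (R e) = T e"
proof -
  have "card E = card unknowns" using assms(1) card_unknowns by simp
  from square_system_solvable[OF finite_E finite_unknowns this system_injective, of coefficient T]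
  obtain x where x0: "\<forall>e\<in>E. (\<Sum>w\<in>unknowns. coefficient e w * x w) = T e" by blast
  have x: "potential x (L e) - potential x (R e) + coboundary x e = T e" if "e \<in> E" for e
    using x0 system_eq[OF that, of x] that by simp
  have "(\<Sum>e\<in>E. coboundary x e * (T e - (potential x (L e) - potential x (R e)))) = 0"
    by (rule coboundary_orthogonal) (use T conserved in \<open>simp add: sum_subtractf\<close>)
  moreover have "T e - (potential x (L e) - potential x (R e)) = coboundary x e" if "e \<in> E" for e
    using x[OF that] by simp
  ultimately have "(\<Sum>e\<in>E. (coboundary x e)\<^sup>2) = 0" by (simp add: power2_eq_square)
  then have "coboundary x e = 0" if "e \<in> E" for e
    using that finite_E by (simp add: sum_nonneg_eq_0_iff)
  then show ?thesis using x by (intro exI[of _ "potential x"]) force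
qed

end

section \<open>Parity along permutations\<close>

text \<open>The product over all \<open>x\<close> of the signs at \<open>x\<close> and at
  \<open>f x\<close> is a square, because \<open>f\<close> only permutes the factors.\<close>

lemma even_card_changes:
  fixes s :: "'a => bool"
  assumes "finite S" "bij_betw f S S"
  shows "even (card {x \<in> S. s x ~= s (f x)})"
proof -
  define g :: "'a => int" where "g x = (if s x then 1 else - 1)" for x
  have "(\<Prod>x\<in>S. g x * g (f x)) = (\<Prod>x\<in>S. g x) * (\<Prod>x\<in>S. g x)"
    unfolding prod.distrib using prod.reindex_bij_betw[OF assms(2), of g] by simp
  also have "\<dots> = (\<Prod>x\<in>S. g x * g x)" by (simp add: prod.distrib)
  also have "\<dots> = 1" by (rule prod.neutral) (simp add: g_def)
  finally have 1: "(\<Prod>x\<in>S. g x * g (f x)) = 1" .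
  have 2: "(\<Prod>x\<in>S. g x * g (f x)) = (\<Prod>x\<in>S. if s x ~= s (f x) then - 1 else 1)"
    by (rule prod.cong) (auto simp: g_def)
  have 3: "(\<Prod>x\<in>S. if s x ~= s (f x) then - 1 else (1::int)) = (- 1) ^ card {x \<in> S. s x ~= s (f x)}"
    unfolding prod.If_cases[OF assms(1)] by (simp add: Int_def conj_commute)
  have "(- 1) ^ card {x \<in> S. s x ~= s (f x)} = (1::int)" using 1 2 3 by simp
  then show ?thesis by (cases "even (card {x \<in> S. s x ~= s (f x)})") (simp_all add: neg_one_odd_power)
qed

text \<open>A function on a cycle that is constant along all steps but one is constant along that
  step too: a single change would contradict parity. Thus one exceptional step \<open>x0\<close> is
  always allowed.\<close>

lemma orbit_const:
  assumes "finite (orbit f x)" "bij_betw f (orbit f x) (orbit f x)"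
    and g: "\<And>y. y \<in> orbit f x ==> y ~= x0 ==> g (f y) = g y"
    and y: "y \<in> orbit f x" "y' \<in> orbit f x"
  shows "g y = g y'"
proof -
  let ?S = "orbit f x"
  have st: "g (f z) = g z" if "z \<in> ?S" for z
  proof (rule ccontr)
    assume neq: "g (f z) ~= g z"
    define s where "s w \<longleftrightarrow> g w = g z" for w
    have zx: "z = x0" using g[OF that] neq by blast
    have "s w = s (f w)" if "w \<in> ?S" "w ~= z" for w using g[OF that(1)] that zx by (simp add: s_def)
    moreover have "s z ~= s (f z)" using neq by (simp add: s_def)
    ultimately have "{w \<in> ?S. s w ~= s (f w)} = {z}" using that by blast
    then show False using even_card_changes[OF assms(1,2), of s] by simp
  qed
  have "g z = g (f x)" if "z \<in> ?S" for z
    using that by induction (auto simp: st)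
  then show ?thesis using y by metis
qed

lemma bij_betw_restrict:
  assumes "inj f" "finite S" "\<And>x. x \<in> S ==> f x \<in> S"
  shows "bij_betw f S S"
  using assms endo_inj_surj[of S f] by (auto simp: bij_betw_def inj_on_def inj_def)

section \<open>Combinatorics of the rotation system\<close>

locale plane_graph =
  fixes G :: bipartite_map and a :: "nat \<times> nat"
  assumes plane: "plane_bipartite_map G" and a_edge: "a \<in> edges G"
begin

abbreviation "n \<equiv> nverts G"
abbreviation "E \<equiv> edges G"
abbreviation "rb \<equiv> rot_b G"
abbreviation "rw \<equiv> rot_w G"
abbreviation "\<phi> \<equiv> face_perm G"
abbreviation "Out \<equiv> outer_face G a"
abbreviation "m \<equiv> outer_size G a"
abbreviation "Lv \<equiv> left_vertex G a"
abbreviation "Rv \<equiv> right_vertex G a"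

definition Eb :: "nat => (nat \<times> nat) set" where "Eb i = {e \<in> E. fst e = i}"
definition Ew :: "nat => (nat \<times> nat) set" where "Ew j = {e \<in> E. snd e = j}"

lemma fst_E: "fst ` E = {..<n}" and snd_E: "snd ` E = {..<n}"
  and rb_permutes: "rb permutes E" and rw_permutes: "rw permutes E"
  and orbit_rb: "e \<in> E ==> orbit rb e = Eb (fst e)"
  and orbit_rw: "e \<in> E ==> orbit rw e = Ew (snd e)"
  and euler: "2 * int n - int (card E) + int (card (faces G)) = 2"
  using plane by (auto simp: plane_bipartite_map_def Eb_def Ew_def)

lemma E_bounds: "e \<in> E ==> fst e < n" "e \<in> E ==> snd e < n"
  using fst_E snd_E by auto

lemma finite_E: "finite E"
proof (rule finite_subset)
  show "E \<subseteq> {..<n} \<times> {..<n}" using E_bounds by (auto simp: mem_Times_iff)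
qed simp

lemma finite_Eb: "finite (Eb i)" and finite_Ew: "finite (Ew i)"
  using finite_E by (auto simp: Eb_def Ew_def)

lemma Eb_nonempty: "i < n ==> Eb i ~= {}" and Ew_nonempty: "i < n ==> Ew i ~= {}"
  using fst_E snd_E by (auto simp: Eb_def Ew_def image_iff set_eq_iff) (metis lessThan_iff prod.collapse)+

lemma rb_in: "rb e \<in> E \<longleftrightarrow> e \<in> E" and rw_in: "rw e \<in> E \<longleftrightarrow> e \<in> E"
  using permutes_in_image rb_permutes rw_permutes by metis+

lemma fst_rb [simp]: "e \<in> E ==> fst (rb e) = fst e"
  using orbit.base[of rb e] orbit_rb[of e] by (auto simp: Eb_def)

lemma snd_rw [simp]: "e \<in> E ==> snd (rw e) = snd e"
  using orbit.base[of rw e] orbit_rw[of e] by (auto simp: Ew_def)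

lemma phi_eq: "\<phi> e = rb (rw e)" by (simp add: face_perm_def)

lemma phi_permutes: "\<phi> permutes E"
  unfolding face_perm_def by (rule permutes_compose[OF rw_permutes rb_permutes])

lemma phi_in: "\<phi> e \<in> E \<longleftrightarrow> e \<in> E" by (simp add: phi_eq rb_in rw_in)

lemma fst_phi: "e \<in> E ==> fst (\<phi> e) = fst (rw e)" by (simp add: phi_eq rw_in)

lemma inj_rots: "inj rb" "inj rw" "inj \<phi>"
  using permutes_inj rb_permutes rw_permutes phi_permutes by metis+

lemma bij_rb: "bij_betw rb (Eb i) (Eb i)"
  by (rule bij_betw_restrict[OF inj_rots(1) finite_Eb]) (auto simp: Eb_def rb_in)

lemma bij_rw: "bij_betw rw (Ew i) (Ew i)"
  by (rule bij_betw_restrict[OF inj_rots(2) finite_Ew]) (auto simp: Ew_def rw_in)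

lemma bij_rb_E: "bij_betw rb E E" and bij_rw_E: "bij_betw rw E E" and bij_phi_E: "bij_betw \<phi> E E"
  using rb_permutes rw_permutes phi_permutes by (auto intro: permutes_imp_bij)

lemma self_orbit: "e \<in> E ==> e \<in> orbit \<phi> e"
  using permutation_self_in_orbit[of \<phi> e] phi_permutes finite_E by (auto simp: permutation_permutes)

lemma orbit_phi_eq: "e \<in> E ==> x \<in> orbit \<phi> e ==> orbit \<phi> x = orbit \<phi> e"
  by (rule orbit_cyclic_eq3[OF cyclic_on_orbit[OF phi_permutes finite_E]])

lemma orbit_phi_subset: "e \<in> E ==> orbit \<phi> e \<subseteq> E"
  using permutes_orbit_subset[OF phi_permutes] .

lemma orbit_phi_step: "e \<in> E ==> orbit \<phi> (\<phi> e) = orbit \<phi> e"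
  by (rule orbit_phi_eq[OF _ orbit.base])

lemma faceD: "F \<in> faces G ==> e \<in> F ==> orbit \<phi> e = F \<and> e \<in> E"
  unfolding faces_def using orbit_phi_eq orbit_phi_subset by blast

lemma face_nonempty: "F \<in> faces G ==> F ~= {}"
  by (auto simp: faces_def orbit_nonempty)

lemma orbit_in_faces: "e \<in> E ==> orbit \<phi> e \<in> faces G"
  by (auto simp: faces_def)

lemma finite_faces: "finite (faces G)"
  using finite_E by (simp add: faces_def)

lemma finite_face: "F \<in> faces G ==> finite F"
  using finite_E faceD by (meson finite_subset subsetI)

lemma bij_phi: "F \<in> faces G ==> bij_betw \<phi> F F"
  by (rule bij_betw_restrict[OF inj_rots(3) finite_face]) (auto simp: faces_def intro: orbit.step)

lemma Union_faces: "\<Union> (faces G) = E"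
  using self_orbit orbit_phi_subset by (fastforce simp: faces_def)

lemma faces_disjoint: "F \<in> faces G ==> F' \<in> faces G ==> F ~= F' ==> F \<inter> F' = {}"
  using faceD by blast

lemma sum_over_faces: "(\<Sum>e\<in>E. f e) = (\<Sum>F\<in>faces G. \<Sum>e\<in>F. f e)"
proof -
  have "(\<Sum>e\<in>\<Union> (faces G). f e) = (\<Sum>F\<in>faces G. \<Sum>e\<in>F. f e)"
    using sum.Union_disjoint[of "faces G" f] finite_face faces_disjoint by (simp add: o_def)
  then show ?thesis by (simp only: Union_faces)
qed

lemma sum_over_blacks: "(\<Sum>e\<in>E. f e) = (\<Sum>i<n. \<Sum>e\<in>Eb i. f e)"
  unfolding Eb_def using sum.group[OF finite_E, of "{..<n}" fst f] fst_E by simp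

lemma sum_over_whites: "(\<Sum>e\<in>E. f e) = (\<Sum>i<n. \<Sum>e\<in>Ew i. f e)"
  unfolding Ew_def using sum.group[OF finite_E, of "{..<n}" snd f] snd_E by simp

text \<open>The exceptional step \<open>x0\<close> accommodates the one corner at which a curve to
  infinity may interrupt the rotation.\<close>

lemma black_const:
  assumes "\<And>x. x \<in> E ==> fst x = fst e ==> x ~= x0 ==> g (rb x) = g x"
    and "e \<in> E" "e' \<in> E" "fst e = fst e'"
  shows "g e = g e'"
proof (rule orbit_const[of rb e x0 g])
  show "finite (orbit rb e)" "bij_betw rb (orbit rb e) (orbit rb e)" using assms orbit_rb finite_Eb bij_rb by auto
qed (use assms orbit_rb in \<open>auto simp: Eb_def\<close>)

lemma white_const:
  assumes "\<And>x. x \<in> E ==> snd x = snd e ==> x ~= x0 ==> g (rw x) = g x"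
    and "e \<in> E" "e' \<in> E" "snd e = snd e'"
  shows "g e = g e'"
proof (rule orbit_const[of rw e x0 g])
  show "finite (orbit rw e)" "bij_betw rw (orbit rw e) (orbit rw e)" using assms orbit_rw finite_Ew bij_rw by auto
qed (use assms orbit_rw in \<open>auto simp: Ew_def\<close>)

lemma face_const:
  assumes "\<And>x. x \<in> F ==> x ~= x0 ==> g (\<phi> x) = g x" and F: "F \<in> faces G" "e \<in> F" "e' \<in> F"
  shows "g e = g e'"
proof (rule orbit_const[of \<phi> e x0 g])
  show "finite (orbit \<phi> e)" "bij_betw \<phi> (orbit \<phi> e) (orbit \<phi> e)" using F faceD finite_face bij_phi by auto
qed (use assms faceD in \<open>auto\<close>)

lemma edges_connected:
  assumes g: "\<And>e e'. e \<in> E ==> e' \<in> E ==> fst e = fst e' \<or> snd e = snd e' ==> g e = g e'"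
    and "e \<in> E" "e' \<in> E"
  shows "g e = g e'"
proof -
  have "(e, e') \<in> {(x, y). x \<in> E \<and> y \<in> E \<and> (fst x = fst y \<or> snd x = snd y)}\<^sup>*"
    using plane assms by (auto simp: plane_bipartite_map_def)
  then show ?thesis by induction (use g in auto)
qed

text \<open>Along edges sharing a vertex the black contribution \<open>X = - Y\<close> stays the
  same, so it is constant on the connected graph. A vertex left out of \<open>B\<close> or
  \<open>W\<close> makes the constant zero. This is the injectivity of the coboundary map as soon as
  one vertex is omitted.\<close>

lemma vertex_potential_zero:
  fixes x y :: "nat => real"
  assumes B: "B \<subseteq> {..<n}" and W: "W \<subseteq> {..<n}" and ne: "B ~= {..<n} \<or> W ~= {..<n}"
    and z: "\<And>e. e \<in> E ==> (if fst e \<in> B then x (fst e) else 0) + (if snd e \<in> W then y (snd e) else 0) = 0"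
  shows "i \<in> B ==> x i = 0" and "j \<in> W ==> y j = 0"
proof -
  define X where "X e = (if fst e \<in> B then x (fst e) else 0)" for e :: "nat \<times> nat"
  define Y where "Y e = (if snd e \<in> W then y (snd e) else 0)" for e :: "nat \<times> nat"
  have XY: "X e = - Y e" if "e \<in> E" for e using z[OF that] by (simp add: X_def Y_def)
  have c: "X e = X e'" if "e \<in> E" "e' \<in> E" for e e'
  proof (rule edges_connected[OF _ that])
    fix e e' assume *: "e \<in> E" "e' \<in> E" "fst e = fst e' \<or> snd e = snd e'"
    from *(3) show "X e = X e'"
    proof
      assume "fst e = fst e'" then show ?thesis by (simp add: X_def)
    next
      assume "snd e = snd e'" then show ?thesis using XY[OF *(1)] XY[OF *(2)] by (simp add: Y_def)
    qed
  qed
  obtain e0 where e0: "e0 \<in> E" "X e0 = 0"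
  proof -
    from ne show ?thesis
    proof
      assume "B ~= {..<n}"
      then obtain i where i: "i < n" "i \<notin> B" using B by auto
      then obtain e where "e \<in> E" "fst e = i" using Eb_nonempty[of i] by (auto simp: Eb_def)
      then show ?thesis using that[of e] i by (simp add: X_def)
    next
      assume "W ~= {..<n}"
      then obtain i where i: "i < n" "i \<notin> W" using W by auto
      then obtain e where "e \<in> E" "snd e = i" using Ew_nonempty[of i] by (auto simp: Ew_def)
      then show ?thesis using that[of e] i XY[of e] by (simp add: Y_def)
    qed
  qed
  then have X0: "X e = 0" if "e \<in> E" for e using c that by metis
  show "x i = 0" if i: "i \<in> B"
  proof -
    have "i < n" using i B by auto
    then obtain e where "e \<in> E" "fst e = i" using Eb_nonempty[of i] by (auto simp: Eb_def)
    then show ?thesis using X0[of e] i by (simp add: X_def)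
  qed
  show "y j = 0" if j: "j \<in> W"
  proof -
    have "j < n" using j W by auto
    then obtain e where "e \<in> E" "snd e = j" using Ew_nonempty[of j] by (auto simp: Ew_def)
    then show ?thesis using X0[of e] XY[of e] j by (simp add: Y_def)
  qed
qed

lemma Out_face: "Out \<in> faces G" and a_Out: "a \<in> Out"
  using orbit_in_faces[OF a_edge] self_orbit[OF a_edge] by (auto simp: outer_face_def)

lemma m_eq: "m = funpow_dist1 \<phi> a a"
proof -
  have "bij_betw (\<lambda>k. (\<phi> ^^ k) a) {0..<funpow_dist1 \<phi> a a} (orbit \<phi> a)"
    unfolding bij_betw_def
    using inj_on_funpow_dist1[OF self_orbit[OF a_edge]] orbit_conv_funpow_dist1[OF self_orbit[OF a_edge]] by simp
  then show ?thesis using bij_betw_same_card by (fastforce simp: outer_size_def outer_face_def)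
qed

lemma bij_outer: "bij_betw (\<lambda>k. (\<phi> ^^ k) a) {..<m} Out"
  unfolding bij_betw_def m_eq lessThan_atLeast0 outer_face_def
  using inj_on_funpow_dist1[OF self_orbit[OF a_edge]] orbit_conv_funpow_dist1[OF self_orbit[OF a_edge]] by simp

text \<open>For \<open>k < m\<close> this is the edge that has \<open>Outer k\<close> on its right.
  The index wraps around at \<open>m\<close>, whereas \<open>Outer m\<close> occurs only on the left
  of an edge, next to the cut at the black end of \<open>a\<close>.\<close>

definition oe :: "nat => nat \<times> nat" where "oe k = (\<phi> ^^ k) a"

lemma oe_0 [simp]: "oe 0 = a" and oe_Suc: "oe (Suc k) = \<phi> (oe k)" by (simp_all add: oe_def)

lemma oe_m: "oe m = a"
  unfolding oe_def m_eq by (rule funpow_dist1_prop[OF self_orbit[OF a_edge]])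

lemma m_pos: "0 < m" by (simp add: m_eq)

lemma oe_Out: "oe k \<in> Out"
  using funpow_in_orbit[OF self_orbit[OF a_edge]] by (simp add: oe_def outer_face_def)

lemma Out_E: "e \<in> Out ==> e \<in> E"
  using orbit_phi_subset[OF a_edge] by (auto simp: outer_face_def)

lemma oe_E: "oe k \<in> E" using oe_Out Out_E by blast

lemma oe_inj: "k < m ==> l < m ==> oe k = oe l \<longleftrightarrow> k = l"
  using bij_outer by (auto simp: bij_betw_def inj_on_def oe_def)

lemma oe_cases:
  assumes "e \<in> Out" obtains k where "k < m" "e = oe k"
  using assms bij_outer by (auto simp: bij_betw_def oe_def)

lemma funpow_dist_oe: "k < m ==> funpow_dist \<phi> a (oe k) = k"
proof -
  assume k: "k < m"
  have "(\<phi> ^^ funpow_dist \<phi> a (oe k)) a = oe k"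
    by (rule funpow_dist_prop) (use oe_Out in \<open>simp add: outer_face_def\<close>)
  then have e: "oe (funpow_dist \<phi> a (oe k)) = oe k" by (simp add: oe_def)
  have "funpow_dist \<phi> a (oe k) \<le> k" unfolding funpow_dist_def by (rule Least_le) (simp add: oe_def)
  then show ?thesis using e oe_inj k by auto
qed

lemma Rv_outer: "k < m ==> Rv (oe k) = Outer k"
  using oe_Out funpow_dist_oe by (simp add: right_vertex_def)

lemma Rv_inner: "e \<notin> Out ==> Rv e = Inner (orbit \<phi> e)"
  by (simp add: right_vertex_def)

lemma Lv_rb: "rb e ~= a ==> Lv e = Rv (rb e)" and Lv_a: "rb e = a ==> Lv e = Outer m"
  by (simp_all add: left_vertex_def)

lemma Out_phi: "e \<in> E ==> \<phi> e \<in> Out \<longleftrightarrow> e \<in> Out"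
  by (metis Out_face a_Out faceD orbit.base orbit_phi_step self_orbit phi_in orbit_in_faces)

text \<open>At a white corner that does not belong to the outer face, the edge and its successor
  border the same dual vertex.\<close>

lemma Lv_rw_inner:
  assumes "e \<in> E" "e \<notin> Out"
  shows "Lv (rw e) = Rv e"
proof -
  have "\<phi> e \<notin> Out" using assms Out_phi by simp
  then have "rb (rw e) ~= a" "rb (rw e) \<notin> Out" using a_Out by (auto simp: phi_eq)
  then show ?thesis
    using assms orbit_phi_step[OF assms(1)] by (simp add: Lv_rb Rv_inner phi_eq)
qed

text \<open>The curve from the white end of \<open>oe k\<close> to infinity passes through this
  corner, so the region index goes up by one.\<close>

lemma Lv_rw_outer:
  assumes "k < m"
  shows "Lv (rw (oe k)) = Outer (Suc k)"
proof (cases "Suc k = m")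
  \<comment> \<open>At the last white vertex the next edge is \<open>a\<close> itself, and the
    corner of \<open>b0\<close> is cut as well: \<open>left_vertex\<close> then returns
    \<open>Outer m\<close> rather than \<open>Outer 0\<close>.\<close>
  case True
  then have "rb (rw (oe k)) = a" using oe_m oe_Suc[of k] by (simp add: phi_eq)
  then show ?thesis using True by (simp add: Lv_a)
next
  case False
  then have "oe (Suc k) ~= oe 0" using assms oe_inj[of "Suc k" 0] by simp
  then have "rb (rw (oe k)) ~= a" by (simp add: oe_Suc phi_eq)
  then show ?thesis
    using False assms Rv_outer[of "Suc k"] by (simp add: Lv_rb oe_Suc phi_eq)
qed

lemma card_V: "B \<subseteq> {..<n} ==> W \<subseteq> {..<n} ==> card (Inl ` B \<union> Inr ` W) = card B + card W"
  by (subst card_Un_disjoint) (auto simp: card_image intro: finite_subset)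

definition star :: "nat + nat => (nat \<times> nat) set" where
  "star v = (case v of Inl i => Eb i | Inr j => Ew j)"

lemma star_sum:
  fixes \<eta> :: "nat + nat => real"
  assumes "e \<in> E"
  shows "(\<Sum>v\<in>{v\<in>Inl ` B \<union> Inr ` W. e \<in> star v}. \<eta> v) =
    (if fst e \<in> B then \<eta> (Inl (fst e)) else 0) + (if snd e \<in> W then \<eta> (Inr (snd e)) else 0)"
proof -
  have "{v\<in>Inl ` B \<union> Inr ` W. e \<in> star v} =
    (if fst e \<in> B then {Inl (fst e)} else {}) \<union> (if snd e \<in> W then {Inr (snd e)} else {})"
    using assms by (auto simp: star_def Eb_def Ew_def)
  then show ?thesis by auto
qed

lemma sum_rb: "(\<Sum>e\<in>Eb i. f (rb e)) = (\<Sum>e\<in>Eb i. f e)"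
  by (rule sum.reindex_bij_betw[OF bij_rb])

lemma sum_rw: "(\<Sum>e\<in>Ew i. f (rw e)) = (\<Sum>e\<in>Ew i. f e)"
  by (rule sum.reindex_bij_betw[OF bij_rw])

text \<open>For vertices in \<open>B\<close> and \<open>W\<close> the regions close up around the
  vertex without a cut, so increments telescope around the rotation. This is the conservation law
  that the decomposition asks for.\<close>

lemma gradient_decompositionI:
  fixes R L :: "nat \<times> nat => dual_vertex"
  assumes "finite D" "\<And>e. e \<in> E ==> L e \<in> D" "\<And>e. e \<in> E ==> R e \<in> D" "d0 \<in> D"
    and B: "B \<subseteq> {..<n}" and W: "W \<subseteq> {..<n}" and ne: "B ~= {..<n} \<or> W ~= {..<n}"
    and b: "\<And>e. e \<in> E ==> fst e \<in> B ==> L e = R (rb e)"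
    and w: "\<And>e. e \<in> E ==> snd e \<in> W ==> L (rw e) = R e"
    and con: "\<And>(\<psi>::dual_vertex => real) d. (\<And>e. e \<in> E ==> \<psi> (L e) = \<psi> (R e)) ==> d \<in> D ==> \<psi> d = \<psi> d0"
  shows "gradient_decomposition E D (Inl ` B \<union> Inr ` W) L R star d0"
proof
  show "finite (Inl ` B \<union> Inr ` W)" using B W finite_subset by blast
  show "star v \<subseteq> E" for v by (auto simp: star_def Eb_def Ew_def split: sum.splits)
  show "(\<Sum>e\<in>star v. \<psi> (L e) - \<psi> (R e)) = 0" if "v \<in> Inl ` B \<union> Inr ` W" for v and \<psi> :: "dual_vertex => real"
    using that
  proof
    assume "v \<in> Inl ` B"
    then obtain i where i: "v = Inl i" "i \<in> B" by blast
    have "(\<Sum>e\<in>Eb i. \<psi> (L e)) = (\<Sum>e\<in>Eb i. \<psi> (R (rb e)))"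
      by (rule sum.cong) (use i b in \<open>auto simp: Eb_def\<close>)
    then show ?thesis using sum_rb[of "\<lambda>e. \<psi> (R e)" i] by (simp add: i star_def sum_subtractf)
  next
    assume "v \<in> Inr ` W"
    then obtain i where i: "v = Inr i" "i \<in> W" by blast
    have "(\<Sum>e\<in>Ew i. \<psi> (L (rw e))) = (\<Sum>e\<in>Ew i. \<psi> (R e))"
      by (rule sum.cong) (use i w in \<open>auto simp: Ew_def\<close>)
    then show ?thesis using sum_rw[of "\<lambda>e. \<psi> (L e)" i] by (simp add: i star_def sum_subtractf)
  qed
  show "\<eta> v = 0" if z: "\<And>e. e \<in> E ==> (\<Sum>v\<in>{v\<in>Inl ` B \<union> Inr ` W. e \<in> star v}. \<eta> v) = 0" and v: "v \<in> Inl ` B \<union> Inr ` W"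
    for v and \<eta> :: "nat + nat => real"
  proof -
    have "(if fst e \<in> B then \<eta> (Inl (fst e)) else 0) + (if snd e \<in> W then \<eta> (Inr (snd e)) else 0) = 0" if "e \<in> E" for e
      using z[OF that] star_sum[OF that, of \<eta> B W] by simp
    from vertex_potential_zero[OF B W ne this] show ?thesis using v by auto
  qed
qed (use assms finite_E in auto)

end

section \<open>Consequences of every edge being matched\<close>

locale elementary_plane_graph = plane_graph +
  assumes matched: "e \<in> edges G ==> \<exists>M. perfect_matching G M \<and> e \<in> M"
begin

lemma matching_fst: "perfect_matching G M ==> bij_betw fst M {..<n}"
  and matching_snd: "perfect_matching G M ==> bij_betw snd M {..<n}"
  and matching_E: "perfect_matching G M ==> M \<subseteq> E"
proof -
  assume M: "perfect_matching G M"
  then show ME: "M \<subseteq> E" by (simp add: perfect_matching_def)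
  have 1: "\<exists>!e. e \<in> M \<and> fst e = i" and 2: "\<exists>!e. e \<in> M \<and> snd e = i" if "i < n" for i
    using M that by (auto simp: perfect_matching_def)
  have "x = y" if "x \<in> M" "y \<in> M" "fst x = fst y" for x y
    using 1[of "fst x"] E_bounds(1)[of x] ME that by auto
  then have "inj_on fst M" by (rule inj_onI)
  moreover have "fst ` M = {..<n}"
  proof
    show "fst ` M \<subseteq> {..<n}" using E_bounds(1) ME by blast
    show "{..<n} \<subseteq> fst ` M" using 1 by (metis imageI lessThan_iff subsetI)
  qed
  ultimately show "bij_betw fst M {..<n}" by (simp add: bij_betw_def)
  have "x = y" if "x \<in> M" "y \<in> M" "snd x = snd y" for x y
    using 2[of "snd x"] E_bounds(2)[of x] ME that by auto
  then have "inj_on snd M" by (rule inj_onI)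
  moreover have "snd ` M = {..<n}"
  proof
    show "snd ` M \<subseteq> {..<n}" using E_bounds(2) ME by blast
    show "{..<n} \<subseteq> snd ` M" using 2 by (metis imageI lessThan_iff subsetI)
  qed
  ultimately show "bij_betw snd M {..<n}" by (simp add: bij_betw_def)
qed

lemma matching_ex_fst: "perfect_matching G M ==> i < n ==> \<exists>e\<in>M. fst e = i"
  and matching_ex_snd: "perfect_matching G M ==> i < n ==> \<exists>e\<in>M. snd e = i"
  unfolding perfect_matching_def by blast+

text \<open>
  A white cut vertex \<open>w\<close> would have edges into two different components, and a matching that uses
  such an edge determines the difference of the numbers of black and white vertices of the
  component.
\<close>

lemma no_white_cut_vertex:
  assumes cb: "\<And>e e'. e \<in> E ==> e' \<in> E ==> fst e = fst e' ==> c e = c e'"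
    and cw: "\<And>e e'. e \<in> E ==> e' \<in> E ==> snd e = snd e' ==> snd e ~= w ==> c e = c e'"
    and "e1 \<in> E" "e2 \<in> E"
  shows "c e1 = c e2"
proof (rule ccontr)
  assume neq: "c e1 ~= c e2"
  define c1 where "c1 = c e1"
  have "\<exists>e\<in>E. \<exists>e'\<in>E. snd e = w \<and> snd e' = w \<and> c e = c1 \<and> c e' ~= c1"
  proof (rule ccontr)
    assume no: "\<not> ?thesis"
    have "(c e1 = c1) = (c e2 = c1)"
    proof (rule edges_connected[of "\<lambda>e. c e = c1"])
      fix e e' assume *: "e \<in> E" "e' \<in> E" "fst e = fst e' \<or> snd e = snd e'"
      show "(c e = c1) = (c e' = c1)"
      proof (cases "fst e = fst e' \<or> snd e ~= w")
        case True then show ?thesis using cb[OF *(1,2)] cw[OF *(1,2)] * by metis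
      next
        case False then show ?thesis using no * by metis
      qed
    qed (fact assms(3) assms(4))+
    then show False using neq by (simp add: c1_def)
  qed
  then obtain e e' where e: "e \<in> E" "e' \<in> E" "snd e = w" "snd e' = w" "c e = c1" "c e' ~= c1" by blast
  define B where "B = fst ` {x \<in> E. c x = c1}"
  define W where "W = snd ` {x \<in> E. c x = c1} - {w}"
  have count: "card B = card (snd ` {x \<in> M. c x = c1})" if M: "perfect_matching G M" for M
  proof -
    have "fst ` {x \<in> M. c x = c1} = B"
    proof
      show "fst ` {x \<in> M. c x = c1} \<subseteq> B" using matching_E[OF M] by (auto simp: B_def)
      show "B \<subseteq> fst ` {x \<in> M. c x = c1}"
      proof
        fix i assume "i \<in> B"
        then obtain x where x: "x \<in> E" "c x = c1" "i = fst x" by (auto simp: B_def)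
        then obtain y where "y \<in> M" "fst y = i"
          using matching_ex_fst[OF M, of i] E_bounds(1)[of x] by blast
        then show "i \<in> fst ` {x \<in> M. c x = c1}" using x cb[of y x] matching_E[OF M] by blast
      qed
    qed
    moreover have "inj_on fst {x \<in> M. c x = c1}" "inj_on snd {x \<in> M. c x = c1}"
      using matching_fst[OF M] matching_snd[OF M] by (auto simp: bij_betw_def inj_on_def)
    ultimately show ?thesis by (metis card_image)
  qed
  have W_M: "snd ` {x \<in> M. c x = c1} - {w} = W" if M: "perfect_matching G M" for M
  proof
    show "snd ` {x \<in> M. c x = c1} - {w} \<subseteq> W" using matching_E[OF M] by (auto simp: W_def)
    show "W \<subseteq> snd ` {x \<in> M. c x = c1} - {w}"
    proof
      fix i assume "i \<in> W"
      then obtain x where x: "x \<in> E" "c x = c1" "i = snd x" "i ~= w" by (auto simp: W_def)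
      then obtain y where "y \<in> M" "snd y = i"
        using matching_ex_snd[OF M, of i] E_bounds(2)[of x] by blast
      then show "i \<in> snd ` {x \<in> M. c x = c1} - {w}" using x cw[of y x] matching_E[OF M] by blast
    qed
  qed
  have fW: "finite W" using finite_E by (simp add: W_def)
  obtain M where M: "perfect_matching G M" "e \<in> M" using matched e by blast
  have "snd ` {x \<in> M. c x = c1} = insert w W"
    using W_M[OF M(1)] M e by (auto simp: image_iff)
  moreover have "w \<notin> W" by (simp add: W_def)
  ultimately have 1: "card B = Suc (card W)" using count[OF M(1)] fW by simp
  obtain M' where M': "perfect_matching G M'" "e' \<in> M'" using matched e by blast
  have "w \<notin> snd ` {x \<in> M'. c x = c1}"
  proof
    assume "w \<in> snd ` {x \<in> M'. c x = c1}"
    then obtain x where "x \<in> M'" "c x = c1" "snd x = snd e'" using e by auto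
    then have "x = e'" using M' matching_snd[OF M'(1)] by (auto simp: bij_betw_def inj_on_def)
    then show False using e \<open>c x = c1\<close> by simp
  qed
  then have "card B = card W" using W_M[OF M'(1)] count[OF M'(1)] by simp
  then show False using 1 by simp
qed

text \<open>If the outer walk visited \<open>w\<close> twice, it could be split at \<open>w\<close>
  into two regions. The dual graph of the remaining \<open>2 * n - 1\<close> vertices stays
  connected because \<open>w\<close> is not a cut vertex, and the dimension count then bounds the
  number of regions, now one more than the number of faces, by a number that Euler's formula
  exceeds.\<close>

lemma outer_white_distinct:
  assumes "i < m" "j < m" "snd (oe i) = snd (oe j)"
  shows "i = j"
proof (rule ccontr)
  assume "i ~= j"
  then obtain i j where ij: "i < j" "j < m" "snd (oe i) = snd (oe j)"
    using assms by (metis linorder_neqE_nat)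
  define w where "w = snd (oe i)"
  \<comment> \<open>The outer face is replaced by two regions, \<open>Outer 1\<close> for the part
    of the walk between the two visits and \<open>Outer 0\<close> for the rest. Going around a face,
    this labelling changes at \<open>w\<close> only.\<close>
  define R where "R e = (if e \<in> Out then Outer (if i < funpow_dist \<phi> a e \<and> funpow_dist \<phi> a e \<le> j then 1 else 0)
    else Inner (orbit \<phi> e))" for e
  define D where "D = Inner ` (faces G - {Out}) \<union> {Outer 0, Outer 1}"
  have R_oe: "R (oe k) = Outer (if i < k \<and> k \<le> j then 1 else 0)" if "k < m" for k
    using that by (simp add: R_def oe_Out funpow_dist_oe)
  have RD: "R e \<in> D" if "e \<in> E" for e
  proof (cases "e \<in> Out")
    case False
    then have "orbit \<phi> e ~= Out" using self_orbit[OF that] by blast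
    then show ?thesis using False orbit_in_faces[OF that] by (auto simp: R_def D_def)
  qed (auto simp: R_def D_def)
  have Rw: "R (\<phi> e) = R e" if "e \<in> E" "snd e ~= w" for e
  proof (cases "e \<in> Out")
    case True
    then obtain k where k: "k < m" "e = oe k" by (rule oe_cases)
    then have kij: "k ~= i" "k ~= j" using that(2) ij(3) by (auto simp: w_def)
    show ?thesis
    proof (cases "Suc k = m")
      case T: True
      then have "\<phi> e = oe 0" using k oe_m by (simp add: oe_Suc[symmetric])
      then show ?thesis using T k kij ij R_oe[of 0] R_oe[of k] by auto
    next
      case False
      then have "\<phi> e = oe (Suc k)" "Suc k < m" using k by (auto simp: oe_Suc)
      then show ?thesis using k kij R_oe[of "Suc k"] R_oe[of k] by auto
    qed
  next
    case False
    then show ?thesis using that Out_phi orbit_phi_step by (simp add: R_def)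
  qed
  let ?V = "Inl ` {..<n} \<union> Inr ` ({..<n} - {w})"
  have wn: "w < n" using E_bounds(2)[OF oe_E] by (simp add: w_def)
  have con: "\<psi> d = \<psi> (Outer 0)" if \<psi>: "\<And>e. e \<in> E ==> \<psi> (R (rb e)) = \<psi> (R e)" and d: "d \<in> D"
    for \<psi> :: "dual_vertex => real" and d
  proof -
    have c: "\<psi> (R e) = \<psi> (R e')" if "e \<in> E" "e' \<in> E" for e e'
    proof (rule no_white_cut_vertex[of "\<lambda>e. \<psi> (R e)" w])
      fix e e' assume *: "e \<in> E" "e' \<in> E"
      show "\<psi> (R e) = \<psi> (R e')" if "fst e = fst e'"
        by (rule black_const[where g = "\<lambda>e. \<psi> (R e)"]) (use * that \<psi> in auto)
      show "\<psi> (R e) = \<psi> (R e')" if sn: "snd e = snd e'" "snd e ~= w"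
      proof (rule white_const[where g = "\<lambda>e. \<psi> (R e)"])
        fix x assume "x \<in> E" "snd x = snd e"
        then show "\<psi> (R (rw x)) = \<psi> (R x)" using Rw[of x] \<psi>[of "rw x"] sn by (simp add: rw_in phi_eq)
      qed (use * sn in auto)
    qed (use that in auto)
    have "\<exists>e\<in>E. R e = d"
      using d unfolding D_def
    proof
      assume "d \<in> Inner ` (faces G - {Out})"
      then obtain F where F: "d = Inner F" "F \<in> faces G" "F ~= Out" by blast
      then obtain e where "e \<in> F" using face_nonempty by blast
      then have eF: "e \<in> E" "orbit \<phi> e = F" using faceD[OF F(2)] by blast+
      then have "e \<notin> Out" using faceD[OF Out_face, of e] F(3) by metis
      with eF show ?thesis using F by (auto simp: R_def)
    next
      assume "d \<in> {Outer 0, Outer 1}"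
      then show ?thesis using R_oe[of 0] R_oe[of j] ij m_pos oe_E[of 0] oe_E[of j] by auto
    qed
    moreover have "R (oe 0) = Outer 0" using R_oe[of 0] m_pos by simp
    ultimately show ?thesis using c oe_E by metis
  qed
  have "gradient_decomposition E D ?V (\<lambda>e. R (rb e)) R star (Outer 0)"
  proof (rule gradient_decompositionI)
    show "finite D" using finite_faces by (simp add: D_def)
    show "R (rb e) \<in> D" if "e \<in> E" for e using RD that rb_in by blast
    show "Outer 0 \<in> D" by (simp add: D_def)
    show "R (rb (rw e)) = R e" if "e \<in> E" "snd e \<in> {..<n} - {w}" for e
      using Rw[of e] that by (simp add: phi_eq)
  qed (use RD wn con in auto)
  then have "card D + card ?V \<le> Suc (card E)" by (rule gradient_decomposition.card_le)
  moreover have "card D = card (faces G) + 1"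
  proof -
    have "card D = card (Inner ` (faces G - {Out})) + card {Outer 0, Outer 1}"
      unfolding D_def using finite_faces by (subst card_Un_disjoint) auto
    also have "\<dots> = card (faces G - {Out}) + 2" by (simp add: card_image inj_on_def)
    finally show ?thesis using card.remove[OF finite_faces Out_face] by simp
  qed
  moreover have "card ?V = n + (n - 1)" using wn by (subst card_V) auto
  \<comment> \<open>The sum of the two cardinalities is
    \<open>card (faces G) + 2 * n = card E + 2\<close>, one too many.\<close>
  ultimately show False using euler wn by linarith
qed

lemma snd_Out_inj:
  assumes "x \<in> Out" "y \<in> Out" "snd x = snd y" shows "x = y"
proof -
  obtain i j where "i < m" "x = oe i" "j < m" "y = oe j"
    using oe_cases[OF assms(1)] oe_cases[OF assms(2)] by metis
  then show ?thesis using outer_white_distinct[of i j] assms(3) by simp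
qed

text \<open>The flow is conserved at all black vertices but \<open>b0\<close> and at all white
  vertices off the outer face, and these are exactly the vertices around which the dual vertices
  close up. The outer face, cut at \<open>b0\<close> and at \<open>m\<close> distinct white
  vertices, contributes \<open>m + 1\<close> dual vertices, so the dimension count is an equality
  and every conserved flow is a gradient.\<close>

lemma potential_exists:
  fixes T :: "nat \<times> nat => real"
  assumes b: "\<And>i. i < n ==> i ~= fst a ==> (\<Sum>e\<in>Eb i. T e) = 0"
    and w: "\<And>j. j < n ==> j \<notin> snd ` Out ==> (\<Sum>e\<in>Ew j. T e) = 0"
  shows "\<exists>\<psi>. \<forall>e\<in>E. \<psi> (Lv e) - \<psi> (Rv e) = T e"
proof -
  define D where "D = dual_vertices G a"
  define B where "B = {..<n} - {fst a}"
  define W where "W = {..<n} - snd ` Out"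
  have RD: "Rv e \<in> D" if "e \<in> E" for e
  proof (cases "e \<in> Out")
    case True
    then obtain k where "k < m" "e = oe k" by (rule oe_cases)
    then show ?thesis using Rv_outer by (auto simp: D_def dual_vertices_def)
  next
    case False
    then have "orbit \<phi> e ~= Out" using self_orbit[OF that] by blast
    then show ?thesis using False orbit_in_faces[OF that] by (auto simp: Rv_inner D_def dual_vertices_def)
  qed
  have LD: "Lv e \<in> D" if "e \<in> E" for e
    using RD[of "rb e"] that rb_in by (auto simp: left_vertex_def D_def dual_vertices_def)
  have con: "\<psi> d = \<psi> (Outer 0)" if \<psi>: "\<And>e. e \<in> E ==> \<psi> (Lv e) = \<psi> (Rv e)" and d: "d \<in> D"
    for \<psi> :: "dual_vertex => real" and d
  proof -
    have c: "\<psi> (Rv e) = \<psi> (Rv e')" if "e \<in> E" "e' \<in> E" for e e'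
    proof (rule edges_connected[of "\<lambda>e. \<psi> (Rv e)"])
      fix e e' assume *: "e \<in> E" "e' \<in> E" "fst e = fst e' \<or> snd e = snd e'"
      from *(3) show "\<psi> (Rv e) = \<psi> (Rv e')"
      proof
        assume f: "fst e = fst e'"
        show ?thesis
        proof (rule black_const[where g = "\<lambda>e. \<psi> (Rv e)" and ?x0.0 = "inv_into UNIV rb a"])
          fix x assume "x \<in> E" "x ~= inv_into UNIV rb a"
          then have "rb x ~= a" using inj_rots(1) by (metis inv_f_f)
          then show "\<psi> (Rv (rb x)) = \<psi> (Rv x)" using \<psi>[OF \<open>x \<in> E\<close>] by (simp add: Lv_rb)
        qed (use * f in auto)
      next
        assume f: "snd e = snd e'"
        define x0 where "x0 = (SOME x. x \<in> Out \<and> snd x = snd e)"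
        show ?thesis
        \<comment> \<open>The rotation around a white vertex is interrupted at most once, since at
          most one edge of the outer walk ends there.\<close>
        proof (rule white_const[where g = "\<lambda>e. \<psi> (Rv e)" and ?x0.0 = x0])
          fix x assume x: "x \<in> E" "snd x = snd e" "x ~= x0"
          have "x \<notin> Out"
          proof
            assume xO: "x \<in> Out"
            have "x0 \<in> Out \<and> snd x0 = snd e" unfolding x0_def by (rule someI[of _ x]) (use x xO in auto)
            then show False using snd_Out_inj[of x x0] xO x by metis
          qed
          then have "Lv (rw x) = Rv x" using Lv_rw_inner x by blast
          then show "\<psi> (Rv (rw x)) = \<psi> (Rv x)" using \<psi>[of "rw x"] x by (simp add: rw_in)
        qed (use * f in auto)
      qed
    qed (use that in auto)
    have "\<exists>e\<in>E. \<psi> (Rv e) = \<psi> d"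
      using d unfolding D_def dual_vertices_def
    proof
      assume "d \<in> Inner ` (faces G - {Out})"
      then obtain F where F: "d = Inner F" "F \<in> faces G" "F ~= Out" by blast
      then obtain e where "e \<in> F" using face_nonempty by blast
      then have eF: "e \<in> E" "orbit \<phi> e = F" using faceD[OF F(2)] by blast+
      then have "e \<notin> Out" using faceD[OF Out_face, of e] F(3) by metis
      with eF show ?thesis using F Rv_inner by metis
    next
      assume "d \<in> Outer ` {..m}"
      then obtain k where k: "d = Outer k" "k \<le> m" by blast
      show ?thesis
      proof (cases "k = m")
        case True
        then have "Lv (rw (oe (m - 1))) = d" using Lv_rw_outer[of "m - 1"] m_pos k by simp
        then show ?thesis using \<psi>[of "rw (oe (m - 1))"] oe_E rw_in by metis
      next
        case False
        then show ?thesis using Rv_outer[of k] k oe_E by (metis le_neq_implies_less)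
      qed
    qed
    moreover have "Rv (oe 0) = Outer 0" using Rv_outer m_pos by blast
    ultimately show ?thesis using c oe_E by metis
  qed
  have gd: "gradient_decomposition E D (Inl ` B \<union> Inr ` W) Lv Rv star (Outer 0)"
  proof (rule gradient_decompositionI)
    show "finite D" using finite_faces by (simp add: D_def dual_vertices_def)
    show "Outer 0 \<in> D" by (simp add: D_def dual_vertices_def)
    show "Lv e = Rv (rb e)" if "e \<in> E" "fst e \<in> B" for e
    proof (rule Lv_rb)
      show "rb e ~= a" using that fst_rb[of e] by (auto simp: B_def)
    qed
    show "Lv (rw e) = Rv e" if "e \<in> E" "snd e \<in> W" for e
      by (rule Lv_rw_inner) (use that in \<open>auto simp: W_def\<close>)
    show "B ~= {..<n} \<or> W ~= {..<n}" using E_bounds(1)[OF a_edge] by (auto simp: B_def)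
  qed (use RD LD con in \<open>auto simp: B_def W_def\<close>)
  have cO: "card (snd ` Out) = m"
    unfolding outer_size_def
    by (rule card_image) (rule inj_onI, rule snd_Out_inj)
  have sO: "snd ` Out \<subseteq> {..<n}" using E_bounds(2) Out_E by auto
  have mn: "m \<le> n" using card_mono[OF _ sO] cO by simp
  have cB: "card B = n - 1" using E_bounds(1)[OF a_edge] by (simp add: B_def)
  have cW: "card W = n - m" unfolding W_def using sO cO by (subst card_Diff_subset) (auto intro: finite_subset)
  have cV: "card (Inl ` B \<union> Inr ` W :: (nat + nat) set) = (n - 1) + (n - m)"
    using card_V[of B W] cB cW by (auto simp: B_def W_def)
  have "card D = card (Inner ` (faces G - {Out})) + card (Outer ` {..m})"
    unfolding D_def dual_vertices_def using finite_faces by (subst card_Un_disjoint) auto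
  also have "\<dots> = card (faces G - {Out}) + Suc m" by (simp add: card_image inj_on_def)
  also have "\<dots> = card (faces G) + m" using card.remove[OF finite_faces Out_face] by simp
  finally have cD: "card D = card (faces G) + m" .
  have n0: "0 < n" using E_bounds(1)[OF a_edge] by simp
  have "card D + card (Inl ` B \<union> Inr ` W :: (nat + nat) set) = Suc (card E)"
    unfolding cD cV using euler mn n0 by linarith
  moreover have "(\<Sum>e\<in>star v. T e) = 0" if "v \<in> Inl ` B \<union> Inr ` W" for v
  proof (cases v)
    case (Inl i) then show ?thesis using that b[of i] by (auto simp: star_def B_def)
  next
    case (Inr j) then show ?thesis using that w[of j] by (auto simp: star_def W_def)
  qed
  ultimately show ?thesis by (rule gradient_decomposition.gradient_exists[OF gd])
qed

end

section \<open>The flow and the sharp corner counts\<close>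

text \<open>The closing step of both counts: lower bounds whose sum is attained are attained
  everywhere.\<close>

lemma sum_eq_imp_eq:
  fixes f l :: "'a => nat"
  assumes "finite A" "\<And>x. x \<in> A ==> l x \<le> f x" "sum f A \<le> sum l A" "x \<in> A"
  shows "f x = l x"
proof (rule ccontr)
  assume "f x ~= l x"
  then have "l x < f x" using assms(2)[OF assms(4)] by simp
  then have "sum l A < sum f A"
    using assms(1,2,4) by (intro sum_strict_mono_ex1) auto
  then show False using assms(3) by simp
qed

lemma card_filter_sum: "finite A ==> card {x \<in> A. P x} = (\<Sum>x\<in>A. of_bool (P x))"
  by (simp add: sum.If_cases of_bool_def Int_def)

text \<open>The scaled matrix has the entries \<open>\<kappa> e * g (fst e)\<close>:
  \<open>\<kappa>\<close> is the real matrix after the column scaling and \<open>g\<close> the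
  complex row multiplier. A column multiplier enters the two factors of each white corner, so
  \<open>\<kappa>\<close> inherits the Kasteleyn sign condition. The assumptions on
  \<open>cr\<close> say that no two segments are parallel and that none is parallel to one of the
  sides indexed by \<open>k < m\<close>.\<close>

locale weighted_plane_graph = elementary_plane_graph +
  fixes g :: "nat => complex" and \<kappa> :: "nat \<times> nat => real" and r :: "nat => complex"
  assumes \<kappa>_nonzero: "e \<in> edges G ==> \<kappa> e ~= 0"
    and \<kappa>_face: "F \<in> faces G ==> F ~= outer_face G a ==>
      (\<Prod>e\<in>F. sgn (\<kappa> e) * sgn (\<kappa> (rot_w G e))) = (- 1) ^ (card F + 1)"
    and \<kappa>_black: "i < nverts G ==> (\<Sum>e\<in>Eb i. \<kappa> e) = (if i = fst a then 1 else 0)"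
    and white_sum: "j < nverts G ==> (\<Sum>e\<in>Ew j. g (fst e) * of_real (\<kappa> e)) =
      (\<Sum>k<outer_size G a. if snd (oe k) = j then r (Suc k) - r k else 0)"
    and g_nonparallel: "i < nverts G ==> i' < nverts G ==> i ~= i' ==> cr (g i) (g i') ~= 0"
    and g_side: "i < nverts G ==> k < outer_size G a ==> cr (g i) (r (Suc k) - r k) ~= 0"
    and outer_polygon: "cyclic_polygon (\<lambda>j. r (j mod Suc (outer_size G a))) (Suc (outer_size G a))"
begin

definition T :: "nat \<times> nat => complex" where "T e = of_real (\<kappa> e) * g (fst e)"
definition q :: "nat => complex" where "q k = r (Suc k) - r k"
abbreviation "b0 \<equiv> fst a"

lemma b0_n: "b0 < n" using E_bounds(1)[OF a_edge] .

lemma m2: "2 \<le> m" using cyclic_polygon.d3[OF outer_polygon] by simp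

lemma g_nonzero: "i < n ==> g i ~= 0"
  using g_side[of i 0] m_pos by auto

lemma T_nonzero: "e \<in> E ==> T e ~= 0"
  using \<kappa>_nonzero g_nonzero E_bounds by (simp add: T_def)

lemma cr_T_g: "e \<in> E ==> i < n ==> fst e ~= i ==> cr (T e) (g i) ~= 0"
  using \<kappa>_nonzero g_nonparallel E_bounds by (simp add: T_def)

lemma cr_T_T: "e \<in> E ==> e' \<in> E ==> fst e ~= fst e' ==> cr (T e) (T e') ~= 0"
  using \<kappa>_nonzero g_nonparallel E_bounds by (simp add: T_def)

lemma cr_T_q: "e \<in> E ==> k < m ==> cr (T e) (q k) ~= 0"
  using \<kappa>_nonzero g_side[of "fst e" k] E_bounds by (simp add: T_def q_def)

lemma cr_q_T: "e \<in> E ==> k < m ==> cr (q k) (T e) ~= 0"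
  using cr_T_q cr_commute[of "q k" "T e"] by auto

lemma sum_T_inner: "j < n ==> j \<notin> snd ` Out ==> (\<Sum>e\<in>Ew j. T e) = 0"
  using white_sum[of j] oe_Out by (auto simp: T_def mult.commute intro!: sum.neutral)

lemma sum_T_outer: "k < m ==> (\<Sum>e\<in>Ew (snd (oe k)). T e) = q k"
proof -
  assume k: "k < m"
  have "(\<Sum>e\<in>Ew (snd (oe k)). T e) = (\<Sum>l<m. if snd (oe l) = snd (oe k) then r (Suc l) - r l else 0)"
    using white_sum[of "snd (oe k)"] E_bounds(2)[OF oe_E] by (simp add: T_def mult.commute)
  also have "\<dots> = (\<Sum>l<m. if l = k then r (Suc l) - r l else 0)"
    by (rule sum.cong) (use outer_white_distinct k in auto)
  finally show ?thesis using k by (simp add: q_def)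
qed

text \<open>The total of the flow, summed over black vertices, is what leaves \<open>b0\<close>;
  summed over white vertices it telescopes along the polygon. Hence the segment of \<open>b0\<close>
  has the direction and length of the closing side.\<close>

lemma g_b0: "g b0 = r m - r 0"
proof -
  have "(\<Sum>e\<in>E. T e) = (\<Sum>i<n. g i * of_real (\<Sum>e\<in>Eb i. \<kappa> e))"
    unfolding sum_over_blacks
    by (rule sum.cong) (auto simp: T_def Eb_def sum_distrib_left of_real_sum mult.commute)
  also have "\<dots> = (\<Sum>i<n. if i = b0 then g i else 0)"
    by (rule sum.cong) (auto simp: \<kappa>_black)
  also have "\<dots> = g b0" using b0_n by simp
  finally have 1: "(\<Sum>e\<in>E. T e) = g b0" .
  have "(\<Sum>e\<in>E. T e) = (\<Sum>j<n. \<Sum>k<m. if snd (oe k) = j then q k else 0)"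
    unfolding sum_over_whites
    by (rule sum.cong) (simp_all add: T_def q_def mult.commute[of "of_real _"] white_sum cong: if_cong)
  also have "\<dots> = (\<Sum>k<m. \<Sum>j<n. if snd (oe k) = j then q k else 0)" by (rule sum.swap)
  also have "\<dots> = (\<Sum>k<m. q k)"
    by (rule sum.cong) (use E_bounds(2)[OF oe_E] in auto)
  also have "\<dots> = r m - r 0" unfolding q_def by (rule sum_lessThan_telescope)
  finally show ?thesis using 1 by simp
qed

section \<open>Black corners\<close>

text \<open>
  \<open>straight x\<close> refers to the corner between \<open>rw x\<close> and \<open>rb (rw x) = \<phi> x\<close> of the face of \<open>x\<close>.
\<close>

definition straight :: "nat \<times> nat => bool" where
  "straight x \<longleftrightarrow> (0 < \<kappa> (rw x) \<longleftrightarrow> 0 < \<kappa> (\<phi> x))"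

definition turnbacks :: "nat => (nat \<times> nat) set" where
  "turnbacks i = {e \<in> Eb i. (0 < \<kappa> e) ~= (0 < \<kappa> (rb e))}"

lemma even_turnbacks: "even (card (turnbacks i))"
  unfolding turnbacks_def by (rule even_card_changes[OF finite_Eb bij_rb])

text \<open>The entries at \<open>i\<close> are nonzero with sum 0, so both signs occur, and the
  number of changes around a cycle is even.\<close>

lemma two_turnbacks:
  assumes "i < n" "i ~= b0"
  shows "2 \<le> card (turnbacks i)"
proof -
  have "turnbacks i ~= {}"
  proof
    assume "turnbacks i = {}"
    then have st: "(0 < \<kappa> (rb e)) = (0 < \<kappa> e)" if "e \<in> E" "fst e = i" for e
      using that unfolding turnbacks_def Eb_def by blast
    obtain e0 where e0: "e0 \<in> Eb i" using Eb_nonempty[OF assms(1)] by blast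
    have c: "(0 < \<kappa> e) = (0 < \<kappa> e0)" if "e \<in> Eb i" for e
      by (rule black_const[where g = "\<lambda>e. 0 < \<kappa> e"]) (use that e0 st in \<open>auto simp: Eb_def\<close>)
    have s0: "(\<Sum>e\<in>Eb i. \<kappa> e) = 0" using \<kappa>_black assms by simp
    show False
    proof (cases "0 < \<kappa> e0")
      case True
      then have "0 < \<kappa> e" if "e \<in> Eb i" for e using c[OF that] by simp
      then have "0 < (\<Sum>e\<in>Eb i. \<kappa> e)" using e0 finite_Eb by (intro sum_pos) auto
      then show False using s0 by simp
    next
      case False
      have "\<kappa> e < 0" if "e \<in> Eb i" for e
        using c[OF that] False \<kappa>_nonzero[of e] that by (auto simp: Eb_def)
      then have "0 < (\<Sum>e\<in>Eb i. - \<kappa> e)" using e0 finite_Eb by (intro sum_pos) auto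
      then show False using s0 by (simp add: sum_negf)
    qed
  qed
  moreover have "finite (turnbacks i)" using finite_Eb by (simp add: turnbacks_def)
  ultimately have "card (turnbacks i) ~= 0" by simp
  moreover have "card (turnbacks i) ~= 1" using even_turnbacks[of i] by auto
  ultimately show ?thesis by linarith
qed

lemma neg_one_power_eq: "(- 1 :: real) ^ i = (- 1) ^ j \<longleftrightarrow> even i = even j"
  by (metis neg_one_even_power neg_one_odd_power one_neq_neg_one)

lemma prod_signs:
  assumes "finite F" "\<And>x. x \<in> F ==> u x ~= 0 \<and> w x ~= (0::real)"
  shows "(\<Prod>x\<in>F. sgn (u x) * sgn (w x)) = (- 1) ^ card {x \<in> F. (0 < u x) ~= (0 < w x)}"
proof -
  have "(\<Prod>x\<in>F. sgn (u x) * sgn (w x)) = (\<Prod>x\<in>F. if (0 < u x) ~= (0 < w x) then - 1 else 1)"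
    by (rule prod.cong) (use assms(2) in \<open>force simp: sgn_if\<close>)+
  also have "\<dots> = (- 1) ^ card {x \<in> F. (0 < u x) ~= (0 < w x)}"
    unfolding prod.If_cases[OF assms(1)] by (simp add: Int_def conj_commute)
  finally show ?thesis .
qed

lemma card_split:
  assumes "finite F" shows "card F = card {x \<in> F. P x} + card {x \<in> F. \<not> P x}"
proof -
  have "card ({x \<in> F. P x} \<union> {x \<in> F. \<not> P x}) = card {x \<in> F. P x} + card {x \<in> F. \<not> P x}"
    using assms by (intro card_Un_disjoint) auto
  moreover have "{x \<in> F. P x} \<union> {x \<in> F. \<not> P x} = F" by blast
  ultimately show ?thesis by simp
qed

text \<open>The product of signs records the parity of the unequal pairs, and the Kasteleyn exponent
  \<open>card F + 1\<close> makes the number of equal pairs odd whatever the degree of the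
  face.\<close>

lemma odd_equal_signs:
  assumes F: "F \<in> faces G" and nz: "\<And>x. x \<in> F ==> u x ~= 0 \<and> w x ~= (0::real)"
    and pr: "(\<Prod>x\<in>F. sgn (u x) * sgn (w x)) = (- 1) ^ (card F + 1)"
  shows "odd (card {x \<in> F. (0 < u x) = (0 < w x)})"
proof -
  have "even (card {x \<in> F. (0 < u x) ~= (0 < w x)}) = even (card F + 1)"
    unfolding neg_one_power_eq[symmetric]
    by (rule trans[OF prod_signs[symmetric] pr]) (use finite_face[OF F] nz in blast)+
  moreover have "card F = card {x \<in> F. (0 < u x) = (0 < w x)} + card {x \<in> F. (0 < u x) ~= (0 < w x)}"
    by (rule card_split[OF finite_face[OF F]])
  ultimately show ?thesis by presburger
qed

lemma prod_phi: "F \<in> faces G ==> (\<Prod>x\<in>F. f (\<phi> x)) = (\<Prod>x\<in>F. f x)"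
  using prod.reindex_bij_betw[OF bij_phi] by metis

text \<open>The Kasteleyn condition pairs the edges \<open>x\<close> and \<open>rw x\<close> at
  white corners. Replacing \<open>x\<close> by \<open>\<phi> x\<close> in one factor, which only
  permutes the face, turns the pairs into those at black corners.\<close>

lemma odd_straights:
  assumes F: "F \<in> faces G" "F ~= Out"
  shows "odd (card {x \<in> F. straight x})"
  unfolding straight_def
proof (rule odd_equal_signs[OF F(1)])
  show "\<kappa> (rw x) ~= 0 \<and> \<kappa> (\<phi> x) ~= 0" if "x \<in> F" for x
    using faceD[OF F(1) that] \<kappa>_nonzero rw_in phi_in by blast
  have "(\<Prod>x\<in>F. sgn (\<kappa> (rw x)) * sgn (\<kappa> (\<phi> x))) = (\<Prod>x\<in>F. sgn (\<kappa> x) * sgn (\<kappa> (rw x)))"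
    unfolding prod.distrib using prod_phi[OF F(1), of "\<lambda>x. sgn (\<kappa> x)"] by simp
  then show "(\<Prod>x\<in>F. sgn (\<kappa> (rw x)) * sgn (\<kappa> (\<phi> x))) = (- 1) ^ (card F + 1)"
    using \<kappa>_face[OF F] by simp
qed

text \<open>Each edge \<open>x\<close> names the black corner between \<open>rw x\<close> and
  \<open>\<phi> x\<close>. If straight it is charged to its face, otherwise to its black
  vertex.\<close>

lemma card_corners:
  "card E = (\<Sum>i<n. card (turnbacks i)) + (\<Sum>F\<in>faces G. card {x \<in> F. straight x})"
proof -
  have "card E = card {x \<in> E. straight x} + card {x \<in> E. \<not> straight x}"
    by (rule card_split[OF finite_E])
  moreover have "card {x \<in> E. straight x} = (\<Sum>F\<in>faces G. card {x \<in> F. straight x})"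
    by (simp add: card_filter_sum finite_E finite_face sum_over_faces)
  moreover have "card {x \<in> E. \<not> straight x} = (\<Sum>x\<in>E. of_bool ((0 < \<kappa> (rw x)) ~= (0 < \<kappa> (rb (rw x)))))"
    by (simp add: card_filter_sum finite_E straight_def phi_eq)
  moreover have "\<dots> = (\<Sum>x\<in>E. of_bool ((0 < \<kappa> x) ~= (0 < \<kappa> (rb x))))"
    by (rule sum.reindex_bij_betw[OF bij_rw_E])
  moreover have "\<dots> = (\<Sum>i<n. card (turnbacks i))"
    by (simp add: turnbacks_def card_filter_sum finite_Eb sum_over_blacks)
  ultimately show ?thesis by simp
qed

lemma card_E: "card E + 2 = 2 * n + card (faces G)" using euler by linarith

text \<open>This is the corner of \<open>b0\<close> at which the outer face is cut. If it were a
  turn, \<open>b0\<close> would have two turns like every other black vertex, and together with one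
  straight corner per inner face this exceeds the number of edges by one.\<close>

lemma last_straight: "straight (oe (m - 1))"
proof (rule ccontr)
  let ?x = "oe (m - 1)"
  assume ns: "\<not> straight ?x"
  have pa: "\<phi> ?x = a" using oe_Suc[of "m - 1"] oe_m m_pos by simp
  have "rw ?x \<in> turnbacks b0"
    using ns pa oe_E[of "m - 1"] fst_phi[of ?x] by (auto simp: turnbacks_def straight_def Eb_def rw_in phi_eq)
  moreover have "finite (turnbacks b0)" using finite_Eb by (simp add: turnbacks_def)
  ultimately have "card (turnbacks b0) ~= 0" using card_eq_0_iff by blast
  moreover have "card (turnbacks b0) ~= 1" using even_turnbacks[of b0] by auto
  ultimately have "2 \<le> card (turnbacks b0)" by linarith
  then have "(\<Sum>i<n. 2) \<le> (\<Sum>i<n. card (turnbacks i))"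
    using two_turnbacks by (intro sum_mono) (metis lessThan_iff)
  moreover have "(\<Sum>F\<in>faces G - {Out}. 1) \<le> (\<Sum>F\<in>faces G. card {x \<in> F. straight x})"
  proof -
    have "(\<Sum>F\<in>faces G - {Out}. 1) \<le> (\<Sum>F\<in>faces G - {Out}. card {x \<in> F. straight x})"
      using odd_straights by (intro sum_mono) (metis DiffE insertI1 odd_card_imp_not_empty odd_pos One_nat_def Suc_leI)
    also have "\<dots> \<le> (\<Sum>F\<in>faces G. card {x \<in> F. straight x})"
      by (rule sum_mono2[OF finite_faces]) auto
    finally show ?thesis .
  qed
  ultimately have "2 * n + card (faces G - {Out}) \<le> card E" by (simp add: card_corners)
  moreover have "card (faces G) = Suc (card (faces G - {Out}))"
    using card.remove[OF finite_faces Out_face] by simp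
  ultimately show False using card_E by linarith
qed

text \<open>The bounds are 2 turns at each black vertex except \<open>b0\<close> and 1 straight
  corner in each face, the outer one included. Their sum \<open>2 * (n - 1) + card (faces G)\<close>
  is the number of edges.\<close>

lemma corner_counts:
  shows "\<And>i. i < n ==> card (turnbacks i) = (if i = b0 then 0 else 2)"
    and "\<And>F. F \<in> faces G ==> card {x \<in> F. straight x} = 1"
proof -
  have b: "(if i = b0 then 0 else 2) \<le> card (turnbacks i)" if "i < n" for i
    using two_turnbacks that by simp
  have f: "1 \<le> card {x \<in> F. straight x}" if "F \<in> faces G" for F
  proof (cases "F = Out")
    case True
    then have "oe (m - 1) \<in> {x \<in> F. straight x}" using last_straight oe_Out[of "m - 1"] by simp
    moreover have "finite {x \<in> F. straight x}" using finite_face[OF that] by simp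
    ultimately have "card {x \<in> F. straight x} ~= 0" by (metis card_0_eq empty_iff)
    then show ?thesis by simp
  next
    case False
    then show ?thesis using odd_pos[OF odd_straights[OF that]] by simp
  qed
  have "(\<Sum>i<n. if i = b0 then 0 else 2 :: nat) = (\<Sum>i\<in>{..<n} - {b0}. 2)"
    by (rule sum.mono_neutral_cong_right) auto
  then have lb: "(\<Sum>i<n. if i = b0 then 0 else 2) + 2 = 2 * n"
    using b0_n by simp
  have s1: "(\<Sum>i<n. if i = b0 then 0 else 2) \<le> (\<Sum>i<n. card (turnbacks i))"
    using b by (intro sum_mono) auto
  have s2: "(\<Sum>F\<in>faces G. 1) \<le> (\<Sum>F\<in>faces G. card {x \<in> F. straight x})"
    using f by (intro sum_mono) auto
  have tot: "(\<Sum>i<n. card (turnbacks i)) + (\<Sum>F\<in>faces G. card {x \<in> F. straight x}) = (\<Sum>i<n. if i = b0 then 0 else 2) + (\<Sum>F\<in>faces G. 1)"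
    using card_corners card_E lb by simp
  show "card (turnbacks i) = (if i = b0 then 0 else 2)" if "i < n" for i
    by (rule sum_eq_imp_eq[of "{..<n}"]) (use b s2 tot that in auto)
  show "card {x \<in> F. straight x} = 1" if "F \<in> faces G" for F
    by (rule sum_eq_imp_eq[of "faces G" "\<lambda>_. 1"]) (use f s1 tot that finite_faces in auto)
qed

lemma straight_singleton:
  assumes "F \<in> faces G"
  obtains z where "\<And>x. x \<in> F \<and> straight x \<longleftrightarrow> x = z"
proof -
  obtain z where "{x \<in> F. straight x} = {z}"
    by (rule card_1_singletonE[OF corner_counts(2)[OF assms]])
  then have "\<And>x. x \<in> F \<and> straight x \<longleftrightarrow> x = z" by blast
  then show ?thesis by (rule that)
qed

lemma straight_unique:
  assumes "F \<in> faces G" "x \<in> F" "y \<in> F" "straight x" "straight y"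
  shows "x = y"
  using straight_singleton[OF assms(1)] assms(2-) by metis

lemma straight_exists:
  assumes "F \<in> faces G"
  shows "\<exists>x\<in>F. straight x"
  using straight_singleton[OF assms] by metis

lemma outer_not_straight: "Suc k < m ==> \<not> straight (oe k)"
  using straight_unique[OF Out_face oe_Out oe_Out _ last_straight, of k] oe_inj[of k "m - 1"] by auto

text \<open>There are no sign changes around \<open>b0\<close>, and the entries there sum to
  1.\<close>

lemma \<kappa>_b0_pos: "e \<in> Eb b0 ==> 0 < \<kappa> e"
proof (rule ccontr)
  assume e: "e \<in> Eb b0" and neg: "\<not> 0 < \<kappa> e"
  have "turnbacks b0 = {}" using corner_counts(1)[OF b0_n] finite_Eb by (simp add: turnbacks_def)
  then have "(0 < \<kappa> (rb x)) = (0 < \<kappa> x)" if "x \<in> E" "fst x = b0" for x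
    using that unfolding turnbacks_def Eb_def by blast
  then have c: "(0 < \<kappa> x) = (0 < \<kappa> e)" if "x \<in> Eb b0" for x
    using black_const[where g = "\<lambda>e. 0 < \<kappa> e" and e = x and e' = e] that e by (auto simp: Eb_def)
  have "\<kappa> x \<le> 0" if "x \<in> Eb b0" for x using c[OF that] neg by simp
  then have "(\<Sum>x\<in>Eb b0. \<kappa> x) \<le> 0" by (rule sum_nonpos)
  then show False using \<kappa>_black[OF b0_n] by simp
qed

end

context weighted_plane_graph
begin

section \<open>White corners\<close>

definition generic_dir :: "complex => bool" where
  "generic_dir v \<longleftrightarrow> (\<forall>e\<in>E. cr v (T e) ~= 0) \<and> (\<forall>k<m. cr v (q k) ~= 0)"

lemma q_nonzero: "k < m ==> q k ~= 0"
  using cr_T_q[OF a_edge, of k] by auto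

lemma generic_dir_perturb:
  assumes "t ~= 0" "finite S" "\<And>x. x \<in> S ==> x ~= 0"
  obtains v where "generic_dir v" "cr v t ~= 0" "0 < cr v t \<longleftrightarrow> \<delta>"
    "\<And>e. e \<in> E ==> cr t (T e) ~= 0 ==> 0 < cr v (T e) \<longleftrightarrow> 0 < cr t (T e)"
    "\<And>k. k < m ==> cr t (q k) ~= 0 ==> 0 < cr v (q k) \<longleftrightarrow> 0 < cr t (q k)"
    "\<And>x. x \<in> S ==> cr v x ~= 0"
proof -
  let ?S = "T ` E \<union> q ` {..<m} \<union> S"
  have fin: "finite ?S" using finite_E assms(2) by simp
  have nz: "x ~= 0" if "x \<in> ?S" for x using that T_nonzero q_nonzero assms(3) by (elim UnE imageE) auto
  show ?thesis
  proof (rule cr_perturb[OF fin assms(1) nz, of \<delta>])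
    fix v
    assume v: "cr v t ~= 0" "0 < cr v t \<longleftrightarrow> \<delta>" "\<And>x. x \<in> ?S ==> cr v x ~= 0"
      "\<And>x. x \<in> ?S ==> cr t x ~= 0 ==> 0 < cr v x \<longleftrightarrow> 0 < cr t x"
    show ?thesis
    proof (rule that[of v])
      show "generic_dir v" unfolding generic_dir_def using v(3) by simp
    qed (use v in simp_all)
  qed
qed

lemma cr_T: "cr v (T e) = \<kappa> e * cr v (g (fst e))"
  by (simp add: T_def)

text \<open>The sign of \<open>cr v (T x)\<close> is that of \<open>\<kappa> x\<close> times a sign
  depending on the black vertex only. Around a face each black corner contributes its vertex sign
  twice, so the product of the components has the Kasteleyn sign again.\<close>

lemma odd_unchanged:
  assumes v: "generic_dir v" and F: "F \<in> faces G" "F ~= Out"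
  shows "odd (card {x \<in> F. (0 < cr v (T x)) = (0 < cr v (T (rw x)))})"
proof (rule odd_equal_signs[OF F(1)])
  have FE: "x \<in> E" "rw x \<in> E" "\<phi> x \<in> E" if "x \<in> F" for x using faceD[OF F(1) that] rw_in phi_in by auto
  show "cr v (T x) ~= 0 \<and> cr v (T (rw x)) ~= 0" if "x \<in> F" for x
    using FE[OF that] v by (simp add: generic_dir_def)
  define \<eta> where "\<eta> i = sgn (cr v (g i))" for i
  have \<eta>: "\<eta> (fst x) * \<eta> (fst x) = 1" if "x \<in> F" for x
  proof -
    have "cr v (g (fst x)) ~= 0" using FE(1)[OF that] v by (auto simp: generic_dir_def cr_T)
    then show ?thesis by (simp add: \<eta>_def sgn_if)
  qed
  have "(\<Prod>x\<in>F. \<eta> (fst x) * \<eta> (fst (rw x))) = (\<Prod>x\<in>F. \<eta> (fst x)) * (\<Prod>x\<in>F. \<eta> (fst (\<phi> x)))"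
    unfolding prod.distrib[symmetric] by (rule prod.cong) (use FE fst_phi in auto)
  also have "\<dots> = (\<Prod>x\<in>F. \<eta> (fst x) * \<eta> (fst x))"
    using prod_phi[OF F(1), of "\<lambda>x. \<eta> (fst x)"] by (simp add: prod.distrib)
  also have "\<dots> = 1" by (rule prod.neutral) (use \<eta> in blast)
  finally have 1: "(\<Prod>x\<in>F. \<eta> (fst x) * \<eta> (fst (rw x))) = 1" .
  have "(\<Prod>x\<in>F. sgn (cr v (T x)) * sgn (cr v (T (rw x))))
    = (\<Prod>x\<in>F. (sgn (\<kappa> x) * sgn (\<kappa> (rw x))) * (\<eta> (fst x) * \<eta> (fst (rw x))))"
    by (rule prod.cong) (simp_all add: cr_T sgn_mult \<eta>_def)
  also have "\<dots> = (\<Prod>x\<in>F. sgn (\<kappa> x) * sgn (\<kappa> (rw x)))"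
    unfolding prod.distrib[of _ "\<lambda>x. \<eta> (fst x) * \<eta> (fst (rw x))"] 1 by simp
  also have "\<dots> = (- 1) ^ (card F + 1)" by (rule \<kappa>_face[OF F])
  finally show "(\<Prod>x\<in>F. sgn (cr v (T x)) * sgn (cr v (T (rw x)))) = (- 1) ^ (card F + 1)" .
qed

definition changes :: "complex => nat => (nat \<times> nat) set" where
  "changes v j = {x \<in> Ew j. (0 < cr v (T x)) ~= (0 < cr v (T (rw x)))}"

lemma finite_changes: "finite (changes v j)" using finite_Ew by (simp add: changes_def)

lemma even_changes: "even (card (changes v j))"
  unfolding changes_def by (rule even_card_changes[OF finite_Ew bij_rw])

text \<open>The step \<open>x0\<close> is exempt because at a white vertex on the outer face the
  corner of the outer face is not counted; parity still makes the sign constant.\<close>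

lemma constant_sign:
  assumes v: "generic_dir v" and st: "\<And>x. x \<in> Ew j ==> x ~= x0 ==> (0 < cr v (T (rw x))) = (0 < cr v (T x))"
    and e: "e \<in> Ew j"
  shows "0 < cr v (\<Sum>x\<in>Ew j. T x) \<longleftrightarrow> 0 < cr v (T e)" "cr v (\<Sum>x\<in>Ew j. T x) ~= 0"
proof -
  have c: "(0 < cr v (T x)) = (0 < cr v (T e))" if "x \<in> Ew j" for x
  proof (rule white_const[where g = "\<lambda>e. 0 < cr v (T e)" and ?x0.0 = x0])
    fix y assume "y \<in> E" "snd y = snd x" "y ~= x0"
    then show "(0 < cr v (T (rw y))) = (0 < cr v (T y))" using st[of y] that by (simp add: Ew_def)
  qed (use that e in \<open>auto simp: Ew_def\<close>)
  have nz: "cr v (T x) ~= 0" if "x \<in> Ew j" for x using that v by (simp add: Ew_def generic_dir_def)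
  have "(0 < cr v (\<Sum>x\<in>Ew j. T x) \<longleftrightarrow> 0 < cr v (T e)) \<and> cr v (\<Sum>x\<in>Ew j. T x) ~= 0"
  proof (cases "0 < cr v (T e)")
    case True
    then have "0 < cr v (T x)" if "x \<in> Ew j" for x using c[OF that] by simp
    then have "0 < (\<Sum>x\<in>Ew j. cr v (T x))" using e finite_Ew by (intro sum_pos) auto
    then show ?thesis using True by (simp add: cr_sum_right)
  next
    case False
    then have "cr v (T x) < 0" if "x \<in> Ew j" for x using c[OF that] nz[OF that] by simp
    then have "0 < (\<Sum>x\<in>Ew j. - cr v (T x))" using e finite_Ew by (intro sum_pos) auto
    then show ?thesis using False by (simp add: cr_sum_right sum_negf)
  qed
  then show "0 < cr v (\<Sum>x\<in>Ew j. T x) \<longleftrightarrow> 0 < cr v (T e)" "cr v (\<Sum>x\<in>Ew j. T x) ~= 0" by auto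
qed

lemma inner_changes_ge:
  assumes v: "generic_dir v" and j: "j < n" "j \<notin> snd ` Out"
  shows "2 \<le> card (changes v j)"
proof -
  obtain e where e: "e \<in> Ew j" using Ew_nonempty[OF j(1)] by blast
  have "changes v j ~= {}"
  proof
    assume "changes v j = {}"
    then have "(0 < cr v (T (rw x))) = (0 < cr v (T x))" if "x \<in> Ew j" for x
      using that unfolding changes_def by blast
    then have "cr v (\<Sum>x\<in>Ew j. T x) ~= 0" using constant_sign(2)[OF v _ e] by blast
    then show False using sum_T_inner[OF j] by simp
  qed
  then have "card (changes v j) ~= 0" using finite_changes by simp
  moreover have "card (changes v j) ~= 1" using even_changes[of v j] by auto
  ultimately show ?thesis by linarith
qed

text \<open>In the polygon of an outer white vertex the edges appear as \<open>- T\<close> and the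
  closing side as \<open>q k\<close>. A mismatch of signs here is therefore the absence of a change
  of sign between the two sides of that polygon.\<close>

definition mismatch_r :: "complex => nat => nat" where
  "mismatch_r v k = of_bool ((0 < cr v (T (oe k))) ~= (0 < cr v (q k)))"

definition mismatch_l :: "complex => nat => nat" where
  "mismatch_l v k = of_bool ((0 < cr v (T (rw (oe k)))) ~= (0 < cr v (q k)))"

text \<open>Without a counted change all components have one sign, which is then that of their sum
  \<open>q k\<close>, so nothing mismatches. With exactly one, parity makes the corner at
  \<open>oe k\<close> a change as well, so exactly one of the two edges there disagrees with
  \<open>q k\<close>.\<close>

lemma outer_changes_ge:
  assumes v: "generic_dir v" and k: "k < m"
  shows "mismatch_r v k + mismatch_l v k \<le> card (changes v (snd (oe k)) - {oe k})"
proof -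
  let ?j = "snd (oe k)" let ?C = "changes v ?j - {oe k}"
  have e: "oe k \<in> Ew ?j" "rw (oe k) \<in> Ew ?j" using oe_E by (auto simp: Ew_def rw_in)
  consider "card ?C = 0" | "card ?C = 1" | "2 \<le> card ?C" by linarith
  then show ?thesis
  proof cases
    case 1
    then have C: "?C = {}" using finite_changes by simp
    have st: "(0 < cr v (T (rw x))) = (0 < cr v (T x))" if "x \<in> Ew ?j" "x ~= oe k" for x
      using that C unfolding changes_def by blast
    have "0 < cr v (q k) \<longleftrightarrow> 0 < cr v (T (oe k))" "0 < cr v (q k) \<longleftrightarrow> 0 < cr v (T (rw (oe k)))"
      using constant_sign(1)[OF v st e(1)] constant_sign(1)[OF v st e(2)] sum_T_outer[OF k] by simp_all
    then show ?thesis by (simp add: mismatch_r_def mismatch_l_def)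
  next
    case 2
    have "oe k \<in> changes v ?j"
    proof (rule ccontr)
      assume "oe k \<notin> changes v ?j"
      then have "?C = changes v ?j" by blast
      then show False using 2 even_changes[of v ?j] by simp
    qed
    then have "(0 < cr v (T (oe k))) ~= (0 < cr v (T (rw (oe k))))" by (simp add: changes_def)
    then show ?thesis using 2 by (simp add: mismatch_r_def mismatch_l_def)
  next
    case 3
    then show ?thesis by (simp add: mismatch_r_def mismatch_l_def)
  qed
qed

interpretation Q: cyclic_polygon "\<lambda>j. r (j mod Suc m)" "Suc m" by (rule outer_polygon)

lemma Q_side: "k < m ==> Q.side k = q k" and Q_side_m: "Q.side m = - g b0"
  by (simp_all add: Q.side_def q_def g_b0)

text \<open>
  The change of sign across the corner of the outer polygon at \<open>r (Suc k)\<close>, counted from the side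
  that precedes it; the side with index \<open>m\<close> is parallel to all edges at \<open>b0\<close>.
\<close>

definition outer_change :: "complex => nat => nat" where
  "outer_change v k = of_bool ((0 < cr v (Q.side k)) ~= (0 < cr v (Q.side (Suc k))))"

lemma sum_outer_change:
  assumes v: "generic_dir v"
  shows "(\<Sum>k<Suc m. outer_change v k) = 2"
proof -
  have nz: "cr v (Q.side j) ~= 0" if "j < Suc m" for j
  proof (cases "j = m")
    case True
    have "cr v (T a) ~= 0" using v a_edge by (simp add: generic_dir_def)
    then show ?thesis using True by (auto simp: Q_side_m cr_T)
  next
    case False
    then show ?thesis using v that by (simp add: Q_side generic_dir_def)
  qed
  have "card {j. j < Suc m \<and> (0 < cr v (Q.side j)) ~= (0 < cr v (Q.side (Suc j)))} = 2"
    using Q.two_sign_changes[of v] nz by (simp add: Q.side_def)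
  moreover have "{j. j < Suc m \<and> (0 < cr v (Q.side j)) ~= (0 < cr v (Q.side (Suc j)))} =
    {j \<in> {..<Suc m}. (0 < cr v (Q.side j)) ~= (0 < cr v (Q.side (Suc j)))}" by auto
  ultimately show ?thesis by (simp only: card_filter_sum[OF finite_lessThan] outer_change_def)
qed

text \<open>The sign changes in the chain \<open>T (rw (oe k))\<close>, \<open>q k\<close>,
  \<open>q (Suc k)\<close>, \<open>T (oe (Suc k))\<close> around the corner \<open>r (Suc k)\<close>
  of \<open>Q\<close>. Side \<open>m\<close> has no white vertex, so at its two ends the chain is
  one term shorter.\<close>

definition corner_excess :: "complex => nat => nat" where
  "corner_excess v k = (if k < m then mismatch_l v k else 0) + outer_change v k
     + (if Suc k mod Suc m < m then mismatch_r v (Suc k mod Suc m) else 0)"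

lemma T_b0_sign: "e \<in> E ==> fst e = b0 ==> 0 < cr v (T e) \<longleftrightarrow> 0 < cr v (g b0)"
  using \<kappa>_b0_pos[of e] by (simp add: cr_T Eb_def zero_less_mult_iff)

lemma fst_rw_last: "fst (rw (oe (m - 1))) = b0"
  using fst_phi[OF oe_E[of "m - 1"]] oe_Suc[of "m - 1"] oe_m m_pos by simp

text \<open>The outer corner is not straight, so the first and the last member of the chain have
  opposite signs and some change occurs in between. At both ends of the closing side its vector
  \<open>- g b0\<close> replaces the missing member, since all edges at \<open>b0\<close> have the
  sign of \<open>g b0\<close>.\<close>

lemma corner_excess_ge:
  assumes v: "generic_dir v" and k: "k < Suc m"
  shows "1 \<le> corner_excess v k"
proof -
  have g0: "cr v (g b0) ~= 0" using v a_edge cr_T[of v a] by (auto simp: generic_dir_def)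
  consider "Suc k < m" | "Suc k = m" | "k = m" using k by linarith
  then show ?thesis
  proof cases
    case 1
    have "\<not> straight (oe k)" by (rule outer_not_straight[OF 1])
    then have ns: "(0 < \<kappa> (rw (oe k))) ~= (0 < \<kappa> (oe (Suc k)))" by (simp add: straight_def oe_Suc)
    have f: "fst (oe (Suc k)) = fst (rw (oe k))" by (simp add: oe_Suc fst_phi oe_E)
    have "cr v (T (rw (oe k))) ~= 0" "cr v (T (oe (Suc k))) ~= 0"
      using v oe_E rw_in by (auto simp: generic_dir_def)
    then have "(0 < cr v (T (rw (oe k)))) ~= (0 < cr v (T (oe (Suc k))))"
      using ns f by (auto simp: cr_T zero_less_mult_iff)
    then show ?thesis
      using 1 by (auto simp: corner_excess_def mismatch_l_def mismatch_r_def outer_change_def Q_side)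
  next
    case 2
    then have k': "k = m - 1" "k < m" by auto
    have "0 < cr v (T (rw (oe k))) \<longleftrightarrow> 0 < cr v (g b0)"
      using T_b0_sign[of "rw (oe k)"] fst_rw_last oe_E rw_in k' by simp
    moreover have "0 < cr v (Q.side (Suc k)) \<longleftrightarrow> \<not> 0 < cr v (g b0)" using g0 2 by (auto simp: Q_side_m)
    ultimately show ?thesis
      using k' by (auto simp: corner_excess_def mismatch_l_def outer_change_def Q_side)
  next
    case 3
    have "0 < cr v (T (oe 0)) \<longleftrightarrow> 0 < cr v (g b0)"
      using T_b0_sign[of a] a_edge by simp
    moreover have "0 < cr v (Q.side k) \<longleftrightarrow> \<not> 0 < cr v (g b0)" using g0 3 by (auto simp: Q_side_m)
    moreover have "Q.side (Suc k) = q 0"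
      using Q.side_periodic[of 0] Q_side[OF m_pos] 3 by simp
    ultimately show ?thesis
      using 3 m_pos by (auto simp: corner_excess_def mismatch_r_def outer_change_def)
  qed
qed

text \<open>The two extra changes are those of the convex polygon \<open>Q\<close> itself.\<close>

lemma sum_corner_excess:
  assumes v: "generic_dir v"
  shows "(\<Sum>k<Suc m. corner_excess v k) = (\<Sum>k<m. mismatch_r v k + mismatch_l v k) + 2"
proof -
  define R where "R k = (if k mod Suc m < m then mismatch_r v (k mod Suc m) else 0)" for k
  have "(\<Sum>k<Suc m. int (R (1 + k))) = (\<Sum>k<Suc m. int (R k))"
    by (rule periodic_sum_shift) (simp only: R_def mod_add_self2)
  then have "(\<Sum>k<Suc m. R (Suc k)) = (\<Sum>k<Suc m. R k)" by (simp flip: of_nat_sum del: sum.lessThan_Suc)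
  moreover have "(\<Sum>k<Suc m. R k) = (\<Sum>k<m. mismatch_r v k)" by (simp add: R_def)
  moreover have "(\<Sum>k<Suc m. corner_excess v k)
    = (\<Sum>k<Suc m. if k < m then mismatch_l v k else 0) + (\<Sum>k<Suc m. outer_change v k) + (\<Sum>k<Suc m. R (Suc k))"
    unfolding corner_excess_def R_def by (simp only: sum.distrib)
  moreover have "(\<Sum>k<Suc m. if k < m then mismatch_l v k else 0) = (\<Sum>k<m. mismatch_l v k)" by simp
  ultimately show ?thesis by (simp only: sum_outer_change[OF v] sum.distrib)
qed

lemma sum_whites_split:
  fixes f :: "nat => nat"
  shows "(\<Sum>j<n. f j) = (\<Sum>j\<in>{..<n} - snd ` Out. f j) + (\<Sum>k<m. f (snd (oe k)))"
proof -
  have "snd ` Out \<subseteq> {..<n}" using E_bounds(2) Out_E by auto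
  then have "(\<Sum>j<n. f j) = (\<Sum>j\<in>{..<n} - snd ` Out. f j) + (\<Sum>j\<in>snd ` Out. f j)"
    by (rule sum.subset_diff) simp
  moreover have "(\<Sum>j\<in>snd ` Out. f j) = (\<Sum>k<m. f (snd (oe k)))"
  proof -
    have "bij_betw (\<lambda>k. snd (oe k)) {..<m} (snd ` Out)"
      unfolding bij_betw_def
    proof
      show "inj_on (\<lambda>k. snd (oe k)) {..<m}" by (rule inj_onI) (use outer_white_distinct in auto)
      show "(\<lambda>k. snd (oe k)) ` {..<m} = snd ` Out"
        using bij_outer unfolding bij_betw_def oe_def by (metis image_image)
    qed
    then show ?thesis by (rule sum.reindex_bij_betw[symmetric])
  qed
  ultimately show ?thesis by simp
qed

lemma outer_white_edge: "x \<in> Out ==> k < m ==> snd x = snd (oe k) ==> x = oe k"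
  using snd_Out_inj oe_Out by blast

text \<open>The count over white corners in direction \<open>v\<close>. As it holds for every
  generic \<open>v\<close>, later arguments choose \<open>v\<close> to suit the configuration that
  is to be excluded.\<close>

lemma corner_equality:
  assumes v: "generic_dir v"
  shows "\<And>F. F \<in> faces G ==> F ~= Out ==> card {x \<in> F. (0 < cr v (T x)) = (0 < cr v (T (rw x)))} = 1"
    and "\<And>j. j < n ==> j \<notin> snd ` Out ==> card (changes v j) = 2"
    and "\<And>k. k < m ==> card (changes v (snd (oe k)) - {oe k}) = mismatch_r v k + mismatch_l v k"
    and "\<And>k. k < Suc m ==> corner_excess v k = 1"
proof -
  let ?u = "\<lambda>F. card {x \<in> F. (0 < cr v (T x)) = (0 < cr v (T (rw x)))}"
  let ?in = "{..<n} - snd ` Out"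
  have u1: "1 \<le> ?u F" if "F \<in> faces G - {Out}" for F
    using odd_pos[OF odd_unchanged[OF v, of F]] that by simp
  have fO: "finite Out" using finite_face[OF Out_face] .
  have OE: "Out \<subseteq> E" using Out_E by blast
  have whites: "(\<Sum>j<n. card (changes v j - Out)) = (\<Sum>j\<in>?in. card (changes v j)) + (\<Sum>k<m. card (changes v (snd (oe k)) - {oe k}))"
  proof -
    have "changes v j - Out = changes v j" if "j \<notin> snd ` Out" for j
      using that by (auto simp: changes_def Ew_def)
    moreover have "changes v (snd (oe k)) - Out = changes v (snd (oe k)) - {oe k}" if "k < m" for k
      using outer_white_edge[OF _ that] oe_Out by (auto simp: changes_def Ew_def)
    ultimately show ?thesis unfolding sum_whites_split by simp
  qed
  \<comment> \<open>The \<open>m\<close> white corners of the outer face are set aside: there the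
    polygon is closed by a side of \<open>Q\<close>, which the mismatches account for.\<close>
  have tot: "card E = card Out + ((\<Sum>F\<in>faces G - {Out}. ?u F) + (\<Sum>j<n. card (changes v j - Out)))"
  proof -
    let ?p = "\<lambda>x. (0 < cr v (T x)) = (0 < cr v (T (rw x)))"
    have "card E = card Out + card (E - Out)" using OE fO finite_E by (simp add: card_Diff_subset card_mono)
    also have "card (E - Out) = card {x \<in> E - Out. ?p x} + card {x \<in> E - Out. \<not> ?p x}"
      by (rule card_split) (use finite_E in simp)
    also have "card {x \<in> E - Out. ?p x} = (\<Sum>F\<in>faces G - {Out}. ?u F)"
    proof -
      have "{x \<in> E - Out. ?p x} = (\<Union>F\<in>faces G - {Out}. {x \<in> F. ?p x})"
        using Union_faces faces_disjoint[OF Out_face] by blast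
      also have "card \<dots> = (\<Sum>F\<in>faces G - {Out}. ?u F)"
        by (rule card_UN_disjoint) (use finite_faces finite_face faces_disjoint in \<open>simp, simp, blast\<close>)
      finally show ?thesis .
    qed
    also have "card {x \<in> E - Out. \<not> ?p x} = (\<Sum>j<n. card (changes v j - Out))"
    proof -
      have "{x \<in> E - Out. \<not> ?p x} = (\<Union>j<n. changes v j - Out)"
        using E_bounds(2) by (auto simp: changes_def Ew_def)
      also have "card \<dots> = (\<Sum>j<n. card (changes v j - Out))"
        by (rule card_UN_disjoint) (use finite_changes in \<open>simp, simp, auto simp: changes_def Ew_def\<close>)
      finally show ?thesis .
    qed
    finally show ?thesis by simp
  qed
  have in2: "2 \<le> card (changes v j)" if "j \<in> ?in" for j
    using inner_changes_ge[OF v, of j] that by simp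
  have ou: "mismatch_r v k + mismatch_l v k \<le> card (changes v (snd (oe k)) - {oe k})" if "k \<in> {..<m}" for k
    using outer_changes_ge[OF v, of k] that by simp
  have ce: "1 \<le> corner_excess v k" if "k \<in> {..<Suc m}" for k
    using corner_excess_ge[OF v, of k] that by simp
  have cO: "card Out = m" by (simp add: outer_size_def)
  have sO: "card (snd ` Out) = m"
    using card_image[of snd Out] snd_Out_inj cO by (simp add: inj_on_def)
  have sub: "snd ` Out \<subseteq> {..<n}" using E_bounds(2) Out_E by auto
  have mn: "m \<le> n" using card_mono[OF _ sub] sO by simp
  have cin: "card ?in = n - m" using sub sO by (subst card_Diff_subset) (auto intro: finite_subset)
  have cF: "card (faces G) = Suc (card (faces G - {Out}))"
    using card.remove[OF finite_faces Out_face] by simp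
  have S1: "(\<Sum>F\<in>faces G - {Out}. 1) \<le> (\<Sum>F\<in>faces G - {Out}. ?u F)" using u1 by (rule sum_mono)
  have S2: "(\<Sum>j\<in>?in. 2) \<le> (\<Sum>j\<in>?in. card (changes v j))" using in2 by (rule sum_mono)
  have S3: "(\<Sum>k<m. mismatch_r v k + mismatch_l v k) \<le> (\<Sum>k<m. card (changes v (snd (oe k)) - {oe k}))"
    using ou by (rule sum_mono)
  have S4: "(\<Sum>k<Suc m. 1) \<le> (\<Sum>k<Suc m. corner_excess v k)" using ce by (rule sum_mono)
  have s1: "(\<Sum>F\<in>faces G - {Out}. 1) = card (faces G - {Out})" by simp
  have s2: "(\<Sum>j\<in>?in. 2) = 2 * (n - m)" by (simp add: cin)
  have s4: "(\<Sum>k<Suc m. 1) = Suc m" by simp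
  \<comment> \<open>The lower bounds add up to
    \<open>m + (card (faces G) - 1) + 2 * (n - m) + (m + 1 - 2)\<close>, which is
    \<open>card E\<close> by Euler's formula.\<close>
  note ineqs = S1[unfolded s1] S2[unfolded s2] S3 S4[unfolded s4 sum_corner_excess[OF v]]
    tot[unfolded whites cO] card_E cF mn
  show "?u F = 1" if "F \<in> faces G" "F ~= Out" for F
    by (rule sum_eq_imp_eq[of "faces G - {Out}" "\<lambda>_. 1" ?u F])
       (use u1 finite_faces that ineqs s1 in \<open>simp, simp, linarith, simp\<close>)
  show "card (changes v j) = 2" if "j < n" "j \<notin> snd ` Out" for j
    by (rule sum_eq_imp_eq[of ?in "\<lambda>_. 2" "\<lambda>j. card (changes v j)" j])
       (use in2 that ineqs s2 in \<open>simp, simp, linarith, simp\<close>)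
  show "card (changes v (snd (oe k)) - {oe k}) = mismatch_r v k + mismatch_l v k" if "k < m" for k
    by (rule sum_eq_imp_eq[of "{..<m}" "\<lambda>k. mismatch_r v k + mismatch_l v k" "\<lambda>k. card (changes v (snd (oe k)) - {oe k})" k])
       (use ou that ineqs in \<open>simp, simp, linarith, simp\<close>)
  show "corner_excess v k = 1" if "k < Suc m" for k
  proof (rule sum_eq_imp_eq[of "{..<Suc m}" "\<lambda>_. 1" "corner_excess v" k])
    show "(\<Sum>k<Suc m. corner_excess v k) \<le> (\<Sum>k<Suc m. 1)"
      unfolding s4 sum_corner_excess[OF v] using ineqs by linarith
  qed (use ce that in auto)
qed

end

locale drawn_graph = weighted_plane_graph +
  fixes \<psi> :: "dual_vertex => complex"
  assumes increment: "e \<in> edges G ==>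
      \<psi> (left_vertex G a e) - \<psi> (right_vertex G a e) = of_real (\<kappa> e) * g (fst e)"
    and base: "\<psi> (Outer 0) = r 0"
begin

lemma psi_diff: "e \<in> E ==> \<psi> (Lv e) - \<psi> (Rv e) = T e"
  using increment by (simp add: T_def)

text \<open>Around the white end of \<open>oe k\<close> the increments sum to \<open>q k\<close> and
  telescope, except at the cut corner, which leaves the difference between the two neighbouring
  outer regions.\<close>

lemma psi_outer: "k \<le> m ==> \<psi> (Outer k) = r k"
proof (induction k)
  case 0 then show ?case by (simp add: base)
next
  case (Suc k)
  let ?j = "snd (oe k)"
  have km: "k < m" using Suc by simp
  have "q k = (\<Sum>x\<in>Ew ?j. \<psi> (Lv x) - \<psi> (Rv x))"
    unfolding sum_T_outer[OF km, symmetric] by (rule sum.cong) (simp_all add: Ew_def psi_diff)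
  also have "\<dots> = (\<Sum>x\<in>Ew ?j. \<psi> (Lv (rw x)) - \<psi> (Rv x))"
    using sum_rw[of "\<lambda>x. \<psi> (Lv x)" ?j] by (simp add: sum_subtractf)
  also have "\<dots> = (\<Sum>x\<in>{oe k}. \<psi> (Lv (rw x)) - \<psi> (Rv x))"
  proof (rule sum.mono_neutral_right[OF finite_Ew])
    show "{oe k} \<subseteq> Ew ?j" using oe_E by (simp add: Ew_def)
    show "\<forall>x\<in>Ew ?j - {oe k}. \<psi> (Lv (rw x)) - \<psi> (Rv x) = 0"
    proof
      fix x assume x: "x \<in> Ew ?j - {oe k}"
      then have "x \<notin> Out" using outer_white_edge[OF _ km, of x] by (auto simp: Ew_def)
      then show "\<psi> (Lv (rw x)) - \<psi> (Rv x) = 0" using Lv_rw_inner[of x] x by (simp add: Ew_def)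
    qed
  qed
  also have "\<dots> = \<psi> (Outer (Suc k)) - \<psi> (Outer k)"
    using Lv_rw_outer[OF km] Rv_outer[OF km] by simp
  finally show ?case using Suc km by (simp add: q_def algebra_simps)
qed

lemma bij_rw_power:
  assumes "e0 \<in> E"
  shows "bij_betw (\<lambda>l. (rw ^^ l) e0) {..<card (Ew (snd e0))} (Ew (snd e0))"
    and "(rw ^^ card (Ew (snd e0))) e0 = e0"
proof -
  have self: "e0 \<in> orbit rw e0"
    using permutation_self_in_orbit[of rw e0] rw_permutes finite_E by (auto simp: permutation_permutes)
  have b: "bij_betw (\<lambda>l. (rw ^^ l) e0) {..<funpow_dist1 rw e0 e0} (Ew (snd e0))"
    unfolding bij_betw_def lessThan_atLeast0 orbit_rw[OF assms, symmetric]
    using inj_on_funpow_dist1[OF self] orbit_conv_funpow_dist1[OF self] by simp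
  then have c: "card (Ew (snd e0)) = funpow_dist1 rw e0 e0"
    using bij_betw_same_card by fastforce
  show "bij_betw (\<lambda>l. (rw ^^ l) e0) {..<card (Ew (snd e0))} (Ew (snd e0))" unfolding c by (rule b)
  show "(rw ^^ card (Ew (snd e0))) e0 = e0" unfolding c by (rule funpow_dist1_prop[OF self])
qed

section \<open>The polygon of a white vertex\<close>

text \<open>
  The dual edges around white \<open>j\<close> are traversed from left to right; if \<open>j\<close> is the white vertex of
  \<open>oe k\<close>, the polygon is closed up by the side from \<open>r k\<close> to \<open>r (Suc k)\<close>, which gets index \<open>N j\<close>.
\<close>

definition ow :: "nat => nat \<times> nat" where
  "ow j = (SOME x. x \<in> Out \<and> snd x = j)"

definition st0 :: "nat => nat \<times> nat" where
  "st0 j = (if j \<in> snd ` Out then rw (ow j) else (SOME e. e \<in> Ew j))"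

definition xs :: "nat => nat => nat \<times> nat" where "xs j l = (rw ^^ l) (st0 j)"

definition N :: "nat => nat" where "N j = card (Ew j)"

definition dP :: "nat => nat" where "dP j = (if j \<in> snd ` Out then Suc (N j) else N j)"

definition P :: "nat => nat => complex" where
  "P j l = (if j \<in> snd ` Out
     then (if l mod Suc (N j) < N j then \<psi> (Lv (xs j (l mod Suc (N j)))) else \<psi> (Rv (ow j)))
     else \<psi> (Lv (xs j l)))"

lemma ow_oe: "k < m ==> ow (snd (oe k)) = oe k"
proof -
  assume k: "k < m"
  have "ow (snd (oe k)) \<in> Out \<and> snd (ow (snd (oe k))) = snd (oe k)"
    unfolding ow_def by (rule someI[of _ "oe k"]) (simp add: oe_Out)
  then show ?thesis using outer_white_edge k by blast
qed

lemma outer_white_cases: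
  assumes "j \<in> snd ` Out" obtains k where "k < m" "j = snd (oe k)"
  using assms oe_cases by (metis imageE)

lemma st0_Ew: "j < n ==> st0 j \<in> Ew j"
proof (cases "j \<in> snd ` Out")
  case True
  then obtain k where "k < m" "j = snd (oe k)" by (rule outer_white_cases)
  then show ?thesis using True ow_oe oe_E by (simp add: st0_def Ew_def rw_in)
next
  case False
  assume "j < n"
  then show ?thesis using False Ew_nonempty[of j] by (simp add: st0_def some_in_eq)
qed

lemma xs_Suc: "xs j (Suc l) = rw (xs j l)" by (simp add: xs_def)

lemma xs_Ew: "j < n ==> xs j l \<in> Ew j"
  by (induction l) (use st0_Ew in \<open>auto simp: xs_Suc xs_def[of _ 0] Ew_def rw_in\<close>)

lemma xs_bij: "j < n ==> bij_betw (xs j) {..<N j} (Ew j)"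
  and xs_N: "j < n ==> xs j (N j) = xs j 0"
proof -
  assume "j < n"
  then have *: "st0 j \<in> E" "snd (st0 j) = j" using st0_Ew by (auto simp: Ew_def)
  have "xs j = (\<lambda>l. (rw ^^ l) (st0 j))" by (auto simp: xs_def)
  then show "bij_betw (xs j) {..<N j} (Ew j)" using bij_rw_power(1)[OF *(1)] * by (simp add: N_def)
  show "xs j (N j) = xs j 0" using bij_rw_power(2)[OF *(1)] * by (simp add: N_def xs_def)
qed

lemma xs_periodic: "j < n ==> xs j (l + N j) = xs j l"
  using xs_N[of j] by (simp add: xs_def funpow_add)

lemma N_pos: "j < n ==> 0 < N j"
  using Ew_nonempty finite_Ew by (simp add: N_def card_gt_0_iff)

lemma xs_E: "j < n ==> xs j l \<in> E" "j < n ==> snd (xs j l) = j"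
  using xs_Ew by (auto simp: Ew_def)

lemma xs_surj: "x \<in> E ==> \<exists>l<N (snd x). xs (snd x) l = x"
proof -
  assume "x \<in> E"
  then have "x \<in> Ew (snd x)" "snd x < n" using E_bounds by (auto simp: Ew_def)
  then have "x \<in> xs (snd x) ` {..<N (snd x)}" using bij_betw_imp_surj_on[OF xs_bij] by simp
  then show ?thesis by auto
qed

lemma xs_inj: "j < n ==> l < N j ==> l' < N j ==> xs j l = xs j l' \<longleftrightarrow> l = l'"
  using bij_betw_imp_inj_on[OF xs_bij] by (auto simp: inj_on_def)

lemma xs_0_outer: "k < m ==> xs (snd (oe k)) 0 = rw (oe k)"
  using oe_Out[of k] by (simp add: xs_def st0_def ow_oe)

lemma xs_last_outer:
  assumes k: "k < m" shows "xs (snd (oe k)) (N (snd (oe k)) - 1) = oe k"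
proof -
  let ?j = "snd (oe k)"
  have j: "?j < n" using E_bounds(2)[OF oe_E] .
  have "rw (xs ?j (N ?j - 1)) = xs ?j (N ?j)" using N_pos[OF j] by (simp flip: xs_Suc)
  then have "rw (xs ?j (N ?j - 1)) = rw (oe k)" using xs_N[OF j] xs_0_outer[OF k] by simp
  then show ?thesis using inj_rots(2) by (simp add: inj_eq)
qed

lemma xs_not_Out:
  assumes j: "j < n" and l: "Suc l < N j \<or> j \<notin> snd ` Out"
  shows "xs j l \<notin> Out"
proof
  assume x: "xs j l \<in> Out"
  then have jO: "j \<in> snd ` Out" using xs_E(2)[OF j, of l] by force
  then obtain k where k: "k < m" "j = snd (oe k)" by (rule outer_white_cases)
  then have "xs j l = oe k" using outer_white_edge[OF x] xs_E(2)[OF j] by simp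
  then have "l = N j - 1" using xs_last_outer[OF k(1)] xs_inj[OF j, of l "N j - 1"] l jO k(2) by auto
  then show False using l jO by auto
qed

lemma dP_inner: "j \<notin> snd ` Out ==> dP j = N j" and dP_outer: "k < m ==> dP (snd (oe k)) = Suc (N (snd (oe k)))"
  using oe_Out by (simp_all add: dP_def)

lemma P_edge:
  assumes j: "j < n" and l: "l < N j \<or> j \<notin> snd ` Out"
  shows "P j l = \<psi> (Lv (xs j l))" "P j (Suc l) = \<psi> (Rv (xs j l))"
proof -
  show "P j l = \<psi> (Lv (xs j l))" using l by (auto simp: P_def)
  show "P j (Suc l) = \<psi> (Rv (xs j l))"
  proof (cases "Suc l < N j \<or> j \<notin> snd ` Out")
    case True
    then have "Lv (rw (xs j l)) = Rv (xs j l)" using Lv_rw_inner xs_E(1)[OF j] xs_not_Out[OF j True] by blast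
    then show ?thesis using True by (auto simp: P_def xs_Suc)
  next
    case False
    then have jO: "j \<in> snd ` Out" and lN: "Suc l = N j" using l by auto
    then obtain k where k: "k < m" "j = snd (oe k)" by (metis outer_white_cases)
    have "l = N j - 1" using lN by simp
    then have "xs j l = oe k" using xs_last_outer[OF k(1)] k(2) by simp
    then show ?thesis using jO lN ow_oe[OF k(1)] k(2) by (simp add: P_def)
  qed
qed

lemma P_outer:
  assumes k: "k < m" and j: "j = snd (oe k)"
  shows "P j (N j) = r k" "P j (Suc (N j)) = r (Suc k)"
proof -
  have jO: "j \<in> snd ` Out" "j < n" using oe_Out j E_bounds(2)[OF oe_E] by auto
  show "P j (N j) = r k" using jO ow_oe[OF k] Rv_outer[OF k] psi_outer[of k] k by (simp add: P_def j)
  show "P j (Suc (N j)) = r (Suc k)"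
    using jO N_pos[OF jO(2)] xs_0_outer[OF k] Lv_rw_outer[OF k] psi_outer[of "Suc k"] k
    by (simp add: P_def j)
qed

lemma P_periodic: "j < n ==> P j (l + dP j) = P j l"
  by (cases "j \<in> snd ` Out") (simp_all add: P_def dP_def xs_periodic del: add_Suc_right)

lemma P_side_edge:
  assumes "j < n" "l < N j \<or> j \<notin> snd ` Out"
  shows "P j (Suc l) - P j l = - T (xs j l)"
  using P_edge[OF assms] psi_diff[OF xs_E(1)[OF assms(1)], of l] by (simp add: algebra_simps)

lemma P_side_outer: "k < m ==> j = snd (oe k) ==> P j (Suc (N j)) - P j (N j) = q k"
  by (simp add: P_outer q_def)

lemma outer_j: "k < m ==> snd (oe k) < n \<and> snd (oe k) \<in> snd ` Out"
  using oe_Out E_bounds(2)[OF oe_E] by auto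

lemma fst_xs_inj: "j < n ==> l < N j ==> l' < N j ==> l ~= l' ==> fst (xs j l) ~= fst (xs j l')"
  using xs_inj xs_E(2) by (metis prod_eqI)

text \<open>One or two edges at an inner white vertex would give a zero flow or two opposite, hence
  parallel, flows. A single edge at an outer one would be parallel to a side of
  \<open>Q\<close>.\<close>

lemma dP_ge_3: assumes j: "j < n" shows "3 \<le> dP j"
proof (cases "j \<in> snd ` Out")
  case True
  then obtain k where k: "k < m" "j = snd (oe k)" by (rule outer_white_cases)
  have "N j ~= 1"
  proof
    assume "N j = 1"
    then obtain x where x: "Ew j = {x}" unfolding N_def by (rule card_1_singletonE)
    then have "T x = q k" using sum_T_outer[OF k(1)] k(2) by simp
    moreover have "x \<in> E" using x by (auto simp: Ew_def)
    ultimately show False using cr_T_q[of x k] k(1) by simp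
  qed
  then show ?thesis using N_pos[OF j] True by (simp add: dP_def)
next
  case False
  have "N j ~= 1"
  proof
    assume "N j = 1"
    then obtain x where x: "Ew j = {x}" unfolding N_def by (rule card_1_singletonE)
    then have "T x = 0" using sum_T_inner[OF j False] by simp
    moreover have "x \<in> E" using x by (auto simp: Ew_def)
    ultimately show False using T_nonzero by blast
  qed
  moreover have "N j ~= 2"
  proof
    assume "N j = 2"
    then obtain x y where x: "Ew j = {x, y}" "x ~= y" unfolding N_def by (auto simp: card_2_iff)
    have "T y = - T x" using sum_T_inner[OF j False] x by (simp add: eq_neg_iff_add_eq_0 add.commute)
    moreover have "x \<in> Ew j" "y \<in> Ew j" using x(1) by blast+
    then have xy: "x \<in> E" "y \<in> E" "snd x = snd y" by (simp_all add: Ew_def)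
    moreover have "fst x ~= fst y" using xy(3) x(2) by (metis prod_eqI)
    ultimately show False using cr_T_T[of x y] by simp
  qed
  ultimately show ?thesis using N_pos[OF j] False by (simp add: dP_def)
qed

text \<open>Stated for an arbitrary function of an oriented segment so that crossing numbers of all
  polygons can be regrouped by edges of the graph.\<close>

lemma sum_sides:
  fixes f :: "complex => complex => 'c::comm_monoid_add"
  assumes j: "j < n"
  shows "(\<Sum>l<dP j. f (P j l) (P j (Suc l))) = (\<Sum>e\<in>Ew j. f (\<psi> (Lv e)) (\<psi> (Rv e)))
    + (\<Sum>k<m. if snd (oe k) = j then f (r k) (r (Suc k)) else 0)"
proof -
  have E: "(\<Sum>l<N j. f (P j l) (P j (Suc l))) = (\<Sum>e\<in>Ew j. f (\<psi> (Lv e)) (\<psi> (Rv e)))"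
    unfolding sum.reindex_bij_betw[OF xs_bij[OF j], of "\<lambda>e. f (\<psi> (Lv e)) (\<psi> (Rv e))", symmetric]
    by (rule sum.cong) (use P_edge[OF j] in simp_all)
  show ?thesis
  proof (cases "j \<in> snd ` Out")
    case True
    then obtain k where k: "k < m" "j = snd (oe k)" by (rule outer_white_cases)
    have "(\<Sum>i<m. if snd (oe i) = j then f (r i) (r (Suc i)) else 0) = (\<Sum>i<m. if i = k then f (r i) (r (Suc i)) else 0)"
      by (rule sum.cong) (use outer_white_distinct k in auto)
    then show ?thesis using E P_outer[OF k] dP_outer[OF k(1)] k by simp
  next
    case False
    then have "snd (oe i) ~= j" for i using oe_Out by blast
    then show ?thesis using E dP_inner[OF False] by simp
  qed
qed

lemma P_side_cases:
  assumes j: "j < n"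
  shows "(\<exists>e\<in>Ew j. P j (Suc l) - P j l = - T e) \<or> (\<exists>k<m. j = snd (oe k) \<and> P j (Suc l) - P j l = q k)"
proof -
  have per: "P j (Suc (l mod dP j)) - P j (l mod dP j) = P j (Suc l) - P j l"
  proof (rule periodic_mod[of "\<lambda>l. P j (Suc l) - P j l"])
    show "P j (Suc (l + dP j)) - P j (l + dP j) = P j (Suc l) - P j l" for l
      using P_periodic[OF j, of "Suc l"] P_periodic[OF j, of l] by simp
  qed
  let ?l = "l mod dP j"
  have ld: "?l < dP j" using dP_ge_3[OF j] by simp
  show ?thesis
  proof (cases "?l < N j")
    case True
    then show ?thesis using P_side_edge[OF j, of ?l] xs_Ew[OF j, of ?l] per by metis
  next
    case False
    then have jO: "j \<in> snd ` Out" "?l = N j" using ld by (auto simp: dP_def less_Suc_eq split: if_splits)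
    then obtain k where "k < m" "j = snd (oe k)" by (metis outer_white_cases)
    then show ?thesis using P_side_outer[of k j] per jO by metis
  qed
qed

lemma sign_changes_generic:
  assumes j: "j < n" and v: "generic_dir v"
  shows "card {l. l < dP j \<and> (0 < cr v (P j (Suc l) - P j l)) ~= (0 < cr v (P j (Suc (Suc l)) - P j (Suc l)))} = 2"
proof -
  define b where "b l \<longleftrightarrow> 0 < cr v (P j (Suc l) - P j l)" for l
  have cd: "card {l. l < dP j \<and> b l ~= b (Suc l)} = (\<Sum>l<dP j. of_bool (b l ~= b (Suc l)))"
    unfolding card_filter_sum[OF finite_lessThan, symmetric] by simp
  have nz: "cr v (T (xs j l)) ~= 0" for l using v xs_E(1)[OF j] by (simp add: generic_dir_def)
  have be: "b l \<longleftrightarrow> \<not> 0 < cr v (T (xs j l))" if "l < N j \<or> j \<notin> snd ` Out" for l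
    unfolding b_def P_side_edge[OF j that] using nz[of l] by auto
  have ch: "xs j l \<in> changes v j \<longleftrightarrow> (0 < cr v (T (xs j l))) ~= (0 < cr v (T (xs j (Suc l))))" for l
    using xs_Ew[OF j] by (simp add: changes_def xs_Suc)
  have cE: "card {x \<in> Ew j. x \<in> S} = (\<Sum>l<N j. of_bool (xs j l \<in> S))" for S
    unfolding card_filter_sum[OF finite_Ew] by (rule sum.reindex_bij_betw[OF xs_bij[OF j], symmetric])
  have "(\<Sum>l<dP j. of_bool (b l ~= b (Suc l))) = (2::nat)"
  proof (cases "j \<in> snd ` Out")
    case False
    have "(\<Sum>l<dP j. of_bool (b l ~= b (Suc l))) = (\<Sum>l<N j. of_bool (xs j l \<in> changes v j))"
      unfolding dP_inner[OF False] ch by (rule sum.cong) (use be False in auto)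
    also have "\<dots> = card (changes v j)"
      unfolding cE[symmetric] by (rule arg_cong[of _ _ card]) (auto simp: changes_def)
    finally show ?thesis using corner_equality(2)[OF v j False] by simp
  next
    case True
    then obtain k where k: "k < m" "j = snd (oe k)" by (rule outer_white_cases)
    have N1: "N j - 1 < N j" "Suc (N j - 1) = N j" using N_pos[OF j] by auto
    have xl: "xs j (N j - 1) = oe k" using xs_last_outer k by simp
    have bN: "b (N j) \<longleftrightarrow> 0 < cr v (q k)" unfolding b_def P_side_outer[OF k] ..
    have "b (Suc (N j)) \<longleftrightarrow> b 0"
      using P_periodic[OF j, of 0] P_periodic[OF j, of 1] dP_outer[OF k(1)] k(2) by (simp add: b_def)
    then have bS: "b (Suc (N j)) \<longleftrightarrow> \<not> 0 < cr v (T (rw (oe k)))"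
      using be[of 0] N_pos[OF j] xs_0_outer[OF k(1)] k(2) by simp
    \<comment> \<open>The last edge of the turn is \<open>oe k\<close>, followed by the side
      \<open>q k\<close> of \<open>Q\<close>. Because the edge enters as \<open>- T (oe k)\<close>,
      this corner is a change exactly when there is no mismatch.\<close>
    have f: "of_bool (b l ~= b (Suc l)) = of_bool (xs j l \<in> changes v j - {oe k})
        + (if l = N j - 1 then 1 - mismatch_r v k else 0)" if l: "l < N j" for l
    proof (cases "l = N j - 1")
      case True
      then show ?thesis using be[OF disjI1[OF l]] bN N1 xl by (auto simp: mismatch_r_def)
    next
      case False
      then have "xs j l ~= oe k" using xs_inj[OF j l N1(1)] xl by metis
      moreover have "Suc l < N j" using False l by linarith
      ultimately show ?thesis using be[OF disjI1[OF l]] be[of "Suc l"] False ch[of l] by auto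
    qed
    have "(\<Sum>l<N j. of_bool (b l ~= b (Suc l))) = (\<Sum>l<N j. of_bool (xs j l \<in> changes v j - {oe k})) + (1 - mismatch_r v k)"
      using f N1(1) by (simp add: sum.distrib)
    also have "(\<Sum>l<N j. of_bool (xs j l \<in> changes v j - {oe k})) = card (changes v j - {oe k})"
      unfolding cE[symmetric] by (rule arg_cong[of _ _ card]) (auto simp: changes_def)
    also have "\<dots> = mismatch_r v k + mismatch_l v k" using corner_equality(3)[OF v k(1)] k(2) by simp
    finally have "(\<Sum>l<N j. of_bool (b l ~= b (Suc l))) = mismatch_r v k + mismatch_l v k + (1 - mismatch_r v k)" .
    moreover have "of_bool (b (N j) ~= b (Suc (N j))) = 1 - mismatch_l v k"
      unfolding bN bS by (auto simp: mismatch_l_def)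
    ultimately show ?thesis
      using True by (simp add: dP_def) (simp add: mismatch_r_def mismatch_l_def)
  qed
  then show ?thesis unfolding cd[symmetric] by (simp add: b_def)
qed

lemma polygon: assumes j: "j < n" shows "cyclic_polygon (P j) (dP j)"
proof
  show "3 \<le> dP j" by (rule dP_ge_3[OF j])
  show "P j (l + dP j) = P j l" for l by (rule P_periodic[OF j])
  show "cr (P j (Suc i) - P j i) (P j (Suc l) - P j l) ~= 0" if il: "i < dP j" "l < dP j" "i ~= l" for i l
  proof (cases "i < N j")
    case i: True
    note si = P_side_edge[OF j disjI1[OF i]]
    show ?thesis
    proof (cases "l < N j")
      case True
      show ?thesis unfolding si P_side_edge[OF j disjI1[OF True]]
        using cr_T_T[OF xs_E(1)[OF j] xs_E(1)[OF j] fst_xs_inj[OF j i True il(3)]] by simp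
    next
      case False
      then have jO: "j \<in> snd ` Out" "l = N j" using il by (auto simp: dP_def split: if_splits)
      then obtain k where k: "k < m" "j = snd (oe k)" by (metis outer_white_cases)
      show ?thesis unfolding si jO(2) P_side_outer[OF k] using cr_T_q[OF xs_E(1)[OF j] k(1)] by simp
    qed
  next
    case False
    then have jO: "j \<in> snd ` Out" "i = N j" using il by (auto simp: dP_def split: if_splits)
    then have l: "l < N j" using il by (auto simp: dP_def)
    obtain k where k: "k < m" "j = snd (oe k)" using jO by (metis outer_white_cases)
    show ?thesis unfolding jO(2) P_side_outer[OF k] P_side_edge[OF j disjI1[OF l]]
      using cr_q_T[OF xs_E(1)[OF j] k(1)] by simp
  qed
  show "card {l. l < dP j \<and> (0 < cr v (P j (Suc l) - P j l)) ~= (0 < cr v (P j (Suc (Suc l)) - P j (Suc l)))} = 2"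
    if nz: "\<And>l. l < dP j ==> cr v (P j (Suc l) - P j l) ~= 0" for v
  proof -
    have nz': "cr v (P j (Suc l) - P j l) ~= 0" for l
    proof -
      have "P j (Suc (l mod dP j)) - P j (l mod dP j) = P j (Suc l) - P j l"
        by (rule periodic_mod[of "\<lambda>l. P j (Suc l) - P j l"])
           (use P_periodic[OF j] in \<open>metis add_Suc\<close>)
      then show ?thesis using nz[of "l mod dP j"] dP_ge_3[OF j] by simp
    qed
    \<comment> \<open>The count is available for directions generic for the whole drawing. A
      perturbation of \<open>v\<close> is one of these and gives every side of this polygon the same
      sign as \<open>v\<close>.\<close>
    have "v ~= 0" using nz'[of 0] by auto
    then obtain w where w: "generic_dir w"
      "\<And>e. e \<in> E ==> cr v (T e) ~= 0 ==> 0 < cr w (T e) \<longleftrightarrow> 0 < cr v (T e)"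
      "\<And>k. k < m ==> cr v (q k) ~= 0 ==> 0 < cr w (q k) \<longleftrightarrow> 0 < cr v (q k)"
      by (rule generic_dir_perturb[of v "{}" True]) auto
    have "0 < cr w (P j (Suc l) - P j l) \<longleftrightarrow> 0 < cr v (P j (Suc l) - P j l)" for l
      using P_side_cases[OF j, of l]
    proof (elim disjE bexE exE conjE)
      fix e assume e: "e \<in> Ew j" "P j (Suc l) - P j l = - T e"
      then have "e \<in> E" by (simp add: Ew_def)
      moreover have "cr v (T e) ~= 0" using nz'[of l] unfolding e(2) by simp
      moreover have "cr w (T e) ~= 0" using w(1) \<open>e \<in> E\<close> by (simp add: generic_dir_def)
      ultimately show ?thesis unfolding e(2) using w(2)[of e] by auto
    next
      fix k assume k: "k < m" "P j (Suc l) - P j l = q k"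
      show ?thesis unfolding k(2) using w(3)[OF k(1)] nz'[of l] unfolding k(2) by blast
    qed
    then show ?thesis using sign_changes_generic[OF j w(1)] by simp
  qed
qed

end

context drawn_graph
begin

abbreviation "orient j \<equiv> cyclic_polygon.orient (P j)"

definition tile :: "nat => complex set" where "tile j = cyclic_polygon.tile (P j) (dP j)"

lemma orient_cases: "j < n ==> orient j = 1 \<or> orient j = - 1"
  using cyclic_polygon.orient_cases[OF polygon] .

lemma orient_side_turn:
  assumes "j < n"
  shows "0 < orient j * cr (P j (Suc l) - P j l) (P j (Suc (Suc l)) - P j (Suc l))"
proof -
  interpret C: cyclic_polygon "P j" "dP j" by (rule polygon[OF assms])
  show ?thesis using C.orient_turn[of l] by (simp add: C.side_def)
qed

lemma orient_corner:
  assumes e: "e \<in> E" "e \<notin> Out"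
  shows "0 < orient (snd e) * cr (T e) (T (rw e))"
proof -
  let ?j = "snd e"
  have j: "?j < n" using E_bounds e by blast
  obtain l where l: "l < N ?j" "xs ?j l = e" using xs_surj[OF e(1)] by blast
  have l': "Suc l < N ?j \<or> ?j \<notin> snd ` Out"
  proof (rule ccontr)
    assume *: "\<not> ?thesis"
    then obtain k where k: "k < m" "?j = snd (oe k)" by (metis outer_white_cases)
    have "l = N ?j - 1" using * l by linarith
    then have "e = oe k" using xs_last_outer[OF k(1)] k(2) l by metis
    then show False using e oe_Out by simp
  qed
  have s1: "P ?j (Suc l) - P ?j l = - T e"
    using P_side_edge[OF j disjI1[OF l(1)]] l(2) by simp
  have s2: "P ?j (Suc (Suc l)) - P ?j (Suc l) = - T (rw e)"
    using P_side_edge[OF j l'[THEN disj_forward, of "Suc l < N ?j" "?j \<notin> snd ` Out"]] l(2) xs_Suc by simp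
  show ?thesis using orient_side_turn[OF j, of l] unfolding s1 s2 by simp
qed

lemma orient_outer_corner:
  assumes k: "k < m"
  shows "0 < orient (snd (oe k)) * cr (q k) (T (oe k))"
    and "orient (snd (oe k)) * cr (q k) (T (rw (oe k))) < 0"
proof -
  let ?j = "snd (oe k)"
  have j: "?j < n" using outer_j[OF k] by simp
  have N: "N ?j - 1 < N ?j" "Suc (N ?j - 1) = N ?j" using N_pos[OF j] by auto
  have s0: "P ?j (Suc (N ?j - 1)) - P ?j (N ?j - 1) = - T (oe k)"
    using P_side_edge[OF j disjI1[OF N(1)]] xs_last_outer[OF k] by simp
  have s1: "P ?j (Suc (N ?j)) - P ?j (N ?j) = q k" by (rule P_side_outer[OF k refl])
  have "P ?j (Suc (Suc (N ?j))) - P ?j (Suc (N ?j)) = P ?j 1 - P ?j 0"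
    using P_periodic[OF j, of 0] P_periodic[OF j, of 1] dP_outer[OF k] by simp
  then have s2: "P ?j (Suc (Suc (N ?j))) - P ?j (Suc (N ?j)) = - T (rw (oe k))"
    using P_side_edge[OF j, of 0] N_pos[OF j] xs_0_outer[OF k] by simp
  have "0 < orient ?j * cr (- T (oe k)) (q k)"
    using orient_side_turn[OF j, of "N ?j - 1"] unfolding s0 unfolding N(2) s1 .
  then show "0 < orient ?j * cr (q k) (T (oe k))" using cr_commute[of "q k" "T (oe k)"] by simp
  have "0 < orient ?j * cr (q k) (- T (rw (oe k)))"
    using orient_side_turn[OF j, of "N ?j"] unfolding s1 s2 .
  then show "orient ?j * cr (q k) (T (rw (oe k))) < 0" by simp
qed

lemma orient_pos_iff: "j < n ==> 0 < orient j * c ==> 0 < c \<longleftrightarrow> 0 < orient j"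
  using orient_cases[of j] by auto

lemma orient_eqI: "j < n ==> j' < n ==> (0 < orient j \<longleftrightarrow> 0 < orient j') ==> orient j = orient j'"
  using orient_cases[of j] orient_cases[of j'] by auto

lemma turnback_opposite:
  assumes x: "x \<in> E" "\<not> straight x"
  obtains c where "c < 0" "T (rw x) = of_real c * T (\<phi> x)"
proof -
  have nz: "\<kappa> (\<phi> x) ~= 0" "\<kappa> (rw x) ~= 0" using \<kappa>_nonzero x rw_in phi_in by auto
  show ?thesis
  proof (rule that[of "\<kappa> (rw x) / \<kappa> (\<phi> x)"])
    show "\<kappa> (rw x) / \<kappa> (\<phi> x) < 0"
      using x(2) nz by (auto simp: straight_def divide_less_0_iff)
    show "T (rw x) = of_real (\<kappa> (rw x) / \<kappa> (\<phi> x)) * T (\<phi> x)"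
      using nz fst_phi[OF x(1)] by (simp add: T_def)
  qed
qed

text \<open>
  Otherwise a suitable direction would separate two corners at the same dual vertex.
\<close>

lemma orient_step_inner:
  assumes x: "x \<in> E" "x \<notin> Out" "\<not> straight x"
  shows "orient (snd x) = orient (snd (\<phi> x))"
proof (rule ccontr)
  assume neq: "orient (snd x) ~= orient (snd (\<phi> x))"
  have y: "\<phi> x \<in> E" "\<phi> x \<notin> Out" using x phi_in Out_phi by auto
  have j: "snd x < n" "snd (\<phi> x) < n" using E_bounds x y by auto
  let ?y = "T (\<phi> x)"
  obtain c where c: "c < 0" "T (rw x) = of_real c * ?y" by (rule turnback_opposite[OF x(1,3)])
  have "0 < (- c) * (orient (snd x) * cr ?y (T x))"
    using orient_corner[OF x(1,2)] cr_commute[of ?y "T x"] unfolding c(2) by (simp add: algebra_simps)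
  then have o1: "0 < orient (snd x) * cr ?y (T x)" by (rule zero_less_mult_pos) (use c(1) in simp)
  have o2: "0 < orient (snd (\<phi> x)) * cr ?y (T (rw (\<phi> x)))" by (rule orient_corner[OF y])
  note s1 = orient_pos_iff[OF j(1) o1] and s2 = orient_pos_iff[OF j(2) o2]
  have ne: "(0 < orient (snd x)) ~= (0 < orient (snd (\<phi> x)))" using neq orient_eqI[OF j] by blast
  \<comment> \<open>With different orientations \<open>T x\<close> and
    \<open>T (rw (\<phi> x))\<close> lie on opposite sides of \<open>?y\<close>. The sign on
    \<open>?y\<close> is chosen so that the corner of \<open>x\<close> and the corner of
    \<open>\<phi> x\<close> both keep their sign, whereas the face has only one such corner.\<close>
  obtain v where v: "generic_dir v" "0 < cr v ?y \<longleftrightarrow> 0 < orient (snd (\<phi> x))"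
    "\<And>e. e \<in> E ==> cr ?y (T e) ~= 0 ==> 0 < cr v (T e) \<longleftrightarrow> 0 < cr ?y (T e)"
    by (rule generic_dir_perturb[of ?y "{}" "0 < orient (snd (\<phi> x))"]) (use T_nonzero[OF y(1)] in auto)
  have "cr ?y (T x) ~= 0" "cr ?y (T (rw (\<phi> x))) ~= 0" using o1 o2 by auto
  then have vx: "0 < cr v (T x) \<longleftrightarrow> 0 < orient (snd x)"
    "0 < cr v (T (rw (\<phi> x))) \<longleftrightarrow> 0 < orient (snd (\<phi> x))"
    using v(3)[of x] v(3)[of "rw (\<phi> x)"] x y rw_in s1 s2 by auto
  have vy: "cr v ?y ~= 0" using v(1) y by (simp add: generic_dir_def)
  have "0 < cr v (T (rw x)) \<longleftrightarrow> \<not> 0 < cr v ?y"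
    unfolding c(2) using c(1) vy by (auto simp: zero_less_mult_iff)
  then have u: "(0 < cr v (T x)) = (0 < cr v (T (rw x)))" "(0 < cr v (T (\<phi> x))) = (0 < cr v (T (rw (\<phi> x))))"
    using vx v(2) ne by auto
  let ?F = "orbit \<phi> x"
  have F: "?F \<in> faces G" "?F ~= Out" "x \<in> ?F" "\<phi> x \<in> ?F"
    using orbit_in_faces x self_orbit orbit.base by fast+
  obtain z where z: "{x \<in> ?F. (0 < cr v (T x)) = (0 < cr v (T (rw x)))} = {z}"
    by (rule card_1_singletonE[OF corner_equality(1)[OF v(1) F(1,2)]])
  have "x \<in> {z}" "\<phi> x \<in> {z}" unfolding z[symmetric] using F u by simp_all
  then show False using neq by simp
qed

interpretation Q: cyclic_polygon "\<lambda>j. r (j mod Suc m)" "Suc m" by (rule outer_polygon)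

text \<open>The same argument with the excess of the outer corner in place of a face: different
  orientations put \<open>q k\<close> and \<open>q (Suc k)\<close> on opposite sides of
  \<open>?y\<close>, and a direction near \<open>?y\<close> can be given a mismatch on top of that
  change, so the excess would be at least 2.\<close>

lemma orient_step_outer:
  assumes k: "Suc k < m"
  shows "orient (snd (oe k)) = orient (snd (oe (Suc k)))"
proof (rule ccontr)
  assume neq: "orient (snd (oe k)) ~= orient (snd (oe (Suc k)))"
  have k': "k < m" using k by simp
  have j: "snd (oe k) < n" "snd (oe (Suc k)) < n" using outer_j k by auto
  let ?y = "T (oe (Suc k))"
  obtain c where c: "c < 0" "T (rw (oe k)) = of_real c * ?y"
    by (rule turnback_opposite[OF oe_E outer_not_straight[OF k]]) (simp add: oe_Suc)
  have "0 < (- c) * (- (orient (snd (oe k)) * cr ?y (q k)))"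
    using orient_outer_corner(2)[OF k'] cr_commute[of ?y "q k"] unfolding c(2) by (simp add: algebra_simps)
  then have o1: "0 < orient (snd (oe k)) * (- cr ?y (q k))" using c(1) by (simp add: zero_less_mult_iff mult_less_0_iff)
  have o2: "0 < orient (snd (oe (Suc k))) * (- cr ?y (q (Suc k)))"
    using orient_outer_corner(1)[OF k] cr_commute[of ?y "q (Suc k)"] by simp
  note s1 = orient_pos_iff[OF j(1) o1] and s2 = orient_pos_iff[OF j(2) o2]
  have ne: "(0 < orient (snd (oe k))) ~= (0 < orient (snd (oe (Suc k))))" using neq orient_eqI[OF j] by blast
  have nz: "cr ?y (q k) ~= 0" "cr ?y (q (Suc k)) ~= 0" using o1 o2 by auto
  obtain v where v: "generic_dir v" "0 < cr v ?y \<longleftrightarrow> 0 < cr ?y (q k)"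
    "\<And>k. k < m ==> cr ?y (q k) ~= 0 ==> 0 < cr v (q k) \<longleftrightarrow> 0 < cr ?y (q k)"
    by (rule generic_dir_perturb[of ?y "{}" "0 < cr ?y (q k)"]) (use T_nonzero[OF oe_E] in auto)
  have vy: "cr v ?y ~= 0" using v(1) oe_E by (simp add: generic_dir_def)
  have "0 < cr v (T (rw (oe k))) \<longleftrightarrow> \<not> 0 < cr v ?y"
    unfolding c(2) using c(1) vy by (auto simp: zero_less_mult_iff)
  then have "mismatch_l v k = 1" using v(2) v(3)[OF k' nz(1)] by (simp add: mismatch_l_def)
  moreover have "outer_change v k = 1"
    using v(3)[OF k' nz(1)] v(3)[OF k nz(2)] s1 s2 ne nz
    by (auto simp: outer_change_def Q_side k k')
  ultimately show False using corner_equality(4)[OF v(1), of k] k by (simp add: corner_excess_def)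
qed

text \<open>Turning corners preserve the orientation. An inner face has a single straight corner,
  and a single exceptional step around a cycle cannot change anything.\<close>

lemma orient_phi:
  assumes "x \<in> E" "x ~= oe (m - 1)"
  shows "orient (snd (\<phi> x)) = orient (snd x)"
proof (cases "x \<in> Out")
  case True
  then obtain k where k: "k < m" "x = oe k" by (rule oe_cases)
  have "k ~= m - 1" using k(2) assms(2) by blast
  then have "Suc k < m" using k(1) by linarith
  then show ?thesis using orient_step_outer k by (simp add: oe_Suc)
next
  case False
  let ?F = "orbit \<phi> x"
  have F: "?F \<in> faces G" "x \<in> ?F" "\<phi> x \<in> ?F"
    using orbit_in_faces assms self_orbit orbit.base by fast+
  have FO: "?F ~= Out" using F False by blast
  obtain s where s: "\<And>y. y \<in> ?F \<and> straight y \<longleftrightarrow> y = s" using straight_singleton[OF F(1)] by blast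
  show ?thesis
  proof (rule face_const[where g = "\<lambda>y. orient (snd y)" and ?x0.0 = s and F = ?F])
    fix y assume y: "y \<in> ?F" "y ~= s"
    then have "y \<in> E" "y \<notin> Out" using faceD[OF F(1) y(1)] faceD[OF Out_face, of y] FO by auto
    moreover have "\<not> straight y" using s y by blast
    ultimately show "orient (snd (\<phi> y)) = orient (snd y)" using orient_step_inner by simp
  qed (use F in auto)
qed

text \<open>Around a black vertex the orientation is preserved at all corners but at most the cut
  one at \<open>b0\<close>, which parity covers; connectedness does the rest.\<close>

lemma orient_const:
  assumes "j < n" "j' < n"
  shows "orient j = orient j'"
proof -
  have c: "orient (snd e) = orient (snd e')" if "e \<in> E" "e' \<in> E" for e e'
  proof (rule edges_connected[of "\<lambda>e. orient (snd e)", OF _ that])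
    fix e e' assume *: "e \<in> E" "e' \<in> E" "fst e = fst e' \<or> snd e = snd e'"
    show "orient (snd e) = orient (snd e')"
    proof (cases "snd e = snd e'")
      case False
      show ?thesis
      proof (rule black_const[where g = "\<lambda>e. orient (snd e)" and ?x0.0 = "rw (oe (m - 1))"])
        fix x assume x: "x \<in> E" "x ~= rw (oe (m - 1))"
        obtain y where y: "y \<in> E" "x = rw y"
          using bij_betw_imp_surj_on[OF bij_rw_E] x(1) by blast
        then have "orient (snd (\<phi> y)) = orient (snd y)" using orient_phi x(2) by blast
        then show "orient (snd (rb x)) = orient (snd x)" using y by (simp add: phi_eq)
      qed (use * False in auto)
    qed simp
  qed
  obtain e e' where "e \<in> Ew j" "e' \<in> Ew j'" using Ew_nonempty assms by blast
  then show ?thesis using c[of e e'] by (simp add: Ew_def)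
qed

section \<open>Coordinates along the image of a black vertex\<close>

definition base_edge :: "nat => nat \<times> nat" where
  "base_edge i = (if i = b0 then a else (SOME e. e \<in> Eb i))"

definition base_pt :: "nat => complex" where "base_pt i = \<psi> (Rv (base_edge i))"

text \<open>The coordinate of \<open>\<psi> (Rv e)\<close> on the line through
  \<open>base_pt\<close> in direction \<open>g\<close>. For \<open>b0\<close> the base is
  \<open>r 0\<close>, which makes the coordinates of its segment run from 0 to 1.\<close>

definition co :: "nat \<times> nat => real" where
  "co e = Re ((\<psi> (Rv e) - base_pt (fst e)) / g (fst e))"

lemma base_edge: "i < n ==> base_edge i \<in> Eb i"
  using Eb_nonempty[of i] a_edge by (simp add: base_edge_def some_in_eq) (simp add: Eb_def)

text \<open>Each step of the rotation around a black vertex moves \<open>\<psi>\<close> by a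
  multiple of \<open>g\<close>, so \<open>cr (g i)\<close> of it is constant; only the step into
  \<open>a\<close> is cut, and it is the one exempted by parity.\<close>

lemma psi_Rv:
  assumes e: "e \<in> E"
  shows "\<psi> (Rv e) = base_pt (fst e) + of_real (co e) * g (fst e)"
proof -
  let ?i = "fst e"
  have i: "?i < n" using E_bounds e by blast
  have "cr (g ?i) (\<psi> (Rv e)) = cr (g ?i) (\<psi> (Rv (base_edge ?i)))"
  proof (rule black_const[where g = "\<lambda>e. cr (g ?i) (\<psi> (Rv e))" and ?x0.0 = "inv_into UNIV rb a"])
    fix x assume x: "x \<in> E" "fst x = ?i" "x ~= inv_into UNIV rb a"
    then have "rb x ~= a" using inj_rots(1) by (metis inv_f_f)
    then have "\<psi> (Rv (rb x)) = \<psi> (Rv x) + T x" using psi_diff[OF x(1)] by (simp add: Lv_rb algebra_simps)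
    then show "cr (g ?i) (\<psi> (Rv (rb x))) = cr (g ?i) (\<psi> (Rv x))" using x(2) by (simp add: T_def)
  qed (use e base_edge[OF i] in \<open>auto simp: Eb_def\<close>)
  then have "cr (g ?i) (\<psi> (Rv e) - base_pt ?i) = 0" by (simp add: base_pt_def)
  then obtain c where c: "\<psi> (Rv e) - base_pt ?i = of_real c * g ?i" using cr_eq_0_iff[OF g_nonzero[OF i]] by blast
  then have "co e = c" using g_nonzero[OF i] by (simp add: co_def)
  then show ?thesis using c by (simp add: algebra_simps)
qed

lemma psi_Lv: "e \<in> E ==> \<psi> (Lv e) = base_pt (fst e) + of_real (co e + \<kappa> e) * g (fst e)"
  using psi_Rv[of e] psi_diff[of e] by (simp add: T_def algebra_simps)

lemma line_coord_eq: "i < n ==> base_pt i + of_real s * g i = base_pt i + of_real t * g i \<longleftrightarrow> s = t"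
  using g_nonzero[of i] by simp

lemma co_rb: "e \<in> E ==> rb e ~= a ==> co (rb e) = co e + \<kappa> e"
  using psi_Lv[of e] psi_Rv[of "rb e"] line_coord_eq[of "fst e"] E_bounds(1)[of e]
  by (simp add: Lv_rb rb_in del: of_real_add)

lemma co_a: "co a = 0"
  by (simp add: co_def base_pt_def base_edge_def)

lemma base_b0: "base_pt b0 = r 0"
  using Rv_outer[OF m_pos] by (simp add: base_pt_def base_edge_def base)

text \<open>Going once around \<open>b0\<close> ends at \<open>Outer m\<close>, that is at
  \<open>r m\<close>, and not back at \<open>r 0\<close>: the coordinate has grown by the total flow
  1.\<close>

lemma co_last: "e \<in> E ==> rb e = a ==> co e + \<kappa> e = 1"
proof -
  assume e: "e \<in> E" "rb e = a"
  have f: "fst e = b0" using fst_rb[OF e(1)] e(2) by simp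
  have "\<psi> (Lv e) = base_pt b0 + of_real 1 * g b0"
    using e psi_outer[of m] base_b0 g_b0 by (simp add: Lv_a)
  then show ?thesis using psi_Lv[OF e(1)] line_coord_eq[OF b0_n] f by (simp del: of_real_add)
qed

section \<open>The tiling\<close>

lemma Rv_D: "e \<in> E ==> Rv e \<in> dual_vertices G a"
proof (cases "e \<in> Out")
  case True
  then obtain k where "k < m" "e = oe k" by (rule oe_cases)
  then show ?thesis using Rv_outer by (auto simp: dual_vertices_def)
next
  case False
  assume e: "e \<in> E"
  then have "orbit \<phi> e ~= Out" using self_orbit False by blast
  then show ?thesis using False orbit_in_faces[OF e] by (auto simp: Rv_inner dual_vertices_def)
qed

lemma Lv_D: "e \<in> E ==> Lv e \<in> dual_vertices G a"
  using Rv_D[of "rb e"] rb_in by (auto simp: left_vertex_def dual_vertices_def)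

lemma Outer_D: "k \<le> m ==> Outer k \<in> dual_vertices G a"
  by (simp add: dual_vertices_def)

lemma finite_D: "finite (dual_vertices G a)"
  using finite_faces by (simp add: dual_vertices_def)

lemma P_D: "j < n ==> P j l \<in> \<psi> ` dual_vertices G a"
proof -
  assume j: "j < n"
  show ?thesis
  proof (cases "j \<in> snd ` Out \<and> \<not> l mod Suc (N j) < N j")
    case True
    then obtain k where k: "k < m" "j = snd (oe k)" by (metis outer_white_cases)
    then have "P j l = \<psi> (Outer k)" using True Rv_outer by (simp add: P_def ow_oe)
    then show ?thesis using Outer_D k by simp
  next
    case False
    then show ?thesis using Lv_D xs_E[OF j] by (auto simp: P_def)
  qed
qed

definition generic_pt :: "complex => complex => bool" where
  "generic_pt v z \<longleftrightarrow> (\<forall>d\<in>dual_vertices G a. cr v (\<psi> d - z) ~= 0) \<and>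
     (\<forall>e\<in>E. cr (T e) (z - \<psi> (Rv e)) ~= 0) \<and> (\<forall>k<m. cr (q k) (z - r k) ~= 0)"

lemma negligible_line: "v ~= 0 ==> negligible {z. cr v (z - c) = 0}"
proof -
  assume "v ~= 0"
  then have "negligible {z. (\<i> * v) \<bullet> z = cr v c}" by (intro negligible_hyperplane) simp
  moreover have "{z. cr v (z - c) = 0} = {z. (\<i> * v) \<bullet> z = cr v c}" by (simp add: cr_inner[symmetric])
  ultimately show ?thesis by simp
qed

text \<open>The excluded points lie on finitely many lines, and a nonempty open set is not
  negligible.\<close>

lemma generic_pt_exists:
  assumes "v ~= 0" "open S" "S ~= {}"
  obtains z where "z \<in> S" "generic_pt v z"
proof -
  let ?B = "(\<Union>d\<in>dual_vertices G a. {z. cr v (z - \<psi> d) = 0}) \<union> (\<Union>e\<in>E. {z. cr (T e) (z - \<psi> (Rv e)) = 0})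
    \<union> (\<Union>k\<in>{..<m}. {z. cr (q k) (z - r k) = 0})"
  have "negligible ?B"
    by (intro negligible_Un negligible_Union) (use finite_D finite_E negligible_line assms(1) T_nonzero q_nonzero in auto)
  then have "\<not> S \<subseteq> ?B" using open_not_negligible[OF assms(2,3)] negligible_subset by blast
  then obtain z where z: "z \<in> S" "z \<notin> ?B" by blast
  have "cr v (\<psi> d - z) = - cr v (z - \<psi> d)" for d by simp
  then have "generic_pt v z" using z(2) unfolding generic_pt_def by auto
  then show ?thesis using that z(1) by blast
qed

text \<open>All dual edges at a black vertex lie on one line, so their crossings telescope around
  the rotation. They cancel unless the rotation is cut, which leaves the closing side of
  \<open>Q\<close> at \<open>b0\<close>.\<close>

lemma sum_crossing_black:
  assumes v: "generic_dir v" and z: "generic_pt v z" and i: "i < n"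
  shows "(\<Sum>e\<in>Eb i. crossing v z (\<psi> (Lv e)) (\<psi> (Rv e))) = (if i = b0 then crossing v z (r m) (r 0) else 0)"
proof -
  obtain e0 where e0: "e0 \<in> E" "fst e0 = i" using Eb_nonempty[OF i] by (auto simp: Eb_def)
  have vg: "cr v (g i) ~= 0" using v e0 by (auto simp: generic_dir_def cr_T)
  obtain F where F: "\<And>\<alpha> \<beta>. cr v (base_pt i + of_real \<alpha> * g i - z) ~= 0 ==> cr v (base_pt i + of_real \<beta> * g i - z) ~= 0 ==>
       crossing v z (base_pt i + of_real \<alpha> * g i) (base_pt i + of_real \<beta> * g i) = F \<beta> - F \<alpha>"
    using crossing_line[OF vg] by blast
  have c: "crossing v z (\<psi> (Lv e)) (\<psi> (Rv e)) = F (co e) - F (co e + \<kappa> e)" if "e \<in> Eb i" for e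
  proof -
    have e: "e \<in> E" "fst e = i" using that by (auto simp: Eb_def)
    have "cr v (\<psi> (Lv e) - z) ~= 0" "cr v (\<psi> (Rv e) - z) ~= 0"
      using z Lv_D[OF e(1)] Rv_D[OF e(1)] by (auto simp: generic_pt_def)
    then show ?thesis using F[of "co e + \<kappa> e" "co e"] unfolding psi_Lv[OF e(1)] psi_Rv[OF e(1)] e(2) by blast
  qed
  have s: "(\<Sum>e\<in>Eb i. F (co e)) = (\<Sum>e\<in>Eb i. F (co (rb e)))" by (rule sum_rb[symmetric])
  have "(\<Sum>e\<in>Eb i. crossing v z (\<psi> (Lv e)) (\<psi> (Rv e))) = (\<Sum>e\<in>Eb i. F (co (rb e)) - F (co e + \<kappa> e))"
    using c s by (simp add: sum_subtractf)
  also have "\<dots> = (\<Sum>e\<in>Eb i. if rb e = a then F 0 - F 1 else 0)"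
    by (rule sum.cong) (use co_rb co_last co_a in \<open>auto simp: Eb_def\<close>)
  also have "\<dots> = (if i = b0 then F 0 - F 1 else 0)"
  proof (cases "i = b0")
    case False
    then have "rb e ~= a" if "e \<in> Eb i" for e using that fst_rb[of e] by (auto simp: Eb_def)
    then show ?thesis using False by simp
  next
    case True
    obtain e where e: "e \<in> Eb i" "rb e = a"
      using bij_betw_imp_surj_on[OF bij_rb[of i]] True a_edge by (metis (mono_tags, lifting) Eb_def imageE mem_Collect_eq)
    have "(\<Sum>x\<in>Eb i. if rb x = a then F 0 - F 1 else 0) = (\<Sum>x\<in>Eb i. if x = e then F 0 - F 1 else 0)"
      by (rule sum.cong) (use e inj_rots(1) in \<open>auto simp: inj_eq\<close>)
    then show ?thesis using e finite_Eb True by simp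
  qed
  finally have sF: "(\<Sum>e\<in>Eb i. crossing v z (\<psi> (Lv e)) (\<psi> (Rv e))) = (if i = b0 then F 0 - F 1 else 0)" .
  have "F 0 - F 1 = crossing v z (r m) (r 0)" if "i = b0"
  proof -
    have *: "base_pt i + of_real 1 * g i = r m" "base_pt i + of_real 0 * g i = r 0"
      using that by (simp_all add: base_b0 g_b0)
    have "cr v (r m - z) ~= 0" "cr v (r 0 - z) ~= 0"
      using z Outer_D[of m] Outer_D[of 0] psi_outer[of m] base by (auto simp: generic_pt_def)
    then show ?thesis using F[of 1 0] unfolding * by simp
  qed
  then show ?thesis unfolding sF by simp
qed

text \<open>Summing the winding numbers of all polygons, every dual edge is used once. Grouped by
  black vertices these contributions reduce to the closing side of \<open>Q\<close>, and the
  remaining sides of \<open>Q\<close> come from the outer white vertices: the total is the winding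
  number of \<open>Q\<close>.\<close>

lemma sum_tiles:
  assumes v: "generic_dir v" and z: "generic_pt v z"
  shows "(\<Sum>j<n. if z \<in> tile j then orient j else 0) = (if z \<in> Q.tile then Q.orient else 0)"
proof -
  have tile_sum: "(if z \<in> tile j then orient j else 0) = (\<Sum>l<dP j. crossing v z (P j l) (P j (Suc l)))" if j: "j < n" for j
  proof -
    interpret C: cyclic_polygon "P j" "dP j" by (rule polygon[OF j])
    have sd: "C.side l = P j (Suc l) - P j l" for l by (simp add: C.side_def)
    show ?thesis unfolding tile_def
    proof (rule C.sum_crossing[symmetric])
      fix l
      show "cr v (C.side l) ~= 0"
        using P_side_cases[OF j, of l] v unfolding sd generic_dir_def Ew_def
        by (elim disjE bexE exE conjE) (simp_all only: cr_simps neg_equal_0_iff_equal, simp_all)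
      show "cr v (P j l - z) ~= 0" using P_D[OF j, of l] z by (auto simp: generic_pt_def)
      assume l: "l < dP j"
      show "cr (C.side l) (z - P j l) ~= 0"
      proof (cases "l < N j")
        case True
        have "cr (T (xs j l)) (z - \<psi> (Rv (xs j l))) ~= 0" using z xs_E(1)[OF j] by (simp add: generic_pt_def)
        moreover have "P j l = \<psi> (Rv (xs j l)) + T (xs j l)"
          using P_edge(1)[OF j disjI1[OF True]] psi_diff[OF xs_E(1)[OF j], of l] by (simp add: algebra_simps)
        ultimately show ?thesis unfolding sd P_side_edge[OF j disjI1[OF True]] by simp
      next
        case False
        then have jO: "j \<in> snd ` Out" "l = N j" using l by (auto simp: dP_def less_Suc_eq split: if_splits)
        then obtain k where k: "k < m" "j = snd (oe k)" by (metis outer_white_cases)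
        show ?thesis unfolding sd jO(2) P_side_outer[OF k] unfolding P_outer(1)[OF k] using z k(1) by (simp add: generic_pt_def)
      qed
    qed
  qed
  have "(\<Sum>j<n. if z \<in> tile j then orient j else 0) = (\<Sum>j<n. (\<Sum>e\<in>Ew j. crossing v z (\<psi> (Lv e)) (\<psi> (Rv e)))
    + (\<Sum>k<m. if snd (oe k) = j then crossing v z (r k) (r (Suc k)) else 0))"
    by (rule sum.cong) (simp_all add: tile_sum sum_sides[of _ "crossing v z"])
  also have "\<dots> = (\<Sum>e\<in>E. crossing v z (\<psi> (Lv e)) (\<psi> (Rv e)))
    + (\<Sum>k<m. \<Sum>j<n. if snd (oe k) = j then crossing v z (r k) (r (Suc k)) else 0)"
    unfolding sum.distrib sum_over_whites by (subst (2) sum.swap) simp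
  also have "(\<Sum>k<m. \<Sum>j<n. if snd (oe k) = j then crossing v z (r k) (r (Suc k)) else 0) = (\<Sum>k<m. crossing v z (r k) (r (Suc k)))"
    by (rule sum.cong) (use outer_j in auto)
  also have "(\<Sum>e\<in>E. crossing v z (\<psi> (Lv e)) (\<psi> (Rv e))) = (\<Sum>i<n. if i = b0 then crossing v z (r m) (r 0) else 0)"
    unfolding sum_over_blacks by (rule sum.cong) (simp_all add: sum_crossing_black[OF v z])
  also have "\<dots> = crossing v z (r m) (r 0)" using b0_n by simp
  also have "crossing v z (r m) (r 0) + (\<Sum>k<m. crossing v z (r k) (r (Suc k)))
    = (\<Sum>l<Suc m. crossing v z (r (l mod Suc m)) (r (Suc l mod Suc m)))" by simp
  also have "\<dots> = (if z \<in> Q.tile then Q.orient else 0)"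
  proof (rule Q.sum_crossing)
    have vm: "cr v (g b0) ~= 0" using v a_edge by (auto simp: generic_dir_def cr_T)
    fix l
    show "cr v (r (l mod Suc m) - z) ~= 0"
      using z Outer_D[of "l mod Suc m"] psi_outer[of "l mod Suc m"] by (auto simp: generic_pt_def less_Suc_eq_le[symmetric])
    assume l: "l < Suc m"
    show "cr v (Q.side l) ~= 0"
      using v vm l by (cases "l = m") (auto simp: Q_side Q_side_m generic_dir_def)
    show "cr (Q.side l) (z - r (l mod Suc m)) ~= 0"
    proof (cases "l = m")
      case True
      have "cr (T a) (z - r 0) ~= 0" using z a_edge Rv_outer[OF m_pos] base by (auto simp: generic_pt_def)
      then have "cr (g b0) (z - r 0) ~= 0" by (auto simp: T_def)
      moreover have "cr (g b0) (z - r m) = cr (g b0) (z - r 0) - cr (g b0) (r m - r 0)" by simp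
      moreover have "cr (g b0) (r m - r 0) = 0" unfolding g_b0 by (rule cr_simps(13))
      ultimately have "cr (g b0) (z - r m) ~= 0" by linarith
      then show ?thesis using True by (simp add: Q_side_m)
    next
      case False
      then show ?thesis using z l by (simp add: Q_side generic_pt_def)
    qed
  qed
  finally show ?thesis .
qed

lemma open_tile: "j < n ==> open (tile j)" and convex_tile: "j < n ==> convex (tile j)"
  and bounded_tile: "j < n ==> bounded (tile j)" and tile_nonempty: "j < n ==> tile j ~= {}"
  unfolding tile_def
  using cyclic_polygon.open_tile[OF polygon] cyclic_polygon.convex_tile[OF polygon]
    cyclic_polygon.bounded_tile[OF polygon] cyclic_polygon.tile_nonempty[OF polygon] by auto

lemma generic_dir_exists: obtains v where "generic_dir v" "v ~= 0"
proof (rule generic_dir_perturb[of 1 "{}" True])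
  fix v assume "generic_dir v" "cr v 1 ~= 0"
  moreover from this have "v ~= 0" by (metis cr_simps(11))
  ultimately show thesis using that[of v] by blast
qed auto

text \<open>With equal orientations the signed sum is a true count. A generic point of one
  particular tile makes the count positive, which fixes the common orientation to be that of
  \<open>Q\<close>.\<close>

lemma count_tiles:
  assumes v: "generic_dir v" and z: "generic_pt v z"
  shows "card {j. j < n \<and> z \<in> tile j} = (if z \<in> Q.tile then 1 else 0)" and "j < n ==> orient j = Q.orient"
proof -
  define \<epsilon> where "\<epsilon> = orient 0"
  have n0: "0 < n" using b0_n by simp
  have o: "orient j = \<epsilon>" if "j < n" for j using orient_const[OF that n0] by (simp add: \<epsilon>_def)
  have e1: "\<epsilon> = 1 \<or> \<epsilon> = - 1" using orient_cases[OF n0] by (simp add: \<epsilon>_def)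
  have S: "\<epsilon> * real (card {j. j < n \<and> z \<in> tile j}) = (if z \<in> Q.tile then Q.orient else 0)" if z: "generic_pt v z" for z
  proof -
    have "(\<Sum>j<n. if z \<in> tile j then orient j else 0) = (\<Sum>j<n. if z \<in> tile j then \<epsilon> else 0)"
      by (rule sum.cong) (simp_all add: o)
    also have "\<dots> = \<epsilon> * real (card {j. j < n \<and> z \<in> tile j})"
      by (simp add: sum.If_cases Int_def)
    finally show ?thesis using sum_tiles[OF v z] by simp
  qed
  have v0: "v ~= 0" using v a_edge by (auto simp: generic_dir_def)
  obtain z0 where z0: "z0 \<in> tile 0" "generic_pt v z0"
    by (rule generic_pt_exists[OF v0 open_tile[OF n0] tile_nonempty[OF n0]])
  define c where "c = card {j. j < n \<and> z0 \<in> tile j}"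
  have "0 < c" using z0 n0 by (auto simp: card_gt_0_iff c_def)
  then have "\<epsilon> = Q.orient" using S[OF z0(2), folded c_def] Q.orient_cases e1 by (auto split: if_splits)
  then show "j < n ==> orient j = Q.orient" using o by simp
  show "card {j. j < n \<and> z \<in> tile j} = (if z \<in> Q.tile then 1 else 0)"
    using S[OF z] \<open>\<epsilon> = Q.orient\<close> e1 by (auto split: if_splits)
qed

lemma tiles_disjoint: "j < n ==> j' < n ==> j ~= j' ==> tile j \<inter> tile j' = {}"
proof (rule ccontr)
  assume j: "j < n" "j' < n" "j ~= j'" and ne: "tile j \<inter> tile j' ~= {}"
  obtain v where v: "generic_dir v" "v ~= 0" by (rule generic_dir_exists)
  obtain z where z: "z \<in> tile j \<inter> tile j'" "generic_pt v z"
    by (rule generic_pt_exists[OF v(2) open_Int[OF open_tile[OF j(1)] open_tile[OF j(2)]] ne])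
  have "card {j, j'} \<le> card {j. j < n \<and> z \<in> tile j}" by (rule card_mono) (use j z in auto)
  also have "\<dots> \<le> 1" using count_tiles(1)[OF v(1) z(2)] by simp
  finally show False using j by simp
qed

definition Qtile :: "complex set" where "Qtile = Q.tile"
definition Qhull :: "complex set" where "Qhull = closure Qtile"

lemma tile_subset: "j < n ==> tile j \<subseteq> Qhull"
proof (rule ccontr)
  assume j: "j < n" and "\<not> tile j \<subseteq> Qhull"
  then have ne: "tile j - Qhull ~= {}" by blast
  have op: "open (tile j - Qhull)" using open_tile[OF j] by (simp add: open_Diff Qhull_def)
  obtain v where v: "generic_dir v" "v ~= 0" by (rule generic_dir_exists)
  obtain z where z: "z \<in> tile j - Qhull" "generic_pt v z" by (rule generic_pt_exists[OF v(2) op ne])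
  then have "z \<notin> Q.tile" using closure_subset by (auto simp: Qhull_def Qtile_def)
  then have "card {j. j < n \<and> z \<in> tile j} = 0" using count_tiles(1)[OF v(1) z(2)] by simp
  then show False using z(1) j by simp
qed

text \<open>An uncovered part of \<open>Qtile\<close> would be open and contain a generic point
  lying in no tile.\<close>

lemma Qhull_eq: "Qhull = (\<Union>j<n. closure (tile j))"
proof
  show "(\<Union>j<n. closure (tile j)) \<subseteq> Qhull"
    using tile_subset by (auto simp: Qhull_def intro: closure_minimal[THEN subsetD])
  have cl: "closed (\<Union>j<n. closure (tile j))" by (intro closed_UN) auto
  have "Qtile \<subseteq> (\<Union>j<n. closure (tile j))"
  proof (rule ccontr)
    assume "\<not> Qtile \<subseteq> (\<Union>j<n. closure (tile j))"
    then have ne: "Qtile - (\<Union>j<n. closure (tile j)) ~= {}" by blast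
    have op: "open (Qtile - (\<Union>j<n. closure (tile j)))" using Q.open_tile cl by (simp add: open_Diff Qtile_def)
    obtain v where v: "generic_dir v" "v ~= 0" by (rule generic_dir_exists)
    obtain z where z: "z \<in> Qtile - (\<Union>j<n. closure (tile j))" "generic_pt v z" by (rule generic_pt_exists[OF v(2) op ne])
    have "card {j. j < n \<and> z \<in> tile j} = 1" using count_tiles(1)[OF v(1) z(2)] z(1) by (simp add: Qtile_def)
    then obtain j where "j < n" "z \<in> tile j" by (metis (mono_tags, lifting) card_1_singletonE insertI1 mem_Collect_eq)
    then show False using z(1) closure_subset by blast
  qed
  then show "Qhull \<subseteq> (\<Union>j<n. closure (tile j))" unfolding Qhull_def by (rule closure_minimal[OF _ cl])
qed

end

context drawn_graph
begin

interpretation Q: cyclic_polygon "\<lambda>j. r (j mod Suc m)" "Suc m" by (rule outer_polygon)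

section \<open>The segments of the black vertices\<close>

definition seg :: "nat \<times> nat => complex set" where
  "seg e = closed_segment (\<psi> (Rv e)) (\<psi> (Lv e))"

definition pt :: "nat => real => complex" where "pt i s = base_pt i + of_real s * g i"

definition coords :: "nat => real set" where "coords i = co ` Eb i \<union> (\<lambda>e. co e + \<kappa> e) ` Eb i"

definition lo :: "nat => real" where "lo i = Min (coords i)"
definition hi :: "nat => real" where "hi i = Max (coords i)"

definition Lseg :: "nat => complex set" where "Lseg i = open_segment (pt i (lo i)) (pt i (hi i))"

lemma coords: "finite (coords i)" "i < n ==> coords i ~= {}"
  using finite_Eb Eb_nonempty by (auto simp: coords_def)

lemma lo_in: "i < n ==> lo i \<in> coords i" and hi_in: "i < n ==> hi i \<in> coords i"
  using coords by (simp_all add: lo_def hi_def)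

lemma lo_le: "t \<in> coords i ==> lo i \<le> t" and le_hi: "t \<in> coords i ==> t \<le> hi i"
  using coords by (simp_all add: lo_def hi_def)

lemma coords_edge: "e \<in> E ==> co e \<in> coords (fst e)" "e \<in> E ==> co e + \<kappa> e \<in> coords (fst e)"
  by (auto simp: coords_def Eb_def)

lemma coords_cases:
  assumes "t \<in> coords i"
  obtains e where "e \<in> E" "fst e = i" "t = co e \<or> t = co e + \<kappa> e"
  using assms unfolding coords_def Eb_def by blast

lemma lo_less_hi: "i < n ==> lo i < hi i"
proof -
  assume i: "i < n"
  then obtain e where e: "e \<in> E" "fst e = i" using Eb_nonempty[of i] by (auto simp: Eb_def)
  have "lo i \<le> co e" "lo i \<le> co e + \<kappa> e" "co e \<le> hi i" "co e + \<kappa> e \<le> hi i"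
    using coords_edge[OF e(1)] e(2) lo_le le_hi by auto
  then show ?thesis using \<kappa>_nonzero[OF e(1)] by linarith
qed

lemma pt_inj: "i < n ==> pt i s = pt i t \<longleftrightarrow> s = t"
  using line_coord_eq by (simp add: pt_def)

lemma psi_pt: "e \<in> E ==> \<psi> (Rv e) = pt (fst e) (co e)" "e \<in> E ==> \<psi> (Lv e) = pt (fst e) (co e + \<kappa> e)"
  by (simp_all only: psi_Rv psi_Lv pt_def)

lemma pt_comb: "(1 - u) *\<^sub>R pt i s + u *\<^sub>R pt i t = pt i (s + u * (t - s))"
  by (simp add: pt_def scaleR_conv_of_real algebra_simps)

lemma pt_add: "pt i s + of_real c * g i = pt i (s + c)"
  by (simp add: pt_def algebra_simps)

lemma closed_segment_pt:
  assumes "s ~= t"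
  shows "closed_segment (pt i s) (pt i t) = pt i ` closed_segment s t"
proof (intro equalityI subsetI)
  fix z assume "z \<in> closed_segment (pt i s) (pt i t)"
  then obtain u where u: "0 \<le> u" "u \<le> 1" "z = pt i (s + u * (t - s))" by (auto simp: in_segment pt_comb)
  moreover have "s + u * (t - s) \<in> closed_segment s t"
    unfolding in_segment using u by (intro exI[of _ u]) (simp add: algebra_simps)
  ultimately show "z \<in> pt i ` closed_segment s t" by blast
next
  fix z assume "z \<in> pt i ` closed_segment s t"
  then obtain u where "0 \<le> u" "u \<le> 1" "z = pt i ((1 - u) *\<^sub>R s + u *\<^sub>R t)" by (auto simp: in_segment)
  then show "z \<in> closed_segment (pt i s) (pt i t)"
    unfolding in_segment pt_comb by (intro exI[of _ u]) (simp add: algebra_simps)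
qed

lemma closed_segment_pt': "s \<le> t ==> closed_segment (pt i s) (pt i t) = pt i ` {s..t}"
  by (cases "s = t") (simp_all add: closed_segment_pt closed_segment_eq_real_ivl)

lemma open_segment_pt:
  assumes "s < t" "i < n"
  shows "open_segment (pt i s) (pt i t) = pt i ` {s<..<t}"
proof -
  have "open_segment (pt i s) (pt i t) = pt i ` {s..t} - {pt i s, pt i t}"
    unfolding open_segment_def using closed_segment_pt'[of s t i] assms by simp
  also have "\<dots> = pt i ` ({s..t} - {s, t})"
    using pt_inj[OF assms(2)] by auto
  also have "{s..t} - {s, t} = {s<..<t}" by auto
  finally show ?thesis .
qed

lemma Lseg_eq: "i < n ==> Lseg i = pt i ` {lo i<..<hi i}"
  unfolding Lseg_def by (rule open_segment_pt[OF lo_less_hi])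

lemma pt_in_Lseg: "i < n ==> pt i s \<in> Lseg i \<longleftrightarrow> lo i < s \<and> s < hi i"
  using pt_inj by (auto simp: Lseg_eq)

lemma closure_Lseg: "i < n ==> closure (Lseg i) = pt i ` {lo i..hi i}"
  using lo_less_hi[of i] pt_inj[of i "lo i" "hi i"] by (simp add: Lseg_def closure_open_segment closed_segment_pt')

lemma seg_pt: "e \<in> E ==> seg e = pt (fst e) ` closed_segment (co e) (co e + \<kappa> e)"
  unfolding seg_def psi_pt by (rule closed_segment_pt) (use \<kappa>_nonzero in simp)

lemma seg_subset_closure: "e \<in> E ==> seg e \<subseteq> closure (Lseg (fst e))"
proof -
  assume e: "e \<in> E"
  have "closed_segment (co e) (co e + \<kappa> e) \<subseteq> {lo (fst e)..hi (fst e)}"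
    by (rule closed_segment_subset) (use coords_edge[OF e] lo_le le_hi in auto)
  then show ?thesis using E_bounds[OF e] by (auto simp: seg_pt[OF e] closure_Lseg)
qed

lemma seg_interior:
  assumes e: "e \<in> E" and p: "p \<in> seg e" "p ~= \<psi> (Rv e)" "p ~= \<psi> (Lv e)"
  obtains u where "0 < u" "u < 1" "p = pt (fst e) (co e + u * \<kappa> e)" "p \<in> Lseg (fst e)"
proof -
  have i: "fst e < n" using E_bounds[OF e] by simp
  obtain u where u: "0 \<le> u" "u \<le> 1" "p = pt (fst e) (co e + u * \<kappa> e)"
    using p(1) unfolding seg_def psi_pt[OF e] in_segment pt_comb by auto
  have u01: "u ~= 0" "u ~= 1" using p(2,3) u(3) psi_pt[OF e] by auto
  have "lo (fst e) \<le> co e" "lo (fst e) \<le> co e + \<kappa> e" "co e \<le> hi (fst e)" "co e + \<kappa> e \<le> hi (fst e)"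
    using coords_edge[OF e] lo_le le_hi by auto
  moreover have "0 < \<kappa> e ==> 0 < u * \<kappa> e \<and> u * \<kappa> e < \<kappa> e" using u u01 by simp
  moreover have "\<kappa> e < 0 ==> u * \<kappa> e < 0 \<and> \<kappa> e < u * \<kappa> e" using u u01 by (simp add: mult_less_0_iff)
  moreover have "\<kappa> e ~= 0" using \<kappa>_nonzero[OF e] .
  ultimately have "lo (fst e) < co e + u * \<kappa> e \<and> co e + u * \<kappa> e < hi (fst e)" by linarith
  then have "p \<in> Lseg (fst e)" using u(3) pt_in_Lseg[OF i] by simp
  then show ?thesis using that u u01 by (metis less_eq_real_def)
qed

text \<open>A discrete intermediate value argument: an uncovered \<open>t\<close> would leave every
  dual edge on one side, and consecutive dual edges share an end, so all of them would be on the
  same side of \<open>t\<close>.\<close>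

lemma segs_cover:
  assumes i: "i < n" and t: "lo i \<le> t" "t \<le> hi i"
  shows "\<exists>e\<in>Eb i. t \<in> closed_segment (co e) (co e + \<kappa> e)"
proof (rule ccontr)
  assume no: "\<not> ?thesis"
  have side: "co e ~= t \<and> co e + \<kappa> e ~= t \<and> (co e < t \<longleftrightarrow> co e + \<kappa> e < t)" if "e \<in> Eb i" for e
  proof -
    have "t \<notin> closed_segment (co e) (co e + \<kappa> e)" using no that by blast
    then show ?thesis unfolding closed_segment_eq_real_ivl by (auto split: if_splits)
  qed
  obtain e0 where e0: "e0 \<in> Eb i" using Eb_nonempty[OF i] by blast
  have c: "(co e < t) = (co e0 < t)" if "e \<in> Eb i" for e
  proof (rule black_const[where g = "\<lambda>e. co e < t" and ?x0.0 = "inv_into UNIV rb a"])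
    fix x assume x: "x \<in> E" "fst x = fst e" "x ~= inv_into UNIV rb a"
    then have "rb x ~= a" using inj_rots(1) by (metis inv_f_f)
    then have "co (rb x) = co x + \<kappa> x" using co_rb x by blast
    then show "(co (rb x) < t) = (co x < t)" using side[of x] x that by (simp add: Eb_def)
  qed (use that e0 in \<open>auto simp: Eb_def\<close>)
  have "(s < t) = (co e0 < t) \<and> s ~= t" if "s \<in> coords i" for s
    using that unfolding coords_def using c side by auto
  from this[OF lo_in[OF i]] this[OF hi_in[OF i]] show False using t by linarith
qed

lemma Union_seg: "i < n ==> (\<Union>e\<in>Eb i. seg e) = closure (Lseg i)"
proof
  assume i: "i < n"
  show "(\<Union>e\<in>Eb i. seg e) \<subseteq> closure (Lseg i)" using seg_subset_closure by (auto simp: Eb_def)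
  show "closure (Lseg i) \<subseteq> (\<Union>e\<in>Eb i. seg e)"
  proof
    fix z assume "z \<in> closure (Lseg i)"
    then obtain t where t: "z = pt i t" "lo i \<le> t" "t \<le> hi i" by (auto simp: closure_Lseg[OF i])
    obtain e where e: "e \<in> Eb i" "t \<in> closed_segment (co e) (co e + \<kappa> e)" using segs_cover[OF i t(2,3)] by blast
    then have "z \<in> seg e" using t(1) by (simp add: seg_pt Eb_def)
    then show "z \<in> (\<Union>e\<in>Eb i. seg e)" using e by blast
  qed
qed

lemma dual_segment_eq: "i < n ==> dual_segment G a \<psi> i = Lseg i"
proof -
  assume i: "i < n"
  have "(\<Union>e \<in> {e \<in> E. fst e = i}. closed_segment (\<psi> (Rv e)) (\<psi> (Lv e))) = closed_segment (pt i (lo i)) (pt i (hi i))"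
    using Union_seg[OF i] closure_Lseg[OF i] closed_segment_pt'[of "lo i" "hi i" i] lo_less_hi[OF i]
    by (simp add: seg_def Eb_def)
  then show ?thesis
    unfolding dual_segment_def Lseg_def using pt_inj[OF i] lo_less_hi[OF i]
    by (simp add: rel_interior_closed_segment)
qed

text \<open>At a straight corner two dual edges with the same sign of \<open>\<kappa>\<close> follow
  each other, so their common end has coordinates of the segment on both sides.\<close>

lemma straight_corner:
  assumes x: "x \<in> E" "\<phi> x ~= a" "straight x"
  shows "\<psi> (Rv (\<phi> x)) \<in> Lseg (fst (\<phi> x))"
proof -
  let ?e = "rw x" and ?i = "fst (\<phi> x)"
  have e: "?e \<in> E" "\<phi> x \<in> E" "fst ?e = ?i" using x rw_in phi_in fst_phi by auto
  have i: "?i < n" using E_bounds e by blast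
  have co: "co (\<phi> x) = co ?e + \<kappa> ?e" using co_rb[OF e(1)] x(2) by (simp add: phi_eq)
  have "\<kappa> ?e ~= 0" "\<kappa> (\<phi> x) ~= 0" using \<kappa>_nonzero e by auto
  moreover have "0 < \<kappa> ?e \<longleftrightarrow> 0 < \<kappa> (\<phi> x)" using x(3) by (simp add: straight_def)
  moreover have "lo ?i \<le> co ?e" "co ?e \<le> hi ?i" "lo ?i \<le> co (\<phi> x) + \<kappa> (\<phi> x)" "co (\<phi> x) + \<kappa> (\<phi> x) \<le> hi ?i"
    using coords_edge[OF e(1)] coords_edge[OF e(2)] e(3) lo_le le_hi by auto
  ultimately have "lo ?i < co (\<phi> x)" "co (\<phi> x) < hi ?i" using co by linarith+
  then show ?thesis using psi_pt(1)[OF e(2)] pt_in_Lseg[OF i] by simp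
qed

text \<open>The coordinates move around a cycle, and at an extreme value the direction of motion
  reverses. The two extremes give two different turns, and there are no more.\<close>

lemma turnbacks_ends:
  assumes i: "i < n" "i ~= b0"
  shows "(\<lambda>e. co (rb e)) ` turnbacks i = {lo i, hi i}"
proof -
  have rba: "rb e ~= a" if "e \<in> Eb i" for e using that i(2) fst_rb[of e] by (auto simp: Eb_def)
  have ro: "co (rb e) = co e + \<kappa> e" if "e \<in> Eb i" for e using co_rb[of e] rba[OF that] that by (simp add: Eb_def)
  have surj: "\<exists>e\<in>Eb i. co (rb e) = t" if "t \<in> coords i" for t
  proof -
    consider x where "x \<in> Eb i" "t = co x" | x where "x \<in> Eb i" "t = co x + \<kappa> x"
      using \<open>t \<in> coords i\<close> unfolding coords_def by blast
    then show ?thesis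
    proof cases
      case 1
      then obtain e where "e \<in> Eb i" "x = rb e" using bij_betw_imp_surj_on[OF bij_rb[of i]] by blast
      then show ?thesis using 1 by blast
    next
      case 2
      then show ?thesis using ro by metis
    qed
  qed
  have rE: "rb e \<in> E" "fst (rb e) = i" "e \<in> E" "fst e = i" if "e \<in> Eb i" for e using that by (auto simp: Eb_def rb_in)
  have bd: "lo i \<le> co e" "co e \<le> hi i" "lo i \<le> co (rb e) + \<kappa> (rb e)" "co (rb e) + \<kappa> (rb e) \<le> hi i" if "e \<in> Eb i" for e
    using rE[OF that] coords_edge[of e] coords_edge[of "rb e"] lo_le le_hi by auto
  obtain e1 where e1: "e1 \<in> Eb i" "co (rb e1) = lo i" using surj[OF lo_in[OF i(1)]] by blast
  obtain e2 where e2: "e2 \<in> Eb i" "co (rb e2) = hi i" using surj[OF hi_in[OF i(1)]] by blast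
  have nz: "\<kappa> e1 ~= 0" "\<kappa> (rb e1) ~= 0" "\<kappa> e2 ~= 0" "\<kappa> (rb e2) ~= 0" using \<kappa>_nonzero rE e1 e2 by blast+
  have "\<not> 0 < \<kappa> e1" "0 < \<kappa> (rb e1)" using bd[OF e1(1)] ro[OF e1(1)] e1(2) nz by linarith+
  then have t1: "e1 \<in> turnbacks i" using e1 by (simp add: turnbacks_def)
  have "0 < \<kappa> e2" "\<not> 0 < \<kappa> (rb e2)" using bd[OF e2(1)] ro[OF e2(1)] e2(2) nz by linarith+
  then have t2: "e2 \<in> turnbacks i" using e2 by (simp add: turnbacks_def)
  have ne: "e1 ~= e2" using e1 e2 lo_less_hi[OF i(1)] by auto
  have "card (turnbacks i) = 2" using corner_counts(1)[OF i(1)] i(2) by simp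
  moreover have "finite (turnbacks i)" using finite_Eb by (simp add: turnbacks_def)
  ultimately have "turnbacks i = {e1, e2}"
    using card_seteq[of "turnbacks i" "{e1, e2}"] t1 t2 ne by simp
  then show ?thesis using e1 e2 by simp
qed

lemma turnback_corner:
  assumes x: "x \<in> E" "\<phi> x ~= a" "\<not> straight x"
  shows "fst (\<phi> x) ~= b0" "\<psi> (Rv (\<phi> x)) = pt (fst (\<phi> x)) (lo (fst (\<phi> x))) \<or> \<psi> (Rv (\<phi> x)) = pt (fst (\<phi> x)) (hi (fst (\<phi> x)))"
proof -
  let ?e = "rw x" and ?i = "fst (\<phi> x)"
  have e: "?e \<in> E" "\<phi> x \<in> E" "fst ?e = ?i" using x rw_in phi_in fst_phi by auto
  have i: "?i < n" using E_bounds e by blast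
  show nb: "?i ~= b0"
    using \<kappa>_b0_pos[of ?e] \<kappa>_b0_pos[of "\<phi> x"] e x(3) by (auto simp: straight_def Eb_def)
  have "?e \<in> turnbacks ?i" using x(3) e by (simp add: turnbacks_def straight_def Eb_def phi_eq)
  then have "co (\<phi> x) \<in> {lo ?i, hi ?i}" using turnbacks_ends[OF i nb] by (auto simp: phi_eq)
  then show "\<psi> (Rv (\<phi> x)) = pt ?i (lo ?i) \<or> \<psi> (Rv (\<phi> x)) = pt ?i (hi ?i)"
    using psi_pt(1)[OF e(2)] by auto
qed

lemma rb_surj:
  assumes "x \<in> E" obtains y where "y \<in> E" "rb y = x"
proof -
  have "x \<in> rb ` E" unfolding bij_betw_imp_surj_on[OF bij_rb_E] by (rule assms)
  then show ?thesis using that by (elim imageE) simp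
qed

lemma rw_surj:
  assumes "x \<in> Ew j" obtains y where "y \<in> Ew j" "rw y = x"
proof -
  have "x \<in> rw ` Ew j" unfolding bij_betw_imp_surj_on[OF bij_rw] by (rule assms)
  then show ?thesis using that by (elim imageE) simp
qed

lemma phi_surj:
  assumes "F \<in> faces G" "x \<in> F" obtains y where "y \<in> F" "\<phi> y = x"
proof -
  have "x \<in> \<phi> ` F" unfolding bij_betw_imp_surj_on[OF bij_phi[OF assms(1)]] by (rule assms)
  then show ?thesis using that by (elim imageE) simp
qed

text \<open>At \<open>b0\<close> all steps go in the positive direction, so the least coordinate is
  that of \<open>a\<close>, where the rotation is cut, and the greatest is reached just before
  returning to it.\<close>

lemma lo_b0: "lo b0 = 0" and hi_b0: "hi b0 = 1"
proof -
  obtain el where el: "el \<in> E" "rb el = a"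
    by (rule rb_surj[OF a_edge])
  have el_b0: "fst el = b0" using fst_rb[OF el(1)] el(2) by simp
  have pos: "0 < \<kappa> e" if "e \<in> E" "fst e = b0" for e using \<kappa>_b0_pos that by (simp add: Eb_def)
  obtain s where s: "s \<in> E" "fst s = b0" "lo b0 = co s \<or> lo b0 = co s + \<kappa> s"
    by (rule coords_cases[OF lo_in[OF b0_n]])
  have "lo b0 \<le> co s" using lo_le coords_edge(1)[OF s(1)] s(2) by simp
  then have ls: "lo b0 = co s" using s(3) pos[OF s(1,2)] by auto
  have "s = a"
  proof (rule ccontr)
    assume "s ~= a"
    obtain x where x: "x \<in> E" "rb x = s" by (rule rb_surj[OF s(1)])
    have "co s = co x + \<kappa> x" using co_rb[OF x(1)] x(2) \<open>s ~= a\<close> by simp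
    moreover have "fst x = b0" using fst_rb[OF x(1)] x(2) s(2) by simp
    ultimately show False using ls pos[OF x(1)] lo_le[OF coords_edge(1)[OF x(1)]] by simp
  qed
  then show "lo b0 = 0" using ls co_a by simp
  obtain t where t: "t \<in> E" "fst t = b0" "hi b0 = co t \<or> hi b0 = co t + \<kappa> t"
    by (rule coords_cases[OF hi_in[OF b0_n]])
  have "co t + \<kappa> t \<le> hi b0" using le_hi coords_edge(2)[OF t(1)] t(2) by simp
  then have ht: "hi b0 = co t + \<kappa> t" using t(3) pos[OF t(1,2)] by auto
  have "rb t = a"
  proof (rule ccontr)
    assume ra: "rb t ~= a"
    have rt: "rb t \<in> E" "fst (rb t) = b0" using t by (auto simp: rb_in)
    have "co (rb t) = co t + \<kappa> t" using co_rb[OF t(1) ra] .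
    then show False using ht pos[OF rt] le_hi[OF coords_edge(2)[OF rt(1)]] rt(2) by simp
  qed
  then show "hi b0 = 1" using ht co_last[OF t(1)] by simp
qed

lemma Lseg_b0: "Lseg b0 = open_segment (r 0) (r m)"
  by (simp add: Lseg_def lo_b0 hi_b0 pt_def base_b0 g_b0)

definition \<Lambda> :: "complex set" where "\<Lambda> = (\<Union>i<n. Lseg i)"
definition Rt :: "complex set" where "Rt = r ` {..m}"

lemma Lseg_subset: "i < n ==> Lseg i \<subseteq> \<Lambda>" by (auto simp: \<Lambda>_def)

lemma same_face: "x \<in> E ==> x \<notin> Out ==> y \<in> orbit \<phi> x ==> y \<in> E \<and> y \<notin> Out \<and> Rv y = Rv x"
proof -
  assume x: "x \<in> E" "x \<notin> Out" and y: "y \<in> orbit \<phi> x"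
  have F: "orbit \<phi> x \<in> faces G" using orbit_in_faces x by simp
  have ox: "orbit \<phi> y = orbit \<phi> x" "y \<in> E" using faceD[OF F y] by auto
  have "y \<notin> Out"
  proof
    assume "y \<in> Out"
    then have "orbit \<phi> x = Out" using faceD[OF Out_face] ox by metis
    then show False using x self_orbit by blast
  qed
  then show ?thesis using x ox by (simp add: Rv_inner)
qed

text \<open>Every inner face has a straight corner, and it lies in the open segment of the black
  vertex of that corner.\<close>

lemma inner_in_\<Lambda>:
  assumes x: "x \<in> E" "x \<notin> Out"
  shows "\<psi> (Rv x) \<in> \<Lambda>"
proof -
  have F: "orbit \<phi> x \<in> faces G" using orbit_in_faces x by simp
  obtain y where y: "y \<in> orbit \<phi> x" "straight y" using straight_exists[OF F] by blast
  have y': "y \<in> E" "y \<notin> Out" "Rv y = Rv x" using same_face[OF x y(1)] by auto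
  have "\<phi> y \<notin> Out" using Out_phi[OF y'(1)] y'(2) by simp
  then have "\<phi> y \<in> E" "\<phi> y ~= a" using y'(1) phi_in a_Out by metis+
  moreover have "Rv (\<phi> y) = Rv x" using same_face[OF x, of "\<phi> y"] y(1) orbit.step by metis
  ultimately have "\<psi> (Rv x) \<in> Lseg (fst (\<phi> y))" using straight_corner[OF y'(1) _ y(2)] by simp
  then show ?thesis using Lseg_subset E_bounds(1)[OF \<open>\<phi> y \<in> E\<close>] by blast
qed

lemma dual_vertex_cases:
  assumes "d \<in> dual_vertices G a"
  obtains k where "k \<le> m" "d = Outer k" | x where "x \<in> E" "x \<notin> Out" "d = Rv x"
  using assms unfolding dual_vertices_def
proof
  assume "d \<in> Inner ` (faces G - {Out})"
  then obtain F where F: "d = Inner F" "F \<in> faces G" "F ~= Out" by blast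
  then obtain x where x: "x \<in> F" using face_nonempty by blast
  have "x \<notin> Out" using faceD[OF Out_face, of x] faceD[OF F(2) x] F(3) by metis
  then show ?thesis using that(2)[of x] faceD[OF F(2) x] F(1) by (simp add: Rv_inner)
next
  assume "d \<in> Outer ` {..m}"
  then show ?thesis using that(1) by blast
qed

lemma psi_in_\<Lambda>_Rt: "d \<in> dual_vertices G a ==> \<psi> d \<in> \<Lambda> \<union> Rt"
  by (erule dual_vertex_cases) (use psi_outer inner_in_\<Lambda> in \<open>auto simp: Rt_def\<close>)

lemma ends_dual:
  assumes i: "i < n" and t: "t = lo i \<or> t = hi i"
  shows "pt i t \<in> \<psi> ` dual_vertices G a"
proof -
  have "t \<in> coords i" using lo_in hi_in i t by blast
  then obtain e where "e \<in> E" "fst e = i" "t = co e \<or> t = co e + \<kappa> e" by (rule coords_cases)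
  then show ?thesis using psi_pt Rv_D Lv_D by (metis imageI)
qed

lemma closure_Lseg_subset: "i < n ==> closure (Lseg i) \<subseteq> \<Lambda> \<union> Rt"
proof
  fix z assume i: "i < n" and "z \<in> closure (Lseg i)"
  then obtain t where t: "z = pt i t" "lo i \<le> t" "t \<le> hi i" by (auto simp: closure_Lseg)
  show "z \<in> \<Lambda> \<union> Rt"
  proof (cases "t = lo i \<or> t = hi i")
    case True
    then obtain d where "d \<in> dual_vertices G a" "z = \<psi> d" using ends_dual[OF i True] t(1) by blast
    then show ?thesis using psi_in_\<Lambda>_Rt by blast
  next
    case False
    then have "z \<in> Lseg i" using t pt_in_Lseg[OF i] by simp
    then show ?thesis using Lseg_subset[OF i] by blast
  qed
qed

lemma frontier_tile:
  assumes j: "j < n"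
  shows "frontier (tile j) = (\<Union>e\<in>Ew j. seg e) \<union> (\<Union>k\<in>{k. k < m \<and> snd (oe k) = j}. closed_segment (r k) (r (Suc k)))"
proof -
  interpret C: cyclic_polygon "P j" "dP j" by (rule polygon[OF j])
  have s: "closed_segment (P j l) (P j (Suc l)) = seg (xs j l)" if "l < N j" for l
    using P_edge[OF j disjI1[OF that]] by (simp add: seg_def closed_segment_commute)
  have E: "(\<Union>l<N j. closed_segment (P j l) (P j (Suc l))) = (\<Union>e\<in>Ew j. seg e)"
  proof -
    have "(\<Union>l<N j. closed_segment (P j l) (P j (Suc l))) = (\<Union>l<N j. seg (xs j l))" using s by auto
    also have "\<dots> = (\<Union>e\<in>xs j ` {..<N j}. seg e)" by blast
    finally show ?thesis using bij_betw_imp_surj_on[OF xs_bij[OF j]] by simp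
  qed
  show ?thesis unfolding tile_def C.frontier_tile
  proof (cases "j \<in> snd ` Out")
    case True
    then obtain k where k: "k < m" "j = snd (oe k)" by (rule outer_white_cases)
    have "{i. i < m \<and> snd (oe i) = j} = {k}" using outer_white_distinct k by auto
    moreover have "{..<dP j} = insert (N j) {..<N j}" using dP_outer[OF k(1)] k(2) by auto
    ultimately show "(\<Union>l<dP j. closed_segment (P j l) (P j (Suc l))) = (\<Union>e\<in>Ew j. seg e) \<union>
      (\<Union>k\<in>{k. k < m \<and> snd (oe k) = j}. closed_segment (r k) (r (Suc k)))"
      using E P_outer[OF k] by auto
  next
    case False
    then have no: "{k. k < m \<and> snd (oe k) = j} = {}" using oe_Out by auto
    show "(\<Union>l<dP j. closed_segment (P j l) (P j (Suc l))) = (\<Union>e\<in>Ew j. seg e) \<union>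
      (\<Union>k\<in>{k. k < m \<and> snd (oe k) = j}. closed_segment (r k) (r (Suc k)))"
      unfolding no using E dP_inner[OF False] by simp
  qed
qed

lemma seg_frontier: "e \<in> E ==> seg e \<subseteq> frontier (tile (snd e))"
  using frontier_tile[of "snd e"] E_bounds[of e] by (auto simp: Ew_def)

lemma closed_Qhull: "closed Qhull" by (simp add: Qhull_def)

lemma seg_Qhull: "e \<in> E ==> seg e \<subseteq> Qhull"
  using seg_frontier[of e] E_bounds[of e] unfolding Qhull_eq frontier_def by blast

lemma closure_Lseg_Qhull: "i < n ==> closure (Lseg i) \<subseteq> Qhull"
  using Union_seg[of i] seg_Qhull unfolding Eb_def by blast

lemma closure_Lseg_edge:
  assumes "i < n" "p \<in> closure (Lseg i)"
  obtains e where "e \<in> E" "fst e = i" "p \<in> seg e"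
proof -
  have "p \<in> (\<Union>e\<in>Eb i. seg e)" using Union_seg assms by simp
  then show ?thesis using that unfolding Eb_def by blast
qed

lemma Qhull_level: "z \<in> Qhull ==> 0 \<le> Q.level l z"
  unfolding Qhull_def Qtile_def Q.closure_tile by (rule Q.closed_tileD)

text \<open>The line of a side of \<open>Q\<close> supports \<open>Q\<close>, so a segment in \<open>Q\<close> meets it only at an end or lies in it.\<close>

lemma Lseg_level_pos:
  assumes i: "i < n" and z: "z \<in> Lseg i" and np: "cr (Q.side l) (g i) ~= 0"
  shows "0 < Q.level l z"
proof (rule ccontr)
  assume "\<not> 0 < Q.level l z"
  obtain t where t: "z = pt i t" "lo i < t" "t < hi i" using z by (auto simp: Lseg_eq[OF i])
  have ends: "0 \<le> Q.level l (pt i (lo i))" "0 \<le> Q.level l (pt i (hi i))"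
  proof -
    have "pt i (lo i) \<in> closure (Lseg i)" "pt i (hi i) \<in> closure (Lseg i)"
      using lo_less_hi[OF i] by (auto simp: closure_Lseg[OF i])
    then show "0 \<le> Q.level l (pt i (lo i))" "0 \<le> Q.level l (pt i (hi i))"
      using Qhull_level closure_Lseg_Qhull[OF i] by blast+
  qed
  have e: "Q.level l (pt i s) = Q.level l z + (s - t) * (Q.orient * cr (Q.side l) (g i))" for s
    using Q.level_affine[of l z "of_real (s - t) * g i"] pt_add[of i t "s - t"] t(1)
    by (simp del: of_real_diff)
  define K where "K = Q.orient * cr (Q.side l) (g i)"
  have "0 \<le> (lo i - t) * K" "0 \<le> (hi i - t) * K"
    using ends[unfolded e, folded K_def] \<open>\<not> 0 < Q.level l z\<close> by linarith+
  then have "K = 0" using t(2,3) by (auto simp: zero_le_mult_iff)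
  then show False using np Q.orient_cases by (auto simp: K_def)
qed

text \<open>Among all pairs of a side of \<open>Q\<close> and a segment, the closing side and the
  segment of \<open>b0\<close> are the only parallel one.\<close>

lemma Q_side_parallel:
  assumes i: "i < n" and l: "l \<le> m" and c: "cr (Q.side l) (g i) = 0"
  shows "l = m \<and> i = b0"
proof (cases "l = m")
  case True
  then have "cr (g b0) (g i) = 0" using c by (simp add: Q_side_m)
  then show ?thesis using g_nonparallel[OF b0_n i] True by auto
next
  case False
  then have "l < m" using l by simp
  then have "cr (q l) (g i) = 0" using c by (simp add: Q_side)
  then show ?thesis using g_side[OF i \<open>l < m\<close>] cr_commute[of "q l" "g i"] by (simp add: q_def)
qed

lemma closed_side_level: "l \<le> m ==> z \<in> closed_segment (r l) (r (Suc l mod Suc m)) ==> Q.level l z = 0"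
proof -
  assume l: "l \<le> m" and "z \<in> closed_segment (r l) (r (Suc l mod Suc m))"
  then obtain u where "z = (1 - u) *\<^sub>R r (l mod Suc m) + u *\<^sub>R r (Suc l mod Suc m)" by (auto simp: in_segment)
  moreover have "Q.level l (r (l mod Suc m)) = 0" by (simp add: Q.level_def)
  moreover have "Q.level l (r (Suc l mod Suc m)) = 0" by (simp add: Q.level_Suc del: mod_Suc)
  ultimately show ?thesis by (simp only: Q.level_comb)
qed

lemma Lseg_side_disjoint:
  assumes i: "i < n" and l: "l \<le> m" and ne: "l ~= m \<or> i ~= b0"
  shows "Lseg i \<inter> closed_segment (r l) (r (Suc l mod Suc m)) = {}"
proof -
  have "cr (Q.side l) (g i) ~= 0" using Q_side_parallel[OF i l] ne by blast
  then show ?thesis using Lseg_level_pos[OF i] closed_side_level[OF l] by fastforce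
qed

lemma Rt_Lseg: "i < n ==> k \<le> m ==> r k \<notin> Lseg i"
proof
  assume i: "i < n" and k: "k \<le> m" and z: "r k \<in> Lseg i"
  show False
  proof (cases "k = m \<and> i = b0")
    case False
    then have "Lseg i \<inter> closed_segment (r k) (r (Suc k mod Suc m)) = {}" using Lseg_side_disjoint[OF i k] by blast
    then show False using z by auto
  next
    case True
    then show False using z by (simp add: Lseg_b0 open_segment_def)
  qed
qed

lemma Rt_\<Lambda>: "Rt \<inter> \<Lambda> = {}"
  using Rt_Lseg by (auto simp: Rt_def \<Lambda>_def)

lemma Lseg_Qtile: "i < n ==> i ~= b0 ==> Lseg i \<subseteq> Qtile"
proof
  fix z assume i: "i < n" "i ~= b0" and z: "z \<in> Lseg i"
  have "0 < Q.level l z" if "l < Suc m" for l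
    by (rule Lseg_level_pos[OF i(1) z]) (use Q_side_parallel[OF i(1), of l] i that in auto)
  then show "z \<in> Qtile" by (simp add: Qtile_def Q.tile_def)
qed

text \<open>Each point of a segment is on the frontier of some tile, and an open tile meeting the
  closure of another one would meet that one.\<close>

lemma tile_Lseg: "j < n ==> i < n ==> tile j \<inter> Lseg i = {}"
proof (rule ccontr)
  assume j: "j < n" and i: "i < n" and "tile j \<inter> Lseg i ~= {}"
  then obtain p where p: "p \<in> tile j" "p \<in> Lseg i" by blast
  then have "p \<in> closure (Lseg i)" using closure_subset by blast
  then obtain e where e: "e \<in> E" "fst e = i" "p \<in> seg e" by (rule closure_Lseg_edge[OF i])
  have j': "snd e < n" using E_bounds e by blast
  have pf: "p \<in> frontier (tile (snd e))" using seg_frontier e by blast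
  then have "p \<in> closure (tile (snd e))" by (simp add: frontier_def)
  then have "tile j \<inter> tile (snd e) ~= {}"
    using p(1) open_tile[OF j] open_Int_closure_eq_empty by blast
  then have "snd e = j" using tiles_disjoint[OF j j'] by blast
  then show False using pf p(1) open_tile[OF j] by (simp add: frontier_def interior_open)
qed

lemma tile_\<Lambda>: "j < n ==> tile j \<inter> \<Lambda> = {}"
  using tile_Lseg by (auto simp: \<Lambda>_def)

lemma Lseg_nearby:
  assumes i: "i < n" and p: "p \<in> Lseg i"
  shows "\<forall>\<^sub>F s in at_right (0::real). p + of_real (c * s) * g i \<in> Lseg i"
proof -
  obtain t where t: "p = pt i t" "lo i < t" "t < hi i" using p by (auto simp: Lseg_eq[OF i])
  have lim: "((\<lambda>s. t + c * s) \<longlongrightarrow> t + c * 0) (at_right (0::real))" by (intro tendsto_intros)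
  have "\<forall>\<^sub>F s in at_right (0::real). lo i < t + c * s" "\<forall>\<^sub>F s in at_right (0::real). t + c * s < hi i"
    using order_tendstoD[OF lim] t by auto
  then have "\<forall>\<^sub>F s in at_right (0::real). lo i < t + c * s \<and> t + c * s < hi i" by (rule eventually_conj)
  then show ?thesis
    by (rule eventually_mono) (simp only: t(1) pt_add pt_in_Lseg[OF i])
qed

text \<open>From a point of an open segment, a short move along the segment stays in it and
  therefore outside all tiles. This is the contradiction used to exclude crossings.\<close>

lemma Lseg_avoids_direction:
  assumes i: "i < n" and p: "p \<in> Lseg i" and j: "j < n"
    and ev: "\<forall>\<^sub>F s in at_right (0::real). p + of_real s * (of_real c * g i) \<in> tile j"
  shows False
proof -
  have "\<forall>\<^sub>F s in at_right (0::real). p + of_real s * (of_real c * g i) \<in> tile j \<and> p + of_real (c * s) * g i \<in> Lseg i"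
    by (rule eventually_conj[OF ev Lseg_nearby[OF i p]])
  then obtain s :: real where "p + of_real s * (of_real c * g i) \<in> tile j" "p + of_real (c * s) * g i \<in> Lseg i"
    using eventually_happens'[OF trivial_limit_at_right_real] by blast
  moreover have "of_real s * (of_real c * g i) = of_real (c * s) * g i" by simp
  ultimately show False using tile_Lseg[OF j i] by auto
qed

text \<open>If the segment passed through the image of a face without being at one of its corners,
  then its line would leave through the angle of a tile at that point.\<close>

lemma black_at_inner_vertex:
  assumes x: "x \<in> E" "x \<notin> Out" and i: "i < n" and p: "\<psi> (Rv x) \<in> Lseg i"
  shows "\<exists>y\<in>orbit \<phi> x. fst y = i"
proof (rule ccontr)
  assume no: "\<not> ?thesis"
  let ?F = "orbit \<phi> x"
  have F: "?F \<in> faces G" "?F ~= Out" using orbit_in_faces x self_orbit by fast+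
  have nz: "cr (g i) (T y) ~= 0" "cr (g i) (T (rw y)) ~= 0" if "y \<in> ?F" for y
  proof -
    have y: "y \<in> E" "rw y \<in> E" "\<phi> y \<in> ?F" using same_face[OF x that] rw_in orbit.step[OF that] by auto
    have "fst y ~= i" "fst (rw y) ~= i" using no that y fst_phi[of y] by metis+
    then have "cr (T y) (g i) ~= 0" "cr (T (rw y)) (g i) ~= 0" using cr_T_g y i by blast+
    then show "cr (g i) (T y) ~= 0" "cr (g i) (T (rw y)) ~= 0"
      using cr_commute[of "g i" "T y"] cr_commute[of "g i" "T (rw y)"] by auto
  qed
  obtain v where v: "generic_dir v"
    "\<And>e. e \<in> E ==> cr (g i) (T e) ~= 0 ==> 0 < cr v (T e) \<longleftrightarrow> 0 < cr (g i) (T e)"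
    by (rule generic_dir_perturb[of "g i" "{}" True]) (use g_nonzero[OF i] in auto)
  \<comment> \<open>The only white corner whose two edges lie on the same side of the line of
    \<open>g i\<close>.\<close>
  obtain y where "{y \<in> ?F. (0 < cr v (T y)) = (0 < cr v (T (rw y)))} = {y}"
    by (rule card_1_singletonE[OF corner_equality(1)[OF v(1) F]])
  then have y: "y \<in> ?F" "(0 < cr v (T y)) = (0 < cr v (T (rw y)))" by auto
  have yE: "y \<in> E" "rw y \<in> E" "y \<notin> Out" "Rv y = Rv x" using same_face[OF x y(1)] rw_in by auto
  have same: "(0 < cr (g i) (T y)) = (0 < cr (g i) (T (rw y)))"
    using v(2)[OF yE(1) nz(1)[OF y(1)]] v(2)[OF yE(2) nz(2)[OF y(1)]] y(2) by simp
  let ?j = "snd y" let ?t = "T y" let ?t' = "T (rw y)"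
  have j: "?j < n" using E_bounds yE by blast
  interpret C: cyclic_polygon "P ?j" "dP ?j" by (rule polygon[OF j])
  obtain l where l: "l < N ?j" "xs ?j l = y" using xs_surj[OF yE(1)] by blast
  have l': "Suc l < N ?j \<or> ?j \<notin> snd ` Out"
  proof (rule ccontr)
    assume *: "\<not> ?thesis"
    then obtain k where k: "k < m" "?j = snd (oe k)" by (metis outer_white_cases)
    have "l = N ?j - 1" using * l by linarith
    then have "y = oe k" using xs_last_outer[OF k(1)] k(2) l by metis
    then show False using yE oe_Out by simp
  qed
  have s1: "C.side l = - ?t" using P_side_edge[OF j disjI1[OF l(1)]] l(2) by (simp add: C.side_def)
  have s2: "C.side (Suc l) = - ?t'" using P_side_edge[OF j, of "Suc l"] l' l(2) xs_Suc by (auto simp: C.side_def)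
  have pv: "P ?j (Suc l) = \<psi> (Rv x)" using P_edge(2)[OF j disjI1[OF l(1)]] l(2) yE(4) by simp
  have D: "cr ?t ?t' ~= 0" using orient_corner[OF yE(1,3)] by auto
  define A where "A = cr (g i) ?t' / cr ?t ?t'"
  define B where "B = cr (g i) ?t / cr ?t ?t'"
  \<comment> \<open>The polygon has the sides \<open>- ?t\<close> and \<open>- ?t'\<close> here, so
    coefficients \<open>A\<close> and \<open>B\<close> of equal sign put \<open>g i\<close> or its
    opposite into the open sector of the corner.\<close>
  have gi: "g i = of_real A * ?t - of_real B * ?t'"
    using cr_expand[OF D, of "g i"] cr_commute[of ?t "g i"] by (simp add: A_def B_def)
  have AB: "(0 < A \<and> 0 < B) \<or> (0 < - A \<and> 0 < - B)"
    using same nz[OF y(1)] D unfolding A_def B_def by (auto simp: zero_less_divide_iff divide_less_0_iff)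
  show False
  proof (cases "0 < A \<and> 0 < B")
    case True
    have "\<forall>\<^sub>F s in at_right (0::real). \<psi> (Rv x) + of_real s * (of_real 1 * g i) \<in> tile ?j"
      using C.sector_in_tile[of A B l] True unfolding s1 s2 pv tile_def gi by (simp add: algebra_simps)
    then show False by (rule Lseg_avoids_direction[OF i p j])
  next
    case False
    then have "0 < - A" "0 < - B" using AB by auto
    then have "\<forall>\<^sub>F s in at_right (0::real). \<psi> (Rv x) + of_real s * (of_real (- 1) * g i) \<in> tile ?j"
      using C.sector_in_tile[of "- A" "- B" l] unfolding s1 s2 pv tile_def gi by (simp add: algebra_simps)
    then show False by (rule Lseg_avoids_direction[OF i p j])
  qed
qed

end

context drawn_graph
begin

interpretation Q: cyclic_polygon "\<lambda>j. r (j mod Suc m)" "Suc m" by (rule outer_polygon)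

text \<open>If the corner of \<open>i\<close> were a turn, the vertex would be an end of the
  segment, which the open segment does not contain.\<close>

lemma straight_at_inner_vertex:
  assumes x: "x \<in> E" "x \<notin> Out" and i: "i < n" and p: "\<psi> (Rv x) \<in> Lseg i"
  shows "\<exists>y\<in>orbit \<phi> x. straight y \<and> fst (\<phi> y) = i"
proof -
  let ?F = "orbit \<phi> x"
  have F: "?F \<in> faces G" using orbit_in_faces x by simp
  obtain z where z: "z \<in> ?F" "fst z = i" using black_at_inner_vertex[OF assms] by blast
  obtain y where y: "y \<in> ?F" "\<phi> y = z" by (rule phi_surj[OF F z(1)])
  have y': "y \<in> E" "y \<notin> Out" using same_face[OF x y(1)] by auto
  have z': "z ~= a" "Rv z = Rv x" using same_face[OF x z(1)] a_Out by auto
  have "straight y"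
  proof (rule ccontr)
    assume "\<not> straight y"
    then have "\<psi> (Rv x) = pt i (lo i) \<or> \<psi> (Rv x) = pt i (hi i)"
      using turnback_corner(2)[OF y'(1)] z' z(2) y(2) by simp
    then have "pt i (lo i) \<in> Lseg i \<or> pt i (hi i) \<in> Lseg i" using p by metis
    then show False using pt_in_Lseg[OF i] by simp
  qed
  then show ?thesis using y z by blast
qed

text \<open>At the image of a face, both segments would need a straight corner, and the face has
  just one. Elsewhere the point is interior to a dual edge, and the other segment, not being
  parallel, would enter the tile bordering that edge.\<close>

lemma Lseg_disjoint:
  assumes i: "i < n" "i' < n" "i ~= i'"
  shows "Lseg i \<inter> Lseg i' = {}"
proof (rule ccontr)
  assume "Lseg i \<inter> Lseg i' ~= {}"
  then obtain p where p: "p \<in> Lseg i" "p \<in> Lseg i'" by blast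
  have vertex: False if d: "d \<in> dual_vertices G a" "p = \<psi> d" for d
    using d(1)
  proof (cases rule: dual_vertex_cases)
    case (1 k)
    then show False using d(2) psi_outer Rt_Lseg[OF i(1)] p(1) by auto
  next
    case (2 x)
    have F: "orbit \<phi> x \<in> faces G" using orbit_in_faces 2 by simp
    obtain y where y: "y \<in> orbit \<phi> x" "straight y" "fst (\<phi> y) = i"
      using straight_at_inner_vertex[OF 2(1,2) i(1)] p d 2 by auto
    obtain y' where y': "y' \<in> orbit \<phi> x" "straight y'" "fst (\<phi> y') = i'"
      using straight_at_inner_vertex[OF 2(1,2) i(2)] p d 2 by auto
    show False using straight_unique[OF F y(1) y'(1) y(2) y'(2)] y(3) y'(3) i(3) by simp
  qed
  have "p \<in> closure (Lseg i)" using p closure_subset by blast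
  then obtain e where e: "e \<in> E" "fst e = i" "p \<in> seg e" by (rule closure_Lseg_edge[OF i(1)])
  have ne: "p ~= \<psi> (Rv e)" "p ~= \<psi> (Lv e)" using vertex Rv_D[OF e(1)] Lv_D[OF e(1)] by blast+
  obtain u where u: "0 < u" "u < 1" "p = pt i (co e + u * \<kappa> e)" using seg_interior[OF e(1,3) ne] e(2) by metis
  let ?j = "snd e"
  have j: "?j < n" using E_bounds e by blast
  interpret C: cyclic_polygon "P ?j" "dP ?j" by (rule polygon[OF j])
  obtain l where l: "l < N ?j" "xs ?j l = e" using xs_surj[OF e(1)] by blast
  have s: "C.side l = - T e" using P_side_edge[OF j disjI1[OF l(1)]] l(2) by (simp add: C.side_def)
  have pl: "P ?j l = pt i (co e + \<kappa> e)" using P_edge(1)[OF j disjI1[OF l(1)]] l(2) psi_pt(2)[OF e(1)] e(2) by simp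
  have pe: "P ?j l + of_real (1 - u) * C.side l = p"
    unfolding s pl u(3) using e(2) by (simp add: pt_def T_def algebra_simps)
  \<comment> \<open>Scaling \<open>g i'\<close> by its own inward component makes that component a
    square, hence positive.\<close>
  define c where "c = C.orient * cr (C.side l) (g i')"
  have "cr (T e) (g i') ~= 0" using cr_T_g[OF e(1) i(2)] e(2) i(3) by simp
  then have "c ~= 0" using C.orient_cases unfolding c_def s by auto
  then have "0 < C.orient * cr (C.side l) (of_real c * g i')"
    unfolding cr_simps using c_def by (simp add: mult.left_commute mult.assoc) (metis c_def not_real_square_gt_zero mult.assoc)
  from C.edge_inward[OF _ _ this, of "1 - u"] u(1,2)
  have "\<forall>\<^sub>F s in at_right (0::real). p + of_real s * (of_real c * g i') \<in> tile ?j"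
    unfolding pe tile_def by simp
  then show False by (rule Lseg_avoids_direction[OF i(2) p(2) j])
qed

text \<open>The roots are limit points: \<open>r 0\<close> and \<open>r m\<close> end the segment of
  \<open>b0\<close>, and every other \<open>r k\<close> is reached at an outer corner, which is a
  turn and so the end of a segment.\<close>

lemma closure_\<Lambda>: "closure \<Lambda> = \<Lambda> \<union> Rt"
proof
  have "closed (\<Union>i<n. closure (Lseg i))" by (intro closed_UN) auto
  then have "closure \<Lambda> \<subseteq> (\<Union>i<n. closure (Lseg i))"
    unfolding \<Lambda>_def by (intro closure_minimal) (use closure_subset in blast)+
  then show "closure \<Lambda> \<subseteq> \<Lambda> \<union> Rt" using closure_Lseg_subset by blast
  have "r k \<in> closure \<Lambda>" if "k \<le> m" for k
  proof -
    have sub: "closure (Lseg i) \<subseteq> closure \<Lambda>" if "i < n" for i using closure_mono[OF Lseg_subset[OF that]] .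
    consider "k = 0" | "k = m" | "0 < k" "k < m" using \<open>k \<le> m\<close> by linarith
    then show ?thesis
    proof cases
      case 1
      have "r 0 \<in> closure (Lseg b0)" using closure_Lseg[OF b0_n] lo_b0 hi_b0 by (auto simp: pt_def base_b0 image_iff)
      then show ?thesis using sub[OF b0_n] 1 by blast
    next
      case 2
      have "r m = pt b0 1" by (simp add: pt_def base_b0 g_b0)
      then have "r m \<in> closure (Lseg b0)" using closure_Lseg[OF b0_n] lo_b0 hi_b0 by auto
      then show ?thesis using sub[OF b0_n] 2 by blast
    next
      case 3
      then obtain l where l: "k = Suc l" by (cases k) auto
      have na: "\<phi> (oe l) ~= a" using oe_inj[of k 0] 3 l by (simp add: oe_Suc[symmetric])
      let ?i = "fst (\<phi> (oe l))"
      have i: "?i < n" using E_bounds oe_E phi_in by blast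
      have "\<psi> (Rv (\<phi> (oe l))) = r k" using Rv_outer[of k] psi_outer[of k] 3 l by (simp add: oe_Suc[symmetric])
      then have "r k \<in> closure (Lseg ?i)"
        using turnback_corner(2)[OF oe_E na outer_not_straight] 3 l lo_less_hi[OF i] by (auto simp: closure_Lseg[OF i])
      then show ?thesis using sub[OF i] by blast
    qed
  qed
  then show "\<Lambda> \<union> Rt \<subseteq> closure \<Lambda>" using closure_subset by (auto simp: Rt_def)
qed

text \<open>Each segment lies in one part of a separation. At an inner face one open segment
  contains the vertex and the others accumulate there, so all go to the same part; connectedness of
  the graph spreads this to all black vertices.\<close>

lemma connected_\<Lambda>: "connected \<Lambda>"
proof (rule connectedI)
  fix A B assume AB: "open A" "open B" "A \<inter> \<Lambda> ~= {}" "B \<inter> \<Lambda> ~= {}" "A \<inter> B \<inter> \<Lambda> = {}" "\<Lambda> \<subseteq> A \<union> B"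
  have one: "Lseg i \<subseteq> A" if i: "i < n" and ne: "A \<inter> Lseg i ~= {}" for i
  proof (rule ccontr)
    assume "\<not> Lseg i \<subseteq> A"
    then have "B \<inter> Lseg i ~= {}" using AB(6) Lseg_subset[OF i] by blast
    moreover have "connected (Lseg i)" by (simp add: Lseg_def convex_connected)
    ultimately show False using connectedD[of "Lseg i" A B] AB Lseg_subset[OF i] ne by blast
  qed
  have oneB: "Lseg i \<subseteq> B" if i: "i < n" and ne: "B \<inter> Lseg i ~= {}" for i
  proof (rule ccontr)
    assume "\<not> Lseg i \<subseteq> B"
    then have "A \<inter> Lseg i ~= {}" using AB(6) Lseg_subset[OF i] by blast
    then have "Lseg i \<subseteq> A" using one i by blast
    then show False using ne AB(5) Lseg_subset[OF i] by blast
  qed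
  have ne: "Lseg i ~= {}" if "i < n" for i using lo_less_hi[OF that] by (simp add: Lseg_eq[OF that])
  define h where "h i \<longleftrightarrow> Lseg i \<subseteq> A" for i
  have vertex: "h (fst y) = h (fst z)" if x: "x \<in> E" "x \<notin> Out" and y: "y \<in> orbit \<phi> x" and z: "z \<in> orbit \<phi> x" for x y z
  proof -
    have F: "orbit \<phi> x \<in> faces G" using orbit_in_faces x by simp
    obtain i where i: "i < n" "\<psi> (Rv x) \<in> Lseg i" using inner_in_\<Lambda>[OF x] by (auto simp: \<Lambda>_def)
    have c: "h (fst y) = h i" if y: "y \<in> orbit \<phi> x" for y
    proof -
      have yE: "y \<in> E" "Rv y = Rv x" using same_face[OF x y] by auto
      have yn: "fst y < n" using E_bounds yE by blast
      have "\<psi> (Rv x) \<in> seg y" using yE by (simp add: seg_def)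
      then have cl: "\<psi> (Rv x) \<in> closure (Lseg (fst y))" using seg_subset_closure[OF yE(1)] by blast
      show ?thesis
      proof
        assume "h i"
        then have "A \<inter> closure (Lseg (fst y)) ~= {}" using cl i by (auto simp: h_def)
        then have "A \<inter> Lseg (fst y) ~= {}" using open_Int_closure_eq_empty[OF AB(1)] by blast
        then show "h (fst y)" using one yn by (simp add: h_def)
      next
        assume hy: "h (fst y)"
        show "h i"
        proof (rule ccontr)
          assume "\<not> h i"
          then have "Lseg i \<subseteq> B"
            using one[OF i(1)] oneB[OF i(1)] AB(6) Lseg_subset[OF i(1)] ne[OF i(1)] unfolding h_def by blast
          then have "B \<inter> closure (Lseg (fst y)) ~= {}" using cl i by blast
          then have "B \<inter> Lseg (fst y) ~= {}" using open_Int_closure_eq_empty[OF AB(2)] by blast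
          then show False using oneB[OF yn] hy ne[OF yn] AB(5) Lseg_subset[OF yn] unfolding h_def by blast
        qed
      qed
    qed
    show ?thesis using c[OF y] c[OF z] by simp
  qed
  have c: "h (fst e) = h (fst e')" if "e \<in> E" "e' \<in> E" for e e'
  proof (rule edges_connected[of "\<lambda>e. h (fst e)", OF _ that])
    fix e e' assume *: "e \<in> E" "e' \<in> E" "fst e = fst e' \<or> snd e = snd e'"
    show "h (fst e) = h (fst e')"
    proof (cases "fst e = fst e'")
      case False
      show ?thesis
      \<comment> \<open>The edge \<open>ow\<close> is exempt: across the corner of the outer face
        the two segments meet only at a root, which is outside \<open>\<Lambda>\<close>.\<close>
      proof (rule white_const[where g = "\<lambda>e. h (fst e)" and ?x0.0 = "ow (snd e)"])
        fix x assume x: "x \<in> E" "snd x = snd e" "x ~= ow (snd e)"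
        have "x \<notin> Out"
        proof
          assume "x \<in> Out"
          then obtain k where "k < m" "x = oe k" by (rule oe_cases)
          then show False using x ow_oe by metis
        qed
        then have "h (fst (\<phi> x)) = h (fst x)"
          using vertex[OF x(1), of "\<phi> x" x] self_orbit[OF x(1)] orbit.base by metis
        then show "h (fst (rw x)) = h (fst x)" using fst_phi[OF x(1)] by simp
      qed (use * False in auto)
    qed simp
  qed
  obtain i i' where i: "i < n" "A \<inter> Lseg i ~= {}" "i' < n" "B \<inter> Lseg i' ~= {}"
    using AB(3,4) by (auto simp: \<Lambda>_def)
  obtain e e' where "e \<in> E" "fst e = i" "e' \<in> E" "fst e' = i'"
    using Eb_nonempty[OF i(1)] Eb_nonempty[OF i(3)] by (auto simp: Eb_def)
  then have "h i = h i'" using c by metis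
  moreover have "h i" using one i by (simp add: h_def)
  ultimately have "Lseg i' \<subseteq> A" by (simp add: h_def)
  moreover have "Lseg i' \<subseteq> B" using oneB i by blast
  ultimately show False using ne[OF i(3)] AB(5) Lseg_subset[OF i(3)] by blast
qed

lemma seg_\<Lambda>:
  assumes e: "e \<in> E" and p: "p \<in> seg e"
    and R: "p = \<psi> (Rv e) ==> p \<in> \<Lambda>" and L: "p = \<psi> (Lv e) ==> p \<in> \<Lambda>"
  shows "p \<in> \<Lambda>"
  using seg_interior[OF e p] R L Lseg_subset[OF E_bounds(1)[OF e]] by blast

lemma inner_frontier: "j < n ==> j \<notin> snd ` Out ==> frontier (tile j) \<subseteq> \<Lambda>"
proof
  fix p assume j: "j < n" "j \<notin> snd ` Out" and p: "p \<in> frontier (tile j)"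
  have "{k. k < m \<and> snd (oe k) = j} = {}" using j oe_Out by auto
  then obtain e where e: "e \<in> Ew j" "p \<in> seg e" using p frontier_tile[OF j(1)] by auto
  then have eE: "e \<in> E" "e \<notin> Out" using j(2) by (auto simp: Ew_def)
  show "p \<in> \<Lambda>"
  proof (rule seg_\<Lambda>[OF eE(1) e(2)])
    show "p \<in> \<Lambda>" if "p = \<psi> (Rv e)" using inner_in_\<Lambda>[OF eE] that by simp
    show "p \<in> \<Lambda>" if "p = \<psi> (Lv e)"
    proof -
      obtain x where x: "x \<in> Ew j" "rw x = e" by (rule rw_surj[OF e(1)])
      then have xE: "x \<in> E" "x \<notin> Out" using j(2) by (auto simp: Ew_def)
      show ?thesis using inner_in_\<Lambda>[OF xE] Lv_rw_inner[OF xE] x(2) that by metis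
    qed
  qed
qed

text \<open>All vertices of the polygon other than the two ends of its side on \<open>Q\<close> are
  images of inner faces, so they belong to \<open>\<Lambda>\<close>.\<close>

lemma outer_frontier: "k < m ==> (\<Union>e\<in>Ew (snd (oe k)). seg e) - {r k, r (Suc k)} \<subseteq> \<Lambda>"
proof
  fix p assume k: "k < m" and p: "p \<in> (\<Union>e\<in>Ew (snd (oe k)). seg e) - {r k, r (Suc k)}"
  let ?j = "snd (oe k)"
  obtain e where e: "e \<in> Ew ?j" "p \<in> seg e" "p ~= r k" "p ~= r (Suc k)" using p by blast
  have eE: "e \<in> E" using e by (simp add: Ew_def)
  show "p \<in> \<Lambda>"
  proof (rule seg_\<Lambda>[OF eE e(2)])
    show "p \<in> \<Lambda>" if pe: "p = \<psi> (Rv e)"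
    proof -
      have "e ~= oe k" using pe e(3) Rv_outer[OF k] psi_outer[of k] k by auto
      moreover have "snd e = snd (oe k)" using e(1) by (simp add: Ew_def)
      ultimately have "e \<notin> Out" using outer_white_edge[OF _ k, of e] by blast
      then show ?thesis using inner_in_\<Lambda>[OF eE] pe by simp
    qed
    show "p \<in> \<Lambda>" if pe: "p = \<psi> (Lv e)"
    proof -
      obtain x where x: "x \<in> Ew ?j" "rw x = e" by (rule rw_surj[OF e(1)])
      then have "x ~= oe k" using pe e(4) Lv_rw_outer[OF k] psi_outer[of "Suc k"] k by auto
      moreover have xj: "x \<in> E" "snd x = snd (oe k)" using x(1) by (simp_all add: Ew_def)
      ultimately have "x \<notin> Out" using outer_white_edge[OF _ k, of x] by blast
      with xj have xE: "x \<in> E" "x \<notin> Out" by auto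
      show ?thesis using inner_in_\<Lambda>[OF xE] Lv_rw_inner[OF xE] x(2) pe by metis
    qed
  qed
qed

text \<open>An inner face has at least two black corners, since otherwise an edge would be its own
  successor around the white vertex. Only one is straight, and a turn is the end of a
  segment.\<close>

lemma inner_vertex_endpoint:
  assumes x: "x \<in> E" "x \<notin> Out"
  shows "\<exists>i<n. \<psi> (Rv x) = pt i (lo i) \<or> \<psi> (Rv x) = pt i (hi i)"
proof -
  have F: "orbit \<phi> x \<in> faces G" using orbit_in_faces x by simp
  have "\<phi> x ~= x"
  proof
    assume fx: "\<phi> x = x"
    then have "rw x = x" using fst_phi[OF x(1)] snd_rw[OF x(1)] by (metis prod_eqI)
    then show False using orient_corner[OF x] by simp
  qed
  then obtain y where y: "y \<in> orbit \<phi> x" "\<not> straight y"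
    using straight_unique[OF F self_orbit[OF x(1)] orbit.base] self_orbit[OF x(1)] orbit.base[of \<phi> x] by metis
  have y': "y \<in> E" "\<phi> y \<in> orbit \<phi> x" using same_face[OF x y(1)] orbit.step[OF y(1)] by auto
  have z: "\<phi> y \<in> E" "\<phi> y ~= a" "Rv (\<phi> y) = Rv x" using same_face[OF x y'(2)] a_Out by auto
  show ?thesis using turnback_corner(2)[OF y'(1) z(2) y(2)] z(3) E_bounds(1)[OF z(1)] by auto
qed

end

section \<open>Arcs on the boundary of convex sets\<close>

lemma arc_interior_connected:
  fixes g :: "real => 'a::t2_space"
  assumes "arc g"
  shows "connected (path_image g - {pathstart g, pathfinish g})"
    and "path_image g - {pathstart g, pathfinish g} ~= {}"
    and "infinite (path_image g)"
proof -
  have inj: "inj_on g {0..1}" and cont: "continuous_on {0..1} g"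
    using assms by (auto simp: arc_def path_def)
  have "g ` {0<..<1} = g ` ({0..1} - {0, 1})" by (rule arg_cong[of _ _ "(`) g"]) auto
  also have "\<dots> = g ` {0..1} - g ` {0, 1}" by (rule inj_on_image_set_diff[OF inj]) auto
  finally have e: "path_image g - {pathstart g, pathfinish g} = g ` {0<..<1}"
    by (simp add: path_image_def pathstart_def pathfinish_def)
  show "connected (path_image g - {pathstart g, pathfinish g})"
    unfolding e by (intro connected_continuous_image continuous_on_subset[OF cont]) auto
  show "path_image g - {pathstart g, pathfinish g} ~= {}" unfolding e by simp
  show "infinite (path_image g)"
    unfolding path_image_def using finite_imageD[OF _ inj] infinite_Icc[of "0::real" 1] by auto
qed

text \<open>Pulled back to the parameter interval, a connected set containing 0 and 1 is
  everything.\<close>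

lemma subarc_eq:
  fixes g :: "real => 'a::t2_space"
  assumes g: "arc g" and S: "connected S" "S \<subseteq> path_image g" "pathstart g \<in> S" "pathfinish g \<in> S"
  shows "S = path_image g"
proof -
  have inj: "inj_on g {0..1}" and cont: "continuous_on {0..1} g"
    using g by (auto simp: arc_def path_def)
  obtain h where h: "homeomorphism {0..1} (g ` {0..1}) g h"
    using homeomorphism_compact[OF compact_Icc cont refl inj] by blast
  have Sg: "S \<subseteq> g ` {0..1}" using S(2) by (simp add: path_image_def)
  have "connected (h ` S)"
    using h Sg S(1) by (meson connected_continuous_image continuous_on_subset homeomorphism_cont2)
  moreover have "0 \<in> h ` S" "1 \<in> h ` S"
    using S(3,4) h by (force simp: pathstart_def pathfinish_def homeomorphism_apply1)+
  ultimately have "{0..1} \<subseteq> h ` S" by (rule connected_contains_Icc)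
  then have "g ` {0..1} \<subseteq> g ` (h ` S)" by (rule image_mono)
  also have "g ` (h ` S) = S" using h Sg by (force simp: homeomorphism_apply2 image_iff subset_iff)
  finally show ?thesis using S(2) by (simp add: path_image_def)
qed

text \<open>The boundary of a bounded convex set with interior is homeomorphic to a circle.\<close>

lemma convex_frontier_simple_closed:
  fixes U :: "complex set"
  assumes "convex U" "bounded U" "interior U ~= {}"
  obtains \<gamma> where "simple_path \<gamma>" "pathfinish \<gamma> = pathstart \<gamma>" "path_image \<gamma> = frontier U"
proof -
  have "aff_dim U = aff_dim (cball (0::complex) 1)"
    using assms(3) by (simp add: aff_dim_nonempty_interior aff_dim_cball)
  then have "rel_frontier (cball (0::complex) 1) homeomorphic rel_frontier U"
    by (intro homeomorphic_rel_frontiers_convex_bounded_sets) (use assms in auto)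
  then have "sphere (0::complex) 1 homeomorphic frontier U"
    using rel_frontier_nonempty_interior[OF assms(3)] by (simp add: rel_frontier_cball)
  then obtain f h where fh: "homeomorphism (sphere (0::complex) 1) (frontier U) f h" unfolding homeomorphic_def by blast
  let ?c = "circlepath 0 1 :: real => complex"
  have im: "path_image ?c = sphere 0 1" by simp
  have sp: "simple_path (f \<circ> ?c)"
  proof (rule simple_path_continuous_image)
    show "simple_path ?c" by (simp add: simple_path_circlepath)
    show "continuous_on (path_image ?c) f" unfolding im using fh by (simp add: homeomorphism_def)
    show "inj_on f (path_image ?c)" unfolding im by (rule inj_onI, drule arg_cong[where f=h]) (simp add: homeomorphism_apply1[OF fh])
  qed
  have "path_image (f \<circ> ?c) = frontier U"
    unfolding path_image_compose im using fh by (simp add: homeomorphism_def)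
  moreover have "pathfinish (f \<circ> ?c) = pathstart (f \<circ> ?c)"
    by (simp add: pathfinish_compose pathstart_compose)
  ultimately show ?thesis using that sp by blast
qed

text \<open>The ends of the side split the boundary curve into two arcs. The open side is connected
  and avoids the ends, so it stays in one of the arcs and fills it; the other arc is the required
  one.\<close>

lemma convex_frontier_arc:
  fixes U :: "complex set"
  assumes U: "convex U" "bounded U" "interior U ~= {}" and xy: "x ~= y" "closed_segment x y \<subseteq> frontier U"
  obtains \<beta> where "arc \<beta>" "pathstart \<beta> = x" "pathfinish \<beta> = y"
    "path_image \<beta> = frontier U - open_segment x y"
proof -
  obtain \<gamma> where \<gamma>: "simple_path \<gamma>" "pathfinish \<gamma> = pathstart \<gamma>" "path_image \<gamma> = frontier U"
    by (rule convex_frontier_simple_closed[OF U])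
  have "x \<in> path_image \<gamma>" "y \<in> path_image \<gamma>" using xy \<gamma>(3) by auto
  from exists_double_arc[OF \<gamma>(1,2) this xy(1)] obtain u d where
    ud: "arc u" "arc d" "pathstart u = x" "pathfinish u = y" "pathstart d = y" "pathfinish d = x"
    "path_image u \<inter> path_image d = {x, y}" "path_image u \<union> path_image d = path_image \<gamma>" by metis
  have os: "open_segment x y \<subseteq> (path_image u - {x, y}) \<union> (path_image d - {x, y})"
    using xy(2) ud(8) \<gamma>(3) unfolding open_segment_def by blast
  have cl: "closed (path_image u)" "closed (path_image d)" using ud closed_arc_image by auto
  have conn: "connected (open_segment x y)" by (simp add: convex_connected)
  have one: "closed_segment x y \<subseteq> path_image u \<or> closed_segment x y \<subseteq> path_image d"
  proof -
    have "open_segment x y \<inter> - path_image d = {} \<or> open_segment x y \<inter> - path_image u = {}"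
    proof (rule ccontr)
      assume *: "\<not> ?thesis"
      have "(- path_image d) \<inter> (- path_image u) \<inter> open_segment x y = {}" using os by blast
      moreover have "open_segment x y \<subseteq> (- path_image d) \<union> (- path_image u)" using ud(7) unfolding open_segment_def by blast
      ultimately show False using connectedD[OF conn, of "- path_image d" "- path_image u"] cl * by blast
    qed
    moreover have "closed_segment x y = open_segment x y \<union> {x, y}" by (rule closed_segment_eq_open)
    moreover have "{x, y} \<subseteq> path_image u" "{x, y} \<subseteq> path_image d" using ud(7) by auto
    ultimately show ?thesis by blast
  qed
  have eq: "closed_segment x y = path_image w" if "arc w" "closed_segment x y \<subseteq> path_image w" "{pathstart w, pathfinish w} = {x, y}" for w
    by (rule subarc_eq[OF that(1) _ that(2)]) (use that(3) in auto)
  have oe: "open_segment x y = closed_segment x y - {x, y}" by (simp add: open_segment_def)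
  show ?thesis
  proof (cases "closed_segment x y \<subseteq> path_image d")
    case True
    have "closed_segment x y = path_image d" by (rule eq[OF ud(2) True]) (use ud in auto)
    then have "path_image u = frontier U - open_segment x y"
      using ud(7,8) \<gamma>(3) unfolding oe by blast
    then show ?thesis using that[of u] ud by blast
  next
    case False
    then have s: "closed_segment x y \<subseteq> path_image u" using one by blast
    have "closed_segment x y = path_image u" by (rule eq[OF ud(1) s]) (use ud in auto)
    then have "path_image (reversepath d) = frontier U - open_segment x y"
      using ud(7,8) \<gamma>(3) unfolding oe by auto
    then show ?thesis using that[of "reversepath d"] ud by (simp add: arc_reversepath)
  qed
qed

text \<open>
  \<open>\<beta>\<close> is a crosscut of the inside of \<open>\<gamma>\<close> and runs along the boundary of the convex set \<open>U\<close>, which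
  \<open>\<Lambda>\<close> avoids.  The side of the crosscut that contains \<open>U\<close> near \<open>\<beta>\<close> cannot meet \<open>\<Lambda>\<close>, because its
  intersection with \<open>\<Lambda>\<close> would be open and closed in the connected set \<open>\<Lambda>\<close>.
\<close>

locale crosscut =
  fixes \<gamma> \<beta> :: "real => complex" and \<Lambda> U :: "complex set" and J :: "'j set"
    and c :: "'j => complex" and b :: "'j => real"
  assumes \<gamma>: "simple_path \<gamma>" "pathfinish \<gamma> = pathstart \<gamma>"
    and connected_\<Lambda>: "connected \<Lambda>" and \<Lambda>_inside: "\<Lambda> \<subseteq> inside (path_image \<gamma>)"
    and \<beta>: "arc \<beta>" "pathstart \<beta> \<in> path_image \<gamma>" "pathfinish \<beta> \<in> path_image \<gamma>"
    and \<beta>_\<Lambda>: "path_image \<beta> - {pathstart \<beta>, pathfinish \<beta>} \<subseteq> \<Lambda>"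
    and finite_J: "finite J" and U_eq: "U = {z. \<forall>l\<in>J. b l < c l \<bullet> z}" and U_nonempty: "U ~= {}"
    and c_nonzero: "l \<in> J ==> c l ~= 0"
    and c_independent: "l \<in> J ==> l' \<in> J ==> l ~= l' ==> \<exists>y. c l \<bullet> y < 0 \<and> c l' \<bullet> y < 0"
    and \<beta>_frontier: "p \<in> path_image \<beta> ==> p \<notin> U \<and> (\<forall>l\<in>J. b l \<le> c l \<bullet> p)"
    and frontier_\<beta>: "p \<in> path_image \<beta> - {pathstart \<beta>, pathfinish \<beta>} ==>
      \<exists>e>0. \<forall>z\<in>ball p e. z \<notin> U \<and> (\<forall>l\<in>J. b l \<le> c l \<bullet> z) \<longrightarrow> z \<in> path_image \<beta>"
    and U_\<Lambda>: "U \<inter> \<Lambda> = {}"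
begin

abbreviation "\<Omega> \<equiv> inside (path_image \<gamma>)"
abbreviation "x0 \<equiv> pathstart \<beta>"
abbreviation "y0 \<equiv> pathfinish \<beta>"
definition \<beta>o :: "complex set" where "\<beta>o = path_image \<beta> - {x0, y0}"

lemma J_props: "open \<Omega>" "connected \<Omega>" "bounded \<Omega>" "\<Omega> \<inter> path_image \<gamma> = {}"
  using Jordan_inside_outside[OF \<gamma>] by (auto simp: inside_no_overlap)

lemma xy_ne: "x0 ~= y0" using arc_distinct_ends[OF \<beta>(1)] by simp

lemma \<beta>o_\<Omega>: "\<beta>o \<subseteq> \<Omega>" using \<beta>_\<Lambda> \<Lambda>_inside by (auto simp: \<beta>o_def)

lemma convex_U: "convex U" and open_U: "open U"
proof -
  have U: "U = (\<Inter>l\<in>J. {z. b l < c l \<bullet> z})" unfolding U_eq by blast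
  show "convex U" unfolding U by (intro convex_INT convex_halfspace_gt)
  show "open U" unfolding U by (intro open_INT finite_J ballI open_halfspace_gt)
qed

lemma arcs:
  obtains c1 c2 where "arc c1" "arc c2" "pathstart c1 = x0" "pathfinish c1 = y0" "pathstart c2 = x0" "pathfinish c2 = y0"
    "path_image c1 \<inter> path_image c2 = {x0, y0}" "path_image c1 \<union> path_image c2 = path_image \<gamma>"
proof -
  from exists_double_arc[OF \<gamma> \<beta>(2,3) xy_ne] obtain u d where
    "arc u" "arc d" "pathstart u = x0" "pathfinish u = y0" "pathstart d = y0" "pathfinish d = x0"
    "path_image u \<inter> path_image d = {x0, y0}" "path_image u \<union> path_image d = path_image \<gamma>" by metis
  then show ?thesis by (intro that[of u "reversepath d"]) (auto simp: arc_reversepath)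
qed

text \<open>Near an inner point of the crosscut, the part of a small disc off \<open>\<beta>\<close>
  consists of two connected pieces. One is the intersection with the convex set \<open>U\<close>,
  the other a union of half discs that meet each other.\<close>

lemma half_disc:
  assumes p: "p \<in> \<beta>o"
  obtains e where "0 < e" "ball p e \<subseteq> \<Omega>" "connected (ball p e \<inter> U)" "ball p e \<inter> U ~= {}"
    "connected (ball p e - U - path_image \<beta>)"
proof -
  obtain e1 where e1: "0 < e1" "ball p e1 \<subseteq> \<Omega>" using J_props(1) p \<beta>o_\<Omega> by (meson openE subsetD)
  obtain e2 where e2: "0 < e2" "\<And>z. z \<in> ball p e2 ==> z \<notin> U ==> (\<forall>l\<in>J. b l \<le> c l \<bullet> z) ==> z \<in> path_image \<beta>"
    using frontier_\<beta>[of p] p unfolding \<beta>o_def by blast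
  \<comment> \<open>The constraints active at \<open>p\<close>; all others hold strictly throughout
    a small disc.\<close>
  define J0 where "J0 = {l \<in> J. c l \<bullet> p = b l}"
  have pf: "p \<notin> U" "\<And>l. l \<in> J ==> b l \<le> c l \<bullet> p" using \<beta>_frontier[of p] p by (auto simp: \<beta>o_def)
  have "open (\<Inter>l\<in>J - J0. {z. b l < c l \<bullet> z})" by (intro open_INT ballI open_halfspace_gt) (use finite_J in auto)
  moreover have "p \<in> (\<Inter>l\<in>J - J0. {z. b l < c l \<bullet> z})" using pf(2) by (force simp: J0_def)
  ultimately obtain e3 where e3: "0 < e3" "ball p e3 \<subseteq> (\<Inter>l\<in>J - J0. {z. b l < c l \<bullet> z})" by (meson openE)
  define e where "e = min e1 (min e2 e3)"
  have e: "0 < e" "ball p e \<subseteq> ball p e1" "ball p e \<subseteq> ball p e2" "ball p e \<subseteq> ball p e3"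
    using e1 e2 e3 by (auto simp: e_def)
  have near: "\<exists>s>0. p + s *\<^sub>R y \<in> ball p e \<and> s < 1" for y
  proof -
    have "\<forall>\<^sub>F s in at_right (0::real). p + s *\<^sub>R y \<in> ball p e"
    proof -
      have "((\<lambda>s. p + s *\<^sub>R y) \<longlongrightarrow> p + 0 *\<^sub>R y) (at_right (0::real))" by (intro tendsto_intros)
      then show ?thesis using topological_tendstoD[of _ "p + 0 *\<^sub>R y" _ "ball p e"] e(1) by simp
    qed
    then have "\<forall>\<^sub>F s in at_right (0::real). p + s *\<^sub>R y \<in> ball p e \<and> s \<in> {0<..<1}"
      by (intro eventually_conj eventually_at_right_real) auto
    then show ?thesis using eventually_happens'[OF trivial_limit_at_right_real] by fastforce
  qed
  \<comment> \<open>In the small disc a point where all weak constraints hold is in \<open>U\<close>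
    or on \<open>\<beta>\<close>, so a point of the second piece violates an active constraint
    strictly.\<close>
  have V: "ball p e - U - path_image \<beta> = \<Union> ((\<lambda>l. ball p e \<inter> {z. c l \<bullet> z < b l}) ` J0)"
  proof (intro equalityI subsetI)
    fix z assume z: "z \<in> ball p e - U - path_image \<beta>"
    then obtain l where l: "l \<in> J" "c l \<bullet> z < b l" using e2(2)[of z] e(3) by force
    have "l \<in> J0" using l e3(2) e(4) z by force
    then show "z \<in> \<Union> ((\<lambda>l. ball p e \<inter> {z. c l \<bullet> z < b l}) ` J0)" using l z by blast
  next
    fix z assume "z \<in> \<Union> ((\<lambda>l. ball p e \<inter> {z. c l \<bullet> z < b l}) ` J0)"
    then obtain l where "l \<in> J" "z \<in> ball p e" "c l \<bullet> z < b l" by (auto simp: J0_def)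
    then show "z \<in> ball p e - U - path_image \<beta>" using \<beta>_frontier[of z] unfolding U_eq by force
  qed
  have hits: "\<exists>z. z \<in> ball p e \<and> c l \<bullet> z < b l \<and> c l' \<bullet> z < b l'" if l: "l \<in> J0" "l' \<in> J0" for l l'
  proof -
    have "\<exists>y. c l \<bullet> y < 0 \<and> c l' \<bullet> y < 0"
    proof (cases "l = l'")
      case True
      then show ?thesis using c_nonzero[of l] l by (intro exI[of _ "- c l"]) (simp add: J0_def)
    qed (use c_independent l in \<open>auto simp: J0_def\<close>)
    then obtain y where y: "c l \<bullet> y < 0" "c l' \<bullet> y < 0" by blast
    obtain s where "s > 0" "p + s *\<^sub>R y \<in> ball p e" using near by blast
    then show ?thesis using y l
      by (intro exI[of _ "p + s *\<^sub>R y"]) (simp add: J0_def inner_add_right mult_pos_neg)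
  qed
  have "connected (\<Union> ((\<lambda>l. ball p e \<inter> {z. c l \<bullet> z < b l}) ` J0))"
  proof (cases "J0 = {}")
    case False
    then obtain l0 where l0: "l0 \<in> J0" by blast
    let ?H = "\<lambda>l. ball p e \<inter> {z. c l \<bullet> z < b l}"
    have cv: "connected (?H l)" for l
      by (intro convex_connected convex_Int convex_ball convex_halfspace_lt)
    have "connected (\<Union> ((\<lambda>l. ?H l0 \<union> ?H l) ` J0))"
    proof (rule connected_Union)
      fix S assume "S \<in> (\<lambda>l. ?H l0 \<union> ?H l) ` J0"
      then obtain l where l: "l \<in> J0" "S = ?H l0 \<union> ?H l" by blast
      have "?H l0 \<inter> ?H l ~= {}" using hits[OF l0 l(1)] by blast
      then show "connected S" unfolding l(2) using cv by (intro connected_Un) auto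
    next
      show "\<Inter> ((\<lambda>l. ?H l0 \<union> ?H l) ` J0) ~= {}" using hits[OF l0 l0] by blast
    qed
    moreover have "\<Union> ((\<lambda>l. ?H l0 \<union> ?H l) ` J0) = \<Union> (?H ` J0)" using l0 by blast
    ultimately show ?thesis by simp
  qed simp
  then have conV: "connected (ball p e - U - path_image \<beta>)" unfolding V .
  obtain u where u: "u \<in> U" using U_nonempty by blast
  obtain s where s: "s > 0" "s < 1" "p + s *\<^sub>R (u - p) \<in> ball p e" using near by blast
  have "p + s *\<^sub>R (u - p) \<in> U"
    unfolding U_eq
  proof (intro CollectI ballI)
    fix l assume l: "l \<in> J"
    have "c l \<bullet> (p + s *\<^sub>R (u - p)) = (1 - s) * (c l \<bullet> p) + s * (c l \<bullet> u)"
      by (simp add: inner_add_right inner_diff_right algebra_simps)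
    moreover have "(1 - s) * b l \<le> (1 - s) * (c l \<bullet> p)" using pf(2)[OF l] s by (intro mult_left_mono) auto
    moreover have "s * b l < s * (c l \<bullet> u)" using u l s unfolding U_eq by (intro mult_strict_left_mono) auto
    moreover have "(1 - s) * b l + s * b l = b l" by (simp add: algebra_simps)
    ultimately show "b l < c l \<bullet> (p + s *\<^sub>R (u - p))" by linarith
  qed
  then have ne: "ball p e \<inter> U ~= {}" using s by blast
  have conU: "connected (ball p e \<inter> U)" by (intro convex_connected convex_Int convex_ball convex_U)
  show ?thesis using that[of e] e e1 conU ne conV by blast
qed

text \<open>Each of the two connected pieces of a small disc lies on one side of the crosscut, and
  both sides occur, so the pieces are the traces of the sides.\<close>

lemma two_sides:
  assumes "S \<subseteq> B" "S \<subseteq> A1 \<or> S \<subseteq> A2" "V \<subseteq> A1 \<or> V \<subseteq> A2" "B \<inter> A1 ~= {}" "B \<inter> A2 ~= {}"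
    "B \<inter> A1 \<subseteq> S \<union> V" "B \<inter> A2 \<subseteq> S \<union> V" "A1 \<inter> A2 = {}"
  shows "B \<inter> A1 = S \<or> B \<inter> A2 = S"
  using assms(2)
proof
  assume S: "S \<subseteq> A1"
  then have "V \<subseteq> A2" using assms(3,5,7,8) by blast
  then have "B \<inter> A1 = S" using S assms(1,6,8) by blast
  then show ?thesis ..
next
  assume S: "S \<subseteq> A2"
  then have "V \<subseteq> A1" using assms(3,4,6,8) by blast
  then have "B \<inter> A2 = S" using S assms(1,7,8) by blast
  then show ?thesis ..
qed

text \<open>The ends of \<open>\<beta>\<close> split \<open>\<gamma>\<close> into two arcs, and each
  closes up with \<open>\<beta>\<close> to a Jordan curve. Their insides \<open>?A1\<close>,
  \<open>?A2\<close> and the open crosscut fill \<open>\<Omega>\<close>. The face sought is the one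
  of these that agrees with \<open>U\<close> near \<open>\<beta>\<close>; being bounded by an arc of
  \<open>\<gamma>\<close>, it shares infinitely many points with the curve.\<close>

lemma crosscut_side:
  obtains A where "A \<in> components (- (\<Lambda> \<union> path_image \<gamma>))" "A \<subseteq> \<Omega>" "frontier A \<inter> \<Lambda> = \<beta>o"
    "infinite (frontier A \<inter> path_image \<gamma>)" "\<And>p. p \<in> \<beta>o ==> \<exists>e>0. ball p e \<inter> A = ball p e \<inter> U"
proof -
  note result = that
  obtain c1 c2 where c12: "arc c1" "arc c2" "pathstart c1 = x0" "pathfinish c1 = y0" "pathstart c2 = x0" "pathfinish c2 = y0"
    "path_image c1 \<inter> path_image c2 = {x0, y0}" "path_image c1 \<union> path_image c2 = path_image \<gamma>" by (rule arcs)
  have \<beta>\<gamma>: "path_image \<gamma> \<inter> path_image \<beta> = {x0, y0}"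
    using \<beta>o_\<Omega> J_props(4) \<beta>(2,3) pathstart_in_path_image pathfinish_in_path_image unfolding \<beta>o_def by blast
  have c\<beta>: "path_image c1 \<inter> path_image \<beta> = {x0, y0}" "path_image c2 \<inter> path_image \<beta> = {x0, y0}"
    using \<beta>\<gamma> c12(7,8) by blast+
  have \<beta>one: "\<beta>o ~= {}" "connected \<beta>o" using arc_interior_connected[OF \<beta>(1)] by (simp_all add: \<beta>o_def)
  have \<beta>o_im: "\<beta>o \<subseteq> path_image \<beta>" by (simp add: \<beta>o_def)
  let ?A1 = "inside (path_image c1 \<union> path_image \<beta>)" and ?A2 = "inside (path_image c2 \<union> path_image \<beta>)"
  have split: "?A1 \<inter> ?A2 = {}" "?A1 \<union> ?A2 \<union> \<beta>o = \<Omega>"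
  proof -
    have "path_image \<beta> \<inter> inside (path_image c1 \<union> path_image c2) ~= {}"
      using \<beta>one(1) \<beta>o_\<Omega> \<beta>o_im c12(8) by auto
    from split_inside_simple_closed_curve[OF arc_imp_simple_path[OF c12(1)] c12(3,4) arc_imp_simple_path[OF c12(2)] c12(5,6)
      arc_imp_simple_path[OF \<beta>(1)] refl refl xy_ne c12(7) c\<beta> this]
    show "?A1 \<inter> ?A2 = {}" "?A1 \<union> ?A2 \<union> \<beta>o = \<Omega>" unfolding c12(8) \<beta>o_def by auto
  qed
  have jordan: "open (inside (path_image w \<union> path_image \<beta>))" "connected (inside (path_image w \<union> path_image \<beta>))"
    "inside (path_image w \<union> path_image \<beta>) ~= {}" "frontier (inside (path_image w \<union> path_image \<beta>)) = path_image w \<union> path_image \<beta>"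
    if "arc w" "pathstart w = x0" "pathfinish w = y0" "path_image w \<inter> path_image \<beta> = {x0, y0}" for w
  proof -
    have "simple_path (w +++ reversepath \<beta>)"
      using that \<beta>(1) by (subst simple_path_join_loop_eq) (auto simp: arc_reversepath)
    moreover have "pathfinish (w +++ reversepath \<beta>) = pathstart (w +++ reversepath \<beta>)" using that by simp
    moreover have "path_image (w +++ reversepath \<beta>) = path_image w \<union> path_image \<beta>"
      using that by (subst path_image_join) auto
    ultimately show "open (inside (path_image w \<union> path_image \<beta>))" "connected (inside (path_image w \<union> path_image \<beta>))"
      "inside (path_image w \<union> path_image \<beta>) ~= {}" "frontier (inside (path_image w \<union> path_image \<beta>)) = path_image w \<union> path_image \<beta>"
      using Jordan_inside_outside[of "w +++ reversepath \<beta>"] by auto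
  qed
  note j1 = jordan[OF c12(1,3,4) c\<beta>(1)] and j2 = jordan[OF c12(2,5,6) c\<beta>(2)]
  have A\<beta>: "?A1 \<inter> path_image \<beta> = {}" "?A2 \<inter> path_image \<beta> = {}"
    using inside_no_overlap[of "path_image c1 \<union> path_image \<beta>"] inside_no_overlap[of "path_image c2 \<union> path_image \<beta>"] by blast+
  have loc: "\<exists>e>0. ball p e \<inter> U ~= {} \<and> (ball p e \<inter> ?A1 = ball p e \<inter> U \<or> ball p e \<inter> ?A2 = ball p e \<inter> U)" if p: "p \<in> \<beta>o" for p
  proof -
    obtain e where e: "0 < e" "ball p e \<subseteq> \<Omega>" "connected (ball p e \<inter> U)" "ball p e \<inter> U ~= {}"
      "connected (ball p e - U - path_image \<beta>)" by (rule half_disc[OF p])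
    let ?V = "ball p e - U - path_image \<beta>"
    have U\<beta>: "U \<inter> path_image \<beta> = {}" using \<beta>_frontier by blast
    have cov: "ball p e - path_image \<beta> \<subseteq> ?A1 \<union> ?A2" using e(2) split(2) \<beta>o_im by blast
    have in1: "S \<subseteq> ?A1 \<or> S \<subseteq> ?A2" if "connected S" "S \<subseteq> ball p e - path_image \<beta>" for S
    proof (rule ccontr)
      assume "\<not> ?thesis"
      then have "?A2 \<inter> S ~= {}" "?A1 \<inter> S ~= {}" using that(2) cov by blast+
      then show False
        using connectedD[OF that(1) j1(1) j2(1)] split(1) cov that(2) by blast
    qed
    have UA: "ball p e \<inter> U \<subseteq> ?A1 \<or> ball p e \<inter> U \<subseteq> ?A2" by (rule in1[OF e(3)]) (use U\<beta> in blast)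
    have VA: "?V \<subseteq> ?A1 \<or> ?V \<subseteq> ?A2" by (rule in1[OF e(5)]) blast
    have "p \<in> closure ?A1" "p \<in> closure ?A2" using p \<beta>o_im j1(4) j2(4) by (auto simp: frontier_def)
    then have hit: "ball p e \<inter> ?A1 ~= {}" "ball p e \<inter> ?A2 ~= {}"
      using e(1) open_Int_closure_eq_empty[OF open_ball, of p e] by (metis centre_in_ball disjoint_iff)+
    have dec: "ball p e \<inter> ?A1 \<subseteq> (ball p e \<inter> U) \<union> ?V" "ball p e \<inter> ?A2 \<subseteq> (ball p e \<inter> U) \<union> ?V" using A\<beta> by blast+
    have "ball p e \<inter> ?A1 = ball p e \<inter> U \<or> ball p e \<inter> ?A2 = ball p e \<inter> U"
      by (rule two_sides[OF _ UA VA hit dec split(1)]) blast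
    then show ?thesis using e(1,4) by blast
  qed
  have main: thesis
    if j: "open A" "connected A" "A ~= {}" "frontier A = path_image w \<union> path_image \<beta>"
      and w: "arc w" "path_image w \<subseteq> path_image \<gamma>" and A: "A \<inter> A' = {}" "A \<union> A' \<union> \<beta>o = \<Omega>" "open A'"
      and A\<beta>: "A \<inter> path_image \<beta> = {}"
      and nb: "\<And>p. p \<in> \<beta>o ==> \<exists>e>0. ball p e \<inter> A = ball p e \<inter> U" for A A' w
  proof -
    have A\<Lambda>: "A \<inter> \<Lambda> = {}"
    proof (rule ccontr)
      assume ne: "A \<inter> \<Lambda> ~= {}"
      \<comment> \<open>The other side together with all open sets that meet \<open>A\<close> inside
        \<open>U\<close> only. It contains the crosscut, and \<open>A\<close> and \<open>W\<close>
        have no common point in \<open>\<Lambda>\<close>, so they would separate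
        \<open>\<Lambda>\<close>.\<close>
      define W where "W = A' \<union> \<Union> {B. open B \<and> B \<inter> A \<subseteq> U}"
      have oW: "open W" using A(3) unfolding W_def by (intro open_Un open_Union) auto
      have AW: "A \<inter> W \<inter> \<Lambda> = {}"
      proof (rule ccontr)
        assume "A \<inter> W \<inter> \<Lambda> ~= {}"
        then obtain z where z: "z \<in> A" "z \<in> W" "z \<in> \<Lambda>" by blast
        then have "z \<notin> A'" using A(1) by blast
        then obtain B where "z \<in> B" "B \<inter> A \<subseteq> U" using z(2) unfolding W_def by blast
        then show False using z U_\<Lambda> by blast
      qed
      have bW: "\<beta>o \<subseteq> W"
      proof
        fix p assume p: "p \<in> \<beta>o"
        obtain e where "e > 0" "ball p e \<inter> A = ball p e \<inter> U" using nb[OF p] by blast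
        then have "p \<in> ball p e" "open (ball p e)" "ball p e \<inter> A \<subseteq> U" by auto
        then show "p \<in> W" unfolding W_def by blast
      qed
      have A'W: "A' \<subseteq> W" unfolding W_def by (rule Un_upper1)
      have cov: "\<Lambda> \<subseteq> A \<union> W" using \<Lambda>_inside A(2) bW A'W by blast
      have "W \<inter> \<Lambda> ~= {}" using bW \<beta>one(1) \<beta>_\<Lambda> unfolding \<beta>o_def by blast
      then show False using connectedD[OF connected_\<Lambda> j(1) oW AW cov] ne by blast
    qed
    have A\<gamma>: "A \<inter> path_image \<gamma> = {}" using A(2) J_props(4) by blast
    have comp: "A \<in> components (- (\<Lambda> \<union> path_image \<gamma>))"
      unfolding in_components_maximal
    proof (intro conjI allI impI)
      show "A \<subseteq> - (\<Lambda> \<union> path_image \<gamma>)" using A\<Lambda> A\<gamma> by blast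
      fix D assume D: "D ~= {} \<and> A \<subseteq> D \<and> D \<subseteq> - (\<Lambda> \<union> path_image \<gamma>) \<and> connected D"
      have "path_image \<beta> \<subseteq> \<Lambda> \<union> path_image \<gamma>" using \<beta>_\<Lambda> \<beta>(2,3) by blast
      then have "D \<inter> frontier A = {}" using D w(2) unfolding j(4) by blast
      moreover have "D \<inter> A ~= {}" using D j(3) by blast
      ultimately have "D - A = {}" using connected_Int_frontier[of D A] D by metis
      then show "D = A" using D by blast
    qed (use j in auto)
    have "path_image \<gamma> \<inter> \<Lambda> = {}" using \<Lambda>_inside J_props(4) by blast
    then have fr: "frontier A \<inter> \<Lambda> = \<beta>o"
      unfolding j(4) using w(2) \<beta>_\<Lambda> \<beta>(2,3) unfolding \<beta>o_def by blast
    have "path_image w \<subseteq> frontier A \<inter> path_image \<gamma>" using j(4) w(2) by blast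
    then have "infinite (frontier A \<inter> path_image \<gamma>)" using arc_interior_connected(3)[OF w(1)] infinite_super by blast
    moreover have "A \<subseteq> \<Omega>" using A(2) by blast
    ultimately show thesis by (intro result[OF comp _ fr _ nb])
  qed
  \<comment> \<open>Which side agrees with \<open>U\<close> is locally constant along the crosscut,
    and the open crosscut is connected.\<close>
  have conn: "(\<forall>p\<in>\<beta>o. \<exists>e>0. ball p e \<inter> ?A1 = ball p e \<inter> U) \<or> (\<forall>p\<in>\<beta>o. \<exists>e>0. ball p e \<inter> ?A2 = ball p e \<inter> U)"
  proof -
    define Op where "Op A = \<Union> {B. open B \<and> B \<inter> A = B \<inter> U}" for A
    have opn: "open (Op A)" for A unfolding Op_def by (intro open_Union) auto
    have Oin: "p \<in> Op A" if "e > 0" "ball p e \<inter> A = ball p e \<inter> U" for p A e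
    proof -
      have "p \<in> ball p e" "open (ball p e)" using that(1) by auto
      then show ?thesis using that(2) unfolding Op_def by blast
    qed
    have cov: "\<beta>o \<subseteq> Op ?A1 \<union> Op ?A2"
    proof
      fix p assume p: "p \<in> \<beta>o"
      obtain e where e: "e > 0" "ball p e \<inter> ?A1 = ball p e \<inter> U \<or> ball p e \<inter> ?A2 = ball p e \<inter> U"
        using loc[OF p] by (elim exE conjE)
      from e(2) show "p \<in> Op ?A1 \<union> Op ?A2"
        by (elim disjE) (simp_all add: Oin[OF e(1)])
    qed
    have ex: "\<exists>e>0. ball p e \<inter> A = ball p e \<inter> U" if pO: "p \<in> Op A" for p A
    proof -
      obtain B where B: "p \<in> B" "open B" "B \<inter> A = B \<inter> U" using pO unfolding Op_def by blast
      obtain e where e: "e > 0" "ball p e \<subseteq> B" using B(1,2) by (meson openE)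
      have "ball p e \<inter> A = ball p e \<inter> (B \<inter> A)" using e(2) by blast
      also have "\<dots> = ball p e \<inter> U" unfolding B(3) using e(2) by blast
      finally show ?thesis using e(1) by blast
    qed
    have disj: "Op ?A1 \<inter> Op ?A2 \<inter> \<beta>o = {}"
    proof (rule ccontr)
      assume "Op ?A1 \<inter> Op ?A2 \<inter> \<beta>o ~= {}"
      then obtain p where p: "p \<in> Op ?A1" "p \<in> Op ?A2" "p \<in> \<beta>o" by blast
      obtain e1 where e1: "e1 > 0" "ball p e1 \<inter> ?A1 = ball p e1 \<inter> U" using ex[OF p(1)] by (elim exE conjE)
      obtain e2 where e2: "e2 > 0" "ball p e2 \<inter> ?A2 = ball p e2 \<inter> U" using ex[OF p(2)] by (elim exE conjE)
      let ?e = "min e1 e2"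
      have "p \<in> closure ?A1" using p(3) \<beta>o_im j1(4) by (auto simp: frontier_def)
      then have "ball p ?e \<inter> ?A1 ~= {}"
        using e1(1) e2(1) open_Int_closure_eq_empty[OF open_ball, of p ?e] by (metis centre_in_ball disjoint_iff min_less_iff_conj)
      then obtain z where z: "z \<in> ball p e1" "z \<in> ball p e2" "z \<in> ?A1" by auto
      have "z \<in> ball p e1 \<inter> U" using z(1,3) e1(2)[symmetric] by simp
      then have "z \<in> ball p e2 \<inter> ?A2" using z(2) e2(2) by simp
      then show False using split(1) z(3) by blast
    qed
    have "Op ?A1 \<inter> \<beta>o = {} \<or> Op ?A2 \<inter> \<beta>o = {}"
      using connectedD[OF \<beta>one(2) opn opn disj cov] .
    then have "\<beta>o \<subseteq> Op ?A1 \<or> \<beta>o \<subseteq> Op ?A2" using cov by blast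
    then show ?thesis
    proof
      assume *: "\<beta>o \<subseteq> Op ?A1"
      show ?thesis by (intro disjI1 ballI ex) (rule subsetD[OF *])
    next
      assume *: "\<beta>o \<subseteq> Op ?A2"
      show ?thesis by (intro disjI2 ballI ex) (rule subsetD[OF *])
    qed
  qed
  show thesis
    using conn
  proof
    assume *: "\<forall>p\<in>\<beta>o. \<exists>e>0. ball p e \<inter> ?A1 = ball p e \<inter> U"
    have "path_image c1 \<subseteq> path_image \<gamma>" using c12(8) by blast
    then show thesis by (rule main[OF j1 c12(1) _ split j2(1) A\<beta>(1) bspec[OF *]])
  next
    assume *: "\<forall>p\<in>\<beta>o. \<exists>e>0. ball p e \<inter> ?A2 = ball p e \<inter> U"
    have "path_image c2 \<subseteq> path_image \<gamma>" "?A2 \<inter> ?A1 = {}" "?A2 \<union> ?A1 \<union> \<beta>o = \<Omega>" using c12(8) split by blast+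
    then show thesis by (rule main[OF j2 c12(2) _ _ _ j1(1) A\<beta>(2) bspec[OF *]])
  qed
qed

end

section \<open>Faces of the T-graph inside an enclosing curve\<close>

locale enclosed_drawing = drawn_graph +
  fixes \<gamma> :: "real => complex"
  assumes curve: "simple_path \<gamma>" "pathfinish \<gamma> = pathstart \<gamma>"
    and curve_roots: "Rt \<subseteq> path_image \<gamma>" and curve_\<Lambda>: "\<Lambda> \<subseteq> inside (path_image \<gamma>)"
begin

interpretation Q: cyclic_polygon "\<lambda>j. r (j mod Suc m)" "Suc m" by (rule outer_polygon)

text \<open>The frontier of the tile without its side on \<open>Q\<close>. This is what the tile
  shares with the face of the T-graph that extends it, and it determines all lengths.\<close>

definition bd :: "nat => complex set" where "bd j = \<Lambda> \<inter> (\<Union>e\<in>Ew j. seg e)"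

definition C :: "complex set set" where "C = components (- (\<Lambda> \<union> path_image \<gamma>))"

lemma root_curve: "k \<le> m ==> r k \<in> path_image \<gamma>"
  using curve_roots by (auto simp: Rt_def)

lemma Jordan: "open (inside (path_image \<gamma>))" "connected (inside (path_image \<gamma>))" "bounded (inside (path_image \<gamma>))"
  "connected (outside (path_image \<gamma>))" "\<not> bounded (outside (path_image \<gamma>))" "outside (path_image \<gamma>) ~= {}"
  "inside (path_image \<gamma>) \<union> outside (path_image \<gamma>) = - path_image \<gamma>"
  using Jordan_inside_outside[OF curve] by auto

lemma \<Lambda>_curve: "\<Lambda> \<inter> path_image \<gamma> = {}"
  using curve_\<Lambda> inside_no_overlap[of "path_image \<gamma>"] by blast

lemma \<Lambda>_nonempty: "\<Lambda> ~= {}"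
proof -
  have "Lseg b0 ~= {}" unfolding Lseg_def by (simp add: pt_inj b0_n lo_less_hi less_imp_neq)
  then show ?thesis using Lseg_subset[OF b0_n] by blast
qed

lemma side_\<Lambda>: "k < m ==> closed_segment (r k) (r (Suc k)) \<inter> \<Lambda> = {}"
  using Lseg_side_disjoint[of _ k] unfolding \<Lambda>_def by fastforce

lemma outer_position: "k < m ==> k' < m ==> snd (oe k) = snd (oe k') \<longleftrightarrow> k = k'"
  using outer_white_distinct by blast

lemma frontier_tile_outer:
  assumes k: "k < m"
  shows "frontier (tile (snd (oe k))) = (\<Union>e\<in>Ew (snd (oe k)). seg e) \<union> closed_segment (r k) (r (Suc k))"
proof -
  have "{k'. k' < m \<and> snd (oe k') = snd (oe k)} = {k}" using outer_position k by blast
  then show ?thesis using frontier_tile[of "snd (oe k)"] outer_j[OF k] by simp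
qed

lemma bd_frontier:
  assumes j: "j < n"
  shows "\<Lambda> \<inter> frontier (tile j) = bd j"
  unfolding frontier_tile[OF j] bd_def using side_\<Lambda> by blast

lemma \<Lambda>_closure_tile: "j < n ==> p \<in> \<Lambda> ==> p \<in> closure (tile j) \<longleftrightarrow> p \<in> bd j"
  using bd_frontier[of j] tile_\<Lambda>[of j] interior_open[OF open_tile] unfolding frontier_def by blast

lemma bd_nonempty:
  assumes j: "j < n" shows "bd j ~= {}"
proof -
  obtain e where e: "e \<in> Ew j" using st0_Ew[OF j] by blast
  then have eE: "e \<in> E" by (simp add: Ew_def)
  have i: "fst e < n" using eE by (simp add: E_bounds)
  let ?p = "pt (fst e) (co e + 1/2 * \<kappa> e)"
  have \<kappa>: "\<kappa> e ~= 0" using \<kappa>_nonzero[OF eE] .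
  have "co e + 1/2 * \<kappa> e = (1 - 1/2) *\<^sub>R co e + (1/2) *\<^sub>R (co e + \<kappa> e)" by (simp add: algebra_simps)
  then have "co e + 1/2 * \<kappa> e \<in> closed_segment (co e) (co e + \<kappa> e)"
    unfolding closed_segment_def by (intro CollectI exI[of _ "1/2"]) simp
  then have "?p \<in> seg e" unfolding seg_pt[OF eE] by (rule imageI)
  moreover have "?p ~= \<psi> (Rv e)" "?p ~= \<psi> (Lv e)" using \<kappa> by (simp_all add: psi_pt eE pt_inj i)
  ultimately have "?p \<in> Lseg (fst e)" using seg_interior[OF eE] by metis
  then show ?thesis using \<open>?p \<in> seg e\<close> e Lseg_subset[OF i] unfolding bd_def by blast
qed

text \<open>Beyond its side on \<open>Q\<close> the face extends up to the curve. The crosscut is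
  the frontier of the tile with that open side removed; its ends are roots, which lie on the
  curve.\<close>

lemma outer_tile_face:
  assumes k: "k < m" and j: "j = snd (oe k)"
  shows "\<exists>A\<in>C. bounded A \<and> frontier A \<inter> \<Lambda> = bd j \<and> (\<forall>p\<in>bd j. \<forall>\<^sub>F z in nhds p. z \<in> A \<longleftrightarrow> z \<in> tile j)"
proof -
  have jn: "j < n" using outer_j[OF k] j by simp
  interpret T: cyclic_polygon "P j" "dP j" by (rule polygon[OF jn])
  have tile: "tile j = T.tile" by (simp add: tile_def)
  have int: "interior (tile j) ~= {}" using interior_open[OF open_tile[OF jn]] tile_nonempty[OF jn] by simp
  have ne: "r k ~= r (Suc k)" using g_side[OF b0_n k] by auto
  have fr: "frontier (tile j) = (\<Union>e\<in>Ew j. seg e) \<union> closed_segment (r k) (r (Suc k))"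
    unfolding j by (rule frontier_tile_outer[OF k])
  have sub: "closed_segment (r k) (r (Suc k)) \<subseteq> frontier (tile j)" unfolding fr by blast
  obtain \<beta> where \<beta>: "arc \<beta>" "pathstart \<beta> = r k" "pathfinish \<beta> = r (Suc k)"
    "path_image \<beta> = frontier (tile j) - open_segment (r k) (r (Suc k))"
    by (rule convex_frontier_arc[OF convex_tile[OF jn] bounded_tile[OF jn] int ne sub])
  have \<beta>o: "path_image \<beta> - {pathstart \<beta>, pathfinish \<beta>} = frontier (tile j) - closed_segment (r k) (r (Suc k))"
    unfolding \<beta> closed_segment_eq_open by blast
  have \<beta>o_bd: "path_image \<beta> - {pathstart \<beta>, pathfinish \<beta>} = bd j"
  proof -
    have "(\<Union>e\<in>Ew j. seg e) - {r k, r (Suc k)} \<subseteq> \<Lambda>" unfolding j by (rule outer_frontier[OF k])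
    then show ?thesis unfolding \<beta>o fr bd_def using side_\<Lambda>[OF k] ends_in_segment[of "r k" "r (Suc k)"] by blast
  qed
  have lev: "z \<in> tile j \<longleftrightarrow> (\<forall>l\<in>{..<dP j}. 0 < T.level l z)" "z \<in> closure (tile j) \<longleftrightarrow> (\<forall>l\<in>{..<dP j}. 0 \<le> T.level l z)" for z
    by (simp_all only: tile T.closure_tile) (auto simp: T.tile_def T.closed_tile_def)
  let ?c = "\<lambda>l. T.orient *\<^sub>R (\<i> * T.side l)" and ?b = "\<lambda>l. T.orient * cr (T.side l) (P j l)"
  have half: "0 < T.level l z \<longleftrightarrow> ?b l < ?c l \<bullet> z" "0 \<le> T.level l z \<longleftrightarrow> ?b l \<le> ?c l \<bullet> z" for l z
    using T.level_halfspace[of l] by (simp_all add: set_eq_iff)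
  have fcl: "z \<in> frontier (tile j) \<longleftrightarrow> z \<notin> tile j \<and> (\<forall>l\<in>{..<dP j}. ?b l \<le> ?c l \<bullet> z)" for z
    unfolding frontier_def interior_open[OF open_tile[OF jn]] using lev(2)[of z] half(2) by auto
  interpret X: crosscut \<gamma> \<beta> \<Lambda> "tile j" "{..<dP j}" ?c ?b
  proof unfold_locales
    show "simple_path \<gamma>" "pathfinish \<gamma> = pathstart \<gamma>" by (rule curve)+
    show "connected \<Lambda>" by (rule connected_\<Lambda>)
    show "\<Lambda> \<subseteq> inside (path_image \<gamma>)" by (rule curve_\<Lambda>)
    show "arc \<beta>" by (rule \<beta>(1))
    show "pathstart \<beta> \<in> path_image \<gamma>" "pathfinish \<beta> \<in> path_image \<gamma>" using root_curve k by (simp_all add: \<beta>)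
    show "path_image \<beta> - {pathstart \<beta>, pathfinish \<beta>} \<subseteq> \<Lambda>" unfolding \<beta>o_bd bd_def by blast
    show "finite {..<dP j}" by simp
    have "z \<in> tile j \<longleftrightarrow> (\<forall>l\<in>{..<dP j}. ?b l < ?c l \<bullet> z)" for z unfolding lev(1) half(1) ..
    then show "tile j = {z. \<forall>l\<in>{..<dP j}. ?b l < ?c l \<bullet> z}" by blast
    show "tile j ~= {}" by (rule tile_nonempty[OF jn])
    show "?c l ~= 0" for l using T.side_nonzero[of l] T.orient_cases by auto
    show "\<exists>y. ?c l \<bullet> y < 0 \<and> ?c l' \<bullet> y < 0" if l: "l \<in> {..<dP j}" "l' \<in> {..<dP j}" "l ~= l'" for l l'
    proof -
      define D where "D = cr (T.side l) (T.side l')"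
      have D: "D ~= 0" unfolding D_def by (rule T.side_nonparallel) (use l in simp)
      have c: "?c l \<bullet> y = T.orient * cr (T.side l) y" for l y by (simp add: cr_inner)
      \<comment> \<open>Two non-parallel constraints can be violated together: the multiples of the
        two sides are chosen so that both values become minus the square of
        \<open>D\<close>.\<close>
      let ?y = "of_real (T.orient * D) * T.side l - of_real (T.orient * D) * T.side l'"
      have y: "cr x ?y = T.orient * D * cr x (T.side l) - T.orient * D * cr x (T.side l')" for x by (simp add: mult.assoc)
      have k1: "cr (T.side l) ?y = - T.orient * D * D" unfolding y by (simp add: D_def)
      have 1: "?c l \<bullet> ?y = - (D * D)" unfolding c k1 by (simp add: mult.assoc)
      have k2: "cr (T.side l') ?y = - T.orient * D * D" unfolding y by (simp add: D_def cr_commute[of "T.side l'" "T.side l"])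
      have 2: "?c l' \<bullet> ?y = - (D * D)" unfolding c k2 by (simp add: mult.assoc)
      have "0 < D * D" using D by (metis not_real_square_gt_zero)
      then show ?thesis using 1 2 by (intro exI[of _ ?y]) simp
    qed
    show "p \<notin> tile j \<and> (\<forall>l\<in>{..<dP j}. ?b l \<le> ?c l \<bullet> p)" if "p \<in> path_image \<beta>" for p
      using that fcl[of p] unfolding \<beta>(4) by blast
    show "\<exists>e>0. \<forall>z\<in>ball p e. z \<notin> tile j \<and> (\<forall>l\<in>{..<dP j}. ?b l \<le> ?c l \<bullet> z) \<longrightarrow> z \<in> path_image \<beta>"
      if p: "p \<in> path_image \<beta> - {pathstart \<beta>, pathfinish \<beta>}" for p
    proof -
      have "p \<in> - closed_segment (r k) (r (Suc k))" using p unfolding \<beta>o by blast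
      then obtain e where e: "e > 0" "ball p e \<subseteq> - closed_segment (r k) (r (Suc k))"
        using open_Compl[OF closed_segment] by (meson openE)
      have "z \<in> path_image \<beta>" if "z \<in> ball p e" "z \<notin> tile j \<and> (\<forall>l\<in>{..<dP j}. ?b l \<le> ?c l \<bullet> z)" for z
        using that e(2) fcl[of z] unfolding \<beta>(4) closed_segment_eq_open by blast
      then show ?thesis using e(1) by blast
    qed
    show "tile j \<inter> \<Lambda> = {}" by (rule tile_\<Lambda>[OF jn])
  qed
  obtain A where A: "A \<in> components (- (\<Lambda> \<union> path_image \<gamma>))" "A \<subseteq> inside (path_image \<gamma>)"
    "frontier A \<inter> \<Lambda> = X.\<beta>o" "\<And>p. p \<in> X.\<beta>o ==> \<exists>e>0. ball p e \<inter> A = ball p e \<inter> tile j"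
    by (rule X.crosscut_side, rule that; blast)
  have bo: "X.\<beta>o = bd j" unfolding X.\<beta>o_def by (rule \<beta>o_bd)
  show ?thesis
  proof (intro bexI[of _ A] conjI ballI)
    show "A \<in> C" using A(1) by (simp add: C_def)
    show "bounded A" by (rule bounded_subset[OF Jordan(3) A(2)])
    show "frontier A \<inter> \<Lambda> = bd j" using A(3) bo by simp
    fix p assume "p \<in> bd j"
    then obtain e where e: "e > 0" "ball p e \<inter> A = ball p e \<inter> tile j" using A(4)[of p] bo by auto
    show "\<forall>\<^sub>F z in nhds p. z \<in> A \<longleftrightarrow> z \<in> tile j"
      by (rule eventually_mono[OF eventually_nhds_ball[OF e(1)]]) (use e(2) in \<open>simp add: set_eq_iff; blast\<close>)
  qed
qed

text \<open>The face on the far side of the segment of \<open>b0\<close>. The same crosscut argument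
  applies with \<open>U\<close> the open half-plane beyond the closing side, which
  \<open>\<Lambda>\<close> avoids.\<close>

lemma base_face:
  obtains A where "A \<in> C" "bounded A" "frontier A \<inter> \<Lambda> = Lseg b0" "infinite (frontier A \<inter> path_image \<gamma>)"
    "\<And>p. p \<in> Lseg b0 ==> \<forall>\<^sub>F z in nhds p. z \<in> A \<longleftrightarrow> Q.level m z < 0"
proof -
  note result = that
  let ?\<beta> = "linepath (r m) (r 0)" and ?U = "{z. Q.level m z < 0}"
  let ?c = "\<lambda>_::unit. - Q.orient *\<^sub>R (\<i> * Q.side m)" and ?b = "\<lambda>_::unit. - Q.orient * cr (Q.side m) (r m)"
  have side: "Q.side m = r 0 - r m" by (simp add: Q.side_def)
  have ne: "r m ~= r 0" using Q.side_nonzero[of m] side by auto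
  have half: "?c l \<bullet> z - ?b l = - Q.level m z" for l z
    by (simp add: Q.level_def cr_inner inner_diff_right algebra_simps)
  have half': "Q.level m z < 0 \<longleftrightarrow> ?b l < ?c l \<bullet> z" "Q.level m z \<le> 0 \<longleftrightarrow> ?b l \<le> ?c l \<bullet> z" for l z
    using half[where z=z] by (metis diff_gt_0_iff_gt neg_0_less_iff_less, metis diff_ge_0_iff_ge neg_0_le_iff_le)
  have \<beta>o: "path_image ?\<beta> - {pathstart ?\<beta>, pathfinish ?\<beta>} = Lseg b0"
    unfolding Lseg_b0 by (simp add: open_segment_def closed_segment_commute insert_commute)
  interpret X: crosscut \<gamma> ?\<beta> \<Lambda> ?U UNIV ?c ?b
  proof unfold_locales
    show "simple_path \<gamma>" "pathfinish \<gamma> = pathstart \<gamma>" by (rule curve)+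
    show "connected \<Lambda>" by (rule connected_\<Lambda>)
    show "\<Lambda> \<subseteq> inside (path_image \<gamma>)" by (rule curve_\<Lambda>)
    show "arc ?\<beta>" using ne by (rule arc_linepath)
    show "pathstart ?\<beta> \<in> path_image \<gamma>" "pathfinish ?\<beta> \<in> path_image \<gamma>" using root_curve by simp_all
    show "path_image ?\<beta> - {pathstart ?\<beta>, pathfinish ?\<beta>} \<subseteq> \<Lambda>" unfolding \<beta>o by (rule Lseg_subset[OF b0_n])
    show "finite (UNIV :: unit set)" by simp
    show "?U = {z. \<forall>l\<in>UNIV. ?b l < ?c l \<bullet> z}" using half'(1) by simp
    have "Q.level m (r m - of_real Q.orient * (\<i> * Q.side m)) < 0"
    proof -
      have "cr (Q.side m) (\<i> * Q.side m) = (norm (Q.side m))\<^sup>2"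
        unfolding cr_inner by (simp add: power2_norm_eq_inner[symmetric] norm_mult)
      then have "Q.level m (r m - of_real Q.orient * (\<i> * Q.side m)) = - (norm (Q.side m))\<^sup>2"
        by (simp add: Q.level_def)
      then show ?thesis using Q.side_nonzero[of m] by simp
    qed
    then show "?U ~= {}" by blast
    show "?c l ~= 0" for l using Q.side_nonzero[of m] Q.orient_cases by auto
    show "\<exists>y. ?c l \<bullet> y < 0 \<and> ?c l' \<bullet> y < 0" if "l ~= l'" for l l' using that by simp
    show "p \<notin> ?U \<and> (\<forall>l\<in>UNIV. ?b l \<le> ?c l \<bullet> p)" if "p \<in> path_image ?\<beta>" for p
    proof -
      have "Q.level m p = 0" by (rule closed_side_level) (use that in auto)
      then show ?thesis using half'(2)[of p] by simp
    qed
    show "\<exists>e>0. \<forall>z\<in>ball p e. z \<notin> ?U \<and> (\<forall>l\<in>UNIV. ?b l \<le> ?c l \<bullet> z) \<longrightarrow> z \<in> path_image ?\<beta>"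
      if p: "p \<in> path_image ?\<beta> - {pathstart ?\<beta>, pathfinish ?\<beta>}" for p
    proof -
      obtain u where u: "0 \<le> u" "u \<le> 1" "p = r m + of_real u * Q.side m"
        using p by (auto simp: closed_segment_def side scaleR_conv_of_real algebra_simps)
      have u01: "u ~= 0" "u ~= 1" using p u(3) side by auto
      \<comment> \<open>The distance from \<open>p\<close> to the nearer end of the side, so that
        points of the line this close to \<open>p\<close> stay on the side.\<close>
      define e where "e = min u (1 - u) * norm (Q.side m)"
      have "e > 0" using u u01 Q.side_nonzero[of m] by (auto simp: e_def)
      moreover have "z \<in> path_image ?\<beta>" if z: "z \<in> ball p e" "z \<notin> ?U \<and> (\<forall>l\<in>UNIV. ?b l \<le> ?c l \<bullet> z)" for z
      proof -
        have "Q.level m z = 0" using z(2) half'(2)[of z] by force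
        then have "cr (Q.side m) (z - r m) = 0" using Q.orient_cases by (auto simp: Q.level_def)
        then obtain t where t: "z - r m = of_real t * Q.side m"
          using iffD1[OF cr_eq_0_iff[OF Q.side_nonzero]] by blast
        then have "z - p = of_real (t - u) * Q.side m" by (simp add: u(3) algebra_simps)
        then have "norm (z - p) = \<bar>t - u\<bar> * norm (Q.side m)" by (simp only: norm_mult norm_of_real)
        then have "\<bar>t - u\<bar> < min u (1 - u)"
          using z(1) Q.side_nonzero[of m] by (auto simp: e_def dist_norm norm_minus_commute)
        then have "0 \<le> t" "t \<le> 1" by auto
        moreover have "z = (1 - t) *\<^sub>R r m + t *\<^sub>R r 0"
          using t side by (simp add: scaleR_conv_of_real algebra_simps)
        ultimately show ?thesis by (auto simp: closed_segment_def)
      qed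
      ultimately show ?thesis by blast
    qed
    show "?U \<inter> \<Lambda> = {}"
    proof -
      have "0 \<le> Q.level m z" if "z \<in> \<Lambda>" for z
        using that closure_Lseg_Qhull closure_subset Qhull_level unfolding \<Lambda>_def by blast
      then show ?thesis by force
    qed
  qed
  obtain A where A: "A \<in> components (- (\<Lambda> \<union> path_image \<gamma>))" "A \<subseteq> inside (path_image \<gamma>)"
    "frontier A \<inter> \<Lambda> = X.\<beta>o" "infinite (frontier A \<inter> path_image \<gamma>)"
    "\<And>p. p \<in> X.\<beta>o ==> \<exists>e>0. ball p e \<inter> A = ball p e \<inter> ?U"
    by (rule X.crosscut_side, rule that; blast)
  have bo: "X.\<beta>o = Lseg b0" unfolding X.\<beta>o_def by (rule \<beta>o)
  have "\<forall>\<^sub>F z in nhds p. z \<in> A \<longleftrightarrow> Q.level m z < 0" if p: "p \<in> Lseg b0" for p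
  proof -
    obtain e where e: "e > 0" "ball p e \<inter> A = ball p e \<inter> ?U" using A(5)[of p] bo p by auto
    show ?thesis
      by (rule eventually_mono[OF eventually_nhds_ball[OF e(1)]]) (use e(2) in \<open>simp add: set_eq_iff; blast\<close>)
  qed
  then show ?thesis
    by (intro result[of A] bounded_subset[OF Jordan(3) A(2)]) (use A bo in \<open>simp_all add: C_def\<close>)
qed

text \<open>The whole frontier of the tile is in \<open>\<Lambda>\<close>, which the curve avoids.
  The curve is connected and passes through a root outside the tile, so it does not enter it and the
  tile is itself a face.\<close>

lemma inner_tile_face:
  assumes j: "j < n" "j \<notin> snd ` Out"
  shows "tile j \<in> C" "frontier (tile j) \<inter> \<Lambda> = bd j"
proof -
  have fr: "frontier (tile j) \<subseteq> \<Lambda>" by (rule inner_frontier[OF j])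
  have "r 0 \<notin> tile j"
  proof
    assume "r 0 \<in> tile j"
    moreover have "r 0 \<in> closure \<Lambda>" unfolding closure_\<Lambda> by (simp add: Rt_def)
    ultimately have "tile j \<inter> \<Lambda> ~= {}" using open_Int_closure_eq_empty[OF open_tile[OF j(1)], of \<Lambda>] by blast
    then show False using tile_\<Lambda>[OF j(1)] by simp
  qed
  then have "path_image \<gamma> - tile j ~= {}" using root_curve[of 0] by blast
  moreover have "path_image \<gamma> \<inter> frontier (tile j) = {}" using fr \<Lambda>_curve by blast
  moreover have "connected (path_image \<gamma>)" using curve(1) by (simp add: connected_simple_path_image)
  ultimately have "path_image \<gamma> \<inter> tile j = {}" using connected_Int_frontier by metis
  then have sub: "tile j \<subseteq> - (\<Lambda> \<union> path_image \<gamma>)" using tile_\<Lambda>[OF j(1)] by blast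
  show "tile j \<in> C"
    unfolding C_def in_components_maximal
  proof (intro conjI allI impI)
    show "tile j ~= {}" "connected (tile j)" using tile_nonempty[OF j(1)] convex_connected[OF convex_tile[OF j(1)]] by auto
    show "tile j \<subseteq> - (\<Lambda> \<union> path_image \<gamma>)" by (rule sub)
    fix D assume D: "D ~= {} \<and> tile j \<subseteq> D \<and> D \<subseteq> - (\<Lambda> \<union> path_image \<gamma>) \<and> connected D"
    have "D \<inter> frontier (tile j) = {}" using D fr by blast
    moreover have "D \<inter> tile j ~= {}" using D tile_nonempty[OF j(1)] by blast
    ultimately have "D - tile j = {}" using connected_Int_frontier[of D "tile j"] D by metis
    then show "D = tile j" using D by blast
  qed
  show "frontier (tile j) \<inter> \<Lambda> = bd j" using bd_frontier[OF j(1)] by (simp add: Int_commute)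
qed

lemma tile_face:
  assumes j: "j < n"
  shows "\<exists>A. A \<in> C \<and> bounded A \<and> frontier A \<inter> \<Lambda> = bd j \<and> (\<forall>p\<in>bd j. \<forall>\<^sub>F z in nhds p. z \<in> A \<longleftrightarrow> z \<in> tile j)"
proof (cases "j \<in> snd ` Out")
  case True
  then obtain k where "k < m" "j = snd (oe k)" by (rule outer_white_cases)
  then show ?thesis using outer_tile_face by blast
next
  case False
  then show ?thesis using inner_tile_face[OF j False] bounded_tile[OF j] by (intro exI[of _ "tile j"]) simp
qed

definition face :: "nat => complex set" where
  "face j = (SOME A. A \<in> C \<and> bounded A \<and> frontier A \<inter> \<Lambda> = bd j \<and> (\<forall>p\<in>bd j. \<forall>\<^sub>F z in nhds p. z \<in> A \<longleftrightarrow> z \<in> tile j))"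

definition face0 :: "complex set" where
  "face0 = (SOME A. A \<in> C \<and> bounded A \<and> frontier A \<inter> \<Lambda> = Lseg b0 \<and> infinite (frontier A \<inter> path_image \<gamma>) \<and>
     (\<forall>p\<in>Lseg b0. \<forall>\<^sub>F z in nhds p. z \<in> A \<longleftrightarrow> Q.level m z < 0))"

lemma face:
  assumes "j < n"
  shows "face j \<in> C" "bounded (face j)" "frontier (face j) \<inter> \<Lambda> = bd j"
    "p \<in> bd j ==> \<forall>\<^sub>F z in nhds p. z \<in> face j \<longleftrightarrow> z \<in> tile j"
  using someI_ex[OF tile_face[OF assms]] unfolding face_def[symmetric] by auto

lemma face0: "face0 \<in> C" "bounded face0" "frontier face0 \<inter> \<Lambda> = Lseg b0" "infinite (frontier face0 \<inter> path_image \<gamma>)"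
  "p \<in> Lseg b0 ==> \<forall>\<^sub>F z in nhds p. z \<in> face0 \<longleftrightarrow> Q.level m z < 0"
proof -
  have "\<exists>A. A \<in> C \<and> bounded A \<and> frontier A \<inter> \<Lambda> = Lseg b0 \<and> infinite (frontier A \<inter> path_image \<gamma>) \<and>
     (\<forall>p\<in>Lseg b0. \<forall>\<^sub>F z in nhds p. z \<in> A \<longleftrightarrow> Q.level m z < 0)"
    by (rule base_face) blast
  note * = someI_ex[OF this, folded face0_def]
  show "face0 \<in> C" "bounded face0" "frontier face0 \<inter> \<Lambda> = Lseg b0" "infinite (frontier face0 \<inter> path_image \<gamma>)"
    "p \<in> Lseg b0 ==> \<forall>\<^sub>F z in nhds p. z \<in> face0 \<longleftrightarrow> Q.level m z < 0" using * by auto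
qed

lemma not_eventually_tile:
  assumes p: "p \<in> closure S" and ev: "\<forall>\<^sub>F z in nhds p. z \<notin> S"
  shows False
proof -
  obtain V where "open V" "p \<in> V" "\<And>z. z \<in> V ==> z \<notin> S" using ev unfolding eventually_nhds by blast
  then show False using p open_Int_closure_eq_empty[of V S] by blast
qed

text \<open>Equal faces have the same boundary in \<open>\<Lambda>\<close>, and near a point of it
  both tiles would coincide with the face. Being disjoint they would be empty there, against the
  point being in their closure.\<close>

lemma face_inj:
  assumes j: "j < n" "j' < n" "j ~= j'"
  shows "face j ~= face j'"
proof
  assume eq: "face j = face j'"
  then have bd: "bd j = bd j'" using face(3)[OF j(1)] face(3)[OF j(2)] by simp
  obtain p where p: "p \<in> bd j" using bd_nonempty[OF j(1)] by blast
  have "\<forall>\<^sub>F z in nhds p. z \<notin> tile j"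
    by (rule eventually_mono[OF eventually_conj[OF face(4)[OF j(1) p] face(4)[OF j(2) p[unfolded bd]]]])
      (use eq tiles_disjoint[OF j] in blast)
  moreover have "p \<in> closure (tile j)" using p \<Lambda>_closure_tile[OF j(1), of p] by (auto simp: bd_def)
  ultimately show False using not_eventually_tile by blast
qed

text \<open>Near a common boundary point \<open>face0\<close> lies strictly beyond the closing side
  of \<open>Q\<close>, and no tile does.\<close>

lemma face0_neq:
  assumes j: "j < n" shows "face j ~= face0"
proof
  assume eq: "face j = face0"
  then have bd: "bd j = Lseg b0" using face(3)[OF j] face0(3) by simp
  obtain p where p: "p \<in> bd j" using bd_nonempty[OF j] by blast
  have lev: "z \<in> tile j ==> 0 \<le> Q.level m z" for z using tile_subset[OF j] Qhull_level by blast
  have "\<forall>\<^sub>F z in nhds p. z \<notin> tile j"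
    by (rule eventually_mono[OF eventually_conj[OF face(4)[OF j p] face0(5)[OF p[unfolded bd]]]])
      (use eq lev in force)
  moreover have "p \<in> closure (tile j)" using p \<Lambda>_closure_tile[OF j, of p] by (auto simp: bd_def)
  ultimately show False using not_eventually_tile by blast
qed

definition Faces :: "complex set set" where "Faces = insert face0 (face ` {..<n})"

lemma near_side:
  assumes "p \<in> \<Lambda>" "k < m" shows "\<forall>\<^sub>F z in nhds p. z \<notin> closed_segment (r k) (r (Suc k))"
proof -
  have "p \<in> - closed_segment (r k) (r (Suc k))" using side_\<Lambda>[OF assms(2)] assms(1) by blast
  then show ?thesis using eventually_nhds_in_open[OF open_Compl[OF closed_segment]] by auto
qed

lemma root_side: "k \<le> m ==> \<exists>l<m. r k \<in> closed_segment (r l) (r (Suc l))"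
proof (cases "k < m")
  case False
  assume "k \<le> m"
  then have "k = Suc (m - 1)" "m - 1 < m" using False m_pos by auto
  then show ?thesis by (metis ends_in_segment(2))
qed (use ends_in_segment(1) in blast)

lemma near_tile:
  assumes p: "p \<in> \<Lambda>" and j: "j < n"
  shows "\<forall>\<^sub>F z in nhds p. z \<in> closure (tile j) \<longrightarrow> z \<in> \<Lambda> \<or> z \<in> \<Union> Faces"
proof (cases "p \<in> bd j")
  case True
  have sides: "\<forall>\<^sub>F z in nhds p. \<forall>k\<in>{..<m}. z \<notin> closed_segment (r k) (r (Suc k))"
    by (rule eventually_ball_finite) (use near_side[OF p] in auto)
  show ?thesis
  proof (rule eventually_mono[OF eventually_conj[OF face(4)[OF j True] sides]], rule impI)
    fix z assume z: "(z \<in> face j \<longleftrightarrow> z \<in> tile j) \<and> (\<forall>k\<in>{..<m}. z \<notin> closed_segment (r k) (r (Suc k)))" "z \<in> closure (tile j)"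
    show "z \<in> \<Lambda> \<or> z \<in> \<Union> Faces"
    proof (cases "z \<in> tile j")
      case True
      then show ?thesis using z(1) j unfolding Faces_def by blast
    next
      case False
      then have "z \<in> frontier (tile j)" using z(2) interior_subset[of "tile j"] unfolding frontier_def by blast
      then obtain e where e: "e \<in> Ew j" "z \<in> seg e" unfolding frontier_tile[OF j] using z(1) by blast
      then have "e \<in> E" by (simp add: Ew_def)
      then have "z \<in> \<Lambda> \<union> Rt" using e(2) seg_subset_closure closure_Lseg_subset[OF E_bounds(1)] by blast
      moreover have "z \<notin> Rt" using root_side z(1) unfolding Rt_def by force
      ultimately show ?thesis by blast
    qed
  qed
next
  case False
  then have "p \<in> - closure (tile j)" using \<Lambda>_closure_tile[OF j p] by blast
  then have "\<forall>\<^sub>F z in nhds p. z \<in> - closure (tile j)" by (intro eventually_nhds_in_open) auto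
  then show ?thesis by (rule eventually_mono) simp
qed

text \<open>A neighbourhood of a point of \<open>\<Lambda>\<close> is filled by
  \<open>\<Lambda>\<close> and the faces already known: inside \<open>Q\<close> because the tiles
  cover it, and beyond the segment of \<open>b0\<close> because of \<open>face0\<close>.\<close>

lemma near_\<Lambda>:
  assumes p: "p \<in> \<Lambda>"
  shows "\<forall>\<^sub>F z in nhds p. z \<in> \<Lambda> \<or> z \<in> \<Union> Faces"
proof -
  have tiles: "\<forall>\<^sub>F z in nhds p. \<forall>j\<in>{..<n}. z \<in> closure (tile j) \<longrightarrow> z \<in> \<Lambda> \<or> z \<in> \<Union> Faces"
    by (rule eventually_ball_finite) (use near_tile[OF p] in auto)
  have out: "\<forall>\<^sub>F z in nhds p. z \<in> Qhull \<or> z \<in> \<Union> Faces"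
  proof -
    obtain i where i: "i < n" "p \<in> Lseg i" using p unfolding \<Lambda>_def by blast
    show ?thesis
    proof (cases "i = b0")
      case False
      then have "p \<in> Qtile" using Lseg_Qtile[OF i(1)] i(2) by blast
      moreover have "open Qtile" unfolding Qtile_def by (rule Q.open_tile)
      ultimately have "\<forall>\<^sub>F z in nhds p. z \<in> Qtile" by (intro eventually_nhds_in_open)
      then show ?thesis by (rule eventually_mono) (use closure_subset in \<open>auto simp: Qhull_def\<close>)
    next
      case True
      then have pb: "p \<in> Lseg b0" using i by simp
      have "\<forall>\<^sub>F z in nhds p. \<forall>l\<in>{..<m}. 0 < Q.level l z"
      proof (rule eventually_ball_finite)
        show "\<forall>l\<in>{..<m}. \<forall>\<^sub>F z in nhds p. 0 < Q.level l z"
        proof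
          fix l assume l: "l \<in> {..<m}"
          have "cr (Q.side l) (g b0) ~= 0" using Q_side_parallel[OF b0_n, of l] l by auto
          then have "p \<in> {z. 0 < Q.level l z}" using Lseg_level_pos[OF b0_n pb] by blast
          moreover have "open {z. 0 < Q.level l z}" unfolding Q.level_halfspace by (rule open_halfspace_gt)
          ultimately show "\<forall>\<^sub>F z in nhds p. 0 < Q.level l z" using eventually_nhds_in_open by fastforce
        qed
      qed simp
      then show ?thesis
      proof (rule eventually_mono[OF eventually_conj[OF face0(5)[OF pb]]])
        fix z assume z: "(z \<in> face0 \<longleftrightarrow> Q.level m z < 0) \<and> (\<forall>l\<in>{..<m}. 0 < Q.level l z)"
        show "z \<in> Qhull \<or> z \<in> \<Union> Faces"
        proof (cases "Q.level m z < 0")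
          case True
          then show ?thesis using z unfolding Faces_def by blast
        next
          case False
          have "0 \<le> Q.level l z" if "l < Suc m" for l
            using that z False by (cases "l = m") (auto intro: less_imp_le)
          then have "z \<in> Q.closed_tile" unfolding Q.closed_tile_def by blast
          then show ?thesis by (simp add: Qhull_def Qtile_def Q.closure_tile)
        qed
      qed
    qed
  qed
  show ?thesis
  proof (rule eventually_mono[OF eventually_conj[OF tiles out]])
    fix z assume z: "(\<forall>j\<in>{..<n}. z \<in> closure (tile j) \<longrightarrow> z \<in> \<Lambda> \<or> z \<in> \<Union> Faces) \<and> (z \<in> Qhull \<or> z \<in> \<Union> Faces)"
    show "z \<in> \<Lambda> \<or> z \<in> \<Union> Faces"
      using z unfolding Qhull_eq by blast
  qed
qed

lemma Union_Lseg: "\<Union> (Lseg ` {..<n}) = \<Lambda>"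
  by (simp add: \<Lambda>_def)

lemma closed_skeleton: "closed (\<Lambda> \<union> path_image \<gamma>)"
proof -
  have "\<Lambda> \<union> path_image \<gamma> = closure \<Lambda> \<union> path_image \<gamma>" unfolding closure_\<Lambda> using curve_roots by blast
  moreover have "closed (path_image \<gamma>)" using curve(1) by (simp add: closed_simple_path_image)
  ultimately show ?thesis by (metis closed_Un closed_closure)
qed

text \<open>A further bounded component could not accumulate at \<open>\<Lambda>\<close>, so it
  would have no frontier inside the curve and contain the entire inside, which includes
  \<open>\<Lambda>\<close>.\<close>

lemma bounded_component:
  assumes D: "D \<in> C" "bounded D"
  shows "D \<in> Faces"
proof (rule ccontr)
  assume DF: "D \<notin> Faces"
  let ?S = "- (\<Lambda> \<union> path_image \<gamma>)"
  have D1: "D ~= {}" "connected D" "D \<subseteq> ?S"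
    using D(1) in_components_nonempty in_components_connected in_components_subset unfolding C_def by blast+
  have oD: "open D" using D(1) open_components[OF open_Compl[OF closed_skeleton]] unfolding C_def by blast
  have dis: "D \<inter> F = {}" if "F \<in> C" "F ~= D" for F
    using components_nonoverlap[of D ?S F] D(1) that unfolding C_def by blast
  have FC: "Faces \<subseteq> C" unfolding Faces_def using face(1) face0(1) by blast
  have DFaces: "D \<inter> \<Union> Faces = {}" using dis FC DF by blast
  have fr\<Lambda>: "closure D \<inter> \<Lambda> = {}"
  proof (rule ccontr)
    assume "closure D \<inter> \<Lambda> ~= {}"
    then obtain p where p: "p \<in> closure D" "p \<in> \<Lambda>" by blast
    have "\<forall>\<^sub>F z in nhds p. z \<notin> D" by (rule eventually_mono[OF near_\<Lambda>[OF p(2)]]) (use DFaces D1(3) in blast)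
    then show False using not_eventually_tile p(1) by blast
  qed
  have D\<Omega>: "D \<subseteq> inside (path_image \<gamma>)"
  proof -
    have "D \<inter> outside (path_image \<gamma>) = {}"
    proof (rule ccontr)
      assume ne: "D \<inter> outside (path_image \<gamma>) ~= {}"
      have "outside (path_image \<gamma>) \<subseteq> ?S"
        using curve_\<Lambda> inside_Int_outside[of "path_image \<gamma>"] outside_no_overlap[of "path_image \<gamma>"] by blast
      then have "outside (path_image \<gamma>) \<subseteq> D"
        by (intro components_maximal[OF D(1)[unfolded C_def] Jordan(4)]) (use ne in blast)+
      then show False using Jordan(5) D(2) bounded_subset by blast
    qed
    then show ?thesis using D1(3) Jordan(7) by blast
  qed
  have "inside (path_image \<gamma>) \<inter> frontier D = {}"
  proof (rule ccontr)
    assume "inside (path_image \<gamma>) \<inter> frontier D ~= {}"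
    then obtain p where p: "p \<in> inside (path_image \<gamma>)" "p \<in> frontier D" by blast
    then have pc: "p \<in> closure D" "p \<notin> D" using interior_open[OF oD] by (auto simp: frontier_def)
    then have "p \<in> ?S" using p(1) fr\<Lambda> inside_no_overlap[of "path_image \<gamma>"] by blast
    then obtain F where F: "F \<in> C" "p \<in> F" unfolding C_def using Union_components[of ?S] by blast
    have "open F" using F(1) open_components[OF open_Compl[OF closed_skeleton]] unfolding C_def by blast
    then have "F \<inter> D ~= {}" using F(2) pc(1) open_Int_closure_eq_empty[of F D] by blast
    then have "F = D" using dis[OF F(1)] by blast
    then show False using F(2) pc(2) by blast
  qed
  moreover have "inside (path_image \<gamma>) \<inter> D ~= {}" using D\<Omega> D1(1) by blast
  ultimately have "inside (path_image \<gamma>) - D = {}" using connected_Int_frontier[OF Jordan(2)] by metis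
  then show False using curve_\<Lambda> \<Lambda>_nonempty D1(3) by blast
qed

lemma T_faces_eq: "T_faces (Lseg ` {..<n}) \<gamma> = Faces"
proof -
  have "{F \<in> C. bounded F} = Faces"
    using bounded_component face(1,2) face0(1,2) unfolding Faces_def by blast
  then show ?thesis unfolding T_faces_def Union_Lseg C_def .
qed

lemma outer_T_face: "outer_T_face (Lseg ` {..<n}) Rt \<gamma> face0"
proof -
  have "finite Rt" by (simp add: Rt_def)
  then have "\<not> frontier face0 \<inter> path_image \<gamma> \<subseteq> Rt" using face0(4) finite_subset by blast
  then show ?thesis unfolding outer_T_face_def T_faces_eq Faces_def by blast
qed

lemma whites_bij: "bij_betw face {..<n} (T_faces (Lseg ` {..<n}) \<gamma> - {face0})"
  unfolding bij_betw_def T_faces_eq Faces_def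
proof
  show "inj_on face {..<n}" by (rule inj_onI) (use face_inj in blast)
  show "face ` {..<n} = insert face0 (face ` {..<n}) - {face0}" using face0_neq by force
qed

end

section \<open>Lengths, the T-graph and its dimer graph\<close>

text \<open>Finitely many points do not affect the measure. They occur because other segments may
  end on this one.\<close>

lemma length_on_segment:
  assumes xy: "x ~= y" and uv: "u \<in> closed_segment x y" "v \<in> closed_segment x y"
    and fin: "finite (open_segment x y \<inter> (S - closed_segment u v))" "finite (open_segment x y \<inter> (closed_segment u v - S))"
  shows "length_on (open_segment x y) S = dist u v"
proof -
  \<comment> \<open>About the chosen ends only this much is known: they span the same open segment.
    The computation runs in the parametrisation that they give.\<close>
  let ?P = "\<lambda>z. case z of (x', y') => x' ~= y' \<and> open_segment x y = open_segment x' y'"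
  have "\<exists>z. ?P z" using xy by (intro exI[of _ "(x, y)"]) simp
  then have "?P (SOME z. ?P z)" by (rule someI_ex)
  obtain x' y' where z1: "(SOME z. ?P z) = (x', y')" by (rule prod.exhaust)
  have z: "x' ~= y'" "open_segment x y = open_segment x' y'"
    using \<open>?P (SOME z. ?P z)\<close> unfolding z1 prod.case by blast+
  have "closure (open_segment x y) = closure (open_segment x' y')" using z(2) by (simp only:)
  then have cl: "closed_segment x y = closed_segment x' y'" using xy z(1) by simp
  define A where "A = {t \<in> {0<..<1}. linepath x' y' t \<in> S}"
  obtain \<alpha> where \<alpha>: "0 \<le> \<alpha>" "\<alpha> \<le> 1" "u = linepath x' y' \<alpha>"
    using uv(1) linepath_image_01[of x' y'] unfolding cl by force
  obtain \<beta> where \<beta>: "0 \<le> \<beta>" "\<beta> \<le> 1" "v = linepath x' y' \<beta>"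
    using uv(2) linepath_image_01[of x' y'] unfolding cl by force
  have inj: "linepath x' y' s = linepath x' y' t \<longleftrightarrow> s = t" for s t
  proof -
    have "linepath x' y' s - linepath x' y' t = (s - t) *\<^sub>R (y' - x')" by (simp add: linepath_def algebra_simps)
    then show ?thesis using z(1) by (metis eq_iff_diff_eq_0 scaleR_eq_0_iff)
  qed
  have comb: "linepath x' y' ((1 - w) * \<alpha> + w * \<beta>) = (1 - w) *\<^sub>R u + w *\<^sub>R v" for w
    unfolding \<alpha>(3) \<beta>(3) linepath_def by (simp add: algebra_simps)
  have seg: "linepath x' y' t \<in> closed_segment u v \<longleftrightarrow> t \<in> closed_segment \<alpha> \<beta>" for t
    unfolding closed_segment_def mem_Collect_eq comb[symmetric] inj real_scaleR_def ..
  have sub: "closed_segment \<alpha> \<beta> \<subseteq> {0..1}" using \<alpha> \<beta> by (auto simp: closed_segment_eq_real_ivl)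
  have inO: "linepath x' y' t \<in> open_segment x y" if "0 < t" "t < 1" for t
    unfolding z(2) in_segment(2) using that z(1) by (auto simp: linepath_def)
  have lin: "inj_on (linepath x' y') X" for X by (rule inj_onI) (simp add: inj)
  have f1: "finite (A - closed_segment \<alpha> \<beta>)"
    by (rule finite_imageD[OF finite_subset[OF _ fin(1)] lin]) (use inO seg in \<open>auto simp: A_def\<close>)
  have f2: "finite ((closed_segment \<alpha> \<beta> \<inter> {0<..<1}) - A)"
    by (rule finite_imageD[OF finite_subset[OF _ fin(2)] lin]) (use inO seg in \<open>auto simp: A_def\<close>)
  have "closed_segment \<alpha> \<beta> - A \<subseteq> ((closed_segment \<alpha> \<beta> \<inter> {0<..<1}) - A) \<union> {0, 1}" using sub by force
  then have f3: "finite (closed_segment \<alpha> \<beta> - A)" using f2 by (meson finite.emptyI finite.insertI finite_UnI finite_subset)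
  have eqA: "A = (closed_segment \<alpha> \<beta> - (closed_segment \<alpha> \<beta> - A)) \<union> (A - closed_segment \<alpha> \<beta>)" by blast
  have B: "closed_segment \<alpha> \<beta> \<in> sets lborel" using borel_closed[OF closed_segment] by simp
  have N: "closed_segment \<alpha> \<beta> - A \<in> null_sets lborel" "A - closed_segment \<alpha> \<beta> \<in> null_sets lborel"
    using f1 f3 by (auto intro: finite_imp_null_set_lborel)
  have "emeasure lborel A = emeasure lborel (closed_segment \<alpha> \<beta> - (closed_segment \<alpha> \<beta> - A))"
    by (subst eqA, rule emeasure_Un_null_set[OF sets.Diff[OF B null_setsD2[OF N(1)]] N(2)])
  also have "\<dots> = emeasure lborel (closed_segment \<alpha> \<beta>)" by (rule emeasure_Diff_null_set[OF N(1) B])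
  finally have "measure lborel A = measure lborel (closed_segment \<alpha> \<beta>)" by (simp add: measure_def)
  also have "\<dots> = \<bar>\<beta> - \<alpha>\<bar>" by (simp add: closed_segment_eq_real_ivl)
  finally have ms: "measure lborel A = \<bar>\<beta> - \<alpha>\<bar>" .
  have "u - v = (\<beta> - \<alpha>) *\<^sub>R (x' - y')" unfolding \<alpha>(3) \<beta>(3) linepath_def by (simp add: algebra_simps)
  then have "dist u v = \<bar>\<beta> - \<alpha>\<bar> * dist x' y'" by (simp add: dist_norm)
  then show ?thesis
    unfolding length_on_def z1 Let_def prod.case A_def[symmetric] ms by simp
qed

context drawn_graph begin

interpretation Q: cyclic_polygon "\<lambda>j. r (j mod Suc m)" "Suc m" by (rule outer_polygon)

lemma Lseg_ends: "i < n ==> pt i (lo i) ~= pt i (hi i)"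
  using lo_less_hi[of i] by (simp add: pt_inj less_imp_neq)

lemma Lseg_nonempty: "i < n ==> Lseg i ~= {}"
  unfolding Lseg_def using Lseg_ends by simp

lemma Lseg_inj: "inj_on Lseg {..<n}"
proof (rule inj_onI, rule ccontr)
  fix i i' assume "i \<in> {..<n}" "i' \<in> {..<n}" "Lseg i = Lseg i'" "i ~= i'"
  then show False using Lseg_disjoint[of i i'] Lseg_nonempty[of i] by simp
qed

lemma closure_Lseg_ends: "i < n ==> closure (Lseg i) = Lseg i \<union> {pt i (lo i), pt i (hi i)}"
  unfolding Lseg_def using Lseg_ends[of i] by (simp add: closed_segment_eq_open)

lemma finite_Lseg_closure:
  assumes "i < n" "i' < n" "i ~= i'"
  shows "finite (Lseg i \<inter> closure (Lseg i'))"
proof -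
  have "Lseg i \<inter> closure (Lseg i') \<subseteq> {pt i' (lo i'), pt i' (hi i')}"
    unfolding closure_Lseg_ends[OF assms(2)] using Lseg_disjoint[OF assms] by blast
  then show ?thesis by (rule finite_subset) simp
qed

text \<open>A point on a supporting line is not an interior point.\<close>

lemma r_frontier:
  assumes S: "r k \<in> S" "\<And>z. z \<in> S ==> 0 \<le> Q.level l z" and l: "Q.level l (r k) = 0"
  shows "r k \<in> frontier S"
proof -
  let ?c = "Q.orient *\<^sub>R (\<i> * Q.side l)" and ?b = "Q.orient * cr (Q.side l) (r (l mod Suc m))"
  have c: "?c ~= 0" using Q.side_nonzero[of l] Q.orient_cases by auto
  have "S \<subseteq> {z. 0 \<le> Q.level l z}" using S(2) by blast
  then have "interior S \<subseteq> {z. 0 < Q.level l z}"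
    unfolding Q.level_halfspace using interior_mono interior_halfspace_ge[OF c, of ?b] by metis
  then have "r k \<notin> interior S" using l by auto
  then show ?thesis using S(1) closure_subset unfolding frontier_def by blast
qed

lemma root_level: "k \<le> m ==> Q.level k (r k) = 0"
  by (rule closed_side_level) auto

lemma root_level_ex: "k \<le> m ==> \<exists>l<m. Q.level l (r k) = 0"
proof (cases "k < m")
  case True
  then show ?thesis using root_level[of k] by auto
next
  case False
  assume "k \<le> m"
  then have k: "k = Suc (m - 1)" "m - 1 < m" using False m_pos by auto
  have "Q.level (m - 1) (r k) = 0" using k m_pos by (intro closed_side_level) auto
  then show ?thesis using k(2) by blast
qed

lemma convex_Qhull: "convex Qhull" and \<Lambda>_Qhull: "closure \<Lambda> \<subseteq> Qhull" and Qtile_Qhull: "Qtile \<subseteq> Qhull"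
  and bounded_Qhull: "bounded Qhull" and open_Qtile: "open Qtile"
proof -
  show "convex Qhull" unfolding Qhull_def Qtile_def by (rule convex_closure[OF Q.convex_tile])
  show "Qtile \<subseteq> Qhull" unfolding Qhull_def by (rule closure_subset)
  show "bounded Qhull" unfolding Qhull_def Qtile_def by (rule bounded_closure[OF Q.bounded_tile])
  show "open Qtile" unfolding Qtile_def by (rule Q.open_tile)
  have "\<Lambda> \<subseteq> Qhull" unfolding \<Lambda>_def using closure_Lseg_Qhull closure_subset by blast
  then show "closure \<Lambda> \<subseteq> Qhull" using closed_Qhull by (rule closure_minimal)
qed

lemma T_graph_Lseg: "T_graph (Lseg ` {..<n}) Rt"
proof -
  have U: "\<Union> (Lseg ` {..<n}) = \<Lambda>" by (simp add: \<Lambda>_def)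
  have "Rt = {z. z islimpt \<Lambda>} - \<Lambda>"
    using closure_\<Lambda> Rt_\<Lambda> unfolding closure_def by blast
  moreover have "Rt \<subseteq> frontier (outside (closure \<Lambda>))"
  proof
    fix p assume "p \<in> Rt"
    then obtain k where k: "k \<le> m" "p = r k" by (auto simp: Rt_def)
    have p: "p \<in> closure \<Lambda>" using \<open>p \<in> Rt\<close> by (simp add: closure_\<Lambda>)
    have "p \<in> frontier Qhull" unfolding k(2)
      by (rule r_frontier[OF _ Qhull_level root_level[OF k(1)]]) (use p \<Lambda>_Qhull k(2) in auto)
    then have "p \<in> closure (- Qhull)" by (simp add: frontier_closures)
    \<comment> \<open>A convex set equals the complement of its outside, so everything off the hull
      can escape from \<open>\<Lambda>\<close>.\<close>
    moreover have "- Qhull \<subseteq> outside (closure \<Lambda>)"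
      using outside_mono[OF \<Lambda>_Qhull] outside_convex[OF convex_Qhull] by simp
    ultimately have "p \<in> closure (outside (closure \<Lambda>))" using closure_mono by blast
    moreover have "p \<notin> outside (closure \<Lambda>)" using p outside_no_overlap[of "closure \<Lambda>"] by blast
    ultimately show "p \<in> frontier (outside (closure \<Lambda>))" using interior_subset unfolding frontier_def by blast
  qed
  moreover have "\<exists>x y. x ~= y \<and> l = open_segment x y" if "l \<in> Lseg ` {..<n}" for l
    using that Lseg_ends unfolding Lseg_def by blast
  moreover have "disjoint (Lseg ` {..<n})"
    using Lseg_disjoint by (intro disjointI) auto
  moreover have "finite Rt" by (simp add: Rt_def)
  ultimately show ?thesis
    unfolding T_graph_def U using connected_\<Lambda> by blast
qed

lemma ends_T_vertices: "i < n ==> {pt i (lo i), pt i (hi i)} \<subseteq> T_vertices (Lseg ` {..<n})"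
proof -
  assume i: "i < n"
  have "open_segment (pt i (lo i)) (pt i (hi i)) \<in> Lseg ` {..<n}" using i unfolding Lseg_def by blast
  moreover have "open_segment (pt i (hi i)) (pt i (lo i)) \<in> Lseg ` {..<n}"
    using calculation by (simp add: open_segment_commute)
  ultimately have "pt i (lo i) \<in> T_vertices (Lseg ` {..<n})" "pt i (hi i) \<in> T_vertices (Lseg ` {..<n})"
    using Lseg_ends[OF i] Lseg_ends[OF i, symmetric] unfolding T_vertices_def mem_Collect_eq by blast+
  then show ?thesis by simp
qed

lemma psi_T_vertices:
  assumes v: "v \<in> dual_vertices G a"
  shows "\<psi> v \<in> T_vertices (Lseg ` {..<n})"
  using v
proof (cases rule: dual_vertex_cases)
  case (1 k)
  have "\<psi> v \<in> Rt" using 1 psi_outer by (simp add: Rt_def)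
  then have "\<psi> v \<in> closure \<Lambda>" "\<psi> v \<notin> \<Lambda>" using closure_\<Lambda> Rt_\<Lambda> by blast+
  moreover have "closure \<Lambda> \<subseteq> (\<Union>i<n. closure (Lseg i))"
    unfolding \<Lambda>_def using closure_subset by (intro closure_minimal closed_UN) auto
  ultimately obtain i where i: "i < n" "\<psi> v \<in> closure (Lseg i)" "\<psi> v \<notin> Lseg i" using Lseg_subset by blast
  then show ?thesis using ends_T_vertices[OF i(1)] unfolding closure_Lseg_ends[OF i(1)] by blast
next
  case (2 x)
  then show ?thesis using inner_vertex_endpoint[of x] ends_T_vertices by blast
qed

lemma base_levels:
  assumes p: "p \<in> Lseg b0"
  shows "l < m ==> 0 < Q.level l p" "Q.level m p = 0"
proof -
  assume l: "l < m"
  have "cr (Q.side l) (g b0) ~= 0" using Q_side_parallel[OF b0_n, of l] l by auto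
  then show "0 < Q.level l p" by (rule Lseg_level_pos[OF b0_n p])
next
  have "p \<in> closed_segment (r m) (r (Suc m mod Suc m))"
    using p open_closed_segment unfolding Lseg_b0 by (auto simp: closed_segment_commute)
  then show "Q.level m p = 0" by (intro closed_side_level) simp
qed

lemma open_level: "open {z. 0 < Q.level l z}" "open {z. Q.level l z < 0}"
proof -
  show "open {z. 0 < Q.level l z}" unfolding Q.level_halfspace by (rule open_halfspace_gt)
  have eq: "{z. Q.level l z < 0} = - {z. 0 \<le> Q.level l z}" by auto
  show "open {z. Q.level l z < 0}" unfolding eq Q.level_halfspace(2) by (intro open_Compl closed_halfspace_ge)
qed

text \<open>
  The boundary of the hull of \<open>Q\<close> and one further point, slightly beyond the side containing the
  segment of \<open>b\<^sub>0\<close>.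
\<close>

lemma enclosing_curve_exists: "\<exists>\<gamma>. enclosing_curve (Lseg ` {..<n}) Rt \<gamma>"
proof -
  obtain p where p: "p \<in> Lseg b0" using Lseg_nonempty[OF b0_n] by blast
  let ?y = "of_real Q.orient * (\<i> * Q.side m)"
  have ly: "Q.level m (z + of_real (- s) * ?y) = Q.level m z - s * (norm (Q.side m))\<^sup>2" for z s
  proof -
    have "cr (Q.side m) (\<i> * Q.side m) = (norm (Q.side m))\<^sup>2"
      unfolding cr_inner by (simp add: power2_norm_eq_inner[symmetric] norm_mult)
    then show ?thesis unfolding Q.level_affine by (simp add: mult.assoc)
  qed
  have "((\<lambda>s. p + of_real (- s) * ?y) \<longlongrightarrow> p + of_real (- 0) * ?y) (at_right (0::real))" by (intro tendsto_intros)
  then have "((\<lambda>s. p + of_real (- s) * ?y) \<longlongrightarrow> p) (at_right (0::real))" by simp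
  moreover have "open (\<Inter>l\<in>{..<m}. {z. 0 < Q.level l z})" by (intro open_INT ballI open_level) simp
  moreover have "p \<in> (\<Inter>l\<in>{..<m}. {z. 0 < Q.level l z})" using base_levels(1)[OF p] by blast
  ultimately have "\<forall>\<^sub>F s in at_right (0::real). p + of_real (- s) * ?y \<in> (\<Inter>l\<in>{..<m}. {z. 0 < Q.level l z})"
    by (rule topological_tendstoD)
  then have "\<forall>\<^sub>F s in at_right (0::real). p + of_real (- s) * ?y \<in> (\<Inter>l\<in>{..<m}. {z. 0 < Q.level l z}) \<and> s \<in> {0<..<1}"
    by (intro eventually_conj eventually_at_right_real) auto
  then obtain s where s: "p + of_real (- s) * ?y \<in> (\<Inter>l\<in>{..<m}. {z. 0 < Q.level l z})" "0 < s"
    using eventually_happens'[OF trivial_limit_at_right_real] by fastforce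
  \<comment> \<open>The extra point is so close to the closing side that it stays strictly inside
    all other sides. These therefore remain supporting lines of the hull and keep the roots on its
    boundary.\<close>
  define z0 where "z0 = p + of_real (- s) * ?y"
  have z0: "\<And>l. l < m ==> 0 < Q.level l z0" "Q.level m z0 < 0"
    using s Q.side_nonzero[of m] base_levels(2)[OF p] by (auto simp: z0_def ly simp del: of_real_minus)
  define H where "H = convex hull (insert z0 Qhull)"
  have H: "convex H" "Qhull \<subseteq> H" "z0 \<in> H" "bounded H"
    unfolding H_def using hull_subset[of "insert z0 Qhull" convex] bounded_Qhull by (auto intro: bounded_convex_hull)
  have lev: "0 \<le> Q.level l z" if z: "z \<in> H" and l: "l < m" for z l
  proof -
    have "convex {z. 0 \<le> Q.level l z}" unfolding Q.level_halfspace by (rule convex_halfspace_ge)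
    then have "H \<subseteq> {z. 0 \<le> Q.level l z}"
      unfolding H_def by (intro hull_minimal) (use Qhull_level z0(1)[OF l] in auto)
    then show ?thesis using z by blast
  qed
  have Qint: "Qtile \<subseteq> interior H" by (rule interior_maximal[OF order.trans[OF Qtile_Qhull H(2)] open_Qtile])
  \<comment> \<open>The segment from \<open>z0\<close> to \<open>p'\<close>, prolonged beyond
    \<open>p'\<close>, enters the open tile of \<open>Q\<close>. Thus \<open>p'\<close> lies
    strictly between an interior point of \<open>H\<close> and a point of \<open>H\<close>.\<close>
  have base: "p' \<in> interior H" if p': "p' \<in> Lseg b0" for p'
  proof -
    have "p' \<in> Q.closed_tile"
      using base_levels[OF p'] by (force simp: Q.closed_tile_def less_Suc_eq intro: less_imp_le)
    moreover have "0 < Q.level l p' \<or> 0 < Q.orient * cr (Q.side l) (p' - z0)" if "l < Suc m" for l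
    proof (cases "l = m")
      case True
      have "Q.orient * cr (Q.side m) (p' - z0) = Q.level m p' - Q.level m z0"
        by (simp add: Q.level_def algebra_simps)
      then show ?thesis using True z0(2) base_levels(2)[OF p'] by simp
    next
      case False
      then show ?thesis using base_levels(1)[OF p', of l] that by simp
    qed
    ultimately have "\<forall>\<^sub>F s in at_right (0::real). p' + of_real s * (p' - z0) \<in> Q.tile"
      by (rule Q.eventually_in_tile)
    then have "\<forall>\<^sub>F s in at_right (0::real). p' + of_real s * (p' - z0) \<in> Q.tile \<and> s \<in> {0<..<1}"
      by (intro eventually_conj eventually_at_right_real) auto
    then obtain s where s: "p' + of_real s * (p' - z0) \<in> Q.tile" "0 < s" "s < 1"
      using eventually_happens'[OF trivial_limit_at_right_real] by fastforce
    let ?w = "p' + of_real s * (p' - z0)"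
    have w: "?w \<in> interior H" using s(1) Qint unfolding Qtile_def by blast
    have pne: "p' ~= z0" using base_levels(2)[OF p'] z0(2) by auto
    \<comment> \<open>Solves \<open>?w = (1 + s) p' - s z0\<close> for \<open>p'\<close> as a convex
      combination.\<close>
    define u where "u = s / (1 + s)"
    have u: "0 < u" "u < 1" "(1 - u) * (1 + s) = 1" "(1 - u) * s = u" using s(2) by (simp_all add: u_def field_simps)
    have "(1 - u) *\<^sub>R ?w + u *\<^sub>R z0 = of_real ((1 - u) * (1 + s)) * p' - of_real ((1 - u) * s) * z0 + of_real u * z0"
      by (simp add: scaleR_conv_of_real algebra_simps)
    then have eq: "p' = (1 - u) *\<^sub>R ?w + u *\<^sub>R z0" unfolding u(3,4) by simp
    have "?w ~= z0"
    proof
      assume "?w = z0"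
      then have "p' = (1 - u) *\<^sub>R z0 + u *\<^sub>R z0" using eq by metis
      then show False using pne by (simp add: scaleR_left_diff_distrib)
    qed
    then have "p' \<in> open_segment ?w z0"
      unfolding in_segment using u(1,2) eq by blast
    then show ?thesis
      using in_interior_closure_convex_segment[OF H(1) w, of z0] H(3) closure_subset by blast
  qed
  have \<Lambda>H: "\<Lambda> \<subseteq> interior H"
  proof
    fix x assume "x \<in> \<Lambda>"
    then obtain i where "i < n" "x \<in> Lseg i" unfolding \<Lambda>_def by blast
    then show "x \<in> interior H" using base Lseg_Qtile[of i] Qint by (cases "i = b0") auto
  qed
  have "interior H ~= {}" using base[OF p] by blast
  then obtain \<gamma> where \<gamma>: "simple_path \<gamma>" "pathfinish \<gamma> = pathstart \<gamma>" "path_image \<gamma> = frontier H"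
    by (rule convex_frontier_simple_closed[OF H(1,4)])
  have RH: "Rt \<subseteq> frontier H"
  proof
    fix x assume "x \<in> Rt"
    then obtain k where k: "k \<le> m" "x = r k" by (auto simp: Rt_def)
    obtain l where l: "l < m" "Q.level l (r k) = 0" using root_level_ex[OF k(1)] by blast
    have "r k \<in> closure \<Lambda>" using \<open>x \<in> Rt\<close> k by (simp add: closure_\<Lambda>)
    then have "r k \<in> H" using \<Lambda>_Qhull H(2) by blast
    then show "x \<in> frontier H" unfolding k(2) by (rule r_frontier[OF _ lev[OF _ l(1)] l(2)])
  qed
  have U: "\<Union> (Lseg ` {..<n}) = \<Lambda>" by (simp add: \<Lambda>_def)
  have "inside (path_image \<gamma>) = interior H" unfolding \<gamma>(3) by (rule inside_frontier_eq_interior[OF H(4,1)])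
  then have "\<Lambda> \<subseteq> inside (path_image \<gamma>)" using \<Lambda>H by (simp only:)
  moreover have "Rt \<subseteq> path_image \<gamma>" unfolding \<gamma>(3) by (rule RH)
  ultimately have "enclosing_curve (Lseg ` {..<n}) Rt \<gamma>"
    unfolding enclosing_curve_def U using \<gamma>(1,2) by blast
  then show ?thesis by (rule exI[where x = \<gamma>])
qed

end

context enclosed_drawing begin

text \<open>Edges at other black vertices lie in closures of other segments and meet this one in
  finitely many points, so only the dual edge of \<open>(i, j)\<close> itself contributes
  length.\<close>

lemma length_on_face:
  assumes i: "i < n" and j: "j < n"
  shows "length_on (Lseg i) (frontier (face j)) = (if (i, j) \<in> E then cmod (T (i, j)) else 0)"
proof -
  let ?x = "pt i (lo i)" and ?y = "pt i (hi i)"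
  have cl: "closed_segment ?x ?y = closure (Lseg i)" using Lseg_ends[OF i] by (simp add: Lseg_def)
  have S: "Lseg i \<inter> frontier (face j) = Lseg i \<inter> (\<Union>e\<in>Ew j. seg e)"
    using face(3)[OF j] Lseg_subset[OF i] unfolding bd_def by blast
  have other: "finite (Lseg i \<inter> (\<Union>e\<in>Ew j - {(i, j)}. seg e))"
  proof -
    have "finite (Lseg i \<inter> seg e)" if e: "e \<in> Ew j - {(i, j)}" for e
    proof -
      have eE: "e \<in> E" "snd e = j" "e ~= (i, j)" using e by (auto simp: Ew_def)
      then have "fst e ~= i" by (metis prod.collapse)
      then have "finite (Lseg i \<inter> closure (Lseg (fst e)))" by (intro finite_Lseg_closure i E_bounds eE) simp
      then show ?thesis by (rule rev_finite_subset) (use seg_subset_closure[OF eE(1)] in blast)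
    qed
    then have "finite (\<Union>e\<in>Ew j - {(i, j)}. Lseg i \<inter> seg e)"
      by (intro finite_UN_I finite_Diff finite_Ew)
    then show ?thesis by (rule rev_finite_subset) blast
  qed
  show ?thesis
  proof (cases "(i, j) \<in> E")
    case True
    have "length_on (open_segment ?x ?y) (frontier (face j)) = dist (\<psi> (Rv (i, j))) (\<psi> (Lv (i, j)))"
    proof (rule length_on_segment[OF Lseg_ends[OF i]])
      have "seg (i, j) \<subseteq> closed_segment ?x ?y" unfolding cl using seg_subset_closure[OF True] by simp
      then show "\<psi> (Rv (i, j)) \<in> closed_segment ?x ?y" "\<psi> (Lv (i, j)) \<in> closed_segment ?x ?y"
        unfolding seg_def by auto
      have 1: "(i, j) \<in> Ew j" using True by (simp add: Ew_def)
      have "Lseg i \<inter> (frontier (face j) - seg (i, j)) \<subseteq> Lseg i \<inter> (\<Union>e\<in>Ew j - {(i, j)}. seg e)" using S by blast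
      then show "finite (open_segment ?x ?y \<inter> (frontier (face j) - closed_segment (\<psi> (Rv (i, j))) (\<psi> (Lv (i, j)))))"
        unfolding Lseg_def[symmetric] seg_def[symmetric] using other by (rule finite_subset)
      have "Lseg i \<inter> (seg (i, j) - frontier (face j)) = {}" using S 1 by blast
      then show "finite (open_segment ?x ?y \<inter> (closed_segment (\<psi> (Rv (i, j))) (\<psi> (Lv (i, j))) - frontier (face j)))"
        unfolding Lseg_def[symmetric] seg_def[symmetric] by simp
    qed
    then show ?thesis
      using True psi_diff[OF True] by (simp add: Lseg_def[symmetric] dist_norm norm_minus_commute)
  next
    case False
    have "length_on (open_segment ?x ?y) (frontier (face j)) = dist ?x ?x"
    proof (rule length_on_segment[OF Lseg_ends[OF i]])
      have "Ew j - {(i, j)} = Ew j" using False by (auto simp: Ew_def)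
      then have "finite (Lseg i \<inter> frontier (face j))" using other S by simp
      then show "finite (open_segment ?x ?y \<inter> (frontier (face j) - closed_segment ?x ?x))"
        unfolding Lseg_def[symmetric] by (rule rev_finite_subset) blast
    qed auto
    then show ?thesis using False by (simp add: Lseg_def[symmetric])
  qed
qed

lemma gauge_equivalent_faces:
  assumes f1: "\<And>j. j < n ==> f1 j ~= 0" and f2: "\<And>i. i < n ==> f2 i ~= 0"
    and w: "\<And>i j. (i, j) \<in> E ==> cmod (T (i, j)) = f1 j * f2 i * \<nu> (i, j)"
  shows "gauge_equivalent_via Lseg (weighted_graph G \<nu>) (dimer_graph (Lseg ` {..<n}) \<gamma> face0)"
proof -
  let ?F = "T_faces (Lseg ` {..<n}) \<gamma> - {face0}"
  have len: "length_on (Lseg i) (frontier (face j)) = (if (i, j) \<in> E then cmod (T (i, j)) else 0)" if "i < n" "j < n" for i j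
    by (rule length_on_face[OF that])
  have adj: "(i, j) \<in> E \<longleftrightarrow> 0 < length_on (Lseg i) (frontier (face j))" if "i < n" "j < n" for i j
    using len[OF that] T_nonzero[of "(i, j)"] by simp
  have fm: "face j \<in> ?F" if "j < n" for j using whites_bij that by (auto simp: bij_betw_def)
  let ?W = "weighted_graph G \<nu>" and ?H = "dimer_graph (Lseg ` {..<n}) \<gamma> face0"
  have W: "blacks ?W = {..<n}" "whites ?W = {..<n}" "adjacency ?W = E" "weight ?W i j = \<nu> (i, j)" for i j
    by (simp_all add: weighted_graph_def)
  have H: "blacks ?H = Lseg ` {..<n}" "whites ?H = ?F" "weight ?H l S = length_on l (frontier S)"
    "(l, S) \<in> adjacency ?H \<longleftrightarrow> l \<in> Lseg ` {..<n} \<and> S \<in> ?F \<and> 0 < length_on l (frontier S)" for l S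
    by (simp_all add: dimer_graph_def)
  show ?thesis
    unfolding gauge_equivalent_via_def W H(1,2)
  proof (rule conjI, goal_cases)
    case 1
    show "bij_betw Lseg {..<n} (Lseg ` {..<n})" using Lseg_inj by (simp add: bij_betw_def)
  next
    case 2
    show ?case
    proof (rule exI[of _ face], rule exI[of _ f1], rule exI[of _ f2], intro conjI ballI)
    show "bij_betw face {..<n} ?F" by (rule whites_bij)
    show "(b, w) \<in> E \<longleftrightarrow> (Lseg b, face w) \<in> adjacency ?H" if "b \<in> {..<n}" "w \<in> {..<n}" for b w
      unfolding H(4) using adj[of b w] fm[of w] that by blast
    show "f1 w ~= 0" if "w \<in> {..<n}" for w using that f1 by simp
    show "f2 b ~= 0" if "b \<in> {..<n}" for b using that f2 by simp
    show "case x of (b, w) => weight ?H (Lseg b) (face w) = f1 w * f2 b * \<nu> (b, w)" if x: "x \<in> E" for x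
      unfolding H(3) using x len[of "fst x" "snd x"] E_bounds[OF x] w[of "fst x" "snd x"] by (simp add: case_prod_beta)
    qed
  qed
qed

end

section \<open>Polynomials and genericity\<close>

lemma polynomials_sum:
  "finite I ==> (\<And>i. i \<in> I ==> f i \<in> polynomials_in C) ==> (\<lambda>x. \<Sum>i\<in>I. f i x) \<in> polynomials_in C"
  by (induction I rule: finite_induct) (auto intro: polynomials_in.intros)

lemma polynomials_prod:
  "finite I ==> (\<And>i. i \<in> I ==> f i \<in> polynomials_in C) ==> (\<lambda>x. \<Prod>i\<in>I. f i x) \<in> polynomials_in C"
  by (induction I rule: finite_induct) (auto intro: polynomials_in.intros)

lemma polynomials_diff:
  assumes "p \<in> polynomials_in C" "q \<in> polynomials_in C"
  shows "(\<lambda>x. p x - q x) \<in> polynomials_in C"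
  using polynomials_in.add[OF assms(1) polynomials_in.mult[OF polynomials_in.const[of "-1"] assms(2)]] by simp

lemma polynomials_det:
  assumes "\<And>i j. i < n ==> j < n ==> (\<lambda>x. k x i j) \<in> polynomials_in C"
  shows "(\<lambda>x. Determinant.det (Matrix.mat n n (\<lambda>(i, j). k x i j))) \<in> polynomials_in C"
proof -
  have "Determinant.det (Matrix.mat n n (\<lambda>(i, j). k x i j)) =
      (\<Sum>p\<in>{p. p permutes {0..<n}}. signof p * (\<Prod>i=0..<n. k x i (p i)))" for x
    by (subst det_def'[of _ n]) (auto intro!: sum.cong prod.cong simp: permutes_in_image)
  moreover have "(\<lambda>x. \<Sum>p\<in>{p. p permutes {0..<n}}. signof p * (\<Prod>i=0..<n. k x i (p i))) \<in> polynomials_in C"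
  proof (rule polynomials_sum)
    fix p assume p: "p \<in> {p. p permutes {0..<n}}"
    have "(\<lambda>x. k x i (p i)) \<in> polynomials_in C" if "i \<in> {0..<n}" for i
      using assms[of i "p i"] that permutes_in_image[of p "{0..<n}" i] p by auto
    then show "(\<lambda>x. signof p * (\<Prod>i=0..<n. k x i (p i))) \<in> polynomials_in C"
      by (intro polynomials_in.mult polynomials_in.const polynomials_prod) auto
  qed (simp add: finite_permutations)
  ultimately show ?thesis by simp
qed

text \<open>Any two points lie on a line on which the coordinates are affine. This reduces
  statements on polynomials in many variables to one variable and covers weights and polygons
  alike.\<close>

definition lines_through :: "('x => real) set => bool" where
  "lines_through C \<longleftrightarrow> (\<forall>x y. \<exists>l::real => 'x. l 0 = x \<and> l 1 = y \<and> (\<forall>c\<in>C. \<exists>\<alpha> \<beta>. \<forall>t. c (l t) = \<alpha> + \<beta> * t))"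

lemma lines_weight_coords: "lines_through (weight_coords E)"
  unfolding lines_through_def
proof (intro allI)
  fix x y :: "'a => real"
  have "\<exists>\<alpha> \<beta>. \<forall>t. c (\<lambda>e. x e + t * (y e - x e)) = \<alpha> + \<beta> * t" if c: "c \<in> weight_coords E" for c
  proof -
    obtain e where "c = (\<lambda>\<nu>. \<nu> e)" using c by (auto simp: weight_coords_def)
    then show ?thesis by (intro exI[of _ "x e"] exI[of _ "y e - x e"]) simp
  qed
  then show "\<exists>l. l 0 = x \<and> l 1 = y \<and> (\<forall>c\<in>weight_coords E. \<exists>\<alpha> \<beta>. \<forall>t. c (l t) = \<alpha> + \<beta> * t)"
    by (intro exI[of _ "\<lambda>t e. x e + t * (y e - x e)"]) auto
qed

lemma lines_polygon_coords: "lines_through (polygon_coords m)"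
  unfolding lines_through_def
proof (intro allI)
  fix x y :: "nat => complex"
  let ?l = "\<lambda>t k. x k + of_real t * (y k - x k)"
  have "\<exists>\<alpha> \<beta>. \<forall>t. c (?l t) = \<alpha> + \<beta> * t" if c: "c \<in> polygon_coords m" for c
  proof -
    obtain k where "c = (\<lambda>r. Re (r k)) \<or> c = (\<lambda>r. Im (r k))" using c by (auto simp: polygon_coords_def)
    then show ?thesis
    proof
      assume "c = (\<lambda>r. Re (r k))"
      then show ?thesis by (intro exI[of _ "Re (x k)"] exI[of _ "Re (y k - x k)"]) simp
    next
      assume "c = (\<lambda>r. Im (r k))"
      then show ?thesis by (intro exI[of _ "Im (x k)"] exI[of _ "Im (y k - x k)"]) simp
    qed
  qed
  then show "\<exists>l. l 0 = x \<and> l 1 = y \<and> (\<forall>c\<in>polygon_coords m. \<exists>\<alpha> \<beta>. \<forall>t. c (l t) = \<alpha> + \<beta> * t)"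
    by (intro exI[of _ ?l]) auto
qed

lemma polynomial_on_line:
  assumes p: "p \<in> polynomials_in C" and l: "\<And>c. c \<in> C ==> \<exists>\<alpha> \<beta>. \<forall>t. c (l t) = \<alpha> + \<beta> * t"
  shows "\<exists>P::real poly. \<forall>t. p (l t) = poly P t"
  using p
proof induction
  case (const c) show ?case by (intro exI[of _ "[:c:]"]) simp
next
  case (coord x)
  then obtain \<alpha> \<beta> where "\<forall>t. x (l t) = \<alpha> + \<beta> * t" using l by blast
  then show ?case by (intro exI[of _ "[:\<alpha>, \<beta>:]"]) (simp add: mult.commute)
next
  case (add p q)
  then obtain P Q where "\<forall>t. p (l t) = poly P t" "\<forall>t. q (l t) = poly Q t" by blast
  then show ?case by (intro exI[of _ "P + Q"]) simp
next
  case (mult p q)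
  then obtain P Q where "\<forall>t. p (l t) = poly P t" "\<forall>t. q (l t) = poly Q t" by blast
  then show ?case by (intro exI[of _ "P * Q"]) simp
qed

text \<open>On the line joining a non-zero of \<open>p\<close> with a non-zero of \<open>q\<close>,
  both become nonzero polynomials in one variable. Their product has finitely many roots, so the
  product of \<open>p\<close> and \<open>q\<close> does not vanish identically.\<close>

lemma generically_conj:
  assumes C: "lines_through C" and P: "generically C P" and Q: "generically C Q"
  shows "generically C (\<lambda>x. P x \<and> Q x)"
proof -
  obtain p x where p: "p \<in> polynomials_in C" "p x ~= 0" "\<And>z. p z ~= 0 ==> P z" using P unfolding generically_def by blast
  obtain q y where q: "q \<in> polynomials_in C" "q y ~= 0" "\<And>z. q z ~= 0 ==> Q z" using Q unfolding generically_def by blast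
  obtain l where l: "l 0 = x" "l 1 = y" "\<And>c. c \<in> C ==> \<exists>\<alpha> \<beta>. \<forall>t. c (l t) = \<alpha> + \<beta> * t"
    using C unfolding lines_through_def by metis
  obtain p' where p': "\<And>t. p (l t) = poly p' t" using polynomial_on_line[where l = l, OF p(1) l(3)] by blast
  obtain q' where q': "\<And>t. q (l t) = poly q' t" using polynomial_on_line[where l = l, OF q(1) l(3)] by blast
  have "poly p' 0 ~= 0" "poly q' 1 ~= 0" using p(2) q(2) l(1,2) p' q' by metis+
  then have "p' * q' ~= 0" by auto
  then have "finite {t. poly (p' * q') t = 0}" by (rule poly_roots_finite)
  then obtain t where "poly (p' * q') t ~= 0" using ex_new_if_finite[OF infinite_UNIV_char_0] by blast
  then have "p (l t) * q (l t) ~= 0" by (simp add: p' q')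
  then show ?thesis
    unfolding generically_def using p(3) q(3) polynomials_in.mult[OF p(1) q(1)]
    by (intro bexI[of _ "\<lambda>x. p x * q x"]) auto
qed

lemma generically_mono: "generically C P ==> (\<And>x. P x ==> Q x) ==> generically C Q"
  unfolding generically_def by blast

lemma generically_True: "(\<And>x. P x) ==> generically C P"
  unfolding generically_def using polynomials_in.const[of 1 C] by force

lemma generically_ball:
  assumes "lines_through C" "finite I" "\<And>i. i \<in> I ==> generically C (P i)"
  shows "generically C (\<lambda>x. \<forall>i\<in>I. P i x)"
  using assms(2,3)
proof (induction I rule: finite_induct)
  case (insert i I)
  then have "generically C (\<lambda>x. P i x \<and> (\<forall>i\<in>I. P i x))" by (intro generically_conj[OF assms(1)]) auto
  then show ?case by (rule generically_mono) auto
qed (rule generically_True, simp)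

lemma generically_nonzero: "p \<in> polynomials_in C ==> p x ~= 0 ==> generically C (\<lambda>x. p x ~= 0)"
  unfolding generically_def by blast

section \<open>Linear systems with square matrices\<close>

lemma det_nonzero_iff:
  fixes k :: "nat => nat => 'a::field"
  shows "Determinant.det (Matrix.mat n n (\<lambda>(i, j). k i j)) ~= 0 \<longleftrightarrow>
    (\<forall>x. (\<forall>i<n. (\<Sum>j<n. k i j * x j) = 0) \<longrightarrow> (\<forall>j<n. x j = 0))"
proof -
  let ?A = "Matrix.mat n n (\<lambda>(i, j). k i j)"
  have A: "?A \<in> carrier_mat n n" by simp
  have mv: "?A *\<^sub>v Matrix.vec n x = Matrix.vec n (\<lambda>i. \<Sum>j<n. k i j * x j)" for x
    by (rule eq_vecI) (auto simp: scalar_prod_def atLeast0LessThan intro!: sum.cong)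
  have v0: "Matrix.vec n x = 0\<^sub>v n \<longleftrightarrow> (\<forall>j<n. x j = 0)" for x :: "nat => 'a" by (auto simp: vec_eq_iff)
  have ex: "(\<exists>v. v \<in> carrier_vec n \<and> P v) \<longleftrightarrow> (\<exists>x. P (Matrix.vec n x))" for P :: "'a Matrix.vec => bool"
  proof
    assume "\<exists>v. v \<in> carrier_vec n \<and> P v"
    then obtain v where v: "v \<in> carrier_vec n" "P v" by blast
    have "Matrix.vec n (\<lambda>i. vec_index v i) = v" using v(1) by (auto intro!: eq_vecI)
    then show "\<exists>x. P (Matrix.vec n x)" using v(2) by metis
  qed (metis vec_carrier)
  show ?thesis
    unfolding det_0_iff_vec_prod_zero_field[OF A] ex mv v0 by blast
qed

lemma inverse_entries:
  fixes k :: "nat => nat => 'a::field"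
  assumes "Determinant.det (Matrix.mat n n (\<lambda>(i, j). k i j)) ~= 0"
  shows "\<exists>B. (\<forall>i<n. \<forall>j<n. (\<Sum>l<n. k i l * B l j) = (if i = j then 1 else 0)) \<and>
    (\<forall>i<n. \<forall>j<n. (\<Sum>l<n. B i l * k l j) = (if i = j then 1 else 0))"
proof -
  let ?A = "Matrix.mat n n (\<lambda>(i, j). k i j)"
  have A: "?A \<in> carrier_mat n n" by simp
  obtain B where B: "B \<in> carrier_mat n n" "B * ?A = 1\<^sub>m n" "?A * B = 1\<^sub>m n"
    using det_non_zero_imp_unit[OF A assms, of "()"] unfolding Units_def ring_mat_def by auto
  have 1: "(\<Sum>l<n. k i l * B $$ (l, j)) = (if i = j then 1 else 0)" if "i < n" "j < n" for i j
  proof -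
    have "(?A * B) $$ (i, j) = (\<Sum>l<n. k i l * B $$ (l, j))"
      using that B(1) by (auto simp: scalar_prod_def atLeast0LessThan intro!: sum.cong)
    then show ?thesis using that by (simp add: B(3))
  qed
  have 2: "(\<Sum>l<n. B $$ (i, l) * k l j) = (if i = j then 1 else 0)" if "i < n" "j < n" for i j
  proof -
    have "(B * ?A) $$ (i, j) = (\<Sum>l<n. B $$ (i, l) * k l j)"
      using that B(1) by (auto simp: scalar_prod_def atLeast0LessThan intro!: sum.cong)
    then show ?thesis using that by (simp add: B(2))
  qed
  show ?thesis by (intro exI[of _ "\<lambda>i j. B $$ (i, j)"] conjI allI impI 1 2)
qed

lemma bij_betw_pick:
  assumes "finite I"
  shows "bij_betw (pick I) {..<card I} I"
proof -
  have "inj_on (pick I) {..<card I}"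
    by (rule linorder_inj_onI) (use pick_mono_le in \<open>force simp: less_imp_neq\<close>)+
  moreover have "pick I ` {..<card I} \<subseteq> I" using pick_in_set_le by auto
  ultimately show ?thesis using assms by (simp add: bij_betw_def card_image card_subset_eq)
qed

text \<open>The form in which non-degeneracy is used: a vector annihilated by all rows but two and
  vanishing at two places restricts to a kernel vector of a minor of size
  \<open>n - 2\<close>.\<close>

lemma nondegenerate_2_kernel:
  assumes nd: "nondegenerate 2 (Matrix.mat n n (\<lambda>(i, j). k i j))"
    and rows: "i < n" "i' < n" "i ~= i'" and cols: "p < n" "p' < n" "p ~= p'" "x p = 0" "x p' = 0"
    and zero: "\<And>a. a < n ==> a ~= i ==> a ~= i' ==> (\<Sum>j<n. k a j * x j) = 0"
    and j: "j < n"
  shows "x j = 0"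
proof -
  let ?A = "Matrix.mat n n (\<lambda>(i, j). k i j)"
  define I where "I = {..<n} - {i, i'}"
  define J where "J = {..<n} - {p, p'}"
  have card: "card I = n - 2" "card J = n - 2"
    using rows cols by (simp_all add: I_def J_def card_Diff_subset)
  have IJ: "{a. a < n \<and> a \<in> I} = I" "{a. a < n \<and> a \<in> J} = J" by (auto simp: I_def J_def)
  have bI: "bij_betw (pick I) {..<n - 2} I" and bJ: "bij_betw (pick J) {..<n - 2} J"
    using bij_betw_pick[of I] bij_betw_pick[of J] card by (simp_all add: I_def J_def)
  have sub: "submatrix ?A I J = Matrix.mat (n - 2) (n - 2) (\<lambda>(b, c). k (pick I b) (pick J c))"
  proof -
    have "pick I b < n" if "b < n - 2" for b using bij_betwE[OF bI] that by (auto simp: I_def)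
    moreover have "pick J b < n" if "b < n - 2" for b using bij_betwE[OF bJ] that by (auto simp: J_def)
    ultimately show ?thesis unfolding submatrix_def by (auto simp: IJ card intro!: eq_matI)
  qed
  have "Determinant.det (submatrix ?A I J) ~= 0"
    using nd card unfolding nondegenerate_def by (simp add: I_def J_def)
  then have ker: "\<And>y. (\<forall>b<n - 2. (\<Sum>c<n - 2. k (pick I b) (pick J c) * y c) = 0) ==> (\<forall>c<n - 2. y c = 0)"
    unfolding sub det_nonzero_iff by blast
  have "\<forall>b<n - 2. (\<Sum>c<n - 2. k (pick I b) (pick J c) * x (pick J c)) = 0"
  proof (intro allI impI)
    fix b assume b: "b < n - 2"
    let ?a = "pick I b"
    have a: "?a \<in> I" using bij_betwE[OF bI] b by blast
    have "(\<Sum>c<n - 2. k ?a (pick J c) * x (pick J c)) = (\<Sum>j\<in>J. k ?a j * x j)"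
      by (rule sum.reindex_bij_betw[OF bJ])
    also have "\<dots> = (\<Sum>j<n. k ?a j * x j)"
      by (rule sum.mono_neutral_left) (use cols in \<open>auto simp: J_def\<close>)
    also have "\<dots> = 0" using zero[of ?a] a by (auto simp: I_def)
    finally show "(\<Sum>c<n - 2. k ?a (pick J c) * x (pick J c)) = 0" .
  qed
  then have y: "\<forall>c<n - 2. x (pick J c) = 0" by (rule ker)
  show ?thesis
  proof (cases "j \<in> J")
    case True
    then obtain c where "c < n - 2" "j = pick J c" using bJ by (auto simp: bij_betw_def)
    then show ?thesis using y by blast
  next
    case False
    then show ?thesis using cols j by (auto simp: J_def)
  qed
qed

section \<open>Generic edge weights\<close>

context elementary_plane_graph begin

text \<open>If every edge touched black \<open>i\<close> or white \<open>j\<close> and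
  \<open>(i, j)\<close> were an edge, a matching containing it could not match any other black
  vertex. If it were not an edge, those at \<open>i\<close> and those at \<open>j\<close> would have
  no end in common, against connectedness.\<close>

lemma edge_avoiding:
  assumes n2: "2 \<le> n" and ij: "i < n" "j < n"
  obtains e where "e \<in> E" "fst e ~= i" "snd e ~= j"
proof (rule ccontr)
  note result = that
  assume "\<not> thesis"
  then have all: "fst e = i \<or> snd e = j" if "e \<in> E" for e using result that by blast
  have fstE: "fst ` E = {..<n}" and sndE: "snd ` E = {..<n}"
    and conn: "\<And>e e'. e \<in> E ==> e' \<in> E ==> (e, e') \<in> {(x, y). x \<in> E \<and> y \<in> E \<and> (fst x = fst y \<or> snd x = snd y)}\<^sup>*"
    using plane unfolding plane_bipartite_map_def by blast+
  obtain i' where i': "i' < n" "i' ~= i" using n2 by (metis One_nat_def Suc_1 Suc_le_lessD less_2_cases_iff linorder_not_less nat_neq_iff not_less_eq_eq zero_less_Suc)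
  show False
  proof (cases "(i, j) \<in> E")
    case True
    obtain M where M: "perfect_matching G M" "(i, j) \<in> M" using matched[OF True] by blast
    obtain e where e: "e \<in> M" "fst e = i'" using M(1) i'(1) unfolding perfect_matching_def by blast
    have "snd e = j" using all[of e] e i' matching_E[OF M(1)] by blast
    moreover have inj: "inj_on snd M" using matching_snd[OF M(1)] by (simp add: bij_betw_def)
    ultimately have "e = (i, j)" using inj_onD[OF inj _ e(1) M(2)] by simp
    then show False using e i' by simp
  next
    case False
    obtain e where e: "e \<in> E" "fst e = i" using fstE ij by (metis imageE lessThan_iff)
    obtain e' where e': "e' \<in> E" "snd e' = j" using sndE ij by (metis imageE lessThan_iff)
    have no: "\<not> (fst x = i \<and> snd x = j)" if "x \<in> E" for x using that False by auto
    have "fst y = i" if "(e, y) \<in> {(x, y). x \<in> E \<and> y \<in> E \<and> (fst x = fst y \<or> snd x = snd y)}\<^sup>*" for y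
      using that
    proof (induction rule: rtrancl_induct)
      case (step y z)
      then have "y \<in> E" "z \<in> E" "fst y = fst z \<or> snd y = snd z" by auto
      then show ?case using all[of z] no[of y] step.IH by metis
    qed (rule e(2))
    then have "fst e' = i" using conn[OF e(1) e'(1)] by blast
    then show False using no[OF e'(1)] e'(2) by simp
  qed
qed

definition kas :: "(nat \<times> nat => real) => (nat \<times> nat => real) => nat => nat => real" where
  "kas s \<nu> i j = (if (i, j) \<in> E then s (i, j) * \<nu> (i, j) else 0)"

lemma kasteleyn_matrix_eq: "kasteleyn_matrix G s \<nu> = Matrix.mat n n (\<lambda>(i, j). kas s \<nu> i j)"
  unfolding kasteleyn_matrix_def by (rule arg_cong[of _ _ "Matrix.mat n n"]) (auto simp: kas_def)

text \<open>The determinant of this matrix is a minor of the Kasteleyn matrix, that is, up to sign, an entry of its adjugate.\<close>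

definition bordered :: "(nat \<times> nat => real) => (nat \<times> nat => real) => nat => nat => nat => nat => real" where
  "bordered s \<nu> i j k l = (if k = i then of_bool (l = j) else kas s \<nu> k l)"

lemma polynomials_kas: "(\<lambda>\<nu>. kas s \<nu> i j) \<in> polynomials_in (weight_coords E)"
proof (cases "(i, j) \<in> E")
  case True
  then have "(\<lambda>\<nu>. \<nu> (i, j)) \<in> weight_coords E" by (auto simp: weight_coords_def)
  then have "(\<lambda>\<nu>. s (i, j) * \<nu> (i, j)) \<in> polynomials_in (weight_coords E)"
    by (intro polynomials_in.mult polynomials_in.const polynomials_in.coord)
  then show ?thesis using True by (simp add: kas_def)
qed (simp add: kas_def polynomials_in.const)

lemma polynomials_bordered: "(\<lambda>\<nu>. bordered s \<nu> i j k l) \<in> polynomials_in (weight_coords E)"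
  by (cases "k = i") (simp_all add: bordered_def polynomials_kas polynomials_in.const)

text \<open>Taking the indicator of a perfect matching as weights turns the matrix into a signed
  permutation matrix.\<close>

lemma kernel_det_kas:
  assumes s: "\<And>e. e \<in> E ==> s e ~= 0"
  shows "\<exists>\<nu>. Determinant.det (Matrix.mat n n (\<lambda>(i, j). kas s \<nu> i j)) ~= 0"
proof -
  obtain M where M: "perfect_matching G M" using matched[OF a_edge] by blast
  let ?\<nu> = "\<lambda>e. of_bool (e \<in> M)"
  have "x j = 0" if x: "\<forall>i<n. (\<Sum>j<n. kas s ?\<nu> i j * x j) = 0" and j: "j < n" for x j
  proof -
    obtain e where e: "e \<in> M" "snd e = j" using M j unfolding perfect_matching_def by blast
    have eE: "e \<in> E" using e matching_E[OF M] by blast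
    have "kas s ?\<nu> (fst e) l * x l = (if l = j then s e * x j else 0)" for l
    proof (cases "l = j")
      case False
      have "(fst e, l) \<notin> M"
      proof
        assume lM: "(fst e, l) \<in> M"
        have inj: "inj_on fst M" using matching_fst[OF M] by (simp add: bij_betw_def)
        have "(fst e, l) = e" using inj_onD[OF inj _ lM e(1)] by simp
        then show False using False e(2) by (metis snd_conv)
      qed
      then show ?thesis using False by (simp add: kas_def)
    qed (use e eE in \<open>auto simp: kas_def\<close>)
    then have "(\<Sum>l<n. kas s ?\<nu> (fst e) l * x l) = s e * x j" using j by simp
    then have "s e * x j = 0" using x E_bounds(1)[OF eE] by simp
    then show ?thesis using s[OF eE] by simp
  qed
  then show ?thesis unfolding det_nonzero_iff by blast
qed

lemma bordered_other: "k ~= i ==> bordered s \<nu> i j k l = kas s \<nu> k l"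
  by (simp add: bordered_def)

lemma bordered_row: "i < n ==> j < n ==> (\<Sum>l<n. bordered s \<nu> i j i l * x l) = x j"
  by (simp add: bordered_def of_bool_def if_distrib[of "\<lambda>c. c * _"] cong: if_cong)

text \<open>Non-degeneracy does not exclude that a minor of size \<open>n - 1\<close> vanishes at
  the given weights, but then its kernel is spanned by one vector \<open>x\<close>, which is nonzero
  at every white vertex other than \<open>j\<close>. Changing the weight of one edge away from
  \<open>i\<close> and \<open>j\<close> destroys this kernel.\<close>

lemma det_bordered_nonzero:
  assumes n2: "2 \<le> n" and s: "\<And>e. e \<in> E ==> s e ~= 0"
    and nd: "nondegenerate 2 (kasteleyn_matrix G s \<nu>0)" and ij: "i < n" "j < n"
  shows "\<exists>\<nu>. Determinant.det (Matrix.mat n n (\<lambda>(k, l). bordered s \<nu> i j k l)) ~= 0"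
proof (cases "Determinant.det (Matrix.mat n n (\<lambda>(k, l). bordered s \<nu>0 i j k l)) = 0")
  case False
  then show ?thesis by blast
next
  case True
  obtain e where e: "e \<in> E" "fst e ~= i" "snd e ~= j" by (rule edge_avoiding[OF n2 ij])
  let ?k = "fst e" and ?l = "snd e"
  have kl: "?k < n" "?l < n" using E_bounds[OF e(1)] .
  note ker = nondegenerate_2_kernel[OF nd[unfolded kasteleyn_matrix_eq]]
  obtain x j0 where x: "\<forall>k<n. (\<Sum>l<n. bordered s \<nu>0 i j k l * x l) = 0" "j0 < n" "x j0 ~= 0"
    using True det_nonzero_iff[of n "bordered s \<nu>0 i j"] by blast
  have xj: "x j = 0" using x(1) ij bordered_row[OF ij, of s \<nu>0 x] by simp
  have xk: "(\<Sum>l<n. kas s \<nu>0 k l * x l) = 0" if "k < n" "k ~= i" for k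
    using x(1)[rule_format, OF that(1)] by (simp only: bordered_other[OF that(2)])
  have xl: "x ?l ~= 0"
  proof
    assume "x ?l = 0"
    then have "x j0 = 0"
      by (rule ker[OF ij(1) kl(1) e(2)[symmetric] ij(2) kl(2) e(3)[symmetric] xj _ xk x(2)])
    then show False using x(3) by simp
  qed
  \<comment> \<open>The change affects row \<open>?k\<close> only, and there adds \<open>s e\<close>
    times the entry at \<open>?l\<close>.\<close>
  let ?\<nu> = "\<nu>0(e := \<nu>0 e + 1)"
  have kas': "kas s ?\<nu> k l = kas s \<nu>0 k l + (if k = ?k \<and> l = ?l then s e else 0)" for k l
    using e(1) by (auto simp: kas_def algebra_simps)
  have sum': "(\<Sum>l<n. kas s ?\<nu> k l * y l) = (\<Sum>l<n. kas s \<nu>0 k l * y l) + (if k = ?k then s e * y ?l else 0)" for k y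
  proof -
    have "(\<Sum>l<n. kas s ?\<nu> k l * y l) =
        (\<Sum>l<n. kas s \<nu>0 k l * y l + (if l = ?l then (if k = ?k then s e * y ?l else 0) else 0))"
      unfolding kas' by (rule sum.cong) (auto simp: distrib_right)
    then show ?thesis using kl(2) by (simp add: sum.distrib)
  qed
  have "y j' = 0" if y: "\<forall>k<n. (\<Sum>l<n. bordered s ?\<nu> i j k l * y l) = 0" and j': "j' < n" for y j'
  proof -
    have yj: "y j = 0" using y ij bordered_row[OF ij, of s ?\<nu> y] by simp
    have yk: "(\<Sum>l<n. kas s \<nu>0 k l * y l) + (if k = ?k then s e * y ?l else 0) = 0" if "k < n" "k ~= i" for k
      using y[rule_format, OF that(1)] sum'[of k y] by (simp only: bordered_other[OF that(2)])
    have yk0: "(\<Sum>l<n. kas s \<nu>0 k l * y l) = 0" if "k < n" "k ~= i" "k ~= ?k" for k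
      using yk[OF that(1,2)] that(3) by simp
    \<comment> \<open>The combination of the new and the old kernel vector that vanishes at
      \<open>?l\<close> as well as at \<open>j\<close>, so that non-degeneracy applies. It shows
      that the new vector is a multiple of \<open>x\<close>.\<close>
    define z where "z t = x ?l * y t - y ?l * x t" for t
    have sz: "(\<Sum>l<n. kas s \<nu>0 k l * z l) = x ?l * (\<Sum>l<n. kas s \<nu>0 k l * y l) - y ?l * (\<Sum>l<n. kas s \<nu>0 k l * x l)" for k
      by (simp add: z_def algebra_simps sum_subtractf sum_distrib_left)
    have zj: "z j = 0" "z ?l = 0" by (simp_all add: z_def xj yj)
    have zk: "(\<Sum>l<n. kas s \<nu>0 k l * z l) = 0" if "k < n" "k ~= i" "k ~= ?k" for k
      using sz[of k] xk[OF that(1,2)] yk0[OF that] by simp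
    have z0: "z t = 0" if "t < n" for t
      by (rule ker[OF ij(1) kl(1) e(2)[symmetric] ij(2) kl(2) e(3)[symmetric] zj zk that])
    have "(\<Sum>l<n. kas s \<nu>0 ?k l * z l) = 0" by (rule sum.neutral) (simp add: z0)
    then have "x ?l * (\<Sum>l<n. kas s \<nu>0 ?k l * y l) = 0" using sz[of ?k] xk[OF kl(1) e(2)] by simp
    then have "(\<Sum>l<n. kas s \<nu>0 ?k l * y l) = 0" using xl by simp
    then have yl: "y ?l = 0" using yk[OF kl(1) e(2)] s[OF e(1)] by simp
    then have "x ?l * y j' = 0" using z0[OF j'] by (simp add: z_def)
    then show "y j' = 0" using xl by simp
  qed
  then have "Determinant.det (Matrix.mat n n (\<lambda>(k, l). bordered s ?\<nu> i j k l)) ~= 0"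
    unfolding det_nonzero_iff by blast
  then show ?thesis by blast
qed

definition good_weights :: "(nat \<times> nat => real) => (nat \<times> nat => real) => bool" where
  "good_weights s \<nu> \<longleftrightarrow> Determinant.det (Matrix.mat n n (\<lambda>(i, j). kas s \<nu> i j)) ~= 0 \<and>
    (\<forall>i<n. \<forall>j<n. Determinant.det (Matrix.mat n n (\<lambda>(k, l). bordered s \<nu> i j k l)) ~= 0)"

lemma generically_good_weights:
  assumes n2: "2 \<le> n" and s: "\<And>e. e \<in> E ==> s e ~= 0"
  shows "generically (weight_coords E) (\<lambda>\<nu>. nondegenerate 2 (kasteleyn_matrix G s \<nu>) \<longrightarrow> good_weights s \<nu>)"
proof (cases "\<exists>\<nu>0. nondegenerate 2 (kasteleyn_matrix G s \<nu>0)")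
  case False
  then show ?thesis by (intro generically_True) blast
next
  case True
  then obtain \<nu>0 where nd: "nondegenerate 2 (kasteleyn_matrix G s \<nu>0)" by blast
  let ?C = "weight_coords E"
  let ?D = "\<lambda>\<nu>. Determinant.det (Matrix.mat n n (\<lambda>(i, j). kas s \<nu> i j))"
  let ?H = "\<lambda>ij \<nu>. Determinant.det (Matrix.mat n n (\<lambda>(k, l). bordered s \<nu> (fst ij) (snd ij) k l))"
  have 1: "generically ?C (\<lambda>\<nu>. ?D \<nu> ~= 0)"
  proof -
    obtain \<nu> where "?D \<nu> ~= 0" using kernel_det_kas[where s = s, OF s] by blast
    then show ?thesis by (rule generically_nonzero[OF polynomials_det[OF polynomials_kas]])
  qed
  have "generically ?C (\<lambda>\<nu>. \<forall>ij\<in>{..<n} \<times> {..<n}. ?H ij \<nu> ~= 0)"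
  proof (rule generically_ball[OF lines_weight_coords])
    fix ij assume "ij \<in> {..<n} \<times> {..<n}"
    then have ij: "fst ij < n" "snd ij < n" by auto
    obtain \<nu> where "?H ij \<nu> ~= 0" using det_bordered_nonzero[where s = s, OF n2 s nd ij] by blast
    then show "generically ?C (\<lambda>\<nu>. ?H ij \<nu> ~= 0)" by (rule generically_nonzero[OF polynomials_det[OF polynomials_bordered]])
  qed simp
  from generically_conj[OF lines_weight_coords 1 this] show ?thesis
    by (rule generically_mono) (auto simp: good_weights_def)
qed

text \<open>If the entry vanished, the column \<open>i\<close> of the inverse would be in the kernel
  of the bordered matrix.\<close>

lemma inverse_entry_nonzero:
  assumes good: "good_weights s \<nu>"
    and KB: "\<And>i j. i < n ==> j < n ==> (\<Sum>l<n. kas s \<nu> i l * B l j) = (if i = j then 1 else 0)"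
    and ij: "i < n" "j < n"
  shows "B j i ~= 0"
proof
  assume 0: "B j i = 0"
  have k0: "\<forall>k<n. (\<Sum>l<n. bordered s \<nu> i j k l * B l i) = 0"
  proof (intro allI impI)
    fix k assume k: "k < n"
    show "(\<Sum>l<n. bordered s \<nu> i j k l * B l i) = 0"
    proof (cases "k = i")
      case True
      then show ?thesis using bordered_row[OF ij, of s \<nu> "\<lambda>l. B l i"] 0 by simp
    next
      case False
      then show ?thesis using KB[OF k ij(1)] by (simp add: bordered_other)
    qed
  qed
  have "Determinant.det (Matrix.mat n n (\<lambda>(k, l). bordered s \<nu> i j k l)) ~= 0"
    using good ij unfolding good_weights_def by simp
  then have "(\<forall>k<n. (\<Sum>l<n. bordered s \<nu> i j k l * B l i) = 0) \<longrightarrow> (\<forall>l<n. B l i = 0)"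
    unfolding det_nonzero_iff by (rule spec[where x = "\<lambda>l. B l i"])
  then have "\<forall>l<n. B l i = 0" using k0 by (rule mp)
  then have "(\<Sum>l<n. kas s \<nu> i l * B l i) = 0" by (intro sum.neutral) simp
  then show False using KB[OF ij(1) ij(1)] by simp
qed

text \<open>The \<open>2 \<times> 2\<close> minors of the inverse are, up to sign, the complementary minors divided by the determinant.\<close>

lemma inverse_minor_nonzero:
  assumes nd: "nondegenerate 2 (kasteleyn_matrix G s \<nu>)"
    and KB: "\<And>i j. i < n ==> j < n ==> (\<Sum>l<n. kas s \<nu> i l * B l j) = (if i = j then 1 else 0)"
    and i: "i < n" "i' < n" "i ~= i'" and p: "p < n" "p' < n" "p ~= p'"
  shows "B p i * B p' i' - B p' i * B p i' ~= 0"
proof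
  assume 0: "B p i * B p' i' - B p' i * B p i' = 0"
  \<comment> \<open>A combination of two columns of the inverse is annihilated by all rows but
    \<open>i\<close> and \<open>i'\<close>. If it also vanishes at \<open>p\<close> and
    \<open>p'\<close> it is zero, and the two omitted rows recover its coefficients.\<close>
  have comb: "\<alpha> = 0 \<and> \<beta> = 0" if "\<alpha> * B p i + \<beta> * B p i' = 0" "\<alpha> * B p' i + \<beta> * B p' i' = 0" for \<alpha> \<beta>
  proof -
    let ?x = "\<lambda>l. \<alpha> * B l i + \<beta> * B l i'"
    have K: "(\<Sum>l<n. kas s \<nu> k l * ?x l) = \<alpha> * (if k = i then 1 else 0) + \<beta> * (if k = i' then 1 else 0)" if "k < n" for k
    proof -
      have "(\<Sum>l<n. kas s \<nu> k l * ?x l) = \<alpha> * (\<Sum>l<n. kas s \<nu> k l * B l i) + \<beta> * (\<Sum>l<n. kas s \<nu> k l * B l i')"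
        by (simp add: algebra_simps sum.distrib sum_distrib_left)
      then show ?thesis using KB[OF that i(1)] KB[OF that i(2)] by simp
    qed
    have x0: "?x j = 0" if jn: "j < n" for j
    proof (rule nondegenerate_2_kernel[where x = ?x, OF nd[unfolded kasteleyn_matrix_eq] i p])
      show "(\<Sum>l<n. kas s \<nu> k l * ?x l) = 0" if "k < n" "k ~= i" "k ~= i'" for k using K[OF that(1)] that(2,3) by simp
    qed (use jn \<open>\<alpha> * B p i + _ = 0\<close> \<open>\<alpha> * B p' i + _ = 0\<close> in simp_all)
    have "(\<Sum>l<n. kas s \<nu> k l * ?x l) = 0" for k by (rule sum.neutral) (simp add: x0)
    then show ?thesis using K[OF i(1)] K[OF i(2)] i(3) by simp
  qed
  have "B p i' = 0 \<and> B p i = 0" using comb[of "B p i'" "- B p i"] 0 by (simp add: algebra_simps)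
  moreover have "B p' i' = 0 \<and> B p' i = 0" using comb[of "B p' i'" "- B p' i"] 0 by (simp add: algebra_simps)
  ultimately show False using comb[of 1 1] by simp
qed

end

section \<open>Convex polygons satisfy the count of sign changes\<close>

text \<open>Ascents and descents balance over a period by telescoping, and a nonconstant sequence
  has some. A unique descent hence leaves exactly two changes.\<close>

lemma two_changes_of_unique_descent:
  fixes b :: "nat => bool"
  assumes d: "0 < d" and per: "\<And>l. b (l + d) = b l" and ex: "b i" "\<not> b i'"
    and uniq: "\<And>l l'. l < d ==> l' < d ==> b l ==> \<not> b (Suc l) ==> b l' ==> \<not> b (Suc l') ==> l = l'"
  shows "card {l. l < d \<and> b l ~= b (Suc l)} = 2"
proof -
  define U where "U = {l. l < d \<and> \<not> b l \<and> b (Suc l)}"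
  define D where "D = {l. l < d \<and> b l \<and> \<not> b (Suc l)}"
  have fin: "finite U" "finite D" by (simp_all add: U_def D_def)
  have UD: "{l. l < d \<and> b l ~= b (Suc l)} = U \<union> D" "U \<inter> D = {}" by (auto simp: U_def D_def)
  have "int (card U) - int (card D) = (\<Sum>l<d. (if \<not> b l \<and> b (Suc l) then 1 else 0) - (if b l \<and> \<not> b (Suc l) then 1 else 0 :: int))"
    by (simp add: sum_subtractf sum.If_cases U_def D_def Int_def lessThan_def)
  also have "\<dots> = (\<Sum>l<d. of_bool (b (Suc l)) - of_bool (b l))"
    by (rule sum.cong) auto
  also have "\<dots> = 0" using per[of 0] using sum_lessThan_telescope[of "\<lambda>l. of_bool (b l) :: int" d] by simp
  finally have eq: "card U = card D" by simp
  have "D ~= {}"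
  proof
    assume D0: "D = {}"
    then have "U = {}" using eq fin by simp
    then have st: "b (Suc l) = b l" if "l < d" for l using that D0 unfolding U_def D_def by blast
    have "b l = b 0" if "l \<le> d" for l using that by (induction l) (use st in auto)
    moreover have "b l = b (l mod d)" for l using periodic_mod[of b d l, OF per] by simp
    ultimately have "b l = b 0" for l using d by (metis mod_less_divisor less_imp_le)
    then show False using ex by blast
  qed
  then obtain x where x: "x \<in> D" by blast
  have "D = {x}"
  proof (intro equalityI subsetI)
    fix y assume "y \<in> D"
    then show "y \<in> {x}" using uniq[of y x] x unfolding D_def by blast
  qed (use x in simp)
  then have "card D = 1" by simp
  then show ?thesis unfolding UD(1) using card_Un_disjoint[OF fin UD(2)] eq by simp
qed

lemma mod_neq: "0 < t ==> t < d ==> (j + t) mod d ~= j mod (d::nat)"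
  using mod_eq_dvd_iff_nat[of j "j + t" d] nat_dvd_not_less[of t d] by auto

text \<open>In a given direction, a vertex at which the height turns from rising to falling is the
  unique highest point of the hull, so there is only one.\<close>

lemma convex_polygon_cyclic:
  assumes conv: "convex_polygon m r"
    and np: "\<And>i j. i \<le> m ==> j \<le> m ==> i ~= j ==> cr (r (Suc i mod Suc m) - r i) (r (Suc j mod Suc m) - r j) ~= 0"
  shows "cyclic_polygon (\<lambda>j. r (j mod Suc m)) (Suc m)"
proof -
  define p where "p j = r (j mod Suc m)" for j
  define side where "side j = p (Suc j) - p j" for j
  let ?d = "Suc m" and ?H = "convex hull (r ` {..m})"
  have m2: "2 \<le> m" and inj: "inj_on r {..m}"
    and edge: "\<And>k. k \<le> m ==> closed_segment (r k) (r (Suc k mod Suc m)) edge_of ?H"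
    using conv by (auto simp: convex_polygon_def)
  have per: "p (j + ?d) = p j" for j by (simp only: p_def mod_add_self2)
  have modle: "j mod ?d \<le> m" for j using mod_less_divisor[of ?d j] by linarith
  have p_inj: "p i = p j \<longleftrightarrow> i mod ?d = j mod ?d" for i j
    unfolding p_def using inj modle by (auto dest: inj_onD)
  have pH: "p j \<in> ?H" for j unfolding p_def using modle by (intro hull_inc) auto
  have face: "closed_segment (p j) (p (Suc j)) face_of ?H" for j
    using edge[OF modle[of j]] by (simp add: edge_of_def p_def mod_Suc_eq)
  have np': "cr (side i) (side j) ~= 0" if "i mod ?d ~= j mod ?d" for i j
    using np[OF modle[of i] modle[of j] that] by (simp add: side_def p_def mod_Suc_eq)
  \<comment> \<open>A vertex strictly inside another side would, by the face property of its own
    side, drag that side's ends into the side starting at \<open>p l\<close>, of which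
    \<open>p l\<close> is an extreme point.\<close>
  have notin: "p l \<notin> closed_segment (p j) (p (Suc j))" if l: "l mod ?d ~= j mod ?d" "l mod ?d ~= Suc j mod ?d" for l j
  proof
    assume "p l \<in> closed_segment (p j) (p (Suc j))"
    then have o: "p l \<in> open_segment (p j) (p (Suc j))" using l by (simp add: open_segment_def p_inj)
    have "p j \<in> closed_segment (p l) (p (Suc l)) \<and> p (Suc j) \<in> closed_segment (p l) (p (Suc l))"
      by (rule face_ofD[OF face o pH pH]) simp
    moreover have "p l extreme_point_of closed_segment (p l) (p (Suc l))" by (simp add: extreme_point_of_segment)
    ultimately show False using o unfolding extreme_point_of_def by blast
  qed
  \<comment> \<open>Faces of a polytope are exposed, which supplies a linear functional that is
    maximal exactly on the side.\<close>
  have functional: "\<exists>c. c \<bullet> side j = 0 \<and> (\<forall>z\<in>?H. c \<bullet> (z - p j) \<le> 0) \<and>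
      (\<forall>l. l mod ?d ~= j mod ?d \<longrightarrow> l mod ?d ~= Suc j mod ?d \<longrightarrow> c \<bullet> (p l - p j) < 0)" for j
  proof -
    have "polyhedron ?H" by (simp add: polyhedron_convex_hull)
    then have "closed_segment (p j) (p (Suc j)) exposed_face_of ?H" using face exposed_face_of_polyhedron by blast
    then obtain c b where cb: "?H \<subseteq> {x. c \<bullet> x \<le> b}" "closed_segment (p j) (p (Suc j)) = ?H \<inter> {x. c \<bullet> x = b}"
      unfolding exposed_face_of_def by blast
    have e: "c \<bullet> p j = b" "c \<bullet> p (Suc j) = b" using cb(2) by (metis (mono_tags) IntE ends_in_segment mem_Collect_eq)+
    have le: "c \<bullet> (z - p j) \<le> 0" if "z \<in> ?H" for z using cb(1) that e(1) by (auto simp: inner_diff_right)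
    have "c \<bullet> (p l - p j) < 0" if l: "l mod ?d ~= j mod ?d" "l mod ?d ~= Suc j mod ?d" for l
    proof -
      have "c \<bullet> p l ~= b" using notin[OF l] pH[of l] unfolding cb(2) by blast
      then show ?thesis using le[OF pH[of l]] e(1) by (simp add: inner_diff_right)
    qed
    then show ?thesis using le e by (intro exI[of _ c]) (simp add: side_def inner_diff_right)
  qed
  \<comment> \<open>The hull lies in the cone spanned at a vertex by its two sides. The functionals
    of these two sides give the signs of the coefficients.\<close>
  have corner: "\<exists>\<alpha> \<beta>. \<alpha> \<le> 0 \<and> 0 \<le> \<beta> \<and> z = p (Suc j) + of_real \<alpha> * side j + of_real \<beta> * side (Suc j)" if z: "z \<in> ?H" for z j
  proof -
    have n1: "Suc (Suc j) mod ?d ~= j mod ?d" "Suc (Suc j) mod ?d ~= Suc j mod ?d" "j mod ?d ~= Suc j mod ?d"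
      using mod_neq[of 2 ?d j] mod_neq[of 1 ?d "Suc j"] mod_neq[of 1 ?d j] m2 by simp_all
    have D: "cr (side j) (side (Suc j)) ~= 0" by (rule np') (rule n1(3))
    obtain \<alpha> \<beta> where ab: "z - p (Suc j) = of_real \<alpha> * side j + of_real \<beta> * side (Suc j)"
      using cr_expand[OF D] by blast
    obtain c where c: "c \<bullet> side j = 0" "c \<bullet> (z - p j) \<le> 0" "c \<bullet> (p (Suc (Suc j)) - p j) < 0"
      using functional[of j] z n1 by blast
    obtain c' where c': "c' \<bullet> side (Suc j) = 0" "c' \<bullet> (z - p (Suc j)) \<le> 0" "c' \<bullet> (p j - p (Suc j)) < 0"
      using functional[of "Suc j"] z n1 by metis
    have "c \<bullet> side (Suc j) < 0" using c(1,3) by (simp add: side_def inner_diff_right)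
    moreover have "c \<bullet> (z - p (Suc j)) \<le> 0" using c(1,2) by (simp add: side_def inner_diff_right)
    then have "\<beta> * (c \<bullet> side (Suc j)) \<le> 0"
      unfolding ab by (simp add: inner_add_right c(1) scaleR_conv_of_real[symmetric])
    ultimately have "0 \<le> \<beta>" by (simp add: mult_le_0_iff)
    have "0 < c' \<bullet> side j" using c'(3) by (simp add: side_def inner_diff_right)
    moreover have "\<alpha> * (c' \<bullet> side j) \<le> 0"
      using c'(2) unfolding ab by (simp add: inner_add_right c'(1) scaleR_conv_of_real[symmetric])
    ultimately have "\<alpha> \<le> 0" by (simp add: mult_le_0_iff)
    moreover have "z = p (Suc j) + of_real \<alpha> * side j + of_real \<beta> * side (Suc j)" using ab by (simp add: algebra_simps)
    ultimately show ?thesis using \<open>0 \<le> \<beta>\<close> by blast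
  qed
  have "card {j. j < ?d \<and> (0 < cr v (side j)) ~= (0 < cr v (side (Suc j)))} = 2"
    if v: "\<And>j. j < ?d ==> cr v (side j) ~= 0" for v
  proof -
    have sper: "side (j + ?d) = side j" for j using per[of "Suc j"] per[of j] by (simp add: side_def)
    have smod: "side (j mod ?d) = side j" for j by (rule periodic_mod[of side ?d, OF sper])
    have v': "cr v (side j) ~= 0" for j using v[of "j mod ?d"] smod[of j] by simp
    have s0: "(\<Sum>j<?d. cr v (side j)) = 0"
    proof -
      have "(\<Sum>j<?d. side j) = p ?d - p 0" unfolding side_def by (rule sum_lessThan_telescope)
      then have "(\<Sum>j<?d. side j) = 0" using per[of 0] by simp
      then show ?thesis using cr_sum_right[of v side "{..<?d}"] by simp
    qed
    have pos: "\<exists>j. 0 < cr v (side j)"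
    proof (rule ccontr)
      assume "\<not> ?thesis"
      then have "cr v (side j) < 0" for j using v'[of j] by (metis linorder_neqE)
      then have "(\<Sum>j<?d. - cr v (side j)) > 0" by (intro sum_pos) auto
      then show False using s0 by (simp add: sum_negf)
    qed
    have neg: "\<exists>j. \<not> 0 < cr v (side j)"
    proof (rule ccontr)
      assume "\<not> ?thesis"
      then have "(\<Sum>j<?d. cr v (side j)) > 0" by (intro sum_pos) auto
      then show False using s0 by simp
    qed
    have max: "cr v z < cr v (p (Suc j))" if j: "0 < cr v (side j)" "\<not> 0 < cr v (side (Suc j))" and z: "z \<in> ?H" "z ~= p (Suc j)" for j z
    proof -
      obtain \<alpha> \<beta> where ab: "\<alpha> \<le> 0" "0 \<le> \<beta>" "z = p (Suc j) + of_real \<alpha> * side j + of_real \<beta> * side (Suc j)"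
        using corner[OF z(1)] by blast
      have j2: "cr v (side (Suc j)) < 0" using j(2) v'[of "Suc j"] by simp
      have "\<alpha> < 0 \<or> 0 < \<beta>" using ab z(2) by (cases "\<alpha> = 0"; cases "\<beta> = 0") auto
      moreover have "\<alpha> * cr v (side j) \<le> 0" "\<beta> * cr v (side (Suc j)) \<le> 0"
        using ab(1,2) j(1) j2 by (auto intro: mult_nonpos_nonneg mult_nonneg_nonpos)
      moreover have "\<alpha> < 0 ==> \<alpha> * cr v (side j) < 0" "0 < \<beta> ==> \<beta> * cr v (side (Suc j)) < 0"
        using j(1) j2 by (auto intro: mult_neg_pos mult_pos_neg)
      ultimately have "\<alpha> * cr v (side j) + \<beta> * cr v (side (Suc j)) < 0" by linarith
      then show ?thesis by (simp add: ab(3))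
    qed
    obtain i i' where "0 < cr v (side i)" "\<not> 0 < cr v (side i')" using pos neg by blast
    then show ?thesis
    proof (rule two_changes_of_unique_descent[where b = "\<lambda>j. 0 < cr v (side j)", rotated 2])
      fix l l' assume l: "l < ?d" "l' < ?d" "0 < cr v (side l)" "\<not> 0 < cr v (side (Suc l))"
        "0 < cr v (side l')" "\<not> 0 < cr v (side (Suc l'))"
      have "p (Suc l) = p (Suc l')"
      proof (rule ccontr)
        assume ne: "p (Suc l) ~= p (Suc l')"
        show False using max[OF l(3,4) pH ne[symmetric]] max[OF l(5,6) pH ne] by simp
      qed
      then have "Suc l mod ?d = Suc l' mod ?d" by (simp add: p_inj)
      then show "l = l'" using l(1,2) by (auto simp: mod_Suc split: if_splits)
    qed (simp_all only: sper zero_less_Suc)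
  qed
  then have "cyclic_polygon p ?d"
    using m2 per np' by unfold_locales (auto simp: side_def)
  then show ?thesis unfolding p_def .
qed

section \<open>Generic polygons\<close>

lemma polynomials_cr:
  assumes "(\<lambda>r. Re (F r)) \<in> polynomials_in C" "(\<lambda>r. Im (F r)) \<in> polynomials_in C"
    "(\<lambda>r. Re (F' r)) \<in> polynomials_in C" "(\<lambda>r. Im (F' r)) \<in> polynomials_in C"
  shows "(\<lambda>r. cr (F r) (F' r)) \<in> polynomials_in C"
  unfolding cr_def by (intro polynomials_diff polynomials_in.mult assms)

lemma polynomials_vertex_diff:
  assumes "k \<le> m" "l \<le> m"
  shows "(\<lambda>r. Re (r k - r l)) \<in> polynomials_in (polygon_coords m)"
    "(\<lambda>r. Im (r k - r l)) \<in> polynomials_in (polygon_coords m)"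
proof -
  have "(\<lambda>r. Re (r i)) \<in> polygon_coords m" "(\<lambda>r. Im (r i)) \<in> polygon_coords m" if "i \<le> m" for i
    using that unfolding polygon_coords_def by blast+
  then show "(\<lambda>r. Re (r k - r l)) \<in> polynomials_in (polygon_coords m)"
    "(\<lambda>r. Im (r k - r l)) \<in> polynomials_in (polygon_coords m)"
    unfolding minus_complex.sel using assms by (intro polynomials_diff polynomials_in.coord; simp)+
qed

text \<open>The form in which every \<open>g i\<close> depends on the polygon: linearly in its first
  \<open>m\<close> sides, with real coefficients given by the inverse matrix.\<close>

definition side_sum :: "nat => (nat => real) => (nat => complex) => complex" where
  "side_sum m c r = (\<Sum>k<m. of_real (c k) * (r (Suc k) - r k))"

lemma polynomials_side_sum:
  "(\<lambda>r. Re (side_sum m c r)) \<in> polynomials_in (polygon_coords m)"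
  "(\<lambda>r. Im (side_sum m c r)) \<in> polynomials_in (polygon_coords m)"
proof -
  have "(\<lambda>r. \<Sum>k<m. c k * Re (r (Suc k) - r k)) \<in> polynomials_in (polygon_coords m)"
    by (intro polynomials_sum polynomials_in.mult polynomials_in.const polynomials_vertex_diff) auto
  then show "(\<lambda>r. Re (side_sum m c r)) \<in> polynomials_in (polygon_coords m)"
    by (simp add: side_sum_def)
  have "(\<lambda>r. \<Sum>k<m. c k * Im (r (Suc k) - r k)) \<in> polynomials_in (polygon_coords m)"
    by (intro polynomials_sum polynomials_in.mult polynomials_in.const polynomials_vertex_diff) auto
  then show "(\<lambda>r. Im (side_sum m c r)) \<in> polynomials_in (polygon_coords m)"
    by (simp add: side_sum_def)
qed

text \<open>A degenerate closed polygon serving as a test point: side \<open>k\<close> is 1, side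
  \<open>l\<close> is \<open>\<i>\<close> and the other sides before the closing one vanish. It
  witnesses that polynomials are nonzero, for which convexity plays no part.\<close>

definition two_sides :: "nat => nat => nat => complex" where
  "two_sides k l j = (\<Sum>i<j. if i = k then 1 else if i = l then \<i> else 0)"

lemma two_sides_diff: "two_sides k l (Suc j) - two_sides k l j = (if j = k then 1 else if j = l then \<i> else 0)"
  by (simp add: two_sides_def)

lemma two_sides_closing:
  assumes "k < m" "l < m" "k ~= l"
  shows "two_sides k l 0 - two_sides k l m = - 1 - \<i>"
proof -
  have "two_sides k l m = (\<Sum>i<m. (if i = k then 1 else 0) + (if i = l then \<i> else 0))"
    unfolding two_sides_def by (rule sum.cong) (use assms in auto)
  then have "two_sides k l m = 1 + \<i>" using assms by (simp add: sum.distrib)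
  then show ?thesis by (simp add: two_sides_def)
qed

lemma side_sum_two_sides:
  assumes "k < m" "l < m" "k ~= l"
  shows "side_sum m c (two_sides k l) = of_real (c k) + of_real (c l) * \<i>"
proof -
  have "side_sum m c (two_sides k l) = (\<Sum>i<m. (if i = k then of_real (c k) else 0) + (if i = l then of_real (c l) * \<i> else 0))"
    unfolding side_sum_def two_sides_diff by (rule sum.cong) (use assms in auto)
  then show ?thesis using assms by (simp add: sum.distrib)
qed

text \<open>At the test polygon the cross product is the \<open>2 \<times> 2\<close> minor of the
  coefficients at \<open>k\<close> and \<open>l\<close>.\<close>

lemma generically_side_sums_nonparallel:
  assumes "k < m" "l < m" "k ~= l" "c k * c' l - c l * c' k ~= 0"
  shows "generically (polygon_coords m) (\<lambda>r. cr (side_sum m c r) (side_sum m c' r) ~= 0)"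
proof (rule generically_nonzero[OF polynomials_cr[OF polynomials_side_sum polynomials_side_sum]])
  show "cr (side_sum m c (two_sides k l)) (side_sum m c' (two_sides k l)) ~= 0"
    unfolding side_sum_two_sides[OF assms(1-3)] using assms(4) by (simp add: cr_def mult.commute)
qed

lemma generically_side_sum_nonparallel:
  assumes "k < m" "l < m" "k ~= l" "c l ~= 0"
  shows "generically (polygon_coords m) (\<lambda>r. cr (side_sum m c r) (r (Suc k) - r k) ~= 0)"
proof (rule generically_nonzero[OF polynomials_cr[OF polynomials_side_sum polynomials_vertex_diff]])
  show "cr (side_sum m c (two_sides k l)) (two_sides k l (Suc k) - two_sides k l k) ~= 0"
    unfolding side_sum_two_sides[OF assms(1-3)] two_sides_diff using assms(4) by (simp add: cr_def)
qed (use assms in auto)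

text \<open>If one of the two is the closing side, a second nonzero side is put elsewhere, so that
  the closing side \<open>- 1 - \<i>\<close> is not parallel to the side 1.\<close>

lemma generically_sides_nonparallel:
  assumes m: "2 \<le> m" and ij: "i \<le> m" "j \<le> m" "i ~= j"
  shows "generically (polygon_coords m)
    (\<lambda>r. cr (r (Suc i mod Suc m) - r i) (r (Suc j mod Suc m) - r j) ~= 0)"
proof -
  have "\<exists>r. cr (r (Suc i mod Suc m) - r i) (r (Suc j mod Suc m) - r j) ~= 0"
  proof -
    consider "i < m" "j < m" | "i = m" "j < m" | "i < m" "j = m" using ij by linarith
    then show ?thesis
    proof cases
      case 1
      then show ?thesis using ij(3) by (intro exI[of _ "two_sides i j"]) (simp add: two_sides_diff cr_def)
    next
      case 2
      obtain k where k: "k < m" "k ~= j" using m by (metis One_nat_def Suc_1 Suc_le_lessD less_2_cases_iff nat_neq_iff not_less_eq_eq le_less_trans less_le_trans zero_less_one)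
      then show ?thesis using 2 two_sides_closing[of j m k] by (intro exI[of _ "two_sides j k"]) (simp add: two_sides_diff cr_def)
    next
      case 3
      obtain k where k: "k < m" "k ~= i" using m by (metis One_nat_def Suc_1 Suc_le_lessD less_2_cases_iff nat_neq_iff not_less_eq_eq le_less_trans less_le_trans zero_less_one)
      then show ?thesis using 3 two_sides_closing[of i m k] by (intro exI[of _ "two_sides i k"]) (simp add: two_sides_diff cr_def)
    qed
  qed
  moreover have "Suc i mod Suc m \<le> m" "Suc j mod Suc m \<le> m" by (simp_all add: less_Suc_eq_le[symmetric])
  ultimately show ?thesis
    using generically_nonzero[OF polynomials_cr[OF polynomials_vertex_diff polynomials_vertex_diff]] ij by blast
qed

section \<open>From the construction to the drawing\<close>

lemma gauge_equivalent_via_cong: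
  assumes "gauge_equivalent_via \<beta> G H" "\<And>b. b \<in> blacks G ==> \<beta> b = \<beta>' b"
    and "\<And>x. x \<in> adjacency G ==> fst x \<in> blacks G"
  shows "gauge_equivalent_via \<beta>' G H"
proof -
  have "bij_betw \<beta> (blacks G) (blacks H)" using assms(1) unfolding gauge_equivalent_via_def by blast
  then have 1: "bij_betw \<beta>' (blacks G) (blacks H)" using bij_betw_cong[of "blacks G" \<beta> \<beta>'] assms(2) by blast
  obtain \<omega> f1 f2 where *: "bij_betw \<omega> (whites G) (whites H)"
    "\<forall>b\<in>blacks G. \<forall>w\<in>whites G. (b, w) \<in> adjacency G \<longleftrightarrow> (\<beta> b, \<omega> w) \<in> adjacency H"
    "\<forall>w\<in>whites G. f1 w ~= 0" "\<forall>b\<in>blacks G. f2 b ~= 0"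
    "\<forall>(b, w)\<in>adjacency G. weight H (\<beta> b) (\<omega> w) = f1 w * f2 b * weight G b w"
    using assms(1) unfolding gauge_equivalent_via_def by (elim conjE exE)
  have 2: "\<forall>b\<in>blacks G. \<forall>w\<in>whites G. (b, w) \<in> adjacency G \<longleftrightarrow> (\<beta>' b, \<omega> w) \<in> adjacency H"
    using *(2) assms(2) by simp
  have 3: "\<forall>(b, w)\<in>adjacency G. weight H (\<beta>' b) (\<omega> w) = f1 w * f2 b * weight G b w"
    using *(5) assms(2) assms(3) by fastforce
  show ?thesis
    unfolding gauge_equivalent_via_def using 1 *(1) 2 *(3,4) 3 by blast
qed

context elementary_plane_graph begin

lemma sum_Eb: "i < n ==> (\<Sum>e\<in>Eb i. h e) = (\<Sum>j<n. if (i, j) \<in> E then h (i, j) else 0)"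
proof -
  have "(\<Sum>e\<in>Eb i. h e) = (\<Sum>j\<in>{j. j < n \<and> (i, j) \<in> E}. h (i, j))"
    by (rule sum.reindex_bij_witness[where j = snd and i = "\<lambda>j. (i, j)"]) (auto simp: Eb_def dest: E_bounds)
  also have "\<dots> = (\<Sum>j<n. if (i, j) \<in> E then h (i, j) else 0)"
    by (rule sum.mono_neutral_cong_left) auto
  finally show ?thesis .
qed

lemma sum_Ew: "j < n ==> (\<Sum>e\<in>Ew j. h e) = (\<Sum>i<n. if (i, j) \<in> E then h (i, j) else 0)"
proof -
  have "(\<Sum>e\<in>Ew j. h e) = (\<Sum>i\<in>{i. i < n \<and> (i, j) \<in> E}. h (i, j))"
    by (rule sum.reindex_bij_witness[where j = fst and i = "\<lambda>i. (i, j)"]) (auto simp: Ew_def dest: E_bounds)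
  also have "\<dots> = (\<Sum>i<n. if (i, j) \<in> E then h (i, j) else 0)"
    by (rule sum.mono_neutral_cong_left) auto
  finally show ?thesis .
qed

lemma m_le_n: "m \<le> n"
proof -
  have "inj_on (\<lambda>k. snd (oe k)) {..<m}" by (rule inj_onI) (use outer_white_distinct in blast)
  moreover have "(\<lambda>k. snd (oe k)) ` {..<m} \<subseteq> {..<n}" using E_bounds(2)[OF oe_E] by auto
  ultimately show ?thesis using card_inj_on_le[of _ "{..<m}" "{..<n}"] by simp
qed

definition white_rhs :: "(nat => complex) => nat => complex" where
  "white_rhs r j = (\<Sum>k<m. if snd (oe k) = j then r (Suc k) - r k else 0)"

lemma construction_iff:
  "construction G a (kasteleyn_matrix G s \<nu>) r f g \<psi> \<longleftrightarrow>
    f \<in> carrier_vec n \<and> (\<forall>i<n. (\<Sum>j<n. kas s \<nu> i j * vec_index f j) = (if i = fst a then 1 else 0)) \<and>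
    g \<in> carrier_vec n \<and>
    (\<forall>j<n. (\<Sum>i<n. of_real (kas s \<nu> i j * vec_index f j) * vec_index g i) = white_rhs r j) \<and>
    (\<forall>e\<in>E. \<psi> (Lv e) - \<psi> (Rv e) = vec_index g (fst e) * of_real (kas s \<nu> (fst e) (snd e) * vec_index f (snd e)))"
proof -
  let ?K = "kasteleyn_matrix G s \<nu>"
  let ?K' = "map_mat complex_of_real (scale_cols ?K f)"
  have K: "?K = Matrix.mat n n (\<lambda>(i, j). kas s \<nu> i j)" by (rule kasteleyn_matrix_eq)
  have K': "?K' = Matrix.mat n n (\<lambda>(i, j). complex_of_real (kas s \<nu> i j * vec_index f j))"
    unfolding K scale_cols_def by (rule eq_matI) auto
  have 1: "?K *\<^sub>v f = A_b G a \<longleftrightarrow> (\<forall>i<n. (\<Sum>j<n. kas s \<nu> i j * vec_index f j) = (if i = fst a then 1 else 0))"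
    if "f \<in> carrier_vec n"
  proof -
    have "?K *\<^sub>v f = Matrix.vec n (\<lambda>i. \<Sum>j<n. kas s \<nu> i j * vec_index f j)"
      unfolding K using that by (intro eq_vecI) (auto simp: scalar_prod_def atLeast0LessThan intro!: sum.cong)
    then show ?thesis using E_bounds(1)[OF a_edge] by (auto simp: A_b_def vec_eq_iff)
  qed
  have 2: "transpose_mat ?K' *\<^sub>v g = A_w G a r \<longleftrightarrow>
      (\<forall>j<n. (\<Sum>i<n. of_real (kas s \<nu> i j * vec_index f j) * vec_index g i) = white_rhs r j)"
    if "g \<in> carrier_vec n"
  proof -
    have "transpose_mat ?K' *\<^sub>v g = Matrix.vec n (\<lambda>j. \<Sum>i<n. of_real (kas s \<nu> i j * vec_index f j) * vec_index g i)"
      unfolding K' using that by (intro eq_vecI) (auto simp: scalar_prod_def atLeast0LessThan intro!: sum.cong)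
    moreover have "A_w G a r = Matrix.vec n (white_rhs r)"
    proof -
      have "(\<Sum>k = 1..m. if outer_white G a k = j then r k - r (k - 1) else 0) = white_rhs r j" for j
        unfolding white_rhs_def
        by (rule sum.reindex_bij_witness[where i = Suc and j = "\<lambda>k. k - 1"]) (auto simp: outer_white_def oe_def)
      then show ?thesis unfolding A_w_def by simp
    qed
    ultimately show ?thesis by (auto simp: vec_eq_iff)
  qed
  have 3: "dual_potential G a (scale_rows g ?K') \<psi> \<longleftrightarrow>
      (\<forall>e\<in>E. \<psi> (Lv e) - \<psi> (Rv e) = vec_index g (fst e) * of_real (kas s \<nu> (fst e) (snd e) * vec_index f (snd e)))"
  proof -
    have "scale_rows g ?K' $$ e = vec_index g (fst e) * of_real (kas s \<nu> (fst e) (snd e) * vec_index f (snd e))" if "e \<in> E" for e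
      unfolding K' scale_rows_def using E_bounds[OF that] by (cases e) simp
    then show ?thesis unfolding dual_potential_def by simp
  qed
  show ?thesis unfolding construction_def Let_def using 1 2 3 by blast
qed

text \<open>The column scaling \<open>f\<close> is the column of the inverse at \<open>b0\<close>.
  Dividing the equations for \<open>g\<close> by it and applying the inverse expresses
  \<open>g i\<close> through the sides, each outer white vertex contributing the quotient of two
  entries of its row.\<close>

lemma construction_solution:
  assumes KB: "\<And>i j. i < n ==> j < n ==> (\<Sum>l<n. kas s \<nu> i l * B l j) = (if i = j then 1 else 0)"
    and BK: "\<And>i j. i < n ==> j < n ==> (\<Sum>l<n. B i l * kas s \<nu> l j) = (if i = j then 1 else 0)"
    and B0: "\<And>i j. i < n ==> j < n ==> B j i ~= 0"
    and con: "construction G a (kasteleyn_matrix G s \<nu>) r f g \<psi>"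
  shows "j < n ==> vec_index f j = B j (fst a)"
    and "i < n ==> vec_index g i = side_sum m (\<lambda>k. B (snd (oe k)) i / B (snd (oe k)) (fst a)) r"
proof -
  have b0: "fst a < n" using E_bounds(1)[OF a_edge] .
  note con' = con[unfolded construction_iff]
  have f: "(\<Sum>j<n. kas s \<nu> i j * vec_index f j) = (if i = fst a then 1 else 0)" if "i < n" for i using con' that by blast
  have g: "(\<Sum>i<n. of_real (kas s \<nu> i j * vec_index f j) * vec_index g i) = white_rhs r j" if "j < n" for j
    using con' that by blast
  have fj: "vec_index f j = B j (fst a)" if j: "j < n" for j
  proof -
    have "vec_index f j = (\<Sum>j'<n. (if j = j' then 1 else 0) * vec_index f j')"
      using j by (simp add: if_distrib[of "\<lambda>c. c * _"] cong: if_cong)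
    also have "\<dots> = (\<Sum>j'<n. (\<Sum>l<n. B j l * kas s \<nu> l j') * vec_index f j')"
      by (rule sum.cong) (simp_all add: BK[OF j])
    also have "\<dots> = (\<Sum>j'<n. \<Sum>l<n. B j l * (kas s \<nu> l j' * vec_index f j'))"
      by (simp add: sum_distrib_right mult.assoc)
    also have "\<dots> = (\<Sum>l<n. \<Sum>j'<n. B j l * (kas s \<nu> l j' * vec_index f j'))" by (rule sum.swap)
    also have "\<dots> = (\<Sum>l<n. B j l * (if l = fst a then 1 else 0))"
      by (rule sum.cong) (simp_all add: sum_distrib_left[symmetric] f)
    also have "\<dots> = B j (fst a)" using b0 by (simp add: if_distrib[of "\<lambda>c. _ * c"] cong: if_cong)
    finally show ?thesis .
  qed
  then show "j < n ==> vec_index f j = B j (fst a)" .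
  assume i: "i < n"
  have col: "(\<Sum>i'<n. of_real (kas s \<nu> i' j) * vec_index g i') = white_rhs r j / of_real (B j (fst a))" if j: "j < n" for j
  proof -
    have "white_rhs r j = of_real (B j (fst a)) * (\<Sum>i'<n. of_real (kas s \<nu> i' j) * vec_index g i')"
      unfolding g[OF j, symmetric] fj[OF j] sum_distrib_left by (rule sum.cong) auto
    then show ?thesis using B0[OF b0 j] by (simp add: field_simps)
  qed
  have "vec_index g i = (\<Sum>i'<n. of_real (if i' = i then 1 else 0) * vec_index g i')"
    using i by (simp add: if_distrib[of of_real] if_distrib[of "\<lambda>c. c * _"] cong: if_cong)
  also have "\<dots> = (\<Sum>i'<n. of_real (\<Sum>j<n. kas s \<nu> i' j * B j i) * vec_index g i')"
    by (rule sum.cong) (simp_all add: KB[OF _ i] del: of_real_sum)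
  also have "\<dots> = (\<Sum>i'<n. \<Sum>j<n. of_real (B j i) * (of_real (kas s \<nu> i' j) * vec_index g i'))"
    by (rule sum.cong) (simp_all add: sum_distrib_left sum_distrib_right mult_ac)
  also have "\<dots> = (\<Sum>j<n. \<Sum>i'<n. of_real (B j i) * (of_real (kas s \<nu> i' j) * vec_index g i'))" by (rule sum.swap)
  also have "\<dots> = (\<Sum>j<n. of_real (B j i) * (white_rhs r j / of_real (B j (fst a))))"
    by (rule sum.cong) (simp_all add: sum_distrib_left[symmetric] col)
  also have "\<dots> = (\<Sum>j<n. \<Sum>k<m. if snd (oe k) = j then of_real (B j i / B j (fst a)) * (r (Suc k) - r k) else 0)"
    unfolding white_rhs_def by (rule sum.cong) (auto simp: sum_distrib_left sum_divide_distrib intro!: sum.cong)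
  also have "\<dots> = (\<Sum>k<m. \<Sum>j<n. if snd (oe k) = j then of_real (B j i / B j (fst a)) * (r (Suc k) - r k) else 0)"
    by (rule sum.swap)
  also have "\<dots> = side_sum m (\<lambda>k. B (snd (oe k)) i / B (snd (oe k)) (fst a)) r"
    unfolding side_sum_def by (rule sum.cong) (use E_bounds(2)[OF oe_E] in simp_all)
  finally show "vec_index g i = side_sum m (\<lambda>k. B (snd (oe k)) i / B (snd (oe k)) (fst a)) r" .
qed

text \<open>The formulas of the solution define \<open>f\<close> and \<open>g\<close>. The scaled
  matrix is then conserved at the required vertices, and its real and imaginary parts have
  potentials.\<close>

lemma construction_exists:
  assumes KB: "\<And>i j. i < n ==> j < n ==> (\<Sum>l<n. kas s \<nu> i l * B l j) = (if i = j then 1 else 0)"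
    and BK: "\<And>i j. i < n ==> j < n ==> (\<Sum>l<n. B i l * kas s \<nu> l j) = (if i = j then 1 else 0)"
    and B0: "\<And>i j. i < n ==> j < n ==> B j i ~= 0"
  shows "\<exists>f g \<psi>. construction G a (kasteleyn_matrix G s \<nu>) r f g \<psi>"
proof -
  have b0: "fst a < n" using E_bounds(1)[OF a_edge] .
  define f where "f = Matrix.vec n (\<lambda>j. B j (fst a))"
  define g where "g = Matrix.vec n (\<lambda>i. \<Sum>j<n. of_real (B j i) * (white_rhs r j / of_real (B j (fst a))))"
  define T where "T e = vec_index g (fst e) * of_real (kas s \<nu> (fst e) (snd e) * vec_index f (snd e))" for e
  have f: "(\<Sum>j<n. kas s \<nu> i j * vec_index f j) = (if i = fst a then 1 else 0)" if "i < n" for i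
    using KB[OF that b0] by (simp add: f_def)
  have g: "(\<Sum>i<n. of_real (kas s \<nu> i j * vec_index f j) * vec_index g i) = white_rhs r j" if j: "j < n" for j
  proof -
    let ?h = "\<lambda>j. white_rhs r j / of_real (B j (fst a))"
    have "(\<Sum>i<n. of_real (kas s \<nu> i j * vec_index f j) * vec_index g i)
        = of_real (B j (fst a)) * (\<Sum>i<n. \<Sum>j'<n. of_real (B j' i * kas s \<nu> i j) * ?h j')"
      unfolding sum_distrib_left using j by (intro sum.cong) (simp_all add: f_def g_def sum_distrib_left mult_ac)
    also have "(\<Sum>i<n. \<Sum>j'<n. of_real (B j' i * kas s \<nu> i j) * ?h j') = (\<Sum>j'<n. \<Sum>i<n. of_real (B j' i * kas s \<nu> i j) * ?h j')"
      by (rule sum.swap)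
    also have "\<dots> = (\<Sum>j'<n. of_real (\<Sum>i<n. B j' i * kas s \<nu> i j) * ?h j')"
      by (simp only: of_real_sum sum_distrib_right)
    also have "\<dots> = (\<Sum>j'<n. if j' = j then ?h j else 0)"
      by (rule sum.cong) (simp_all add: BK[OF _ j] del: of_real_sum)
    also have "\<dots> = ?h j" using j by simp
    finally show ?thesis using B0[OF b0 j] by simp
  qed
  have black: "(\<Sum>e\<in>Eb i. T e) = (if i = fst a then vec_index g i else 0)" if i: "i < n" for i
  proof -
    have "(\<Sum>e\<in>Eb i. T e) = (\<Sum>j<n. vec_index g i * of_real (kas s \<nu> i j * vec_index f j))"
      unfolding sum_Eb[OF i] T_def by (rule sum.cong) (auto simp: kas_def)
    also have "\<dots> = vec_index g i * of_real (\<Sum>j<n. kas s \<nu> i j * vec_index f j)"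
      by (simp only: of_real_sum sum_distrib_left)
    finally show ?thesis using f[OF i] by simp
  qed
  have white: "(\<Sum>e\<in>Ew j. T e) = white_rhs r j" if j: "j < n" for j
    unfolding sum_Ew[OF j] T_def g[OF j, symmetric] by (rule sum.cong) (auto simp: kas_def)
  have white0: "white_rhs r j = 0" if "j \<notin> snd ` Out" for j
    unfolding white_rhs_def using that oe_Out by (intro sum.neutral) auto
  have sums: "(\<Sum>e\<in>Eb i. Re (T e)) = 0" "(\<Sum>e\<in>Eb i. Im (T e)) = 0" if "i < n" "i ~= fst a" for i
    using black[OF that(1)] that(2) by (simp_all add: Re_sum[symmetric] Im_sum[symmetric] del: Re_sum Im_sum)
  have sums': "(\<Sum>e\<in>Ew j. Re (T e)) = 0" "(\<Sum>e\<in>Ew j. Im (T e)) = 0" if "j < n" "j \<notin> snd ` Out" for j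
    using white[OF that(1)] white0[OF that(2)] by (simp_all add: Re_sum[symmetric] Im_sum[symmetric] del: Re_sum Im_sum)
  obtain \<psi>1 where \<psi>1: "\<forall>e\<in>E. \<psi>1 (Lv e) - \<psi>1 (Rv e) = Re (T e)" using potential_exists[of "\<lambda>e. Re (T e)"] sums(1) sums'(1) by blast
  obtain \<psi>2 where \<psi>2: "\<forall>e\<in>E. \<psi>2 (Lv e) - \<psi>2 (Rv e) = Im (T e)" using potential_exists[of "\<lambda>e. Im (T e)"] sums(2) sums'(2) by blast
  have "\<forall>e\<in>E. Complex (\<psi>1 (Lv e)) (\<psi>2 (Lv e)) - Complex (\<psi>1 (Rv e)) (\<psi>2 (Rv e)) = T e"
    using \<psi>1 \<psi>2 by (simp add: complex_eq_iff)
  moreover have "f \<in> carrier_vec n" "g \<in> carrier_vec n" by (simp_all add: f_def g_def)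
  ultimately have "construction G a (kasteleyn_matrix G s \<nu>) r f g (\<lambda>v. Complex (\<psi>1 v) (\<psi>2 v))"
    unfolding construction_iff T_def using f g by blast
  then show ?thesis by blast
qed

text \<open>The coefficients of \<open>g i\<close> and \<open>g i'\<close> at the first two outer
  white vertices form a nonzero \<open>2 \<times> 2\<close> minor of the inverse, up to nonzero
  column factors, so these directions are not parallel for generic \<open>r\<close>. Against a side
  a single nonzero coefficient at another side suffices.\<close>

lemma generically_good_polygon:
  assumes nd: "nondegenerate 2 (kasteleyn_matrix G s \<nu>)" and m2: "2 \<le> m"
    and KB: "\<And>i j. i < n ==> j < n ==> (\<Sum>l<n. kas s \<nu> i l * B l j) = (if i = j then 1 else 0)"
    and B0: "\<And>i j. i < n ==> j < n ==> B j i ~= 0"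
  defines "gr \<equiv> \<lambda>r i. side_sum m (\<lambda>k. B (snd (oe k)) i / B (snd (oe k)) (fst a)) r"
  shows "generically (polygon_coords m) (\<lambda>r.
    (\<forall>i<n. \<forall>i'<n. i ~= i' \<longrightarrow> cr (gr r i) (gr r i') ~= 0) \<and>
    (\<forall>i<n. \<forall>k<m. cr (gr r i) (r (Suc k) - r k) ~= 0) \<and>
    (\<forall>i\<le>m. \<forall>j\<le>m. i ~= j \<longrightarrow> cr (r (Suc i mod Suc m) - r i) (r (Suc j mod Suc m) - r j) ~= 0))"
proof -
  let ?C = "polygon_coords m"
  have b0: "fst a < n" using E_bounds(1)[OF a_edge] .
  have w: "snd (oe k) < n" for k using E_bounds(2)[OF oe_E] .
  have "generically ?C (\<lambda>r. \<forall>(i, i')\<in>{(i, i'). i < n \<and> i' < n \<and> i ~= i'}. cr (gr r i) (gr r i') ~= 0)"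
  proof (rule generically_ball[OF lines_polygon_coords])
    show "finite {(i, i'). i < n \<and> i' < n \<and> i ~= i'}" by (rule finite_subset[of _ "{..<n} \<times> {..<n}"]) auto
    fix x assume "x \<in> {(i, i'). i < n \<and> i' < n \<and> i ~= i'}"
    then obtain i i' where i: "x = (i, i')" "i < n" "i' < n" "i ~= i'" by blast
    let ?w = "snd (oe 0)" and ?w' = "snd (oe 1)"
    have ne: "?w ~= ?w'" using outer_white_distinct[of 0 1] m2 by auto
    have "B ?w i * B ?w' i' - B ?w' i * B ?w i' ~= 0"
      by (rule inverse_minor_nonzero[OF nd KB i(2-4) w w ne])
    then have "B ?w i / B ?w (fst a) * (B ?w' i' / B ?w' (fst a)) - B ?w' i / B ?w' (fst a) * (B ?w i' / B ?w (fst a)) ~= 0"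
      using B0[OF b0 w[of 0]] B0[OF b0 w[of 1]] by (simp add: field_simps)
    then have "generically ?C (\<lambda>r. cr (gr r i) (gr r i') ~= 0)"
      unfolding gr_def by (intro generically_side_sums_nonparallel[of 0 m 1]) (use m2 in auto)
    then show "generically ?C (\<lambda>r. case x of (i, i') => cr (gr r i) (gr r i') ~= 0)" by (simp add: i(1))
  qed
  moreover have "generically ?C (\<lambda>r. \<forall>(i, k)\<in>{..<n} \<times> {..<m}. cr (gr r i) (r (Suc k) - r k) ~= 0)"
  proof (rule generically_ball[OF lines_polygon_coords])
    fix x assume "x \<in> {..<n} \<times> {..<m}"
    then obtain i k where i: "x = (i, k)" "i < n" "k < m" by blast
    define l where "l = (if k = 0 then 1 else 0 :: nat)"
    have l: "l < m" "k ~= l" using m2 by (auto simp: l_def)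
    have "generically ?C (\<lambda>r. cr (gr r i) (r (Suc k) - r k) ~= 0)"
      unfolding gr_def by (rule generically_side_sum_nonparallel[OF i(3) l]) (use B0[OF i(2) w] B0[OF b0 w] in simp)
    then show "generically ?C (\<lambda>r. case x of (i, k) => cr (gr r i) (r (Suc k) - r k) ~= 0)" by (simp add: i(1))
  qed simp
  moreover have "generically ?C (\<lambda>r. \<forall>(i, j)\<in>{(i, j). i \<le> m \<and> j \<le> m \<and> i ~= j}. cr (r (Suc i mod Suc m) - r i) (r (Suc j mod Suc m) - r j) ~= 0)"
  proof (rule generically_ball[OF lines_polygon_coords])
    show "finite {(i, j). i \<le> m \<and> j \<le> m \<and> i ~= j}" by (rule finite_subset[of _ "{..m} \<times> {..m}"]) auto
    fix x assume "x \<in> {(i, j). i \<le> m \<and> j \<le> m \<and> i ~= j}"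
    then show "generically ?C (\<lambda>r. case x of (i, j) => cr (r (Suc i mod Suc m) - r i) (r (Suc j mod Suc m) - r j) ~= 0)"
      using generically_sides_nonparallel[OF m2] by auto
  qed
  ultimately have gen: "generically ?C (\<lambda>r.
    (\<forall>(i, i')\<in>{(i, i'). i < n \<and> i' < n \<and> i ~= i'}. cr (gr r i) (gr r i') ~= 0) \<and>
    (\<forall>(i, k)\<in>{..<n} \<times> {..<m}. cr (gr r i) (r (Suc k) - r k) ~= 0) \<and>
    (\<forall>(i, j)\<in>{(i, j). i \<le> m \<and> j \<le> m \<and> i ~= j}. cr (r (Suc i mod Suc m) - r i) (r (Suc j mod Suc m) - r j) ~= 0))"
    by (intro generically_conj[OF lines_polygon_coords])
  have pairs: "(\<forall>(i, j)\<in>{(i, j). p i \<and> q j \<and> i ~= j}. Q i j) \<longleftrightarrow> (\<forall>i. p i \<longrightarrow> (\<forall>j. q j \<longrightarrow> i ~= j \<longrightarrow> Q i j))"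
    "(\<forall>(i, j)\<in>{..<k} \<times> {..<l}. Q i j) \<longleftrightarrow> (\<forall>i<k. \<forall>j<l. Q i j)" for p q Q and k l :: nat
    by auto
  show ?thesis using gen unfolding pairs .
qed

text \<open>The two edges at a white corner share their column multiplier, whose sign appears
  squared, so the Kasteleyn condition passes from \<open>s\<close> to \<open>\<kappa>\<close>. The
  translation moves \<open>Outer 0\<close> to \<open>r 0\<close>; all other outer regions
  follow.\<close>

lemma construction_drawing:
  assumes ks: "kasteleyn_signs G a s" and \<nu>: "\<And>e. e \<in> E ==> 0 < \<nu> e"
    and con: "construction G a (kasteleyn_matrix G s \<nu>) r f g \<psi>"
    and f0: "\<And>j. j < n ==> vec_index f j ~= 0"
    and g1: "\<And>i i'. i < n ==> i' < n ==> i ~= i' ==> cr (vec_index g i) (vec_index g i') ~= 0"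
    and g2: "\<And>i k. i < n ==> k < m ==> cr (vec_index g i) (r (Suc k) - r k) ~= 0"
    and conv: "convex_polygon m r"
    and sides: "\<And>i j. i \<le> m ==> j \<le> m ==> i ~= j ==> cr (r (Suc i mod Suc m) - r i) (r (Suc j mod Suc m) - r j) ~= 0"
  defines "\<kappa> \<equiv> \<lambda>e. s e * \<nu> e * vec_index f (snd e)"
  shows "drawn_graph G a (vec_index g) \<kappa> r (\<lambda>v. \<psi> v + (r 0 - \<psi> (Outer 0)))"
proof -
  have s: "s e = 1 \<or> s e = - 1" if "e \<in> E" for e using ks that by (auto simp: kasteleyn_signs_def)
  have \<kappa>: "kas s \<nu> (fst e) (snd e) * vec_index f (snd e) = \<kappa> e" if "e \<in> E" for e
    using that by (simp add: kas_def \<kappa>_def)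
  note con' = con[unfolded construction_iff]
  show ?thesis
  proof (intro drawn_graph.intro weighted_plane_graph.intro weighted_plane_graph_axioms.intro drawn_graph_axioms.intro)
    show "elementary_plane_graph G a" by (rule elementary_plane_graph_axioms)
  next
    fix e assume e: "e \<in> E"
    show "\<kappa> e ~= 0" using s[OF e] \<nu>[OF e] f0[OF E_bounds(2)[OF e]] by (auto simp: \<kappa>_def)
    have "\<psi> (Lv e) - \<psi> (Rv e) = vec_index g (fst e) * of_real (\<kappa> e)"
      unfolding \<kappa>[OF e, symmetric] using con' e by blast
    then show "\<psi> (Lv e) + (r 0 - \<psi> (Outer 0)) - (\<psi> (Rv e) + (r 0 - \<psi> (Outer 0))) = of_real (\<kappa> e) * vec_index g (fst e)"
      by (simp add: mult.commute)
  next
    fix F assume F: "F \<in> faces G" "F ~= Out"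
    have "sgn (\<kappa> e) * sgn (\<kappa> (rw e)) = s e * s (rw e)" if "e \<in> F" for e
    proof -
      have e: "e \<in> E" using faceD[OF F(1) that] by blast
      have rwe: "rw e \<in> E" "snd (rw e) = snd e" using e by (simp_all add: rw_in)
      have "sgn (\<kappa> x) = s x * sgn (vec_index f (snd x))" if "x \<in> E" for x
        using s[OF that] \<nu>[OF that] by (auto simp: \<kappa>_def sgn_mult)
      then have "sgn (\<kappa> e) * sgn (\<kappa> (rw e)) = s e * s (rw e) * (sgn (vec_index f (snd e)) * sgn (vec_index f (snd e)))"
        using e rwe by simp
      then show ?thesis using f0[OF E_bounds(2)[OF e]] by (simp add: sgn_if)
    qed
    then have "(\<Prod>e\<in>F. sgn (\<kappa> e) * sgn (\<kappa> (rw e))) = (\<Prod>e\<in>F. s e * s (rw e))" by (intro prod.cong) auto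
    then show "(\<Prod>e\<in>F. sgn (\<kappa> e) * sgn (\<kappa> (rw e))) = (- 1) ^ (card F + 1)"
      using ks F unfolding kasteleyn_signs_def by auto
  next
    fix i assume i: "i < n"
    have "(\<Sum>e\<in>Eb i. \<kappa> e) = (\<Sum>j<n. kas s \<nu> i j * vec_index f j)"
      unfolding sum_Eb[OF i] by (rule sum.cong) (auto simp: kas_def \<kappa>_def)
    then show "(\<Sum>e\<in>Eb i. \<kappa> e) = (if i = fst a then 1 else 0)" using con' i by simp
  next
    fix j assume j: "j < n"
    have "(\<Sum>e\<in>Ew j. vec_index g (fst e) * of_real (\<kappa> e)) = (\<Sum>i<n. of_real (kas s \<nu> i j * vec_index f j) * vec_index g i)"
      unfolding sum_Ew[OF j] by (rule sum.cong) (auto simp: kas_def \<kappa>_def)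
    then show "(\<Sum>e\<in>Ew j. vec_index g (fst e) * of_real (\<kappa> e)) = (\<Sum>k<m. if snd (oe k) = j then r (Suc k) - r k else 0)"
      using con' j by (simp add: white_rhs_def)
  next
    show "cyclic_polygon (\<lambda>j. r (j mod Suc m)) (Suc m)" by (rule convex_polygon_cyclic[OF conv sides])
  next
    show "cr (vec_index g i) (vec_index g i') ~= 0" if "i < n" "i' < n" "i ~= i'" for i i' using g1 that .
    show "cr (vec_index g i) (r (Suc k) - r k) ~= 0" if "i < n" "k < m" for i k using g2 that .
    show "\<psi> (Outer 0) + (r 0 - \<psi> (Outer 0)) = r 0" by simp
  qed
qed

lemma construction_T_graph:
  assumes ks: "kasteleyn_signs G a s" and \<nu>: "\<And>e. e \<in> E ==> 0 < \<nu> e"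
    and con: "construction G a (kasteleyn_matrix G s \<nu>) r f g \<psi>"
    and f0: "\<And>j. j < n ==> vec_index f j ~= 0"
    and g1: "\<And>i i'. i < n ==> i' < n ==> i ~= i' ==> cr (vec_index g i) (vec_index g i') ~= 0"
    and g2: "\<And>i k. i < n ==> k < m ==> cr (vec_index g i) (r (Suc k) - r k) ~= 0"
    and conv: "convex_polygon m r"
    and sides: "\<And>i j. i \<le> m ==> j \<le> m ==> i ~= j ==> cr (r (Suc i mod Suc m) - r i) (r (Suc j mod Suc m) - r j) ~= 0"
  shows "\<exists>c. let \<psi>' = (\<lambda>v. \<psi> v + c);
                 L = dual_segment G a \<psi>';
                 \<L> = L ` {..<n};
                 R = r ` {..m}
             in T_graph \<L> R \<and>
                (\<exists>\<gamma>. enclosing_curve \<L> R \<gamma>) \<and>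
                (\<forall>\<gamma>. enclosing_curve \<L> R \<gamma> \<longrightarrow>
                  (\<exists>F0. outer_T_face \<L> R \<gamma> F0 \<and>
                    gauge_equivalent_via L (weighted_graph G \<nu>) (dimer_graph \<L> \<gamma> F0))) \<and>
                (\<forall>v \<in> dual_vertices G a. \<psi>' v \<in> T_vertices \<L>) \<and>
                (\<forall>k \<le> m. \<psi>' (Outer k) \<in> R)"
proof -
  define c where "c = r 0 - \<psi> (Outer 0)"
  define \<psi>' where "\<psi>' = (\<lambda>v. \<psi> v + c)"
  define \<kappa> where "\<kappa> = (\<lambda>e. s e * \<nu> e * vec_index f (snd e))"
  interpret D: drawn_graph G a "vec_index g" \<kappa> r \<psi>'
    unfolding \<kappa>_def \<psi>'_def c_def by (rule construction_drawing[OF ks \<nu> con f0 g1 g2 conv sides])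
  let ?L = "dual_segment G a \<psi>'"
  have L: "?L ` {..<n} = D.Lseg ` {..<n}" by (rule image_cong) (simp_all add: D.dual_segment_eq)
  have R: "D.Rt = r ` {..m}" by (rule D.Rt_def)
  have gauge: "\<exists>F0. outer_T_face (D.Lseg ` {..<n}) (r ` {..m}) \<gamma> F0 \<and>
      gauge_equivalent_via ?L (weighted_graph G \<nu>) (dimer_graph (D.Lseg ` {..<n}) \<gamma> F0)"
    if \<gamma>: "enclosing_curve (D.Lseg ` {..<n}) (r ` {..m}) \<gamma>" for \<gamma>
  proof -
    interpret C: enclosed_drawing G a "vec_index g" \<kappa> r \<psi>' \<gamma>
      using \<gamma> unfolding enclosing_curve_def R[symmetric] by unfold_locales (simp_all add: D.\<Lambda>_def)
    \<comment> \<open>A dual edge has length \<open>\<bar>f j\<bar> * cmod (g i) * \<nu>\<close>, so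
      the absolute values of the column and row multipliers are the gauge functions.\<close>
    have "gauge_equivalent_via D.Lseg (weighted_graph G \<nu>) (dimer_graph (D.Lseg ` {..<n}) \<gamma> C.face0)"
    proof (rule C.gauge_equivalent_faces)
      show "\<bar>vec_index f j\<bar> ~= 0" if "j < n" for j using f0[OF that] by simp
      show "cmod (vec_index g i) ~= 0" if "i < n" for i using D.g_nonzero[OF that] by simp
      show "cmod (D.T (i, j)) = \<bar>vec_index f j\<bar> * cmod (vec_index g i) * \<nu> (i, j)" if e: "(i, j) \<in> E" for i j
      proof -
        have "\<bar>s (i, j)\<bar> = 1" using ks e unfolding kasteleyn_signs_def by force
        moreover have "D.T (i, j) = of_real (\<kappa> (i, j)) * vec_index g i" by (simp add: D.T_def)
        ultimately show ?thesis using \<nu>[OF e] by (simp add: \<kappa>_def norm_mult abs_mult)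
      qed
    qed
    then have "gauge_equivalent_via ?L (weighted_graph G \<nu>) (dimer_graph (D.Lseg ` {..<n}) \<gamma> C.face0)"
      by (rule gauge_equivalent_via_cong) (auto simp: weighted_graph_def D.dual_segment_eq dest: E_bounds)
    then show ?thesis using C.outer_T_face unfolding R by blast
  qed
  show ?thesis
    unfolding Let_def
  proof (rule exI[of _ c], fold \<psi>'_def, unfold L, intro conjI allI ballI impI)
    show "T_graph (D.Lseg ` {..<n}) (r ` {..m})" using D.T_graph_Lseg unfolding R .
    show "\<exists>\<gamma>. enclosing_curve (D.Lseg ` {..<n}) (r ` {..m}) \<gamma>" using D.enclosing_curve_exists unfolding R .
    have \<psi>'_eq: "\<psi> v + c = \<psi>' v" for v by (simp add: \<psi>'_def)
    show "\<psi> v + c \<in> T_vertices (D.Lseg ` {..<n})" if "v \<in> dual_vertices G a" for v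
      unfolding \<psi>'_eq by (rule D.psi_T_vertices[OF that])
    show "\<psi> (Outer k) + c \<in> r ` {..m}" if "k \<le> m" for k
      unfolding \<psi>'_eq using D.psi_outer[OF that] that by simp
  qed (rule gauge)
qed

end

theorem theorem3:
  fixes G :: bipartite_map and a :: "nat \<times> nat" and s :: "nat \<times> nat \<Rightarrow> real"
  assumes "plane_bipartite_map G"
    and "\<exists>M. perfect_matching G M"
    and "\<forall>e \<in> edges G. \<exists>M. perfect_matching G M \<and> e \<in> M"
    and "a \<in> edges G"
    and "kasteleyn_signs G a s"
  shows "generically (weight_coords (edges G)) (\<lambda>\<nu>.
    (\<forall>e \<in> edges G. \<nu> e > 0) \<longrightarrow> nondegenerate 2 (kasteleyn_matrix G s \<nu>) \<longrightarrow>
    generically (polygon_coords (outer_size G a)) (\<lambda>r.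
      convex_polygon (outer_size G a) r \<longrightarrow>
      (\<exists>f g \<psi>. construction G a (kasteleyn_matrix G s \<nu>) r f g \<psi>) \<and>
      (\<forall>f g \<psi>. construction G a (kasteleyn_matrix G s \<nu>) r f g \<psi> \<longrightarrow>
        (\<exists>c. let \<psi>' = (\<lambda>v. \<psi> v + c);
                 L = dual_segment G a \<psi>';
                 \<L> = L ` {..<nverts G};
                 R = r ` {..outer_size G a}
             in T_graph \<L> R \<and>
                (\<exists>\<gamma>. enclosing_curve \<L> R \<gamma>) \<and>
                (\<forall>\<gamma>. enclosing_curve \<L> R \<gamma> \<longrightarrow>
                  (\<exists>F0. outer_T_face \<L> R \<gamma> F0 \<and>
                    gauge_equivalent_via L (weighted_graph G \<nu>) (dimer_graph \<L> \<gamma> F0))) \<and>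
                (\<forall>v \<in> dual_vertices G a. \<psi>' v \<in> T_vertices \<L>) \<and>
                (\<forall>k \<le> outer_size G a. \<psi>' (Outer k) \<in> R)))))"
proof -
  interpret elementary_plane_graph G a
    by unfold_locales (use assms in blast)+
  show ?thesis
  proof (cases "2 \<le> m")
    case False
    \<comment> \<open>A polygon with fewer than three vertices is not convex in the sense used, and
      the claim holds vacuously.\<close>
    then have "\<not> convex_polygon m r" for r by (simp add: convex_polygon_def)
    then show ?thesis by (intro generically_True impI) (simp add: generically_True)
  next
    case m2: True
    have n2: "2 \<le> n" using m2 m_le_n by simp
    have s0: "s e ~= 0" if "e \<in> E" for e using assms(5) that unfolding kasteleyn_signs_def by force
    show ?thesis
    proof (rule generically_mono[OF generically_good_weights[where s = s, OF n2 s0]], assumption, intro impI)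
      fix \<nu> assume good: "nondegenerate 2 (kasteleyn_matrix G s \<nu>) \<longrightarrow> good_weights s \<nu>"
        and \<nu>: "\<forall>e\<in>E. 0 < \<nu> e" and nd: "nondegenerate 2 (kasteleyn_matrix G s \<nu>)"
      have gw: "good_weights s \<nu>" using good nd by blast
      then have det: "Determinant.det (Matrix.mat n n (\<lambda>(i, j). kas s \<nu> i j)) ~= 0" unfolding good_weights_def by blast
      obtain B where B: "\<forall>i<n. \<forall>j<n. (\<Sum>l<n. kas s \<nu> i l * B l j) = (if i = j then 1 else 0)"
        "\<forall>i<n. \<forall>j<n. (\<Sum>l<n. B i l * kas s \<nu> l j) = (if i = j then 1 else 0)"
        using inverse_entries[where k = "kas s \<nu>", OF det] by (elim exE conjE)
      note KB = B(1)[rule_format] and BK = B(2)[rule_format]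
      have B0: "B j i ~= 0" if "i < n" "j < n" for i j by (rule inverse_entry_nonzero[OF gw KB that])
      show "generically (polygon_coords m) (\<lambda>r. convex_polygon m r \<longrightarrow>
        (\<exists>f g \<psi>. construction G a (kasteleyn_matrix G s \<nu>) r f g \<psi>) \<and>
        (\<forall>f g \<psi>. construction G a (kasteleyn_matrix G s \<nu>) r f g \<psi> \<longrightarrow>
        (\<exists>c. let \<psi>' = (\<lambda>v. \<psi> v + c);
                 L = dual_segment G a \<psi>';
                 \<L> = L ` {..<n};
                 R = r ` {..m}
             in T_graph \<L> R \<and>
                (\<exists>\<gamma>. enclosing_curve \<L> R \<gamma>) \<and>
                (\<forall>\<gamma>. enclosing_curve \<L> R \<gamma> \<longrightarrow>
                  (\<exists>F0. outer_T_face \<L> R \<gamma> F0 \<and>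
                    gauge_equivalent_via L (weighted_graph G \<nu>) (dimer_graph \<L> \<gamma> F0))) \<and>
                (\<forall>v \<in> dual_vertices G a. \<psi>' v \<in> T_vertices \<L>) \<and>
                (\<forall>k \<le> m. \<psi>' (Outer k) \<in> R))))"
      proof (rule generically_mono[OF generically_good_polygon[OF nd m2 KB B0]], assumption+, intro impI conjI allI)
        fix r
        show "\<exists>f g \<psi>. construction G a (kasteleyn_matrix G s \<nu>) r f g \<psi>"
          by (rule construction_exists[OF KB BK B0])
      next
        fix r f g \<psi>
        let ?gr = "\<lambda>r i. side_sum m (\<lambda>k. B (snd (oe k)) i / B (snd (oe k)) (fst a)) r"
        assume gen: "(\<forall>i<n. \<forall>i'<n. i ~= i' \<longrightarrow> cr (?gr r i) (?gr r i') ~= 0) \<and>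
            (\<forall>i<n. \<forall>k<m. cr (?gr r i) (r (Suc k) - r k) ~= 0) \<and>
            (\<forall>i\<le>m. \<forall>j\<le>m. i ~= j \<longrightarrow> cr (r (Suc i mod Suc m) - r i) (r (Suc j mod Suc m) - r j) ~= 0)"
          and conv: "convex_polygon m r"
          and con: "construction G a (kasteleyn_matrix G s \<nu>) r f g \<psi>"
        have sol: "j < n ==> vec_index f j = B j (fst a)" "i < n ==> vec_index g i = ?gr r i" for i j
          by (erule construction_solution[where B = B, OF _ _ _ con, rotated -1]; fact KB BK B0)+
        have b0: "fst a < n" using E_bounds(1)[OF a_edge] .
        show "\<exists>c. let \<psi>' = (\<lambda>v. \<psi> v + c);
                 L = dual_segment G a \<psi>';
                 \<L> = L ` {..<n};
                 R = r ` {..m}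
             in T_graph \<L> R \<and>
                (\<exists>\<gamma>. enclosing_curve \<L> R \<gamma>) \<and>
                (\<forall>\<gamma>. enclosing_curve \<L> R \<gamma> \<longrightarrow>
                  (\<exists>F0. outer_T_face \<L> R \<gamma> F0 \<and>
                    gauge_equivalent_via L (weighted_graph G \<nu>) (dimer_graph \<L> \<gamma> F0))) \<and>
                (\<forall>v \<in> dual_vertices G a. \<psi>' v \<in> T_vertices \<L>) \<and>
                (\<forall>k \<le> m. \<psi>' (Outer k) \<in> R)"
        proof (rule construction_T_graph[OF assms(5) _ con _ _ _ conv])
          show "0 < \<nu> e" if "e \<in> E" for e using \<nu> that by blast
          show "vec_index f j ~= 0" if "j < n" for j using sol(1)[OF that] B0[OF b0 that] by simp
          show "cr (vec_index g i) (vec_index g i') ~= 0" if "i < n" "i' < n" "i ~= i'" for i i'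
            using gen that by (simp add: sol(2))
          show "cr (vec_index g i) (r (Suc k) - r k) ~= 0" if "i < n" "k < m" for i k
            using gen that by (simp add: sol(2))
          show "cr (r (Suc i mod Suc m) - r i) (r (Suc j mod Suc m) - r j) ~= 0" if "i \<le> m" "j \<le> m" "i ~= j" for i j
            using gen that by blast
        qed
      qed
    qed
  qed
qed

end
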